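(* Let $W$ be a matrix $A_2$ weight, $\Omega\subseteq\mathbb{R}^d$ a domain, and $F:\Omega\to\mathcal{M}_{n\times d}(\mathbb{C})$ with $F\in L^2(\Omega,W^{-1})$ and $\|W^{-1/2}F\|\in L^{s}(\Omega)$ for some $s>2$. Suppose the coefficients $A=(A^{\alpha\beta}_{ij})$ satisfy the degenerate ellipticity conditions (E1) and (E2) below and $\vec u\in H^{1,2}(\Omega,W)$ is a weak solution of the system (S). Then there exists $q>2$ such that for every ball $B_r$ with $B_{2r}\subset\Omega$ (concentric balls $B_{r/2}\subset B_r\subset B_{2r}$ of radii $r/2,r,2r$), $$\left(\frac{1}{|B_{r/2}|}\int_{B_{r/2}}\|W^{1/2}(x)D\vec u(x)\|^q\,dx\right)^{1/q}\lesssim\left(\frac{1}{|B_r|}\int_{B_r}\|W^{1/2}(x)D\vec u(x)\|^2dx\right)^{1/2}+\left(\frac{1}{|B_r|}\int_{B_r}\|W^{-1/2}(x)F(x)\|^q dx\right)^{1/q}.$$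
   Context: A matrix weight is a function $W:\mathbb{R}^d\to\mathcal{M}_{n\times n}(\mathbb{C})$ with locally integrable entries whose values are a.e. positive definite; $[W]_{A_2}=\sup_Q\frac1{|Q|}\int_Q\frac1{|Q|}\int_Q\|W^{1/2}(x)W^{-1/2}(y)\|^2dy\,dx$ and $W\in A_2$ if finite. Coefficients $A^{\alpha\beta}_{ij}:\Omega\to\mathbb{C}$ ($1\le i,j\le n$, $1\le\alpha,\beta\le d$) are measurable and satisfy, for a.e. $x$ and all $\eta,\nu\in\mathcal{M}_{n\times d}(\mathbb{C})$: (E1) $\mathrm{Re}\sum_{i,j,\alpha,\beta}A^{\alpha\beta}_{ij}(x)\eta^j_\beta\overline{\eta^i_\alpha}\gtrsim\|W^{1/2}(x)\eta\|^2$; (E2) $|\sum_{i,j,\alpha,\beta}A^{\alpha\beta}_{ij}(x)\nu^j_\beta\overline{\eta^i_\alpha}|\lesssim\|W^{1/2}(x)\eta\|\,\|W^{1/2}(x)\nu\|$. The system (S) is $\sum_{j}\sum_{\alpha,\beta}\partial_\alpha(A^{\alpha\beta}_{ij}\partial_\beta u_j)=-(\mathrm{div}F)_i$, $i=1,\dots,n$, where $(\mathrm{div}F)_i=\sum_\alpha\partial_\alpha F_{i\alpha}$; $\vec u$ is a weak solution if $\int_\Omega\sum A^{\alpha\beta}_{ij}\partial_\beta u_j\overline{\partial_\alpha\varphi_i}\,dx=-\int_\Omega\sum_{i,\alpha}F_{i\alpha}\overline{\partial_\alpha\varphi_i}\,dx$ for all $\vec\varphi\in C_c^\infty(\Omega;\mathbb{C}^n)$.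 $H^{1,p}(\Omega,W)$ is the completion of $\{\vec u\in C^\infty(\Omega):\|\vec u\|<\infty\}$ in the norm $(\int_\Omega|W^{1/p}\vec u|^p)^{1/p}+(\int_\Omega\|W^{1/p}D\vec u\|^p)^{1/p}$; $F\in L^2(\Omega,W^{-1})$ means $\int_\Omega\|W^{-1/2}F\|^2<\infty$. Implicit constants in the conclusion do not depend on the ball. *)

theory Defs
  imports "HOL-Analysis.Analysis"
begin

text \<open>An n x m complex matrix is an element of complex^'m^'n (row index 'n, column index 'm).
  The matrix norm used throughout is the operator norm (l2 to l2).\<close>

definition opnorm :: "complex^'m^'n \<Rightarrow> real" where
  "opnorm M = onorm (\<lambda>v. M *v v)"

definition hermitian :: "complex^'n^'n \<Rightarrow> bool" where
  "hermitian M \<longleftrightarrow> (\<forall>i j. M$i$j = cnj (M$j$i))"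

definition psd_matrix :: "complex^'n^'n \<Rightarrow> bool" where
  "psd_matrix M \<longleftrightarrow> hermitian M \<and>
     (\<forall>v. 0 \<le> Re (\<Sum>i\<in>UNIV. \<Sum>j\<in>UNIV. cnj (v$i) * M$i$j * v$j))"

definition posdef_matrix :: "complex^'n^'n \<Rightarrow> bool" where
  "posdef_matrix M \<longleftrightarrow> hermitian M \<and>
     (\<forall>v. v \<noteq> 0 \<longrightarrow> 0 < Re (\<Sum>i\<in>UNIV. \<Sum>j\<in>UNIV. cnj (v$i) * M$i$j * v$j))"

definition msqrt :: "complex^'n^'n \<Rightarrow> complex^'n^'n" where
  "msqrt M = (THE R. psd_matrix R \<and> R ** R = M)"

definition minvsqrt :: "complex^'n^'n \<Rightarrow> complex^'n^'n" where
  "minvsqrt M = matrix_inv (msqrt M)"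

definition matrix_weight :: "(real^'d \<Rightarrow> complex^'n^'n) \<Rightarrow> bool" where
  "matrix_weight W \<longleftrightarrow>
     (\<forall>i j. \<forall>K. compact K \<longrightarrow> set_integrable lebesgue K (\<lambda>x. W x $ i $ j)) \<and>
     (AE x in lebesgue. posdef_matrix (W x))"

definition cube :: "real^'d \<Rightarrow> real \<Rightarrow> (real^'d) set" where
  "cube a h = cbox a (\<chi> k. a$k + h)"

definition matrix_A2 :: "(real^'d \<Rightarrow> complex^'n^'n) \<Rightarrow> bool" where
  "matrix_A2 W \<longleftrightarrow> matrix_weight W \<and>
     (\<exists>C::real. \<forall>a h. h > 0 \<longrightarrow>
        (\<integral>\<^sup>+ x. (\<integral>\<^sup>+ y. ennreal ((opnorm (msqrt (W x) ** minvsqrt (W y)))\<^sup>2)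
              * indicator (cube a h) y \<partial>lebesgue) * indicator (cube a h) x \<partial>lebesgue)
        \<le> ennreal (C * (measure lebesgue (cube a h))\<^sup>2))"

definition partial :: "'d \<Rightarrow> (real^'d \<Rightarrow> 'b::real_normed_vector) \<Rightarrow> real^'d \<Rightarrow> 'b" where
  "partial \<alpha> g x = vector_derivative (\<lambda>t. g (x + t *\<^sub>R axis \<alpha> 1)) (at 0)"

primrec iter_partial :: "'d list \<Rightarrow> (real^'d \<Rightarrow> 'b::real_normed_vector) \<Rightarrow> real^'d \<Rightarrow> 'b" where
  "iter_partial [] g = g"
| "iter_partial (\<alpha> # \<alpha>s) g = partial \<alpha> (iter_partial \<alpha>s g)"

definition smooth_on :: "(real^'d) set \<Rightarrow> (real^'d \<Rightarrow> 'b::real_normed_vector) \<Rightarrow> bool" where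
  "smooth_on S g \<longleftrightarrow> (\<forall>\<alpha>s. continuous_on S (iter_partial \<alpha>s g) \<and>
      (\<forall>\<alpha>. \<forall>x\<in>S. (\<lambda>t. iter_partial \<alpha>s g (x + t *\<^sub>R axis \<alpha> 1)) differentiable (at 0)))"

definition grad :: "(real^'d \<Rightarrow> complex^'n) \<Rightarrow> real^'d \<Rightarrow> complex^'d^'n" where
  "grad u x = (\<chi> j \<beta>. partial \<beta> u x $ j)"

definition test_fun :: "(real^'d) set \<Rightarrow> (real^'d \<Rightarrow> complex^'n) \<Rightarrow> bool" where
  "test_fun \<Omega> \<phi> \<longleftrightarrow> smooth_on \<Omega> \<phi> \<and> compact (closure {x. \<phi> x \<noteq> 0}) \<and>
      closure {x. \<phi> x \<noteq> 0} \<subseteq> \<Omega>"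

text \<open>H^{1,2}(Omega,W) is the completion of the smooth functions of finite norm.  An element of the
  completion is represented by the pair (u, G) of limits in L^2(Omega,W), where G plays the role of D u:
  there are smooth phi_k of finite norm with phi_k -> u and D phi_k -> G in the weighted L^2 norms.\<close>

definition H12_fun :: "(real^'d) set \<Rightarrow> (real^'d \<Rightarrow> complex^'n^'n)
    \<Rightarrow> (real^'d \<Rightarrow> complex^'n) \<Rightarrow> (real^'d \<Rightarrow> complex^'d^'n) \<Rightarrow> bool" where
  "H12_fun \<Omega> W u G \<longleftrightarrow>
     set_borel_measurable lebesgue \<Omega> u \<and> set_borel_measurable lebesgue \<Omega> G \<and>
     (\<exists>\<phi>::nat \<Rightarrow> real^'d \<Rightarrow> complex^'n.
        (\<forall>k. smooth_on \<Omega> (\<phi> k) \<and>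
             (\<integral>\<^sup>+ x\<in>\<Omega>. ennreal ((norm (msqrt (W x) *v \<phi> k x))\<^sup>2) \<partial>lebesgue) < \<infinity> \<and>
             (\<integral>\<^sup>+ x\<in>\<Omega>. ennreal ((opnorm (msqrt (W x) ** grad (\<phi> k) x))\<^sup>2) \<partial>lebesgue) < \<infinity>) \<and>
        (\<lambda>k. \<integral>\<^sup>+ x\<in>\<Omega>. ennreal ((norm (msqrt (W x) *v (u x - \<phi> k x)))\<^sup>2) \<partial>lebesgue)
           \<longlonglongrightarrow> 0 \<and>
        (\<lambda>k. \<integral>\<^sup>+ x\<in>\<Omega>. ennreal ((opnorm (msqrt (W x) ** (G x - grad (\<phi> k) x)))\<^sup>2) \<partial>lebesgue)
           \<longlonglongrightarrow> 0)"

definition bilin :: "('d \<Rightarrow> 'd \<Rightarrow> 'n \<Rightarrow> 'n \<Rightarrow> real^'d \<Rightarrow> complex) \<Rightarrow> real^'d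
    \<Rightarrow> complex^'d^'n \<Rightarrow> complex^'d^'n \<Rightarrow> complex" where
  "bilin A x \<nu> \<eta> = (\<Sum>i\<in>UNIV. \<Sum>j\<in>UNIV. \<Sum>\<alpha>\<in>UNIV. \<Sum>\<beta>\<in>UNIV.
       A \<alpha> \<beta> i j x * \<nu>$j$\<beta> * cnj (\<eta>$i$\<alpha>))"

definition E1 :: "(real^'d) set \<Rightarrow> (real^'d \<Rightarrow> complex^'n^'n)
    \<Rightarrow> ('d \<Rightarrow> 'd \<Rightarrow> 'n \<Rightarrow> 'n \<Rightarrow> real^'d \<Rightarrow> complex) \<Rightarrow> bool" where
  "E1 \<Omega> W A \<longleftrightarrow> (\<exists>c>0. AE x in lebesgue. x \<in> \<Omega> \<longrightarrow>
      (\<forall>\<eta>. c * (opnorm (msqrt (W x) ** \<eta>))\<^sup>2 \<le> Re (bilin A x \<eta> \<eta>)))"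

definition E2 :: "(real^'d) set \<Rightarrow> (real^'d \<Rightarrow> complex^'n^'n)
    \<Rightarrow> ('d \<Rightarrow> 'd \<Rightarrow> 'n \<Rightarrow> 'n \<Rightarrow> real^'d \<Rightarrow> complex) \<Rightarrow> bool" where
  "E2 \<Omega> W A \<longleftrightarrow> (\<exists>C. AE x in lebesgue. x \<in> \<Omega> \<longrightarrow>
      (\<forall>\<eta> \<nu>. cmod (bilin A x \<nu> \<eta>) \<le> C * opnorm (msqrt (W x) ** \<eta>) * opnorm (msqrt (W x) ** \<nu>)))"

text \<open>Weak solution of (S), with D u represented by G.\<close>

definition weak_solution :: "(real^'d) set \<Rightarrow> ('d \<Rightarrow> 'd \<Rightarrow> 'n \<Rightarrow> 'n \<Rightarrow> real^'d \<Rightarrow> complex)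
    \<Rightarrow> (real^'d \<Rightarrow> complex^'d^'n) \<Rightarrow> (real^'d \<Rightarrow> complex^'d^'n) \<Rightarrow> bool" where
  "weak_solution \<Omega> A G F \<longleftrightarrow> (\<forall>\<phi>. test_fun \<Omega> \<phi> \<longrightarrow>
      (LINT x:\<Omega>|lebesgue. bilin A x (G x) (grad \<phi> x)) =
      - (LINT x:\<Omega>|lebesgue. \<Sum>i\<in>UNIV. \<Sum>\<alpha>\<in>UNIV. F x $ i $ \<alpha> * cnj (grad \<phi> x $ i $ \<alpha>)))"

definition enn_root :: "real \<Rightarrow> ennreal \<Rightarrow> ennreal" where
  "enn_root p a = (if a = \<infinity> then \<infinity> else ennreal (enn2real a powr (1 / p)))"

definition Lp_avg :: "real \<Rightarrow> (real^'d) set \<Rightarrow> (real^'d \<Rightarrow> real) \<Rightarrow> ennreal" where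
  "Lp_avg p B f = enn_root p ((\<integral>\<^sup>+ x\<in>B. ennreal (f x powr p) \<partial>lebesgue) / emeasure lebesgue B)"

definition domain :: "(real^'d) set \<Rightarrow> bool" where
  "domain \<Omega> \<longleftrightarrow> open \<Omega> \<and> connected \<Omega> \<and> \<Omega> \<noteq> {}"

end

theory Submission
  imports Defs
begin

text \<open>
  Write \<open>g = |W\<^sup>1\<^sup>/\<^sup>2 Du|\<close>, \<open>f = |W\<^sup>-\<^sup>1\<^sup>/\<^sup>2 F|\<close> and \<open>K x y = |W\<^sup>1\<^sup>/\<^sup>2(x) W\<^sup>-\<^sup>1\<^sup>/\<^sup>2(y)|\<close>. For a fixed vector \<open>e\<close> the function
  \<open>y \<mapsto> |W\<^sup>-\<^sup>1\<^sup>/\<^sup>2(y) e|\<close> satisfies a reverse Hoelder inequality with constants independent of \<open>e\<close>, because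
  \<open>|W\<^sup>-\<^sup>1\<^sup>/\<^sup>2(y) e| \<le> K x y |W\<^sup>-\<^sup>1\<^sup>/\<^sup>2(x) e|\<close>; Gehring's lemma then makes \<open>K x\<close> integrable to a power above 2, uniformly in \<open>x\<close>.
  The fundamental theorem of calculus along segments bounds \<open>|W\<^sup>1\<^sup>/\<^sup>2(x) (\<phi>(x) - c)|\<close> by integrals of
  \<open>K x y |W\<^sup>1\<^sup>/\<^sup>2(y) D\<phi>(y)|\<close>, and the extra integrability of \<open>K\<close> yields a Poincare inequality whose right-hand side is an
  \<open>L\<^sup>1\<close> norm of the weighted gradient plus a small multiple of its \<open>L\<^sup>2\<close> norm. Combined with the Caccioppoli
  inequality, this is a reverse Hoelder inequality for \<open>g\<close> with data \<open>f\<close>, to which Gehring's lemma applies again.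
\<close>

section \<open>Gehring's lemma\<close>

text \<open>The classical route uses a Poincare inequality from an exponent below 2 up to 2. Here
  the gain sits in the form of the hypothesis of Gehring's lemma: for a level \<open>l\<close>
  bounding the quadratic mean of \<open>g\<close> on the doubled ball, a small multiple of
  \<open>l\<^sup>2\<close> times the volume plus \<open>l\<close> times the integral of
  \<open>g\<close> is an admissible bound, and a kernel with equi-integrable square gives just that.
  A matrix weight offers no scalar density to improve; the way out is that the square of
  \<open>K x y\<close> is a finite sum of squares of scalar functions |W^{-1/2}(y) e|, with e
  running through the columns of W^{1/2}(x).

  Two more obstacles shape the text. An element of the completion is only a limit of smooth
  functions, so test functions are built from a smooth approximant, chosen anew for every ball and
  level so that its error is small against \<open>l\<^sup>2\<close> times the volume. And the weight
  is given up to null sets, whereas the kernel arguments use Borel functions invertible at every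
  point; such a representative rests on a square root obtained as a pointwise limit.\<close>

lemma sets_borel_ball[measurable]: "ball (x::'a::metric_space) t \<in> sets borel"
  by simp

section \<open>Vitali coverings and points of low density\<close>

text \<open>The summation step behind both Vitali arguments. The sets \<open>Y i\<close> may
  overlap, since they only have to dominate \<open>S\<close>; the disjoint \<open>X i\<close> inside
  \<open>T\<close> make the sum on the right collapse to one integral. Sums over \<open>I\<close>
  are integrals over \<open>count_space I\<close>, so that they can be exchanged with the integral
  over \<open>M\<close>.\<close>

lemma nn_integral_cover_le_disjoint:
  fixes f h :: "'a \<Rightarrow> ennreal"
  assumes I: "countable I"
    and [measurable]: "f \<in> borel_measurable M" "h \<in> borel_measurable M"
    and X[measurable]: "\<And>i. i \<in> I \<Longrightarrow> X i \<in> sets M" and Y[measurable]: "\<And>i. i \<in> I \<Longrightarrow> Y i \<in> sets M"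
    and cov: "S \<subseteq> (\<Union>i\<in>I. Y i)" and disj: "disjoint_family_on X I" and T: "\<And>i. i \<in> I \<Longrightarrow> X i \<subseteq> T"
    and le: "\<And>i. i \<in> I \<Longrightarrow> (\<integral>\<^sup>+x\<in>Y i. f x \<partial>M) \<le> (\<integral>\<^sup>+x\<in>X i. h x \<partial>M)"
  shows "(\<integral>\<^sup>+x\<in>S. f x \<partial>M) \<le> (\<integral>\<^sup>+x\<in>T. h x \<partial>M)"
proof -
  have "(\<integral>\<^sup>+x\<in>S. f x \<partial>M) \<le> (\<integral>\<^sup>+x. (\<integral>\<^sup>+i. f x * indicator (Y i) x \<partial>count_space I) \<partial>M)"
  proof (intro nn_integral_mono)
    fix x
    show "f x * indicator S x \<le> (\<integral>\<^sup>+i. f x * indicator (Y i) x \<partial>count_space I)"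
    proof (cases "x \<in> S")
      case True
      then obtain i where "i \<in> I" "x \<in> Y i" using cov by auto
      then show ?thesis
        using nn_integral_ge_point[of i I "\<lambda>i. f x * indicator (Y i) x"] True by simp
    qed simp
  qed
  also have "\<dots> = (\<integral>\<^sup>+i. (\<integral>\<^sup>+x. f x * indicator (Y i) x \<partial>M) \<partial>count_space I)"
    by (intro nn_integral_count_space_nn_integral I) measurable
  also have "\<dots> \<le> (\<integral>\<^sup>+i. (\<integral>\<^sup>+x. h x * indicator (X i) x \<partial>M) \<partial>count_space I)"
    by (rule nn_integral_mono) (auto intro: le)
  also have "\<dots> = (\<integral>\<^sup>+x. (\<integral>\<^sup>+i. h x * indicator (X i) x \<partial>count_space I) \<partial>M)"
    by (intro nn_integral_count_space_nn_integral[symmetric] I) measurable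
  also have "\<dots> \<le> (\<integral>\<^sup>+x\<in>T. h x \<partial>M)"
  proof (intro nn_integral_mono)
    fix x
    show "(\<integral>\<^sup>+i. h x * indicator (X i) x \<partial>count_space I) \<le> h x * indicator T x"
    proof (cases "\<exists>i\<in>I. x \<in> X i")
      case True
      then obtain i where i: "i \<in> I" "x \<in> X i" by auto
      have "(\<integral>\<^sup>+j. h x * indicator (X j) x \<partial>count_space I) = (\<integral>\<^sup>+j. h x * indicator {i} j \<partial>count_space I)"
        using i disj by (intro nn_integral_cong) (auto simp: disjoint_family_on_def indicator_def)
      also have "\<dots> = h x"
        using i by (subst nn_integral_count_space'[where A="{i}"]) auto
      finally show ?thesis using i T by (auto simp: indicator_def)
    next
      case False
      then have "(\<integral>\<^sup>+j. h x * indicator (X j) x \<partial>count_space I) = (\<integral>\<^sup>+j. 0 \<partial>count_space I)"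
        by (intro nn_integral_cong) (auto simp: indicator_def)
      then show ?thesis by simp
    qed
  qed
  finally show ?thesis .
qed

text \<open>Writing membership in the moving ball as \<open>dist x y < t\<close> makes the integrand
  jointly measurable, which the indicator of \<open>ball x t\<close> hides.\<close>

lemma borel_measurable_nn_integral_ball:
  fixes h :: "'a::euclidean_space \<Rightarrow> ennreal"
  assumes [measurable]: "h \<in> borel_measurable borel"
  shows "(\<lambda>x. \<integral>\<^sup>+y\<in>ball x t. h y \<partial>lborel) \<in> borel_measurable borel"
proof -
  have eq: "(\<lambda>x. \<integral>\<^sup>+y\<in>ball x t. h y \<partial>lborel) = (\<lambda>x. \<integral>\<^sup>+y. h y * (if dist x y < t then 1 else 0) \<partial>lborel)"
    by (intro ext nn_integral_cong) (auto simp: indicator_def)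
  have "(\<lambda>x. \<integral>\<^sup>+y. h y * (if dist x y < t then 1 else 0) \<partial>lborel) \<in> borel_measurable lborel"
    by measurable
  then show ?thesis unfolding eq by simp
qed

text \<open>Small balls centred in \<open>S\<close> and contained in an open \<open>U\<close> form a
  Vitali family for \<open>S\<close>. Disjoint balls of low average therefore exhaust
  \<open>S\<close> up to a null set, and the integral of \<open>h\<close> over \<open>S\<close> is
  at most \<open>c\<close> times the measure of \<open>U\<close>. Letting \<open>U\<close> shrink to
  \<open>S\<close> contradicts \<open>c < h\<close> on \<open>S\<close> unless \<open>S\<close> is
  null. This serves as a one-sided form of Lebesgue's differentiation theorem.\<close>

lemma null_set_if_low_density:
  fixes h :: "'a::euclidean_space \<Rightarrow> ennreal" and c e :: real
  assumes [measurable]: "h \<in> borel_measurable borel" "S \<in> sets borel" and finS: "emeasure lborel S < \<infinity>"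
    and c: "0 \<le> c" and e: "0 < e"
    and big: "\<And>x. x \<in> S \<Longrightarrow> c < h x"
    and dens: "\<And>x t. x \<in> S \<Longrightarrow> t \<in> \<rat> \<Longrightarrow> 0 < t \<Longrightarrow> t < e \<Longrightarrow>
      (\<integral>\<^sup>+y\<in>ball x t. h y \<partial>lborel) \<le> c * emeasure lborel (ball x t)"
  shows "emeasure lborel S = 0"
proof -
    have H: "(\<integral>\<^sup>+x\<in>S. h x \<partial>lborel) \<le> c * (emeasure lborel S + ennreal \<epsilon>)" if \<epsilon>: "\<epsilon> > 0" for \<epsilon>
    proof -
      have Sl: "S \<in> sets lebesgue" by (rule sets_completionI_sets) measurable
      obtain U where U: "open U" "S \<subseteq> U" "emeasure lebesgue (U - S) < ennreal \<epsilon>"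
        by (rule sets_lebesgue_outer_open[OF Sl \<epsilon>])
      have Um[measurable]: "U \<in> sets borel" using U by auto
      have emU: "emeasure lborel U \<le> emeasure lborel S + ennreal \<epsilon>"
      proof -
        have "emeasure lborel U = emeasure lborel S + emeasure lborel (U - S)"
          using U(2) by (subst plus_emeasure) (auto simp: Un_absorb1)
        also have "emeasure lborel (U - S) = emeasure lebesgue (U - S)" by simp
        finally show ?thesis using U(3) by (simp add: add_left_mono less_imp_le)
      qed
      \<comment> \<open>The Vitali family: a centre in \<open>S\<close> with a rational radius,
        since the density hypothesis speaks of rational radii.\<close>
      define K where "K = {(x, t). x \<in> S \<and> t \<in> \<rat> \<and> 0 < t \<and> t < e \<and> ball x t \<subseteq> U}"
      have fine: "\<exists>i. i \<in> K \<and> x \<in> ball (fst i) (snd i) \<and> snd i < d" if x: "x \<in> S" and d: "0 < d" for x d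
      proof -
        obtain r where r: "r > 0" "ball x r \<subseteq> U" using U(1,2) x by (meson open_contains_ball subsetD)
        obtain t where t: "t \<in> \<rat>" "0 < t" "t < min (min d e) r"
          using Rats_dense_in_real[of 0 "min (min d e) r"] d e r by auto
        have "(x, t) \<in> K" unfolding K_def using x t r by auto
        then show ?thesis using t by (intro exI[of _ "(x,t)"]) auto
      qed
      obtain C where C: "countable C" "C \<subseteq> K"
        "pairwise (\<lambda>i j. disjnt (ball (fst i) (snd i)) (ball (fst j) (snd j))) C"
        "negligible (S - (\<Union>i \<in> C. ball (fst i) (snd i)))"
        by (rule Vitali_covering_theorem_balls[OF fine])
      let ?V = "\<Union>i \<in> C. ball (fst i) (snd i)"
      have "S - ?V \<in> null_sets lebesgue" using C(4) by (simp add: negligible_iff_null_sets)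
      then have "AE x in lebesgue. x \<notin> S - ?V" by (rule AE_not_in)
      then have "AE x in lborel. x \<notin> S - ?V" by (simp add: AE_completion_iff)
      then have "(\<integral>\<^sup>+x\<in>S. h x \<partial>lborel) \<le> (\<integral>\<^sup>+x\<in>?V. h x \<partial>lborel)"
        by (intro nn_integral_mono_AE) (auto elim!: eventually_mono simp: indicator_def)
      also have "\<dots> \<le> (\<integral>\<^sup>+x\<in>U. ennreal c \<partial>lborel)"
      proof (rule nn_integral_cover_le_disjoint[where X="\<lambda>i. ball (fst i) (snd i)" and Y="\<lambda>i. ball (fst i) (snd i)" and I=C])
        show "disjoint_family_on (\<lambda>i. ball (fst i) (snd i)) C"
          using C(3) by (auto simp: disjoint_family_on_def pairwise_def disjnt_def)
        fix i assume "i \<in> C"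
        then have i: "i \<in> K" using C by auto
        then show "ball (fst i) (snd i) \<subseteq> U" by (auto simp: K_def)
        show "(\<integral>\<^sup>+x\<in>ball (fst i) (snd i). h x \<partial>lborel) \<le> (\<integral>\<^sup>+x\<in>ball (fst i) (snd i). ennreal c \<partial>lborel)"
          using i dens by (auto simp: K_def nn_integral_cmult_indicator)
      qed (use C in auto)
      also have "\<dots> = c * emeasure lborel U" by (simp add: nn_integral_cmult_indicator)
      also have "\<dots> \<le> c * (emeasure lborel S + ennreal \<epsilon>)" by (intro mult_left_mono emU) simp
      finally show ?thesis .
    qed
    have le: "(\<integral>\<^sup>+x\<in>S. h x \<partial>lborel) \<le> c * emeasure lborel S"
    proof (rule ennreal_le_epsilon)
      \<comment> \<open>The error is divided by \<open>c + 1\<close> rather than \<open>c\<close> to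
        cover \<open>c = 0\<close>.\<close>
      fix \<epsilon> :: real assume "0 < \<epsilon>"
      have "(\<integral>\<^sup>+x\<in>S. h x \<partial>lborel) \<le> c * (emeasure lborel S + ennreal (\<epsilon> / (c + 1)))"
        using c \<open>0 < \<epsilon>\<close> by (intro H divide_pos_pos) auto
      also have "\<dots> = c * emeasure lborel S + ennreal (c * (\<epsilon> / (c+1)))"
        using c \<open>0 < \<epsilon>\<close> by (simp add: distrib_left ennreal_mult del: times_divide_eq_right)
      also have "\<dots> \<le> c * emeasure lborel S + ennreal \<epsilon>"
        using c \<open>0 < \<epsilon>\<close> by (intro add_left_mono ennreal_leI) (auto simp: field_simps)
      finally show "(\<integral>\<^sup>+x\<in>S. h x \<partial>lborel) \<le> c * emeasure lborel S + ennreal \<epsilon>" .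
    qed
    have ge: "(\<integral>\<^sup>+x. ennreal c * indicator S x \<partial>lborel) \<le> (\<integral>\<^sup>+x\<in>S. h x \<partial>lborel)"
      using big by (intro nn_integral_mono) (auto simp: indicator_def less_imp_le)
    have "(\<integral>\<^sup>+x. h x * indicator S x - ennreal c * indicator S x \<partial>lborel) =
        (\<integral>\<^sup>+x\<in>S. h x \<partial>lborel) - (\<integral>\<^sup>+x. ennreal c * indicator S x \<partial>lborel)"
    proof (rule nn_integral_diff)
      show "(\<integral>\<^sup>+ x. ennreal c * indicator S x \<partial>lborel) \<noteq> \<infinity>"
        using finS by (auto simp: nn_integral_cmult_indicator ennreal_mult_eq_top_iff)
    qed (use big in \<open>auto simp: indicator_def less_imp_le\<close>)
    also have "\<dots> = 0"
      using le_less_trans[OF le] le finS by (simp add: nn_integral_cmult_indicator diff_eq_0_iff_ennreal ennreal_mult_less_top)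
    finally have "AE x in lborel. h x * indicator S x - ennreal c * indicator S x = 0"
      by (simp add: nn_integral_0_iff_AE)
    then have "AE x in lborel. x \<notin> S"
    proof (rule AE_mp, intro AE_I2 impI notI)
      fix x assume "h x * indicator S x - ennreal c * indicator S x = 0" "x \<in> S"
      then show False using big[of x] by (auto simp: diff_eq_0_iff_ennreal dest: leD)
    qed
    then show ?thesis using AE_iff_measurable[of S lborel "\<lambda>x. x \<notin> S"] by auto
  qed

text \<open>Restricting the radii to the rationals writes the set as a countable intersection of
  Borel sets. Cutting with the balls of radius \<open>m\<close> provides the finite measure that
  \<open>null_set_if_low_density\<close> asks for.\<close>

lemma negligible_low_density_points:
  fixes h :: "'a::euclidean_space \<Rightarrow> ennreal" and c e :: real
  assumes [measurable]: "h \<in> borel_measurable borel"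
    and c: "0 \<le> c" and e: "0 < e"
  shows "emeasure lborel {x. h x > c \<and> (\<forall>t\<in>\<rat>. 0 < t \<and> t < e \<longrightarrow>
      (\<integral>\<^sup>+y\<in>ball x t. h y \<partial>lborel) \<le> c * emeasure lborel (ball x t))} = 0" (is "emeasure lborel ?N = 0")
proof -
  note borel_measurable_nn_integral_ball[measurable]
  have meas_ball: "emeasure lborel (ball x t) = ennreal (unit_ball_vol DIM('a) * (max 0 t) ^ DIM('a))" for x :: 'a and t
    using emeasure_ball[of t x] by (cases "t \<ge> 0") (auto simp: max_def zero_power ball_empty)
  have cnt: "countable (\<rat>::real set)" by (rule countable_rat)
  have N[measurable]: "?N \<in> sets borel"
  proof -
    have "?N = {x \<in> space borel. h x > c} \<inter> (\<Inter>t\<in>\<rat>. {x \<in> space borel. 0 < t \<and> t < e \<longrightarrow>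
      (\<integral>\<^sup>+y\<in>ball x t. h y \<partial>lborel) \<le> c * emeasure lborel (ball x t)})" by auto
    also have "\<dots> \<in> sets borel"
      unfolding meas_ball
      by (intro sets.Int sets.countable_INT'' cnt) measurable
    finally show ?thesis .
  qed
  have "emeasure lborel (?N \<inter> ball 0 m) = 0" for m :: nat
  proof -
    let ?S = "?N \<inter> ball 0 m"
    have finS: "emeasure lborel ?S < \<infinity>"
      by (rule le_less_trans[OF emeasure_mono[of _ "ball 0 m"]]) (use emeasure_lborel_ball_finite[of "0::'a" "real m"] in auto)
    show ?thesis
      by (rule null_set_if_low_density[where h=h and c=c and e=e]) (use finS c e in auto)
  qed
  then have "emeasure lborel (\<Union>m::nat. ?N \<inter> ball 0 m) = 0"
    by (intro emeasure_UN_eq_0) auto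
  moreover have "(\<Union>m::nat. ?N \<inter> ball 0 m) = ?N"
  proof -
    have "\<exists>m::nat. x \<in> ball 0 (real m)" for x :: 'a using reals_Archimedean2[of "norm x"] by auto
    then show ?thesis by blast
  qed
  ultimately show ?thesis by simp
qed

section \<open>Stopping balls and the estimate of level sets\<close>

lemma emeasure_ball_mult:
  fixes x :: "'a::euclidean_space"
  assumes "0 \<le> c" "0 \<le> t"
  shows "emeasure lborel (ball x (c * t)) = ennreal (c ^ DIM('a)) * emeasure lborel (ball x t)"
  using assms by (simp add: emeasure_ball power_mult_distrib ennreal_mult[symmetric] mult_ac)

text \<open>The radius is within a factor 2 of the supremum of the radii of balls around \<open>x\<close> on which the
  average of \<open>h\<close> exceeds \<open>c\<close>.\<close>

lemma obtain_stopping_radius: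
  fixes h :: "'a::euclidean_space \<Rightarrow> ennreal" and c R :: real
  assumes R: "0 < R" and ex: "\<exists>t. 0 < t \<and> t < R \<and> (\<integral>\<^sup>+y\<in>ball x t. h y \<partial>lborel) > c * emeasure lborel (ball x t)"
    and top: "\<And>t. R / 20 \<le> t \<Longrightarrow> t \<le> R \<Longrightarrow> (\<integral>\<^sup>+y\<in>ball x t. h y \<partial>lborel) \<le> c * emeasure lborel (ball x t)"
  obtains t where "0 < t" "10 * t \<le> R" "(\<integral>\<^sup>+y\<in>ball x t. h y \<partial>lborel) > c * emeasure lborel (ball x t)"
    "\<And>s. 2 * t \<le> s \<Longrightarrow> s \<le> R \<Longrightarrow> (\<integral>\<^sup>+y\<in>ball x s. h y \<partial>lborel) \<le> c * emeasure lborel (ball x s)"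
proof -
  define S where "S = {t. 0 < t \<and> t \<le> R \<and> (\<integral>\<^sup>+y\<in>ball x t. h y \<partial>lborel) > c * emeasure lborel (ball x t)}"
  have ne: "S \<noteq> {}" using ex by (auto simp: S_def intro: less_imp_le)
  \<comment> \<open>Membership in \<open>S\<close> forces a radius below \<open>R / 20\<close>. Ten
    times such a radius, that is the doubling followed by the five-fold Vitali enlargement, still
    stays below \<open>R\<close>.\<close>
  have small: "t < R / 20" if "t \<in> S" for t
  proof (rule ccontr)
    assume "\<not> t < R / 20"
    with top[of t] that show False by (auto simp: S_def not_less)
  qed
  have bdd: "bdd_above S" using small by (intro bdd_aboveI[of _ "R/20"]) (auto intro: less_imp_le)
  obtain t0 where t0: "t0 \<in> S" using ne by auto
  have "0 < Sup S" using cSup_upper[OF t0 bdd] t0 by (auto simp: S_def)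
  then have "Sup S / 2 < Sup S" by simp
  then obtain t where t: "t \<in> S" "Sup S / 2 < t" using less_cSup_iff[OF ne bdd] by auto
  show ?thesis
  proof (rule that[of t])
    show "0 < t" "10 * t \<le> R" "(\<integral>\<^sup>+y\<in>ball x t. h y \<partial>lborel) > c * emeasure lborel (ball x t)"
      using t small[of t] by (auto simp: S_def)
    fix s assume s: "2 * t \<le> s" "s \<le> R"
    have "s \<notin> S" using cSup_upper[OF _ bdd, of s] t s by auto
    then show "(\<integral>\<^sup>+y\<in>ball x s. h y \<partial>lborel) \<le> c * emeasure lborel (ball x s)"
      using s \<open>0 < t\<close> by (auto simp: S_def not_less)
  qed
qed

lemma nn_integral_split_bounded:
  fixes \<phi> :: "'a \<Rightarrow> ennreal"
  assumes [measurable]: "\<phi> \<in> borel_measurable M" "B \<in> sets M" "Measurable.pred M Q"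
    and c: "\<And>y. \<not> Q y \<Longrightarrow> \<phi> y \<le> c"
  shows "(\<integral>\<^sup>+y\<in>B. \<phi> y \<partial>M) \<le> c * emeasure M B + (\<integral>\<^sup>+y\<in>B. \<phi> y * indicator {y. Q y} y \<partial>M)"
proof -
  have "(\<integral>\<^sup>+y\<in>B. \<phi> y \<partial>M) \<le> (\<integral>\<^sup>+y. c * indicator B y + \<phi> y * indicator {y. Q y} y * indicator B y \<partial>M)"
    using c by (intro nn_integral_mono) (auto simp: indicator_def)
  also have "\<dots> = (\<integral>\<^sup>+y. c * indicator B y \<partial>M) + (\<integral>\<^sup>+y\<in>B. \<phi> y * indicator {y. Q y} y \<partial>M)"
    by (rule nn_integral_add) measurable
  finally show ?thesis by (simp add: nn_integral_cmult_indicator)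
qed

lemma nn_integral_lincomb:
  fixes f g :: "'a \<Rightarrow> ennreal"
  assumes "f \<in> borel_measurable M" "g \<in> borel_measurable M"
  shows "(\<integral>\<^sup>+x. c * (d * f x + g x) \<partial>M) = c * (d * (\<integral>\<^sup>+x. f x \<partial>M) + (\<integral>\<^sup>+x. g x \<partial>M))"
  using assms by (simp add: nn_integral_cmult nn_integral_add)

text \<open>Almost every point with \<open>G > \<mu>\<close> has a stopping ball whose mean of
  \<open>G\<^sup>2\<close> exceeds \<open>\<mu>\<^sup>2\<close>, while the mean over every ball of
  at least twice the radius, up to \<open>Rd x\<close>, does not. On the doubled ball the reverse
  Hoelder hypothesis applies at level \<open>\<mu>\<close>; the parts of \<open>G\<close> and
  \<open>H\<close> below \<open>\<kappa> * \<mu>\<close> and the \<open>\<theta>\<close> term are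
  absorbed by the lower bound. What remains is summed over a Vitali selection. The largest radius
  depends on the point because the weight of \<open>gehring_dist_weight\<close> is comparable only
  on balls adapted to the distance from the boundary.\<close>

lemma level_set_estimate:
  fixes G H :: "'a::euclidean_space \<Rightarrow> real" and Rd :: "'a \<Rightarrow> real" and \<mu> \<theta> b \<kappa> R0 :: real
  assumes [measurable]: "G \<in> borel_measurable borel" "H \<in> borel_measurable borel"
    and G0: "\<And>x. 0 \<le> G x" and H0: "\<And>x. 0 \<le> H x"
    and fin: "(\<integral>\<^sup>+x. ennreal ((G x)\<^sup>2) \<partial>lborel) < \<infinity>"
    and lam: "0 < \<mu>" and b: "0 \<le> b" and \<theta>0: "0 \<le> \<theta>"
    and Rd: "\<And>x. G x > \<mu> \<Longrightarrow> 0 < Rd x \<and> Rd x \<le> R0"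
    and top: "\<And>x t. G x > \<mu> \<Longrightarrow> Rd x / 20 \<le> t \<Longrightarrow> t \<le> Rd x \<Longrightarrow>
        (\<integral>\<^sup>+y\<in>ball x t. ennreal ((G y)\<^sup>2) \<partial>lborel) \<le> ennreal (\<mu>\<^sup>2) * emeasure lborel (ball x t)"
    and rh: "\<And>x t. G x > \<mu> \<Longrightarrow> 0 < t \<Longrightarrow> 2 * t \<le> Rd x \<Longrightarrow>
        (\<integral>\<^sup>+y\<in>ball x (2*t). ennreal ((G y)\<^sup>2) \<partial>lborel) \<le> ennreal (\<mu>\<^sup>2) * emeasure lborel (ball x (2*t)) \<Longrightarrow>
        (\<integral>\<^sup>+y\<in>ball x t. ennreal ((G y)\<^sup>2) \<partial>lborel) \<le> ennreal (\<theta> * \<mu>\<^sup>2) * emeasure lborel (ball x (2*t))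
          + ennreal (b * \<mu>) * (\<integral>\<^sup>+y\<in>ball x (2*t). ennreal (G y) \<partial>lborel)
          + ennreal b * (\<integral>\<^sup>+y\<in>ball x (2*t). ennreal ((H y)\<^sup>2) \<partial>lborel)"
    and \<theta>: "\<theta> * 2 ^ DIM('a) \<le> 1/4"
    and \<kappa>: "0 < \<kappa>" "b * (\<kappa> + \<kappa>\<^sup>2) * 2 ^ DIM('a) \<le> 1/4"
  shows "(\<integral>\<^sup>+x. ennreal ((G x)\<^sup>2) * indicator {x. G x > \<mu>} x \<partial>lborel) \<le>
      ennreal (2 * 10 ^ DIM('a) * b) * (ennreal \<mu> * (\<integral>\<^sup>+x. ennreal (G x) * indicator {x. G x > \<kappa> * \<mu>} x \<partial>lborel)
        + (\<integral>\<^sup>+x. ennreal ((H x)\<^sup>2) * indicator {x. H x > \<kappa> * \<mu>} x \<partial>lborel))"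
proof -
  let ?d = "DIM('a)"
  let ?I = "\<lambda>S. \<integral>\<^sup>+y\<in>S. ennreal ((G y)\<^sup>2) \<partial>lborel"
  define h where "h x = ennreal (2 * 10 ^ ?d * b) * (ennreal \<mu> * (ennreal (G x) * indicator {x. G x > \<kappa> * \<mu>} x)
        + ennreal ((H x)\<^sup>2) * indicator {x. H x > \<kappa> * \<mu>} x)" for x
  have h[measurable]: "h \<in> borel_measurable borel" unfolding h_def by measurable
  \<comment> \<open>The points that possess a stopping ball. The density lemma with radii below
    \<open>1 / Suc n\<close> shows that almost every point with \<open>G > \<mu>\<close> is one of
    them.\<close>
  define E where "E = {x. G x > \<mu> \<and> (\<exists>t. 0 < t \<and> t < Rd x \<and> ?I (ball x t) > \<mu>\<^sup>2 * emeasure lborel (ball x t))}"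
  have AE: "AE x in lborel. G x > \<mu> \<longrightarrow> x \<in> E"
  proof -
    let ?N = "\<lambda>n::nat. {x. ennreal ((G x)\<^sup>2) > \<mu>\<^sup>2 \<and> (\<forall>t\<in>\<rat>. 0 < t \<and> t < 1 / Suc n \<longrightarrow>
      ?I (ball x t) \<le> \<mu>\<^sup>2 * emeasure lborel (ball x t))}"
    have "emeasure lborel (?N n) = 0" for n
      by (rule negligible_low_density_points) auto
    have *: "AE x in lborel. x \<notin> ?N n" for n
    proof -
      have meas: "?N n \<in> sets borel"
      proof -
        note borel_measurable_nn_integral_ball[measurable]
        have "?N n = {x \<in> space borel. ennreal ((G x)\<^sup>2) > \<mu>\<^sup>2} \<inter> (\<Inter>t\<in>\<rat>. {x \<in> space borel. 0 < t \<and> t < 1 / Suc n \<longrightarrow>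
            ?I (ball x t) \<le> \<mu>\<^sup>2 * emeasure lborel (ball (0::'a) t)})" by (auto simp: emeasure_ball)
        also have "\<dots> \<in> sets borel"
          by (intro sets.Int sets.countable_INT'' countable_rat) measurable
        finally show ?thesis .
      qed
      show ?thesis
        by (rule AE_not_in) (use meas \<open>\<And>n. emeasure lborel (?N n) = 0\<close> in \<open>auto simp: null_sets_def\<close>)
    qed
    have "AE x in lborel. \<forall>n. x \<notin> ?N n" using * by (subst AE_all_countable) auto
    then show ?thesis
    proof (rule AE_mp, intro AE_I2 impI)
      fix x assume x: "\<forall>n. x \<notin> ?N n" and Gx: "\<mu> < G x"
      obtain n where n: "1 / real (Suc n) < Rd x" using Rd[OF Gx] by (metis inverse_eq_divide reals_Archimedean)
      have "\<mu>\<^sup>2 < (G x)\<^sup>2" using Gx lam by (intro power_strict_mono) auto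
      then have "ennreal (\<mu>\<^sup>2) < ennreal ((G x)\<^sup>2)" using lam by (subst ennreal_less_iff) auto
      then obtain t where "0 < t" "t < 1 / Suc n" "?I (ball x t) > \<mu>\<^sup>2 * emeasure lborel (ball x t)"
        using x[rule_format, of n] by (auto simp: not_le)
      then show "x \<in> E" using n Gx unfolding E_def by (auto intro!: exI[of _ t])
    qed
  qed
  \<comment> \<open>The ball on the left is the five-fold enlargement of the ball on the right,
    which is the relation that the Vitali covering lemma supplies.\<close>
  have stop: "\<exists>t. 0 < t \<and> 10 * t \<le> Rd x \<and> ?I (ball x (10*t)) \<le> (\<integral>\<^sup>+y\<in>ball x (2*t). h y \<partial>lborel)" if x: "x \<in> E" for x
  proof -
    have Gx: "G x > \<mu>" using x by (auto simp: E_def)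
    obtain t where t: "0 < t" "10 * t \<le> Rd x" "?I (ball x t) > \<mu>\<^sup>2 * emeasure lborel (ball x t)"
       and big: "\<And>s. 2 * t \<le> s \<Longrightarrow> s \<le> Rd x \<Longrightarrow> ?I (ball x s) \<le> \<mu>\<^sup>2 * emeasure lborel (ball x s)"
    proof (rule obtain_stopping_radius[where R="Rd x" and x=x and c="\<mu>\<^sup>2" and h="\<lambda>y. ennreal ((G y)\<^sup>2)"])
      show "0 < Rd x" using Rd[OF Gx] by simp
      show "\<exists>t>0. t < Rd x \<and> ?I (ball x t) > ennreal (\<mu>\<^sup>2) * emeasure lborel (ball x t)" using x by (simp add: E_def)
    qed (use top[OF Gx] in auto)
    obtain v where v: "emeasure lborel (ball x t) = ennreal v" "v > 0"
      using t(1) by (simp add: emeasure_ball)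
    have v2: "emeasure lborel (ball x (2*t)) = ennreal (2^?d * v)" and v10: "emeasure lborel (ball x (10*t)) = ennreal (10^?d * v)"
      using t v by (auto simp: emeasure_ball_mult ennreal_mult[symmetric])
    define a where "a = (\<integral>\<^sup>+y\<in>ball x (2*t). ennreal (G y) * indicator {y. G y > \<kappa> * \<mu>} y \<partial>lborel)"
    define c where "c = (\<integral>\<^sup>+y\<in>ball x (2*t). ennreal ((H y)\<^sup>2) * indicator {y. H y > \<kappa> * \<mu>} y \<partial>lborel)"
    have "(\<integral>\<^sup>+y\<in>ball x (2*t). ennreal (G y) \<partial>lborel) \<le> ennreal (\<kappa> * \<mu>) * emeasure lborel (ball x (2*t)) + a"
      unfolding a_def by (rule nn_integral_split_bounded) (auto intro: ennreal_leI)
    then have 1: "(\<integral>\<^sup>+y\<in>ball x (2*t). ennreal (G y) \<partial>lborel) \<le> ennreal (\<kappa> * \<mu> * (2^?d * v)) + a"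
      using \<kappa> lam v by (simp add: v2 ennreal_mult[symmetric])
    have "(\<integral>\<^sup>+y\<in>ball x (2*t). ennreal ((H y)\<^sup>2) \<partial>lborel) \<le> ennreal ((\<kappa> * \<mu>)\<^sup>2) * emeasure lborel (ball x (2*t)) + c"
      unfolding c_def by (rule nn_integral_split_bounded) (auto intro!: ennreal_leI power_mono simp: H0)
    then have 2: "(\<integral>\<^sup>+y\<in>ball x (2*t). ennreal ((H y)\<^sup>2) \<partial>lborel) \<le> ennreal ((\<kappa> * \<mu>)\<^sup>2 * (2^?d * v)) + c"
      using \<kappa> lam v by (simp add: v2 ennreal_mult[symmetric])
    have "?I (ball x t) \<le> ennreal (\<theta> * \<mu>\<^sup>2) * emeasure lborel (ball x (2*t))
          + ennreal (b * \<mu>) * (\<integral>\<^sup>+y\<in>ball x (2*t). ennreal (G y) \<partial>lborel)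
          + ennreal b * (\<integral>\<^sup>+y\<in>ball x (2*t). ennreal ((H y)\<^sup>2) \<partial>lborel)"
      using rh[OF Gx t(1)] t big[of "2*t"] by auto
    also have "\<dots> \<le> ennreal (\<theta> * \<mu>\<^sup>2 * (2^?d * v)) + ennreal (b * \<mu>) * (ennreal (\<kappa> * \<mu> * (2^?d * v)) + a)
        + ennreal b * (ennreal ((\<kappa> * \<mu>)\<^sup>2 * (2^?d * v)) + c)"
      using 1 2 v \<theta>0 by (intro add_mono mult_left_mono) (auto simp: v2 ennreal_mult[symmetric])
    also have "\<dots> = ennreal (\<mu>\<^sup>2 * v * (\<theta> * 2^?d + b * (\<kappa> + \<kappa>\<^sup>2) * 2^?d)) + ennreal b * (ennreal \<mu> * a + c)"
    proof -
      let ?X = "2^?d * v"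
      have X: "0 \<le> ?X" using v by simp
      have e1: "ennreal (b * \<mu>) * (ennreal (\<kappa> * \<mu> * ?X) + a) = ennreal (b * \<mu> * (\<kappa> * \<mu> * ?X)) + ennreal b * (ennreal \<mu> * a)"
        using b lam \<kappa>(1) X by (simp only: distrib_left ennreal_mult mult_nonneg_nonneg less_imp_le mult.assoc)
      have e2: "ennreal b * (ennreal ((\<kappa> * \<mu>)\<^sup>2 * ?X) + c) = ennreal (b * ((\<kappa> * \<mu>)\<^sup>2 * ?X)) + ennreal b * c"
        using b X by (simp only: distrib_left ennreal_mult mult_nonneg_nonneg zero_le_power2)
      have "ennreal (\<theta> * \<mu>\<^sup>2 * ?X) + (ennreal (b * \<mu> * (\<kappa> * \<mu> * ?X)) + ennreal b * (ennreal \<mu> * a))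
        + (ennreal (b * ((\<kappa> * \<mu>)\<^sup>2 * ?X)) + ennreal b * c)
        = (ennreal (\<theta> * \<mu>\<^sup>2 * ?X) + ennreal (b * \<mu> * (\<kappa> * \<mu> * ?X)) + ennreal (b * ((\<kappa> * \<mu>)\<^sup>2 * ?X))) + ennreal b * (ennreal \<mu> * a + c)"
        by (simp add: distrib_left add_ac)
      also have "ennreal (\<theta> * \<mu>\<^sup>2 * ?X) + ennreal (b * \<mu> * (\<kappa> * \<mu> * ?X)) + ennreal (b * ((\<kappa> * \<mu>)\<^sup>2 * ?X))
        = ennreal (\<theta> * \<mu>\<^sup>2 * ?X + b * \<mu> * (\<kappa> * \<mu> * ?X) + b * ((\<kappa> * \<mu>)\<^sup>2 * ?X))"
      proof -
        have "0 \<le> \<theta> * \<mu>\<^sup>2 * ?X" "0 \<le> b * \<mu> * (\<kappa> * \<mu> * ?X)" "0 \<le> b * ((\<kappa> * \<mu>)\<^sup>2 * ?X)"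
          using b lam \<kappa>(1) v \<theta>0 by auto
        then show ?thesis by (metis ennreal_plus add_nonneg_nonneg)
      qed
      also have "\<theta> * \<mu>\<^sup>2 * ?X + b * \<mu> * (\<kappa> * \<mu> * ?X) + b * ((\<kappa> * \<mu>)\<^sup>2 * ?X) = \<mu>\<^sup>2 * v * (\<theta> * 2^?d + b * (\<kappa> + \<kappa>\<^sup>2) * 2^?d)"
        by (simp add: algebra_simps power2_eq_square)
      finally show ?thesis unfolding e1 e2 .
    qed
    \<comment> \<open>The two smallness hypotheses contribute 1/4 each; their factors 2^d convert
      the volume of \<open>ball x (2*t)\<close> into that of \<open>ball x t\<close>. Half of the
      lower bound \<open>\<mu>\<^sup>2 * v\<close> is left over.\<close>
    also have "\<dots> \<le> ennreal (\<mu>\<^sup>2 * v * (1/2)) + ennreal b * (ennreal \<mu> * a + c)"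
      using \<theta> \<kappa>(2) v by (intro add_right_mono ennreal_leI mult_left_mono) auto
    finally have "ennreal (\<mu>\<^sup>2 * v) < ennreal (\<mu>\<^sup>2 * v * (1/2)) + ennreal b * (ennreal \<mu> * a + c)"
      using t(3) v by (simp add: ennreal_mult[symmetric])
    then have A: "ennreal (\<mu>\<^sup>2 * v / 2) \<le> ennreal b * (ennreal \<mu> * a + c)"
    proof -
      assume *: "ennreal (\<mu>\<^sup>2 * v) < ennreal (\<mu>\<^sup>2 * v * (1/2)) + ennreal b * (ennreal \<mu> * a + c)"
      show ?thesis
      proof (cases "ennreal b * (ennreal \<mu> * a + c)")
        case (real z)
        then show ?thesis using * v by (simp add: ennreal_plus[symmetric] ennreal_less_iff del: ennreal_plus)
      qed simp
    qed
    \<comment> \<open>The stopping property at radius \<open>10 * t\<close> trades the integral of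
      \<open>G\<^sup>2\<close> for volume, and \<open>A\<close> bounds that volume by integrals over
      the upper level sets.\<close>
    have "?I (ball x (10*t)) \<le> ennreal (\<mu>\<^sup>2) * ennreal (10^?d * v)"
      using big[of "10*t"] t by (simp add: v10)
    also have "\<dots> = ennreal (2 * 10^?d) * ennreal (\<mu>\<^sup>2 * v / 2)"
      using v by (simp add: ennreal_mult[symmetric])
    also have "\<dots> \<le> ennreal (2 * 10^?d) * (ennreal b * (ennreal \<mu> * a + c))"
      by (intro mult_left_mono A) simp
    also have "\<dots> = (\<integral>\<^sup>+y\<in>ball x (2*t). h y \<partial>lborel)"
    proof -
      have "(\<integral>\<^sup>+y\<in>ball x (2*t). h y \<partial>lborel) = (\<integral>\<^sup>+y. ennreal (2 * 10 ^ ?d * b) *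
          (ennreal \<mu> * (ennreal (G y) * indicator {x. G x > \<kappa> * \<mu>} y * indicator (ball x (2*t)) y)
        + ennreal ((H y)\<^sup>2) * indicator {x. H x > \<kappa> * \<mu>} y * indicator (ball x (2*t)) y) \<partial>lborel)"
        unfolding h_def by (intro nn_integral_cong) (auto split: split_indicator)
      also have "\<dots> = ennreal (2 * 10 ^ ?d * b) * (ennreal \<mu> * a + c)"
        unfolding a_def c_def by (rule nn_integral_lincomb) measurable
      also have "\<dots> = ennreal (2 * 10^?d) * (ennreal b * (ennreal \<mu> * a + c))"
        using b by (simp add: ennreal_mult mult.assoc)
      finally show ?thesis by simp
    qed
    finally show ?thesis using t by blast
  qed
  define P where "P x t \<longleftrightarrow> 0 < t \<and> 10 * t \<le> Rd x \<and> ?I (ball x (10*t)) \<le> (\<integral>\<^sup>+y\<in>ball x (2*t). h y \<partial>lborel)" for x t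
  have "\<forall>x\<in>E. \<exists>t. P x t" unfolding P_def using stop by (rule ballI)
  then obtain T where "\<forall>x\<in>E. P x (T x)" by (rule bchoice[THEN exE])
  then have T: "0 < T x" "10 * T x \<le> Rd x" "?I (ball x (10*T x)) \<le> (\<integral>\<^sup>+y\<in>ball x (2*T x). h y \<partial>lborel)" if "x \<in> E" for x
    using that by (auto simp: P_def)
  have cov: "E \<subseteq> (\<Union>x\<in>E. ball x (2 * T x))" using T(1) by force
  \<comment> \<open>The Vitali covering lemma selects from balls of bounded radius;
    \<open>R0\<close> is that bound.\<close>
  have bd: "0 < 2 * T x \<and> 2 * T x \<le> R0" if "x \<in> E" for x
  proof -
    have "Rd x \<le> R0" "0 < Rd x" using Rd[of x] that by (auto simp: E_def)
    then show ?thesis using T(1,2)[OF that] by linarith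
  qed
  obtain C where C: "countable C" "C \<subseteq> E" "pairwise (\<lambda>i j. disjnt (ball i (2 * T i)) (ball j (2 * T j))) C"
     "E \<subseteq> (\<Union>i\<in>C. ball i (5 * (2 * T i)))"
    by (rule Vitali_covering_lemma_balls[OF cov bd])
  have "(\<integral>\<^sup>+x. ennreal ((G x)\<^sup>2) * indicator {x. G x > \<mu>} x \<partial>lborel) \<le> ?I E"
    using AE by (intro nn_integral_mono_AE) (auto elim!: eventually_mono simp: indicator_def)
  also have "\<dots> \<le> (\<integral>\<^sup>+x\<in>UNIV. h x \<partial>lborel)"
  proof (rule nn_integral_cover_le_disjoint[where I=C and X="\<lambda>i. ball i (2 * T i)" and Y="\<lambda>i. ball i (10 * T i)"])
    show "disjoint_family_on (\<lambda>i. ball i (2 * T i)) C"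
      using C(3) by (auto simp: disjoint_family_on_def pairwise_def disjnt_def)
  qed (use C(1,2,4) T(3) in auto)
  also have "\<dots> = ennreal (2 * 10 ^ DIM('a) * b) * (ennreal \<mu> * (\<integral>\<^sup>+x. ennreal (G x) * indicator {x. G x > \<kappa> * \<mu>} x \<partial>lborel)
        + (\<integral>\<^sup>+x. ennreal ((H x)\<^sup>2) * indicator {x. H x > \<kappa> * \<mu>} x \<partial>lborel))"
    unfolding h_def indicator_UNIV mult_1_right
    by (rule nn_integral_lincomb) measurable
  finally show ?thesis .
qed

section \<open>Integration over the levels\<close>

lemma nn_integral_powr_Icc:
  fixes a b \<epsilon> :: real
  assumes "0 < a" "a \<le> b" "0 < \<epsilon>"
  shows "(\<integral>\<^sup>+l. ennreal (\<epsilon> * l powr (\<epsilon> - 1)) * indicator {a..b} l \<partial>lborel) = ennreal (b powr \<epsilon> - a powr \<epsilon>)"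
proof (rule nn_integral_FTC_Icc[where F="\<lambda>l. l powr \<epsilon>"])
  fix x assume "x \<in> {a..b}"
  then show "((\<lambda>l. l powr \<epsilon>) has_real_derivative \<epsilon> * x powr (\<epsilon> - 1)) (at x)"
    using assms by (auto intro!: derivative_eq_intros)
qed (use assms in auto)

text \<open>Integrate the level estimate against \<open>\<epsilon> * l powr (\<epsilon> - 1)\<close>
  and exchange the integrals. The left side turns into \<open>G\<^sup>2 * G powr \<epsilon>\<close>,
  and the \<open>G\<close> term on the right reproduces it with the factor
  \<open>A * \<epsilon> / \<kappa>\<^sup>2\<close>, which is at most 1/2 and can be absorbed; this
  is what limits the gain in the exponent. The levels below \<open>l1\<close> account for the term
  with \<open>l1 powr \<epsilon>\<close>.\<close>

lemma higher_integrability_from_level_sets: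
  fixes G H :: "'a::euclidean_space \<Rightarrow> real" and A \<kappa> \<epsilon> l1 :: real
  assumes [measurable]: "G \<in> borel_measurable borel" "H \<in> borel_measurable borel"
    and G0: "\<And>x. 0 \<le> G x" and H0: "\<And>x. 0 \<le> H x"
    and fin: "(\<integral>\<^sup>+x. ennreal ((G x)\<^sup>2) \<partial>lborel) < \<infinity>"
    and l1: "0 < l1" and A: "0 \<le> A" and \<kappa>: "0 < \<kappa>" "\<kappa> \<le> 1" and \<epsilon>: "0 < \<epsilon>" "\<epsilon> \<le> 1" "A * \<epsilon> \<le> \<kappa>\<^sup>2 / 2"
    and level: "\<And>l. l1 \<le> l \<Longrightarrow> (\<integral>\<^sup>+x. ennreal ((G x)\<^sup>2) * indicator {x. G x > l} x \<partial>lborel) \<le>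
      ennreal A * (ennreal l * (\<integral>\<^sup>+x. ennreal (G x) * indicator {x. G x > \<kappa> * l} x \<partial>lborel)
        + (\<integral>\<^sup>+x. ennreal ((H x)\<^sup>2) * indicator {x. H x > \<kappa> * l} x \<partial>lborel))"
  shows "(\<integral>\<^sup>+x. ennreal ((G x)\<^sup>2 * G x powr \<epsilon>) \<partial>lborel) \<le>
    ennreal (2 * l1 powr \<epsilon>) * (\<integral>\<^sup>+x. ennreal ((G x)\<^sup>2) \<partial>lborel) + ennreal (2 * A / \<kappa>) * (\<integral>\<^sup>+x. ennreal ((H x)\<^sup>2 * H x powr \<epsilon>) \<partial>lborel)"
    (is "_ \<le> ?R")
proof -
  define w where "w l = ennreal (\<epsilon> * l powr (\<epsilon> - 1))" for l
  have w[measurable]: "w \<in> borel_measurable borel" unfolding w_def by measurable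
  \<comment> \<open>Truncating at \<open>m\<close> the factor raised to the power
    \<open>\<epsilon>\<close> keeps the integral finite, as absorption demands. Monotone convergence
    removes \<open>m\<close> at the end.\<close>
  have trunc: "(\<integral>\<^sup>+x. ennreal ((G x)\<^sup>2 * (min (G x) m) powr \<epsilon>) \<partial>lborel) \<le> ?R" if m: "l1 \<le> m" for m
  proof -
    let ?T = "\<lambda>x. min (G x) m"
    let ?X = "\<integral>\<^sup>+x. ennreal ((G x)\<^sup>2 * ?T x powr \<epsilon>) \<partial>lborel"
    let ?H = "\<integral>\<^sup>+x. ennreal ((H x)\<^sup>2 * H x powr \<epsilon>) \<partial>lborel"
    have m0: "0 < m" using l1 m by simp
    have T0: "0 \<le> ?T x" for x using G0[of x] m0 by auto
    \<comment> \<open>Layer-cake formula for the truncated power above the level \<open>l1\<close>.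
      The conditions \<open>l \<le> m\<close> and \<open>l < G x\<close> describe
      \<open>l \<le> ?T x\<close> up to the single point \<open>G x\<close>.\<close>
    have lower: "ennreal (?T x powr \<epsilon>) \<le> ennreal (l1 powr \<epsilon>) + (\<integral>\<^sup>+l. w l * indicator {l1..m} l * indicator {l. l < G x} l \<partial>lborel)" for x
    proof (cases "l1 \<le> ?T x")
      case True
      have "ennreal (?T x powr \<epsilon>) = ennreal (l1 powr \<epsilon>) + ennreal (?T x powr \<epsilon> - l1 powr \<epsilon>)"
        using True l1 \<epsilon> by (subst ennreal_plus[symmetric]) (auto intro!: powr_mono2)
      also have "ennreal (?T x powr \<epsilon> - l1 powr \<epsilon>) = (\<integral>\<^sup>+l. w l * indicator {l1..?T x} l \<partial>lborel)"
        unfolding w_def using True l1 \<epsilon> by (subst nn_integral_powr_Icc) auto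
      also have "\<dots> \<le> (\<integral>\<^sup>+l. w l * indicator {l1..m} l * indicator {l. l < G x} l \<partial>lborel)"
      proof (intro nn_integral_mono_AE)
        show "AE l in lborel. w l * indicator {l1..?T x} l \<le> w l * indicator {l1..m} l * indicator {l. l < G x} l"
          using AE_lborel_singleton[of "G x"] by eventually_elim (auto simp: indicator_def)
      qed
      finally show ?thesis by simp
    next
      case False
      then have "?T x powr \<epsilon> \<le> l1 powr \<epsilon>" using T0[of x] \<epsilon> by (intro powr_mono2) auto
      then show ?thesis by (intro add_increasing2 ennreal_leI) auto
    qed
    \<comment> \<open>In the range of integration \<open>l \<le> ?T x / \<kappa>\<close>, where
      \<open>\<kappa> \<le> 1\<close> handles the truncation. The integrand
      \<open>\<epsilon> * l powr \<epsilon>\<close> is bounded by its value at that end, so the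
      factor \<open>\<epsilon>\<close> survives;
      \<open>\<kappa> \<le> \<kappa> powr \<epsilon>\<close> then removes the fractional power of
      \<open>\<kappa>\<close>.\<close>
    have u1: "(\<integral>\<^sup>+l. w l * ennreal l * indicator {l1..m} l * indicator {l. \<kappa> * l < G x} l \<partial>lborel)
        \<le> ennreal (\<epsilon> / \<kappa>\<^sup>2 * (?T x * ?T x powr \<epsilon>))" for x
    proof -
      have "w l * ennreal l * indicator {l1..m} l * indicator {l. \<kappa> * l < G x} l
        \<le> ennreal (\<epsilon> * (?T x / \<kappa>) powr \<epsilon>) * indicator {0..?T x / \<kappa>} l" for l
      proof (cases "l \<in> {l1..m} \<and> \<kappa> * l < G x")
        case True
        then have l: "0 < l" "l \<le> ?T x / \<kappa>"
        proof -
          show "0 < l" using True l1 by auto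
          have "\<kappa> * l \<le> m" using True \<kappa> \<open>0 < l\<close> by (smt (verit) atLeastAtMost_iff mult_left_le_one_le)
          then show "l \<le> ?T x / \<kappa>" using True \<kappa> by (simp add: field_simps)
        qed
        have "w l * ennreal l = ennreal (\<epsilon> * l powr \<epsilon>)"
          unfolding w_def using l \<epsilon> by (simp add: ennreal_mult[symmetric] powr_diff)
        also have "\<dots> \<le> ennreal (\<epsilon> * (?T x / \<kappa>) powr \<epsilon>)"
          using l \<epsilon> by (intro ennreal_leI mult_left_mono powr_mono2) auto
        finally show ?thesis using True l by auto
      qed (auto simp: indicator_def)
      then have "(\<integral>\<^sup>+l. w l * ennreal l * indicator {l1..m} l * indicator {l. \<kappa> * l < G x} l \<partial>lborel)
        \<le> (\<integral>\<^sup>+l. ennreal (\<epsilon> * (?T x / \<kappa>) powr \<epsilon>) * indicator {0..?T x / \<kappa>} l \<partial>lborel)"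
        by (intro nn_integral_mono)
      also have "\<dots> = ennreal (\<epsilon> * (?T x / \<kappa>) powr \<epsilon> * (?T x / \<kappa>))"
        using T0[of x] \<kappa> \<epsilon> by (simp add: nn_integral_cmult_indicator ennreal_mult[symmetric])
      also have "\<dots> \<le> ennreal (\<epsilon> / \<kappa>\<^sup>2 * (?T x * ?T x powr \<epsilon>))"
      proof (intro ennreal_leI)
        have "(?T x / \<kappa>) powr \<epsilon> = ?T x powr \<epsilon> / \<kappa> powr \<epsilon>" using T0[of x] \<kappa> by (simp add: powr_divide)
        also have "\<dots> \<le> ?T x powr \<epsilon> / \<kappa>"
        proof -
          have "\<kappa> \<le> \<kappa> powr \<epsilon>" using \<kappa> \<epsilon> powr_mono'[of \<epsilon> 1 \<kappa>] by simp
          then show ?thesis using \<kappa> by (intro divide_left_mono) auto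
        qed
        finally have "\<epsilon> * (?T x / \<kappa>) powr \<epsilon> * (?T x / \<kappa>) \<le> \<epsilon> * (?T x powr \<epsilon> / \<kappa>) * (?T x / \<kappa>)"
          using \<epsilon> T0[of x] \<kappa> by (intro mult_right_mono mult_left_mono) auto
        then show "\<epsilon> * (?T x / \<kappa>) powr \<epsilon> * (?T x / \<kappa>) \<le> \<epsilon> / \<kappa>\<^sup>2 * (?T x * ?T x powr \<epsilon>)"
          by (simp add: power2_eq_square mult_ac)
      qed
      finally show ?thesis .
    qed
    \<comment> \<open>Without the extra factor \<open>l\<close> the weight integrates exactly and no
      small factor appears. This term contains only \<open>H\<close> and is not absorbed.\<close>
    have u2: "(\<integral>\<^sup>+l. w l * indicator {l1..m} l * indicator {l. \<kappa> * l < H x} l \<partial>lborel)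
        \<le> ennreal (1 / \<kappa> * H x powr \<epsilon>)" for x
    proof (cases "l1 \<le> H x / \<kappa>")
      case True
      have "(\<integral>\<^sup>+l. w l * indicator {l1..m} l * indicator {l. \<kappa> * l < H x} l \<partial>lborel)
         \<le> (\<integral>\<^sup>+l. w l * indicator {l1..H x / \<kappa>} l \<partial>lborel)"
        using \<kappa> by (intro nn_integral_mono) (auto simp: indicator_def field_simps)
      also have "\<dots> = ennreal ((H x / \<kappa>) powr \<epsilon> - l1 powr \<epsilon>)"
        unfolding w_def using True l1 \<epsilon> by (subst nn_integral_powr_Icc) auto
      also have "\<dots> \<le> ennreal (1 / \<kappa> * H x powr \<epsilon>)"
      proof (intro ennreal_leI)
        have "\<kappa> \<le> \<kappa> powr \<epsilon>" using \<kappa> \<epsilon> powr_mono'[of \<epsilon> 1 \<kappa>] by simp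
        then have "H x powr \<epsilon> / \<kappa> powr \<epsilon> \<le> H x powr \<epsilon> / \<kappa>" using \<kappa> by (intro divide_left_mono) auto
        then show "(H x / \<kappa>) powr \<epsilon> - l1 powr \<epsilon> \<le> 1 / \<kappa> * H x powr \<epsilon>"
          using H0[of x] \<kappa> powr_ge_zero[of l1 \<epsilon>] by (simp add: powr_divide del: powr_ge_zero)
      qed
      finally show ?thesis .
    next
      case False
      have "\<not> \<kappa> * l < H x" if "l1 \<le> l" for l
      proof -
        have "H x < \<kappa> * l1" using False \<kappa> by (simp add: field_simps)
        also have "\<dots> \<le> \<kappa> * l" using that \<kappa> by (intro mult_left_mono) auto
        finally show ?thesis by simp
      qed
      then have "(\<integral>\<^sup>+l. w l * indicator {l1..m} l * indicator {l. \<kappa> * l < H x} l \<partial>lborel) = (\<integral>\<^sup>+l. 0 \<partial>(lborel::real measure))"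
        by (intro nn_integral_cong) (auto simp: indicator_def)
      then show ?thesis by simp
    qed
    let ?L = "\<integral>\<^sup>+l. w l * indicator {l1..m} l * (\<integral>\<^sup>+x. ennreal ((G x)\<^sup>2) * indicator {x. G x > l} x \<partial>lborel) \<partial>lborel"
    \<comment> \<open>Used with \<open>c = 1\<close> on the left side of the level estimate and with
      \<open>c = \<kappa>\<close> for both terms on the right; hence the factor \<open>1 * l\<close>
      below.\<close>
    have swap: "(\<integral>\<^sup>+l. v l * (\<integral>\<^sup>+x. ennreal (Q x) * indicator {x. c * l < Z x} x \<partial>lborel) \<partial>lborel)
        = (\<integral>\<^sup>+x. ennreal (Q x) * (\<integral>\<^sup>+l. v l * indicator {l. c * l < Z x} l \<partial>lborel) \<partial>lborel)"
      if [measurable]: "v \<in> borel_measurable borel" "Q \<in> borel_measurable borel" "Z \<in> borel_measurable borel"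
      for v :: "real \<Rightarrow> ennreal" and Q Z :: "'a \<Rightarrow> real" and c :: real
    proof -
      have 1: "(\<lambda>(l, x). v l * (ennreal (Q x) * (if c * l < Z x then 1 else 0))) \<in> borel_measurable (lborel \<Otimes>\<^sub>M lborel)"
        by measurable
      have "(\<integral>\<^sup>+l. v l * (\<integral>\<^sup>+x. ennreal (Q x) * indicator {x. c * l < Z x} x \<partial>lborel) \<partial>lborel)
        = (\<integral>\<^sup>+l. (\<integral>\<^sup>+x. v l * (ennreal (Q x) * (if c * l < Z x then 1 else 0)) \<partial>lborel) \<partial>lborel)"
        by (intro nn_integral_cong, subst nn_integral_cmult[symmetric]) (auto intro!: nn_integral_cong simp: indicator_def)
      also have "\<dots> = (\<integral>\<^sup>+x. (\<integral>\<^sup>+l. v l * (ennreal (Q x) * (if c * l < Z x then 1 else 0)) \<partial>lborel) \<partial>lborel)"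
        by (rule lborel_pair.Fubini'[symmetric]) (use 1 in simp)
      also have "\<dots> = (\<integral>\<^sup>+x. ennreal (Q x) * (\<integral>\<^sup>+l. v l * indicator {l. c * l < Z x} l \<partial>lborel) \<partial>lborel)"
        by (intro nn_integral_cong, subst nn_integral_cmult[symmetric]) (auto intro!: nn_integral_cong simp: indicator_def mult.commute)
      finally show ?thesis .
    qed
    have "?X \<le> (\<integral>\<^sup>+x. ennreal (l1 powr \<epsilon>) * ennreal ((G x)\<^sup>2) + ennreal ((G x)\<^sup>2) *
        (\<integral>\<^sup>+l. w l * indicator {l1..m} l * indicator {l. 1 * l < G x} l \<partial>lborel) \<partial>lborel)"
    proof (intro nn_integral_mono)
      fix x
      have "ennreal ((G x)\<^sup>2 * ?T x powr \<epsilon>) = ennreal ((G x)\<^sup>2) * ennreal (?T x powr \<epsilon>)" by (simp add: ennreal_mult)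
      also have "\<dots> \<le> ennreal ((G x)\<^sup>2) * (ennreal (l1 powr \<epsilon>) + (\<integral>\<^sup>+l. w l * indicator {l1..m} l * indicator {l. l < G x} l \<partial>lborel))"
        by (intro mult_left_mono lower) auto
      finally show "ennreal ((G x)\<^sup>2 * ?T x powr \<epsilon>) \<le> ennreal (l1 powr \<epsilon>) * ennreal ((G x)\<^sup>2) + ennreal ((G x)\<^sup>2) *
        (\<integral>\<^sup>+l. w l * indicator {l1..m} l * indicator {l. 1 * l < G x} l \<partial>lborel)"
        by (simp add: distrib_left mult_ac)
    qed
    also have "\<dots> = ennreal (l1 powr \<epsilon>) * (\<integral>\<^sup>+x. ennreal ((G x)\<^sup>2) \<partial>lborel) + (\<integral>\<^sup>+x. ennreal ((G x)\<^sup>2) *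
        (\<integral>\<^sup>+l. w l * indicator {l1..m} l * indicator {l. 1 * l < G x} l \<partial>lborel) \<partial>lborel)"
      by (subst nn_integral_add) (auto simp: nn_integral_cmult indicator_def intro!: borel_measurable_times)
    also have "(\<integral>\<^sup>+x. ennreal ((G x)\<^sup>2) *
        (\<integral>\<^sup>+l. w l * indicator {l1..m} l * indicator {l. 1 * l < G x} l \<partial>lborel) \<partial>lborel) = ?L"
      by (subst swap[symmetric]) auto
    also have "?L \<le> (\<integral>\<^sup>+l. ennreal A * (w l * ennreal l * indicator {l1..m} l * (\<integral>\<^sup>+x. ennreal (G x) * indicator {x. \<kappa> * l < G x} x \<partial>lborel)
        + w l * indicator {l1..m} l * (\<integral>\<^sup>+x. ennreal ((H x)\<^sup>2) * indicator {x. \<kappa> * l < H x} x \<partial>lborel)) \<partial>lborel)"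
    proof (intro nn_integral_mono)
      fix l
      show "w l * indicator {l1..m} l * (\<integral>\<^sup>+x. ennreal ((G x)\<^sup>2) * indicator {x. G x > l} x \<partial>lborel) \<le>
       ennreal A * (w l * ennreal l * indicator {l1..m} l * (\<integral>\<^sup>+x. ennreal (G x) * indicator {x. \<kappa> * l < G x} x \<partial>lborel)
        + w l * indicator {l1..m} l * (\<integral>\<^sup>+x. ennreal ((H x)\<^sup>2) * indicator {x. \<kappa> * l < H x} x \<partial>lborel))"
      proof (cases "l \<in> {l1..m}")
        case True
        have "w l * (\<integral>\<^sup>+x. ennreal ((G x)\<^sup>2) * indicator {x. G x > l} x \<partial>lborel) \<le> w l * (ennreal A * (ennreal l * (\<integral>\<^sup>+x. ennreal (G x) * indicator {x. G x > \<kappa> * l} x \<partial>lborel)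
        + (\<integral>\<^sup>+x. ennreal ((H x)\<^sup>2) * indicator {x. H x > \<kappa> * l} x \<partial>lborel)))"
          using True by (intro mult_left_mono level) auto
        then show ?thesis using True by (simp add: distrib_left mult_ac)
      qed simp
    qed
    also have "\<dots> = ennreal A * ((\<integral>\<^sup>+x. ennreal (G x) * (\<integral>\<^sup>+l. w l * ennreal l * indicator {l1..m} l * indicator {l. \<kappa> * l < G x} l \<partial>lborel) \<partial>lborel)
        + (\<integral>\<^sup>+x. ennreal ((H x)\<^sup>2) * (\<integral>\<^sup>+l. w l * indicator {l1..m} l * indicator {l. \<kappa> * l < H x} l \<partial>lborel) \<partial>lborel))"
      by (subst nn_integral_cmult, measurable, subst nn_integral_add, measurable, subst (1 2) swap) (auto simp: mult.assoc)
    also have "\<dots> \<le> ennreal A * ((\<integral>\<^sup>+x. ennreal (G x) * ennreal (\<epsilon> / \<kappa>\<^sup>2 * (?T x * ?T x powr \<epsilon>)) \<partial>lborel)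
        + (\<integral>\<^sup>+x. ennreal ((H x)\<^sup>2) * ennreal (1 / \<kappa> * H x powr \<epsilon>) \<partial>lborel))"
      by (intro mult_left_mono add_mono nn_integral_mono u1 u2) auto
    also have "\<dots> \<le> ennreal A * (ennreal (\<epsilon> / \<kappa>\<^sup>2) * ?X + ennreal (1 / \<kappa>) * ?H)"
    proof (intro mult_left_mono add_mono)
      have "(\<integral>\<^sup>+x. ennreal (G x) * ennreal (\<epsilon> / \<kappa>\<^sup>2 * (?T x * ?T x powr \<epsilon>)) \<partial>lborel) \<le> (\<integral>\<^sup>+x. ennreal (\<epsilon> / \<kappa>\<^sup>2) * ennreal ((G x)\<^sup>2 * ?T x powr \<epsilon>) \<partial>lborel)"
      proof (intro nn_integral_mono)
        fix x
        have "G x * (\<epsilon> / \<kappa>\<^sup>2 * (?T x * ?T x powr \<epsilon>)) \<le> G x * (\<epsilon> / \<kappa>\<^sup>2 * (G x * ?T x powr \<epsilon>))"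
          using \<epsilon> G0[of x] T0[of x] by (intro mult_left_mono mult_right_mono) auto
        then show "ennreal (G x) * ennreal (\<epsilon> / \<kappa>\<^sup>2 * (?T x * ?T x powr \<epsilon>)) \<le> ennreal (\<epsilon> / \<kappa>\<^sup>2) * ennreal ((G x)\<^sup>2 * ?T x powr \<epsilon>)"
          using \<epsilon> G0[of x] T0[of x]
          by (subst (1 2) ennreal_mult[symmetric]) (auto intro!: ennreal_leI simp: power2_eq_square mult_ac)
      qed
      then show "(\<integral>\<^sup>+x. ennreal (G x) * ennreal (\<epsilon> / \<kappa>\<^sup>2 * (?T x * ?T x powr \<epsilon>)) \<partial>lborel) \<le> ennreal (\<epsilon> / \<kappa>\<^sup>2) * ?X"
        by (simp add: nn_integral_cmult)
      have "(\<integral>\<^sup>+x. ennreal ((H x)\<^sup>2) * ennreal (1 / \<kappa> * H x powr \<epsilon>) \<partial>lborel) = (\<integral>\<^sup>+x. ennreal (1 / \<kappa>) * ennreal ((H x)\<^sup>2 * H x powr \<epsilon>) \<partial>lborel)"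
        using \<kappa> by (intro nn_integral_cong, subst (1 2) ennreal_mult[symmetric]) (auto simp: mult_ac)
      then show "(\<integral>\<^sup>+x. ennreal ((H x)\<^sup>2) * ennreal (1 / \<kappa> * H x powr \<epsilon>) \<partial>lborel) \<le> ennreal (1 / \<kappa>) * ?H"
        by (simp add: nn_integral_cmult)
    qed auto
    also have "\<dots> = ennreal (A * (\<epsilon> / \<kappa>\<^sup>2)) * ?X + ennreal (A / \<kappa>) * ?H"
    proof -
      have "ennreal A * ennreal (\<epsilon> / \<kappa>\<^sup>2) = ennreal (A * (\<epsilon> / \<kappa>\<^sup>2))" using A \<epsilon> by (intro ennreal_mult[symmetric]) auto
      moreover have "ennreal A * ennreal (1 / \<kappa>) = ennreal (A / \<kappa>)" using A \<kappa> by (subst ennreal_mult[symmetric]) auto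
      ultimately show ?thesis by (simp only: distrib_left mult.assoc[symmetric])
    qed
    also have "\<dots> \<le> ennreal (1/2) * ?X + ennreal (A / \<kappa>) * ?H"
      using \<epsilon>(3) \<kappa> by (intro add_right_mono mult_right_mono ennreal_leI) (auto simp: field_simps)
    finally have X: "?X \<le> ennreal (l1 powr \<epsilon>) * (\<integral>\<^sup>+x. ennreal ((G x)\<^sup>2) \<partial>lborel) + (ennreal (1/2) * ?X + ennreal (A / \<kappa>) * ?H)"
      by (simp add: add_left_mono)
    have Xfin: "?X < \<infinity>"
    proof -
      have "?X \<le> (\<integral>\<^sup>+x. ennreal (m powr \<epsilon>) * ennreal ((G x)\<^sup>2) \<partial>lborel)"
      proof (intro nn_integral_mono)
        fix x
        have "?T x powr \<epsilon> \<le> m powr \<epsilon>" using T0[of x] \<epsilon> by (intro powr_mono2) auto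
        then show "ennreal ((G x)\<^sup>2 * ?T x powr \<epsilon>) \<le> ennreal (m powr \<epsilon>) * ennreal ((G x)\<^sup>2)"
          by (subst ennreal_mult[symmetric]) (auto intro!: ennreal_leI mult_left_mono simp: mult.commute[of "m powr \<epsilon>"])
      qed
      also have "\<dots> < \<infinity>" using fin by (simp add: nn_integral_cmult ennreal_mult_less_top)
      finally show ?thesis .
    qed
    let ?a = "ennreal (l1 powr \<epsilon>) * (\<integral>\<^sup>+x. ennreal ((G x)\<^sup>2) \<partial>lborel)" and ?c = "ennreal (A / \<kappa>) * ?H"
    have "?X \<le> ennreal 2 * (?a + ?c)"
    proof (cases "?a + ?c")
      case (real z)
      obtain y where y: "?X = ennreal y" "0 \<le> y" using Xfin by (cases ?X) auto
      have "ennreal y \<le> (?a + ?c) + ennreal (1/2) * ennreal y" using X y by (simp add: add_ac)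
      also have "\<dots> = ennreal (z + 1/2 * y)" using real y by (simp add: ennreal_mult[symmetric] del: ennreal_half)
      finally have "y \<le> z + y / 2" using real y by (subst (asm) ennreal_le_iff) auto
      then have "y \<le> 2 * z" by simp
      then show ?thesis using real y by (simp add: ennreal_mult'[symmetric] del: ennreal_numeral)
    next
      case top
      show ?thesis unfolding top by (simp add: ennreal_mult_top)
    qed
    also have "\<dots> = ?R"
    proof -
      have "ennreal 2 * ennreal (A / \<kappa>) = ennreal (2 * A / \<kappa>)" "ennreal 2 * ennreal (l1 powr \<epsilon>) = ennreal (2 * l1 powr \<epsilon>)"
        using A \<kappa> by (auto simp: ennreal_mult'[symmetric] simp del: ennreal_numeral)
      then show ?thesis by (simp only: distrib_left mult.assoc[symmetric])
    qed
    finally show ?thesis .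
  qed
  have "(\<integral>\<^sup>+x. ennreal ((G x)\<^sup>2 * G x powr \<epsilon>) \<partial>lborel) = (\<integral>\<^sup>+x. (SUP k::nat. ennreal ((G x)\<^sup>2 * (min (G x) (l1 + k)) powr \<epsilon>)) \<partial>lborel)"
  proof (intro nn_integral_cong antisym SUP_least)
    fix x
    obtain k :: nat where "G x \<le> k" using real_arch_simple by blast
    then show "ennreal ((G x)\<^sup>2 * G x powr \<epsilon>) \<le> (SUP k::nat. ennreal ((G x)\<^sup>2 * (min (G x) (l1 + k)) powr \<epsilon>))"
      using l1 by (intro SUP_upper2[of k]) (auto simp: min_def)
    fix k :: nat
    show "ennreal ((G x)\<^sup>2 * (min (G x) (l1 + k)) powr \<epsilon>) \<le> ennreal ((G x)\<^sup>2 * G x powr \<epsilon>)"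
      using l1 \<epsilon> G0[of x] by (intro ennreal_leI mult_left_mono powr_mono2) auto
  qed
  also have "\<dots> = (SUP k::nat. \<integral>\<^sup>+x. ennreal ((G x)\<^sup>2 * (min (G x) (l1 + k)) powr \<epsilon>) \<partial>lborel)"
  proof (rule nn_integral_monotone_convergence_SUP)
    show "incseq (\<lambda>k x. ennreal ((G x)\<^sup>2 * (min (G x) (l1 + real k)) powr \<epsilon>))"
      using l1 \<epsilon> G0 by (auto simp: incseq_def le_fun_def intro!: ennreal_leI mult_left_mono powr_mono2)
  qed measurable
  also have "\<dots> \<le> ?R" by (intro SUP_least trunc) auto
  finally show ?thesis .
qed

section \<open>Localisation to a ball and Gehring's lemma\<close>

lemma nn_set_integral_cmult:
  fixes f :: "'a \<Rightarrow> ennreal"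
  assumes [measurable]: "f \<in> borel_measurable M" "S \<in> sets M"
  shows "(\<integral>\<^sup>+y\<in>S. c * f y \<partial>M) = c * (\<integral>\<^sup>+y\<in>S. f y \<partial>M)"
  unfolding mult.assoc by (rule nn_integral_cmult) measurable

lemma nn_set_integral_mono:
  assumes "\<And>y. y \<in> S \<Longrightarrow> f y \<le> g y"
  shows "(\<integral>\<^sup>+y\<in>S. f y \<partial>M) \<le> (\<integral>\<^sup>+y\<in>S. g y \<partial>M)"
  by (intro nn_integral_mono) (use assms in \<open>auto simp: indicator_def\<close>)

lemma nn_set_integral_mono_set:
  assumes "S \<subseteq> T"
  shows "(\<integral>\<^sup>+y\<in>S. f y \<partial>M) \<le> (\<integral>\<^sup>+y\<in>T. f y \<partial>M)"
  by (intro nn_integral_mono) (use assms in \<open>auto simp: indicator_def\<close>)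

text \<open>Multiplying \<open>g\<close> by a power of the normalised distance to the boundary makes the stopping time
  argument work on the whole ball at once: the weight is essentially constant on the stopping balls.\<close>

lemma gehring_dist_weight:
  fixes g f :: "'a::euclidean_space \<Rightarrow> real" and r L b \<kappa> \<epsilon> :: real and x0 :: 'a
  assumes [measurable]: "g \<in> borel_measurable borel" "f \<in> borel_measurable borel"
    and g0: "\<And>x. 0 \<le> g x" and f0: "\<And>x. 0 \<le> f x"
    and r: "0 < r" and L: "0 < L" and b: "0 \<le> b"
    and gL: "(\<integral>\<^sup>+y\<in>ball x0 r. ennreal ((g y)\<^sup>2) \<partial>lborel) \<le> ennreal (L\<^sup>2) * emeasure lborel (ball x0 r)"
    and rh: "\<And>x t l. 0 < t \<Longrightarrow> 0 < l \<Longrightarrow> ball x (2*t) \<subseteq> ball x0 r \<Longrightarrow>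
        (\<integral>\<^sup>+y\<in>ball x (2*t). ennreal ((g y)\<^sup>2) \<partial>lborel) \<le> ennreal (l\<^sup>2) * emeasure lborel (ball x (2*t)) \<Longrightarrow>
        (\<integral>\<^sup>+y\<in>ball x t. ennreal ((g y)\<^sup>2) \<partial>lborel) \<le> ennreal (l\<^sup>2 / (4 * 8^DIM('a))) * emeasure lborel (ball x (2*t))
          + ennreal (b * l) * (\<integral>\<^sup>+y\<in>ball x (2*t). ennreal (g y) \<partial>lborel)
          + ennreal b * (\<integral>\<^sup>+y\<in>ball x (2*t). ennreal ((f y)\<^sup>2) \<partial>lborel)"
    and \<kappa>: "0 < \<kappa>" "\<kappa> \<le> 1" "4^DIM('a) * b * (\<kappa> + \<kappa>\<^sup>2) * 2 ^ DIM('a) \<le> 1/4"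
    and \<epsilon>: "0 < \<epsilon>" "\<epsilon> \<le> 1" "2 * 10^DIM('a) * (4^DIM('a) * b) * \<epsilon> \<le> \<kappa>\<^sup>2 / 2"
  defines "\<delta> \<equiv> \<lambda>y. max 0 ((r - dist x0 y) / r)"
  defines "G \<equiv> \<lambda>y. sqrt (\<delta> y) ^ DIM('a) * g y" and "H \<equiv> \<lambda>y. sqrt (\<delta> y) ^ DIM('a) * f y"
  shows "(\<integral>\<^sup>+x. ennreal ((G x)\<^sup>2 * G x powr \<epsilon>) \<partial>lborel) \<le>
    ennreal (2 * (80^DIM('a) * L) powr \<epsilon>) * (\<integral>\<^sup>+x. ennreal ((G x)\<^sup>2) \<partial>lborel)
     + ennreal (2 * (2 * 10^DIM('a) * (4^DIM('a) * b)) / \<kappa>) * (\<integral>\<^sup>+x. ennreal ((H x)\<^sup>2 * H x powr \<epsilon>) \<partial>lborel)"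
proof -
  let ?d = "DIM('a)"
  have dpos: "0 < ?d" by simp
  have \<delta>m[measurable]: "\<delta> \<in> borel_measurable borel" unfolding \<delta>_def by measurable
  have [measurable]: "G \<in> borel_measurable borel" "H \<in> borel_measurable borel"
    unfolding G_def H_def by measurable
  have \<delta>0: "0 \<le> \<delta> y" for y by (simp add: \<delta>_def)
  have \<delta>1: "\<delta> y \<le> 1" for y using r by (simp add: \<delta>_def)
  have s1: "sqrt (\<delta> y) ^ ?d \<le> 1" for y using \<delta>0[of y] \<delta>1[of y] by (intro power_le_one) auto
  have s0: "0 \<le> sqrt (\<delta> y) ^ ?d" for y using \<delta>0 by simp
  have G0: "0 \<le> G y" and H0: "0 \<le> H y" for y using s0 g0 f0 by (auto simp: G_def H_def)
  have Gg: "G y \<le> g y" for y unfolding G_def using mult_left_le_one_le[OF g0 s0 s1] .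
  have out: "\<delta> y = 0" if "y \<notin> ball x0 r" for y using that r by (auto simp: \<delta>_def divide_nonpos_pos)
  have G_out: "G y = 0" if "y \<notin> ball x0 r" for y using out[OF that] by (simp add: G_def zero_power)
  have fin: "(\<integral>\<^sup>+x. ennreal ((G x)\<^sup>2) \<partial>lborel) < \<infinity>"
  proof -
    have "(\<integral>\<^sup>+x. ennreal ((G x)\<^sup>2) \<partial>lborel) \<le> (\<integral>\<^sup>+y\<in>ball x0 r. ennreal ((g y)\<^sup>2) \<partial>lborel)"
      using Gg G0 G_out by (intro nn_integral_mono) (auto simp: indicator_def intro!: ennreal_leI power_mono)
    also have "\<dots> < \<infinity>"
      using gL emeasure_lborel_ball_finite[of x0 r] by (auto simp: ennreal_mult_less_top intro: le_less_trans)
    finally show ?thesis .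
  qed
  \<comment> \<open>Half the distance from \<open>x\<close> to the boundary of the ball: within it
    \<open>\<delta>\<close> changes at most by a factor 2.\<close>
  define Rd where "Rd x = r * \<delta> x / 2" for x
  have inb: "x \<in> ball x0 r" "0 < \<delta> x" "\<delta> x = (r - dist x0 x) / r" if "G x > 0" for x
  proof -
    show x: "x \<in> ball x0 r" using that G_out[of x] by force
    have "\<delta> x \<noteq> 0" using that by (auto simp: G_def zero_power)
    then show "0 < \<delta> x" using \<delta>0[of x] by simp
    then show "\<delta> x = (r - dist x0 x) / r" by (auto simp: \<delta>_def)
  qed
  have sub: "ball x t \<subseteq> ball x0 r" "\<And>y. y \<in> ball x t \<Longrightarrow> \<delta> x / 2 \<le> \<delta> y \<and> \<delta> y \<le> 2 * \<delta> x"
    if Gx: "G x > 0" and tR: "t \<le> Rd x" for x t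
  proof -
    have d: "r * \<delta> x = r - dist x0 x" using inb(3)[OF Gx] r by simp
    have "y \<in> ball x0 r \<and> \<delta> x / 2 \<le> \<delta> y \<and> \<delta> y \<le> 2 * \<delta> x" if y: "y \<in> ball x t" for y
    proof -
      have yt: "dist x y < r * \<delta> x / 2" using y tR by (simp add: Rd_def)
      have t1: "dist x0 y \<le> dist x0 x + dist x y" "dist x0 x \<le> dist x0 y + dist x y"
        using dist_triangle[of x0 y x] dist_triangle[of x0 x y] by (auto simp: dist_commute)
      have pos: "0 < r * \<delta> x" using r inb(2)[OF Gx] by simp
      have inn: "dist x0 y < r" using yt t1 d pos by linarith
      have ry: "r * \<delta> y = r - dist x0 y" using inn r by (simp add: \<delta>_def max_def)
      have "r * (\<delta> x / 2) \<le> r * \<delta> y" "r * \<delta> y \<le> r * (2 * \<delta> x)" using ry d yt t1 pos by auto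
      then show ?thesis using inn r by auto
    qed
    then show "ball x t \<subseteq> ball x0 r" "\<And>y. y \<in> ball x t \<Longrightarrow> \<delta> x / 2 \<le> \<delta> y \<and> \<delta> y \<le> 2 * \<delta> x" by auto
  qed
  \<comment> \<open>The threshold comes from the radii \<open>t\<close> near \<open>Rd x\<close>.
    There \<open>r * \<delta> x \<le> 40 * t\<close> and
    \<open>\<delta> y \<le> 2 * \<delta> x\<close>, so the factor \<open>\<delta> y\<close> to the
    power d inside the square of \<open>G\<close> turns the volume of \<open>ball x0 r\<close> into
    at most 80^d times that of \<open>ball x t\<close>. This cancellation dictates the exponent d/2
    of \<open>\<delta>\<close> in \<open>G\<close>.\<close>
  have level: "(\<integral>\<^sup>+x. ennreal ((G x)\<^sup>2) * indicator {x. G x > l} x \<partial>lborel) \<le>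
      ennreal (2 * 10 ^ ?d * (4^?d * b)) * (ennreal l * (\<integral>\<^sup>+x. ennreal (G x) * indicator {x. G x > \<kappa> * l} x \<partial>lborel)
        + (\<integral>\<^sup>+x. ennreal ((H x)\<^sup>2) * indicator {x. H x > \<kappa> * l} x \<partial>lborel))" if l: "80^?d * L \<le> l" for l
  proof (rule level_set_estimate[where Rd=Rd and \<theta>="1 / (4 * 2^?d)" and \<kappa>=\<kappa> and ?R0.0=r])
    have L80: "0 < 80^?d * L" using L by simp
    then show l0: "0 < l" using l by linarith
    show "0 \<le> 4 ^ ?d * b" using b by simp
    show "0 < Rd x \<and> Rd x \<le> r" if "G x > l" for x
    proof -
      have "0 < \<delta> x" using inb(2)[of x] that l0 by auto
      moreover have "r * \<delta> x \<le> r * 1" using \<delta>1[of x] r by (intro mult_left_mono) auto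
      ultimately show ?thesis using r by (auto simp: Rd_def)
    qed
    show "(\<integral>\<^sup>+y\<in>ball x t. ennreal ((G y)\<^sup>2) \<partial>lborel) \<le> ennreal (l\<^sup>2) * emeasure lborel (ball x t)"
      if "G x > l" "Rd x / 20 \<le> t" "t \<le> Rd x" for x t
    proof -
      have Gx: "G x > 0" using that l0 by auto
      note S = sub[OF Gx that(3)]
      have "(\<integral>\<^sup>+y\<in>ball x t. ennreal ((G y)\<^sup>2) \<partial>lborel) \<le> (\<integral>\<^sup>+y\<in>ball x t. ennreal ((2 * \<delta> x)^?d) * ennreal ((g y)\<^sup>2) \<partial>lborel)"
      proof (rule nn_set_integral_mono)
        fix y assume "y \<in> ball x t"
        then have "\<delta> y \<le> 2 * \<delta> x" using S by auto
        have "(G y)\<^sup>2 = \<delta> y ^ ?d * (g y)\<^sup>2"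
        proof -
          have "(sqrt (\<delta> y) ^ ?d)\<^sup>2 = \<delta> y ^ ?d" using \<delta>0[of y] by (metis mult.commute power_mult real_sqrt_pow2)
          then show ?thesis by (simp add: G_def power_mult_distrib)
        qed
        also have "\<dots> \<le> (2 * \<delta> x)^?d * (g y)\<^sup>2"
          using \<open>\<delta> y \<le> 2 * \<delta> x\<close> \<delta>0[of y] by (intro mult_right_mono power_mono) auto
        finally show "ennreal ((G y)\<^sup>2) \<le> ennreal ((2 * \<delta> x)^?d) * ennreal ((g y)\<^sup>2)"
          using \<delta>0[of x] by (subst ennreal_mult[symmetric]) (auto intro: ennreal_leI)
      qed
      also have "\<dots> = ennreal ((2 * \<delta> x)^?d) * (\<integral>\<^sup>+y\<in>ball x t. ennreal ((g y)\<^sup>2) \<partial>lborel)"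
        by (rule nn_set_integral_cmult) auto
      also have "\<dots> \<le> ennreal ((2 * \<delta> x)^?d) * (\<integral>\<^sup>+y\<in>ball x0 r. ennreal ((g y)\<^sup>2) \<partial>lborel)"
        by (intro mult_left_mono nn_set_integral_mono_set S) auto
      also have "\<dots> \<le> ennreal ((2 * \<delta> x)^?d) * (ennreal (L\<^sup>2) * emeasure lborel (ball x0 r))"
        by (intro mult_left_mono gL) auto
      also have "\<dots> \<le> ennreal (l\<^sup>2) * emeasure lborel (ball x t)"
      proof -
        have dx: "0 < \<delta> x" using inb(2)[OF Gx] .
        have tt: "r * \<delta> x \<le> 40 * t" using that(2) by (simp add: Rd_def)
        have "0 < r * \<delta> x" using dx r by simp
        then have t0: "0 < t" using tt by linarith
        have "(2 * \<delta> x)^?d * (L\<^sup>2 * (unit_ball_vol ?d * r ^ ?d)) = L\<^sup>2 * unit_ball_vol ?d * (2 * (r * \<delta> x))^?d"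
          by (simp add: power_mult_distrib mult_ac)
        also have "\<dots> \<le> L\<^sup>2 * unit_ball_vol ?d * (80 * t)^?d"
          using tt dx r by (intro mult_left_mono power_mono) auto
        also have "\<dots> = (80^?d * L\<^sup>2) * (unit_ball_vol ?d * t^?d)" by (simp add: power_mult_distrib mult_ac)
        also have "\<dots> \<le> l\<^sup>2 * (unit_ball_vol ?d * t^?d)"
        proof (intro mult_right_mono)
          have "80^?d * L\<^sup>2 \<le> (80^?d)\<^sup>2 * L\<^sup>2"
          proof -
            have "(1::real) \<le> 80^?d" by (rule one_le_power) simp
            then have "(80::real)^?d * 1 \<le> 80^?d * 80^?d" by (intro mult_left_mono) auto
            then show ?thesis by (intro mult_right_mono) (auto simp: power2_eq_square)
          qed
          also have "\<dots> = (80^?d * L)\<^sup>2" by (simp add: power_mult_distrib)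
          also have "\<dots> \<le> l\<^sup>2" using l L by (intro power_mono) auto
          finally show "80^?d * L\<^sup>2 \<le> l\<^sup>2" .
        qed (use t0 in auto)
        finally show ?thesis using dx t0 r by (simp add: emeasure_ball ennreal_mult[symmetric] ennreal_leI)
      qed
      finally show ?thesis .
    qed
    show "(\<integral>\<^sup>+y\<in>ball x t. ennreal ((G y)\<^sup>2) \<partial>lborel) \<le> ennreal (1 / (4 * 2^?d) * l\<^sup>2) * emeasure lborel (ball x (2*t))
          + ennreal (4 ^ ?d * b * l) * (\<integral>\<^sup>+y\<in>ball x (2*t). ennreal (G y) \<partial>lborel)
          + ennreal (4 ^ ?d * b) * (\<integral>\<^sup>+y\<in>ball x (2*t). ennreal ((H y)\<^sup>2) \<partial>lborel)"
      if Gxl: "G x > l" and t0: "0 < t" and tR: "2 * t \<le> Rd x"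
        and le: "(\<integral>\<^sup>+y\<in>ball x (2*t). ennreal ((G y)\<^sup>2) \<partial>lborel) \<le> ennreal (l\<^sup>2) * emeasure lborel (ball x (2*t))" for x t
    proof -
      have Gx: "G x > 0" using that l0 by auto
      note S = sub[OF Gx tR]
      have dx: "0 < \<delta> x" using inb(2)[OF Gx] .
      \<comment> \<open>On the doubled ball the weight lies between \<open>c\<close> and 2^d
        \<open>c\<close>, so \<open>g\<close> is controlled at level \<open>l / c\<close>. Going to
        \<open>g\<close> and back costs 4^d in the squares, and 8^d in the reverse Hoelder
        hypothesis leaves the value \<open>1 / (4 * 2^?d)\<close> chosen for
        \<open>\<theta>\<close>.\<close>
      define c where "c = sqrt (\<delta> x / 2) ^ ?d"
      have c: "0 < c" unfolding c_def using dx by simp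
      have cs: "c \<le> sqrt (\<delta> y) ^ ?d \<and> sqrt (\<delta> y) ^ ?d \<le> 2^?d * c" if "y \<in> ball x (2*t)" for y
      proof
        have D: "\<delta> x / 2 \<le> \<delta> y" "\<delta> y \<le> 2 * \<delta> x" using S that by auto
        show "c \<le> sqrt (\<delta> y) ^ ?d" unfolding c_def using D dx by (intro power_mono real_sqrt_le_mono) auto
        have "sqrt (\<delta> y) ^ ?d \<le> (2 * sqrt (\<delta> x / 2)) ^ ?d"
        proof (intro power_mono)
          have "sqrt (\<delta> y) \<le> sqrt (4 * (\<delta> x / 2))" using D by (intro real_sqrt_le_mono) auto
          also have "\<dots> = 2 * sqrt (\<delta> x / 2)" by (subst real_sqrt_mult) simp
          finally show "sqrt (\<delta> y) \<le> 2 * sqrt (\<delta> x / 2)" .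
        qed (use \<delta>0 in auto)
        then show "sqrt (\<delta> y) ^ ?d \<le> 2^?d * c" unfolding c_def by (simp add: power_mult_distrib)
      qed
      have gG: "c * g y \<le> G y" "G y \<le> 2^?d * c * g y" "c * f y \<le> H y" if "y \<in> ball x (2*t)" for y
        unfolding G_def H_def using cs[OF that] g0[of y] f0[of y] by (auto intro: mult_right_mono)
      have g2: "ennreal ((g y)\<^sup>2) \<le> ennreal (1 / c\<^sup>2) * ennreal ((G y)\<^sup>2)" if "y \<in> ball x (2*t)" for y
      proof -
        have "(c * g y)\<^sup>2 \<le> (G y)\<^sup>2" using gG(1)[OF that] c g0[of y] by (intro power_mono) auto
        then show ?thesis using c by (subst ennreal_mult[symmetric]) (auto intro!: ennreal_leI simp: field_simps power_mult_distrib)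
      qed
      have f2: "ennreal ((f y)\<^sup>2) \<le> ennreal (1 / c\<^sup>2) * ennreal ((H y)\<^sup>2)" if "y \<in> ball x (2*t)" for y
      proof -
        have "(c * f y)\<^sup>2 \<le> (H y)\<^sup>2" using gG(3)[OF that] c f0[of y] by (intro power_mono) auto
        then show ?thesis using c by (subst ennreal_mult[symmetric]) (auto intro!: ennreal_leI simp: field_simps power_mult_distrib)
      qed
      have g1: "ennreal (g y) \<le> ennreal (1 / c) * ennreal (G y)" if "y \<in> ball x (2*t)" for y
        using gG(1)[OF that] c G0[of y] by (subst ennreal_mult[symmetric]) (auto intro!: ennreal_leI simp: field_simps)
      let ?v = "emeasure lborel (ball x (2*t))"
      let ?IG = "\<integral>\<^sup>+y\<in>ball x (2*t). ennreal (G y) \<partial>lborel" and ?IH = "\<integral>\<^sup>+y\<in>ball x (2*t). ennreal ((H y)\<^sup>2) \<partial>lborel"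
      have "(\<integral>\<^sup>+y\<in>ball x (2*t). ennreal ((g y)\<^sup>2) \<partial>lborel) \<le> (\<integral>\<^sup>+y\<in>ball x (2*t). ennreal (1 / c\<^sup>2) * ennreal ((G y)\<^sup>2) \<partial>lborel)"
        by (rule nn_set_integral_mono[OF g2])
      also have "\<dots> = ennreal (1 / c\<^sup>2) * (\<integral>\<^sup>+y\<in>ball x (2*t). ennreal ((G y)\<^sup>2) \<partial>lborel)"
        by (rule nn_set_integral_cmult) auto
      also have "\<dots> \<le> ennreal (1 / c\<^sup>2) * (ennreal (l\<^sup>2) * ?v)" by (intro mult_left_mono le) auto
      also have "\<dots> = ennreal ((l / c)\<^sup>2) * ?v"
        using c by (simp add: mult.assoc[symmetric] ennreal_mult[symmetric] power_divide)
      finally have A: "(\<integral>\<^sup>+y\<in>ball x t. ennreal ((g y)\<^sup>2) \<partial>lborel) \<le> ennreal ((l/c)\<^sup>2 / (4 * 8^?d)) * ?v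
          + ennreal (b * (l/c)) * (\<integral>\<^sup>+y\<in>ball x (2*t). ennreal (g y) \<partial>lborel)
          + ennreal b * (\<integral>\<^sup>+y\<in>ball x (2*t). ennreal ((f y)\<^sup>2) \<partial>lborel)"
        using rh[OF t0 _ S(1), of "l/c"] l0 c by simp
      have B1: "(\<integral>\<^sup>+y\<in>ball x (2*t). ennreal (g y) \<partial>lborel) \<le> ennreal (1 / c) * ?IG"
      proof -
        have "(\<integral>\<^sup>+y\<in>ball x (2*t). ennreal (g y) \<partial>lborel) \<le> (\<integral>\<^sup>+y\<in>ball x (2*t). ennreal (1 / c) * ennreal (G y) \<partial>lborel)"
          by (rule nn_set_integral_mono[OF g1])
        also have "\<dots> = ennreal (1 / c) * (\<integral>\<^sup>+y\<in>ball x (2*t). ennreal (G y) \<partial>lborel)"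
          by (rule nn_set_integral_cmult) auto
        finally show ?thesis .
      qed
      have B2: "(\<integral>\<^sup>+y\<in>ball x (2*t). ennreal ((f y)\<^sup>2) \<partial>lborel) \<le> ennreal (1 / c\<^sup>2) * ?IH"
      proof -
        have "(\<integral>\<^sup>+y\<in>ball x (2*t). ennreal ((f y)\<^sup>2) \<partial>lborel) \<le> (\<integral>\<^sup>+y\<in>ball x (2*t). ennreal (1 / c\<^sup>2) * ennreal ((H y)\<^sup>2) \<partial>lborel)"
          by (rule nn_set_integral_mono[OF f2])
        also have "\<dots> = ennreal (1 / c\<^sup>2) * (\<integral>\<^sup>+y\<in>ball x (2*t). ennreal ((H y)\<^sup>2) \<partial>lborel)"
          by (rule nn_set_integral_cmult) auto
        finally show ?thesis .
      qed
      have "(\<integral>\<^sup>+y\<in>ball x t. ennreal ((G y)\<^sup>2) \<partial>lborel) \<le> (\<integral>\<^sup>+y\<in>ball x t. ennreal ((2^?d * c)\<^sup>2) * ennreal ((g y)\<^sup>2) \<partial>lborel)"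
      proof (rule nn_set_integral_mono)
        fix y assume "y \<in> ball x t"
        then have "y \<in> ball x (2*t)" using t0 by auto
        then have "(G y)\<^sup>2 \<le> (2^?d * c * g y)\<^sup>2" using gG(2) G0[of y] by (intro power_mono) auto
        then show "ennreal ((G y)\<^sup>2) \<le> ennreal ((2^?d * c)\<^sup>2) * ennreal ((g y)\<^sup>2)"
          by (subst ennreal_mult[symmetric]) (auto intro: ennreal_leI simp: power_mult_distrib)
      qed
      also have "\<dots> = ennreal ((2^?d * c)\<^sup>2) * (\<integral>\<^sup>+y\<in>ball x t. ennreal ((g y)\<^sup>2) \<partial>lborel)"
        by (rule nn_set_integral_cmult) auto
      also have "\<dots> \<le> ennreal ((2^?d * c)\<^sup>2) * (ennreal ((l/c)\<^sup>2 / (4 * 8^?d)) * ?v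
          + ennreal (b * (l/c)) * (ennreal (1/c) * ?IG) + ennreal b * (ennreal (1 / c\<^sup>2) * ?IH))"
        by (rule mult_left_mono[OF order_trans[OF A]]) (auto intro!: add_mono mult_left_mono B1 B2)
      also have "\<dots> = ennreal (1 / (4 * 2^?d) * l\<^sup>2) * ?v + ennreal (4 ^ ?d * b * l) * ?IG + ennreal (4 ^ ?d * b) * ?IH"
      proof -
        have "((2::real)^?d)\<^sup>2 = (2\<^sup>2)^?d" by (simp only: power_mult[symmetric] mult.commute)
        then have four: "((2::real)^?d)\<^sup>2 = 4^?d" by simp
        have e1: "(2^?d * c)\<^sup>2 * ((l/c)\<^sup>2 / (4 * 8^?d)) = 1 / (4 * 2^?d) * l\<^sup>2"
        proof -
          have "(8::real)^?d = 4^?d * 2^?d" by (simp add: power_mult_distrib[symmetric])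
          then show ?thesis using c by (simp add: power_mult_distrib four field_simps)
        qed
        have e2: "(2^?d * c)\<^sup>2 * ((b * (l/c)) * (1/c)) = 4 ^ ?d * b * l"
          using c by (simp add: power_mult_distrib four) (simp add: power2_eq_square)
        have e3: "(2^?d * c)\<^sup>2 * (b * (1 / c\<^sup>2)) = 4 ^ ?d * b"
          using c by (simp add: power_mult_distrib four)
        have E1: "ennreal ((2^?d * c)\<^sup>2) * (ennreal ((l/c)\<^sup>2 / (4 * 8^?d)) * ?v) = ennreal (1 / (4 * 2^?d) * l\<^sup>2) * ?v"
          unfolding mult.assoc[symmetric] e1[symmetric] by (subst ennreal_mult) auto
        have E2: "ennreal ((2^?d * c)\<^sup>2) * (ennreal (b * (l/c)) * (ennreal (1/c) * ?IG)) = ennreal (4 ^ ?d * b * l) * ?IG"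
          unfolding e2[symmetric] using b l0 c by (subst ennreal_mult, simp, simp, subst ennreal_mult) (auto simp: mult.assoc)
        have E3: "ennreal ((2^?d * c)\<^sup>2) * (ennreal b * (ennreal (1/c\<^sup>2) * ?IH)) = ennreal (4 ^ ?d * b) * ?IH"
          unfolding e3[symmetric] using b l0 c by (subst ennreal_mult, simp, simp, subst ennreal_mult) (auto simp: mult.assoc)
        show ?thesis unfolding distrib_left E1 E2 E3 ..
      qed
      finally show ?thesis .
    qed
  qed (use G0 H0 fin \<kappa> in auto)
  show ?thesis
  proof (rule higher_integrability_from_level_sets[OF _ _ G0 H0 fin _ _ \<kappa>(1,2) \<epsilon> level])
    show "0 < 80^?d * L" using L by simp
    show "0 \<le> 2 * 10 ^ ?d * (4^?d * b)" using b by simp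
  qed auto
qed

text \<open>The level \<open>l\<close> stands in for the quadratic mean of \<open>g\<close>; the constant in front of \<open>l\<^sup>2\<close> is small enough to be absorbed
  in the stopping time argument.\<close>

definition weak_reverse_Holder :: "real \<Rightarrow> 'a::euclidean_space set \<Rightarrow> ('a \<Rightarrow> real) \<Rightarrow> ('a \<Rightarrow> real) \<Rightarrow> bool" where
  "weak_reverse_Holder b S g f \<longleftrightarrow> (\<forall>x t l. 0 < t \<longrightarrow> 0 < l \<longrightarrow> ball x (2*t) \<subseteq> S \<longrightarrow>
        (\<integral>\<^sup>+y\<in>ball x (2*t). ennreal ((g y)\<^sup>2) \<partial>lborel) \<le> ennreal (l\<^sup>2) * emeasure lborel (ball x (2*t)) \<longrightarrow>
        (\<integral>\<^sup>+y\<in>ball x t. ennreal ((g y)\<^sup>2) \<partial>lborel) \<le> ennreal (l\<^sup>2 / (4 * 8^DIM('a))) * emeasure lborel (ball x (2*t))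
          + ennreal (b * l) * (\<integral>\<^sup>+y\<in>ball x (2*t). ennreal (g y) \<partial>lborel)
          + ennreal b * (\<integral>\<^sup>+y\<in>ball x (2*t). ennreal ((f y)\<^sup>2) \<partial>lborel))"

text \<open>The constants are fixed by \<open>b\<close> and the dimension before functions and balls
  enter, which is what later gives one exponent for all kernels \<open>K x\<close>. On the half ball
  the weight of \<open>gehring_dist_weight\<close> is at least 2^-d and everywhere it is at most 1,
  so the estimate for the weighted functions returns to \<open>g\<close> and
  \<open>f\<close>.\<close>

theorem gehring:
  fixes b :: real
  assumes b: "0 \<le> b"
  shows "\<exists>q>2. \<exists>C>0. \<forall>(g::'a::euclidean_space \<Rightarrow> real) f x0 r L.
    g \<in> borel_measurable borel \<longrightarrow> f \<in> borel_measurable borel \<longrightarrow> (\<forall>x. 0 \<le> g x) \<longrightarrow> (\<forall>x. 0 \<le> f x) \<longrightarrow>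
    0 < r \<longrightarrow> 0 < L \<longrightarrow>
    (\<integral>\<^sup>+y\<in>ball x0 r. ennreal ((g y)\<^sup>2) \<partial>lborel) \<le> ennreal (L\<^sup>2) * emeasure lborel (ball x0 r) \<longrightarrow>
    weak_reverse_Holder b (ball x0 r) g f \<longrightarrow>
    (\<integral>\<^sup>+y\<in>ball x0 (r/2). ennreal (g y powr q) \<partial>lborel) \<le>
      ennreal C * (ennreal (L powr q) * emeasure lborel (ball x0 r) + (\<integral>\<^sup>+y\<in>ball x0 r. ennreal (f y powr q) \<partial>lborel))"
proof -
  let ?d = "DIM('a)"
  define E where "E = 8^?d * b"
  have E: "0 \<le> E" using b by (simp add: E_def)
  \<comment> \<open>Since \<open>\<kappa>\<^sup>2 \<le> \<kappa>\<close>, the smallness condition of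
    the level estimate reduces to \<open>8 * E * \<kappa> \<le> 1\<close>; the summand 1 in the
    denominator covers \<open>E = 0\<close>.\<close>
  define \<kappa> where "\<kappa> = 1 / (1 + 8 * E)"
  have \<kappa>: "0 < \<kappa>" "\<kappa> \<le> 1" unfolding \<kappa>_def using E by auto
  have \<kappa>3: "4^?d * b * (\<kappa> + \<kappa>\<^sup>2) * 2 ^ ?d \<le> 1/4"
  proof -
    have "\<kappa>\<^sup>2 \<le> \<kappa>" using \<kappa> by (simp add: power2_eq_square mult_left_le_one_le)
    then have "E * (\<kappa> + \<kappa>\<^sup>2) \<le> E * (2 * \<kappa>)" using E by (intro mult_left_mono) auto
    also have "\<dots> \<le> 1/4" unfolding \<kappa>_def using E by (simp add: field_simps)
    finally have "E * (\<kappa> + \<kappa>\<^sup>2) \<le> 1/4" .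
    moreover have "(4::real)^?d * 2^?d = 8^?d" by (simp add: power_mult_distrib[symmetric])
    then have "4^?d * b * (\<kappa> + \<kappa>\<^sup>2) * 2 ^ ?d = E * (\<kappa> + \<kappa>\<^sup>2)" unfolding E_def by (simp add: mult_ac)
    ultimately show ?thesis by (simp only:)
  qed
  define A where "A = 2 * 10^?d * (4^?d * b)"
  have A: "0 \<le> A" using b by (simp add: A_def)
  \<comment> \<open>The largest convenient value with
    \<open>A * \<epsilon> \<le> \<kappa>\<^sup>2 / 2\<close>; it is the gain over the exponent
    2.\<close>
  define \<epsilon> where "\<epsilon> = \<kappa>\<^sup>2 / (1 + 2 * A)"
  have \<epsilon>: "0 < \<epsilon>" "\<epsilon> \<le> 1" "A * \<epsilon> \<le> \<kappa>\<^sup>2 / 2"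
  proof -
    show "0 < \<epsilon>" unfolding \<epsilon>_def using \<kappa> A by (intro divide_pos_pos add_pos_nonneg) auto
    have "\<kappa>\<^sup>2 \<le> 1" using \<kappa> by (simp add: power_le_one)
    then show "\<epsilon> \<le> 1" unfolding \<epsilon>_def using A by (simp add: field_simps)
    have "\<kappa>\<^sup>2 * (A * 2) \<le> \<kappa>\<^sup>2 * (1 + 2 * A)" by (intro mult_left_mono) auto
    then show "A * \<epsilon> \<le> \<kappa>\<^sup>2 / 2" unfolding \<epsilon>_def using A by (simp add: field_simps)
  qed
  define q where "q = 2 + \<epsilon>"
  define C where "C = (2^?d) powr q * (2 * (80^?d) powr \<epsilon> + 2 * A / \<kappa>)"
  have Cpos: "0 < C" unfolding C_def using A \<kappa> by (intro mult_pos_pos add_pos_nonneg) auto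
  have main: "(\<integral>\<^sup>+y\<in>ball x0 (r/2). ennreal (g y powr q) \<partial>lborel) \<le>
      ennreal C * (ennreal (L powr q) * emeasure lborel (ball x0 r) + (\<integral>\<^sup>+y\<in>ball x0 r. ennreal (f y powr q) \<partial>lborel))"
    if [measurable]: "g \<in> borel_measurable borel" "f \<in> borel_measurable borel" and g0: "\<And>x. 0 \<le> g x" and f0: "\<And>x. 0 \<le> f x"
      and r: "0 < r" and L: "0 < L"
      and gL: "(\<integral>\<^sup>+y\<in>ball x0 r. ennreal ((g y)\<^sup>2) \<partial>lborel) \<le> ennreal (L\<^sup>2) * emeasure lborel (ball x0 r)"
      and rh: "weak_reverse_Holder b (ball x0 r) g f" for g f :: "'a \<Rightarrow> real" and x0 r L
  proof -
    define \<delta> where "\<delta> = (\<lambda>y. max 0 ((r - dist x0 y) / r))"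
    define G where "G = (\<lambda>y. sqrt (\<delta> y) ^ ?d * g y)"
    define H where "H = (\<lambda>y. sqrt (\<delta> y) ^ ?d * f y)"
    have [measurable]: "\<delta> \<in> borel_measurable borel" unfolding \<delta>_def by measurable
    have [measurable]: "G \<in> borel_measurable borel" "H \<in> borel_measurable borel" unfolding G_def H_def by measurable
    have est: "(\<integral>\<^sup>+x. ennreal ((G x)\<^sup>2 * G x powr \<epsilon>) \<partial>lborel) \<le>
      ennreal (2 * (80^?d * L) powr \<epsilon>) * (\<integral>\<^sup>+x. ennreal ((G x)\<^sup>2) \<partial>lborel)
       + ennreal (2 * A / \<kappa>) * (\<integral>\<^sup>+x. ennreal ((H x)\<^sup>2 * H x powr \<epsilon>) \<partial>lborel)"
      unfolding G_def H_def \<delta>_def A_def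
      by (rule gehring_dist_weight[OF _ _ g0 f0 r L b gL _ \<kappa> \<kappa>3 \<epsilon>[unfolded A_def]])
         (use rh in \<open>auto simp: weak_reverse_Holder_def\<close>)
    have s0: "0 \<le> sqrt (\<delta> y) ^ ?d" for y by (simp add: \<delta>_def)
    have s1: "sqrt (\<delta> y) ^ ?d \<le> 1" for y using r by (intro power_le_one) (auto simp: \<delta>_def)
    have G0: "0 \<le> G y" and H0: "0 \<le> H y" for y using s0 g0 f0 by (auto simp: G_def H_def)
    have Gg: "G y \<le> g y" and Hf: "H y \<le> f y" for y
      unfolding G_def H_def using mult_left_le_one_le[OF g0 s0 s1] mult_left_le_one_le[OF f0 s0 s1] by auto
    have out: "G y = 0" "H y = 0" if "y \<notin> ball x0 r" for y
    proof -
      have "(r - dist x0 y) / r \<le> 0" using that r by (intro divide_nonpos_pos) auto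
      then have "\<delta> y = 0" by (simp add: \<delta>_def)
      then show "G y = 0" "H y = 0" by (simp_all add: G_def H_def zero_power)
    qed
    have inn: "g y \<le> 2^?d * G y" if "y \<in> ball x0 (r/2)" for y
    proof -
      have "1/2 \<le> (r - dist x0 y) / r" using that r by (simp add: field_simps)
      then have "1/2 \<le> \<delta> y" unfolding \<delta>_def by (rule max.coboundedI2)
      then have "(1/2)\<^sup>2 \<le> \<delta> y" by (simp add: power2_eq_square)
      then have "1/2 \<le> sqrt (\<delta> y)" by (rule real_le_rsqrt)
      then have "(1/2)^?d \<le> sqrt (\<delta> y)^?d" by (intro power_mono) auto
      then have "1 \<le> 2^?d * sqrt (\<delta> y)^?d" by (simp add: power_one_over field_simps)
      then have "1 * g y \<le> 2^?d * sqrt (\<delta> y)^?d * g y" using g0[of y] by (intro mult_right_mono) auto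
      then show ?thesis by (simp add: G_def)
    qed
    have pw: "z\<^sup>2 * z powr \<epsilon> = z powr q" if "0 \<le> z" for z :: real
      using that \<epsilon> by (cases "z = 0") (auto simp: q_def powr_add)
    have "(\<integral>\<^sup>+y\<in>ball x0 (r/2). ennreal (g y powr q) \<partial>lborel) \<le> (\<integral>\<^sup>+y. ennreal ((2^?d) powr q) * ennreal ((G y)\<^sup>2 * G y powr \<epsilon>) \<partial>lborel)"
    proof (intro nn_integral_mono)
      fix y
      have "g y powr q \<le> (2^?d * G y) powr q" if "y \<in> ball x0 (r/2)"
        using inn[OF that] g0 \<epsilon> by (intro powr_mono2) (auto simp: q_def)
      then show "ennreal (g y powr q) * indicator (ball x0 (r/2)) y \<le> ennreal ((2^?d) powr q) * ennreal ((G y)\<^sup>2 * G y powr \<epsilon>)"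
        using G0[of y] by (auto simp: pw powr_mult ennreal_mult[symmetric] ennreal_leI split: split_indicator)
    qed
    also have "\<dots> = ennreal ((2^?d) powr q) * (\<integral>\<^sup>+y. ennreal ((G y)\<^sup>2 * G y powr \<epsilon>) \<partial>lborel)"
      by (rule nn_integral_cmult) measurable
    also have "\<dots> \<le> ennreal ((2^?d) powr q) * (ennreal (2 * (80^?d * L) powr \<epsilon>) * (ennreal (L\<^sup>2) * emeasure lborel (ball x0 r))
       + ennreal (2 * A / \<kappa>) * (\<integral>\<^sup>+y\<in>ball x0 r. ennreal (f y powr q) \<partial>lborel))"
    proof (intro mult_left_mono order_trans[OF est] add_mono)
      have "(\<integral>\<^sup>+x. ennreal ((G x)\<^sup>2) \<partial>lborel) \<le> (\<integral>\<^sup>+y\<in>ball x0 r. ennreal ((g y)\<^sup>2) \<partial>lborel)"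
        using Gg G0 out by (intro nn_integral_mono) (auto simp: indicator_def intro!: ennreal_leI power_mono)
      then show "(\<integral>\<^sup>+x. ennreal ((G x)\<^sup>2) \<partial>lborel) \<le> ennreal (L\<^sup>2) * emeasure lborel (ball x0 r)" using gL by (rule order_trans)
      show "(\<integral>\<^sup>+x. ennreal ((H x)\<^sup>2 * H x powr \<epsilon>) \<partial>lborel) \<le> (\<integral>\<^sup>+y\<in>ball x0 r. ennreal (f y powr q) \<partial>lborel)"
      proof (intro nn_integral_mono)
        fix y
        have "H y powr q \<le> f y powr q" using Hf H0 \<epsilon> by (intro powr_mono2) (auto simp: q_def)
        then show "ennreal ((H y)\<^sup>2 * H y powr \<epsilon>) \<le> ennreal (f y powr q) * indicator (ball x0 r) y"
          using H0[of y] out[of y] by (auto simp: pw ennreal_leI split: split_indicator)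
      qed
    qed auto
    also have "\<dots> \<le> ennreal ((2^?d) powr q) * (ennreal (2 * (80^?d) powr \<epsilon> + 2 * A / \<kappa>) * (ennreal (L powr q) * emeasure lborel (ball x0 r))
       + ennreal (2 * (80^?d) powr \<epsilon> + 2 * A / \<kappa>) * (\<integral>\<^sup>+y\<in>ball x0 r. ennreal (f y powr q) \<partial>lborel))"
    proof (intro mult_left_mono add_mono mult_right_mono)
      have eq: "2 * (80^?d * L) powr \<epsilon> * L\<^sup>2 = 2 * (80^?d) powr \<epsilon> * L powr q"
        using L by (simp add: powr_mult pw[symmetric])
      have "ennreal (2 * (80^?d * L) powr \<epsilon>) * (ennreal (L\<^sup>2) * emeasure lborel (ball x0 r)) =
        ennreal (2 * (80^?d) powr \<epsilon>) * (ennreal (L powr q) * emeasure lborel (ball x0 r))"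
        unfolding mult.assoc[symmetric]
        by (subst ennreal_mult[symmetric], simp, simp, subst ennreal_mult[symmetric], simp, simp, simp only: eq)
      also have "\<dots> \<le> ennreal (2 * (80^?d) powr \<epsilon> + 2 * A / \<kappa>) * (ennreal (L powr q) * emeasure lborel (ball x0 r))"
        using A \<kappa> by (intro mult_right_mono ennreal_leI) auto
      finally show "ennreal (2 * (80^?d * L) powr \<epsilon>) * (ennreal (L\<^sup>2) * emeasure lborel (ball x0 r)) \<le>
         ennreal (2 * (80^?d) powr \<epsilon> + 2 * A / \<kappa>) * (ennreal (L powr q) * emeasure lborel (ball x0 r))" .
    qed (auto intro!: ennreal_leI)
    also have "\<dots> = ennreal C * (ennreal (L powr q) * emeasure lborel (ball x0 r) + (\<integral>\<^sup>+y\<in>ball x0 r. ennreal (f y powr q) \<partial>lborel))"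
    proof -
      have nn: "0 \<le> 2 * (80^?d) powr \<epsilon> + 2 * A / \<kappa>" using A \<kappa> by (intro add_nonneg_nonneg) auto
      show ?thesis unfolding C_def ennreal_mult[OF powr_ge_zero nn] by (simp only: distrib_left mult.assoc)
    qed
    finally show ?thesis .
  qed
  have "q > 2" using \<epsilon> by (simp add: q_def)
  then show ?thesis using Cpos main by (intro exI[of _ q] conjI exI[of _ C]) auto
qed

section \<open>Square roots of positive definite matrices\<close>

text \<open>Identifies \<open>norm\<close> on matrices as the Hilbert-Schmidt norm. It splits into
  columns and is invariant under adjoints, so the estimates run in it; passing between it and
  \<open>opnorm\<close> costs dimensional factors only.\<close>

lemma norm_matrix_sq: "(norm (A::complex^'m^'n))\<^sup>2 = (\<Sum>i\<in>UNIV. \<Sum>j\<in>UNIV. (cmod (A$i$j))\<^sup>2)"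
  by (simp add: norm_vec_def L2_set_def sum_nonneg)

lemma norm_cvec_sq: "(norm (x::complex^'n))\<^sup>2 = (\<Sum>i\<in>UNIV. (cmod (x$i))\<^sup>2)"
  by (simp add: norm_vec_def L2_set_def sum_nonneg)

lemma cmod_sum_mult_le: "(cmod (\<Sum>j\<in>S. a j * b j))\<^sup>2 \<le> (\<Sum>j\<in>S. (cmod (a j))\<^sup>2) * (\<Sum>j\<in>S. (cmod (b j))\<^sup>2)"
proof -
  have "cmod (\<Sum>j\<in>S. a j * b j) \<le> (\<Sum>j\<in>S. cmod (a j) * cmod (b j))"
    by (rule order_trans[OF norm_sum]) (simp add: norm_mult)
  then have "(cmod (\<Sum>j\<in>S. a j * b j))\<^sup>2 \<le> (\<Sum>j\<in>S. cmod (a j) * cmod (b j))\<^sup>2" by (intro power_mono) auto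
  also have "\<dots> \<le> (\<Sum>j\<in>S. (cmod (a j))\<^sup>2) * (\<Sum>j\<in>S. (cmod (b j))\<^sup>2)" by (rule Cauchy_Schwarz_ineq_sum)
  finally show ?thesis .
qed

lemma norm_matrix_vector_mult_le: "norm ((A::complex^'m^'n) *v x) \<le> norm A * norm x"
proof (rule power2_le_imp_le)
  have "(norm (A *v x))\<^sup>2 = (\<Sum>i\<in>UNIV. (cmod (\<Sum>j\<in>UNIV. A$i$j * x$j))\<^sup>2)"
    by (simp add: norm_cvec_sq matrix_vector_mult_def)
  also have "\<dots> \<le> (\<Sum>i\<in>UNIV. (\<Sum>j\<in>UNIV. (cmod (A$i$j))\<^sup>2) * (\<Sum>j\<in>UNIV. (cmod (x$j))\<^sup>2))"
    by (intro sum_mono cmod_sum_mult_le)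
  also have "\<dots> = (norm A * norm x)\<^sup>2"
    by (simp add: power_mult_distrib norm_matrix_sq norm_cvec_sq sum_distrib_right)
  finally show "(norm (A *v x))\<^sup>2 \<le> (norm A * norm x)\<^sup>2" .
qed simp

lemma norm_matrix_mult_le: "norm ((A::complex^'k^'n) ** (B::complex^'m^'k)) \<le> norm A * norm B"
proof (rule power2_le_imp_le)
  have "(norm (A ** B))\<^sup>2 = (\<Sum>i\<in>UNIV. \<Sum>k\<in>UNIV. (cmod (\<Sum>j\<in>UNIV. A$i$j * B$j$k))\<^sup>2)"
    by (simp add: norm_matrix_sq matrix_matrix_mult_def)
  also have "\<dots> \<le> (\<Sum>i\<in>UNIV. \<Sum>k\<in>UNIV. (\<Sum>j\<in>UNIV. (cmod (A$i$j))\<^sup>2) * (\<Sum>j\<in>UNIV. (cmod (B$j$k))\<^sup>2))"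
    by (intro sum_mono cmod_sum_mult_le)
  also have "\<dots> = (\<Sum>i\<in>UNIV. \<Sum>j\<in>UNIV. (cmod (A$i$j))\<^sup>2) * (\<Sum>k\<in>UNIV. \<Sum>j\<in>UNIV. (cmod (B$j$k))\<^sup>2)"
    by (simp add: sum_product)
  also have "(\<Sum>k\<in>UNIV. \<Sum>j\<in>UNIV. (cmod (B$j$k))\<^sup>2) = (\<Sum>j\<in>UNIV. \<Sum>k\<in>UNIV. (cmod (B$j$k))\<^sup>2)"
    by (rule sum.swap)
  finally show "(norm (A ** B))\<^sup>2 \<le> (norm A * norm B)\<^sup>2"
    by (simp add: power_mult_distrib norm_matrix_sq)
qed simp

lemma norm_matrix_sq_columns: "(norm ((A::complex^'k^'n) ** (B::complex^'m^'k)))\<^sup>2 = (\<Sum>j\<in>UNIV. (norm (A *v column j B))\<^sup>2)"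
proof -
  have "(norm (A ** B))\<^sup>2 = (\<Sum>i\<in>UNIV. \<Sum>j\<in>UNIV. (cmod ((A *v column j B)$i))\<^sup>2)"
    by (simp add: norm_matrix_sq matrix_matrix_mult_def matrix_vector_mult_def column_def)
  also have "\<dots> = (\<Sum>j\<in>UNIV. \<Sum>i\<in>UNIV. (cmod ((A *v column j B)$i))\<^sup>2)" by (rule sum.swap)
  finally show ?thesis by (simp add: norm_cvec_sq)
qed

lemma hermitianD: "hermitian A \<Longrightarrow> A$i$j = cnj (A$j$i)"
  unfolding hermitian_def by blast

text \<open>For hermitian factors \<open>B ** A\<close> is the adjoint of \<open>A ** B\<close>, and
  the Hilbert-Schmidt norm does not see adjoints.\<close>

lemma norm_hermitian_mult_commute:
  fixes A B :: "complex^'n^'n"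
  assumes "hermitian A" "hermitian B"
  shows "norm (A ** B) = norm (B ** A)"
proof -
  have "cmod ((A ** B)$i$j) = cmod ((B ** A)$j$i)" for i j
  proof -
    have "(A ** B)$i$j = (\<Sum>k\<in>UNIV. cnj (B$j$k * A$k$i))"
      unfolding matrix_matrix_mult_def using hermitianD[OF assms(1), of i] hermitianD[OF assms(2), of _ j]
      by (simp add: mult.commute)
    also have "\<dots> = cnj ((B ** A)$j$i)" by (simp add: matrix_matrix_mult_def)
    finally show ?thesis by simp
  qed
  then have "(norm (A ** B))\<^sup>2 = (\<Sum>i\<in>UNIV. \<Sum>j\<in>UNIV. (cmod ((B ** A)$j$i))\<^sup>2)" by (simp add: norm_matrix_sq)
  also have "\<dots> = (norm (B ** A))\<^sup>2" unfolding norm_matrix_sq by (rule sum.swap)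
  finally show ?thesis by (simp add: power2_eq_iff_nonneg)
qed

lemma opnorm_nonneg: "0 \<le> opnorm A"
  unfolding opnorm_def by (rule onorm_pos_le) simp

lemma norm_le_opnorm_mult: "norm (A *v x) \<le> opnorm A * norm x"
  unfolding opnorm_def by (rule onorm) simp

lemma opnorm_bound: "(\<And>x. norm (A *v x) \<le> b * norm x) \<Longrightarrow> opnorm A \<le> b"
  unfolding opnorm_def by (rule onorm_le)

lemma opnorm_le_norm: "opnorm A \<le> norm A"
  by (rule opnorm_bound) (rule norm_matrix_vector_mult_le)

text \<open>Every column is the image of a unit vector. The argument gives the square root of the
  number of columns; the larger factor keeps later constants free of roots.\<close>

lemma norm_le_card_opnorm: "norm (A::complex^'m^'n) \<le> CARD('m) * opnorm A"
proof -
  have "(norm A)\<^sup>2 = (\<Sum>j\<in>UNIV. (norm (column j A))\<^sup>2)"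
    by (simp add: norm_matrix_sq norm_cvec_sq column_def) (rule sum.swap)
  also have "\<dots> \<le> (\<Sum>j\<in>(UNIV::'m set). (opnorm A)\<^sup>2)"
    proof (intro sum_mono power_mono)
    fix j :: 'm
    have "norm (axis j (1::complex)) = 1" by (simp add: norm_axis_1)
    moreover have "A *v axis j 1 = column j A"
      by (simp add: vec_eq_iff matrix_vector_mult_def column_def axis_def if_distrib cong: if_cong)
    ultimately show "norm (column j A) \<le> opnorm A"
      using norm_le_opnorm_mult[of A "axis j 1"] by simp
  qed auto
  also have "\<dots> = CARD('m) * (opnorm A)\<^sup>2" by simp
  also have "\<dots> \<le> (CARD('m) * opnorm A)\<^sup>2"
  proof -
    have "1 \<le> real CARD('m)" by (simp add: Suc_leI)
    then have "real CARD('m) * 1 \<le> real CARD('m) * real CARD('m)" by (intro mult_left_mono) auto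
    then have "real CARD('m) * (opnorm A)\<^sup>2 \<le> (real CARD('m) * real CARD('m)) * (opnorm A)\<^sup>2"
      by (intro mult_right_mono) (simp_all only: mult_1_right zero_le_power2)
    then show ?thesis by (simp only: power_mult_distrib power2_eq_square mult_ac)
  qed
  finally show ?thesis by (rule power2_le_imp_le) (simp add: opnorm_nonneg)
qed

lemma opnorm_triangle: "opnorm (A + B) \<le> opnorm A + opnorm B"
proof (rule opnorm_bound)
  fix x
  have "norm ((A + B) *v x) \<le> norm (A *v x) + norm (B *v x)"
    by (simp add: matrix_vector_mult_add_rdistrib norm_triangle_ineq)
  also have "\<dots> \<le> (opnorm A + opnorm B) * norm x"
    using norm_le_opnorm_mult[of A x] norm_le_opnorm_mult[of B x] by (simp add: distrib_right)
  finally show "norm ((A + B) *v x) \<le> (opnorm A + opnorm B) * norm x" .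
qed

lemma opnorm_mult_le: "opnorm (A ** B) \<le> opnorm A * opnorm B"
proof (rule opnorm_bound)
  fix x
  have "norm ((A ** B) *v x) \<le> opnorm A * norm (B *v x)"
    unfolding matrix_vector_mul_assoc[symmetric] by (rule norm_le_opnorm_mult)
  also have "\<dots> \<le> opnorm A * (opnorm B * norm x)"
    by (intro mult_left_mono norm_le_opnorm_mult opnorm_nonneg)
  finally show "norm ((A ** B) *v x) \<le> opnorm A * opnorm B * norm x" by simp
qed

lemma opnorm_scaleR: "opnorm (c *\<^sub>R A) \<le> \<bar>c\<bar> * opnorm A"
proof (rule opnorm_bound)
  fix x
  have "(c *\<^sub>R A) *v x = c *\<^sub>R (A *v x)" by (simp add: vec_eq_iff matrix_vector_mult_def scaleR_sum_right)
  then show "norm ((c *\<^sub>R A) *v x) \<le> \<bar>c\<bar> * opnorm A * norm x"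
    using norm_le_opnorm_mult[of A x] by (simp add: mult_left_mono mult.assoc)
qed

text \<open>Two triangle inequalities make \<open>opnorm\<close> Lipschitz for \<open>norm\<close>.
  Continuity serves Borel measurability and the limit in the square root iteration.\<close>

lemma continuous_opnorm: "continuous_on UNIV (opnorm :: complex^'m^'n \<Rightarrow> real)"
proof -
  have "\<bar>opnorm A - opnorm B\<bar> \<le> norm (A - B)" for A B :: "complex^'m^'n"
    using opnorm_triangle[of "A - B" B] opnorm_triangle[of "B - A" A] opnorm_le_norm[of "A - B"] opnorm_le_norm[of "B - A"]
    by (simp add: norm_minus_commute)
  then have "1-lipschitz_on UNIV (opnorm :: complex^'m^'n \<Rightarrow> real)"
    by (intro lipschitz_onI) (auto simp: dist_norm)
  then show ?thesis by (rule lipschitz_on_continuous_on)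
qed

lemma borel_measurable_opnorm[measurable]: "opnorm \<in> borel_measurable borel"
  by (rule borel_measurable_continuous_onI) (rule continuous_opnorm)

text \<open>The real inner product of complex vectors is the real part of the hermitian one, so the
  forms in \<open>psd_matrix\<close> and \<open>posdef_matrix\<close> become inner products.\<close>

lemma inner_matrix_vector: "v \<bullet> (M *v v) = Re (\<Sum>i\<in>UNIV. \<Sum>j\<in>UNIV. cnj (v$i) * M$i$j * v$j)" for v :: "complex^'n"
  by (simp add: inner_vec_def matrix_vector_mult_def inner_complex_def sum_distrib_left sum.distrib[symmetric]
      algebra_simps del: sum.distrib)

section \<open>The positive square root by a fixed-point iteration\<close>

lemma matrix_mult_diff_left: "(A - B) ** C = A ** C - B ** C" for A :: "complex^'k^'n"
  by (simp add: vec_eq_iff matrix_matrix_mult_def sum_subtractf left_diff_distrib)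

lemma matrix_mult_add_left: "(A + B) ** C = A ** C + B ** C" for A :: "complex^'k^'n"
  by (simp add: vec_eq_iff matrix_matrix_mult_def sum.distrib distrib_right)

lemma matrix_mult_diff_right: "A ** (B - C) = A ** B - A ** C" for A :: "complex^'k^'n"
  by (simp add: vec_eq_iff matrix_matrix_mult_def sum_subtractf right_diff_distrib)

lemma matrix_mult_scaleR_left: "(c *\<^sub>R A) ** B = c *\<^sub>R (A ** B)" for A :: "complex^'k^'n"
  by (simp add: vec_eq_iff matrix_matrix_mult_def scaleR_sum_right)

lemma matrix_mult_scaleR_right: "A ** (c *\<^sub>R B) = c *\<^sub>R (A ** B)" for A :: "complex^'k^'n"
  by (simp add: vec_eq_iff matrix_matrix_mult_def scaleR_sum_right)

lemma matrix_vector_scaleR: "(c *\<^sub>R A) *v x = c *\<^sub>R (A *v x)" for A :: "complex^'k^'n"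
  by (simp add: vec_eq_iff matrix_vector_mult_def scaleR_sum_right)

lemma tendsto_matrix_mult:
  fixes A :: "'a \<Rightarrow> complex^'k^'n" and B :: "'a \<Rightarrow> complex^'m^'k"
  assumes "(A \<longlongrightarrow> a) F" "(B \<longlongrightarrow> b) F"
  shows "((\<lambda>x. A x ** B x) \<longlongrightarrow> a ** b) F"
proof (rule vec_tendstoI, rule vec_tendstoI)
  fix i j
  show "((\<lambda>x. (A x ** B x)$i$j) \<longlongrightarrow> (a ** b)$i$j) F"
    unfolding matrix_matrix_mult_def by (simp, intro tendsto_intros assms)
qed

text \<open>Fixed-point iteration for \<open>Y = (B + Y\<^sup>2) / 2\<close>; then \<open>(1 - Y)\<^sup>2 = 1 - B\<close>.\<close>

primrec sqrt_iter :: "complex^'n^'n \<Rightarrow> nat \<Rightarrow> complex^'n^'n" where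
  "sqrt_iter B 0 = 0"
| "sqrt_iter B (Suc k) = (1/2) *\<^sub>R (B + sqrt_iter B k ** sqrt_iter B k)"

text \<open>Induction: from \<open>y \<le> b \<le> 1\<close> follows
  \<open>(b + y\<^sup>2) / 2 \<le> b\<close>.\<close>

lemma sqrt_iter_opnorm:
  assumes "opnorm B \<le> 1"
  shows "opnorm (sqrt_iter B k) \<le> opnorm B"
proof (induction k)
  case 0
  show ?case using order_trans[OF opnorm_le_norm[of "0::complex^'n^'n"], of "opnorm B"] opnorm_nonneg[of B] by simp
next
  case (Suc k)
  let ?Y = "sqrt_iter B k"
  have "opnorm ((1/2) *\<^sub>R (B + ?Y ** ?Y)) \<le> \<bar>1/2\<bar> * opnorm (B + ?Y ** ?Y)" by (rule opnorm_scaleR)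
  also have "\<dots> \<le> 1/2 * (opnorm B + opnorm ?Y * opnorm ?Y)"
    using opnorm_triangle[of B "?Y ** ?Y"] opnorm_mult_le[of ?Y ?Y] by simp
  also have "opnorm ?Y * opnorm ?Y \<le> 1 * opnorm B"
    using Suc assms opnorm_nonneg[of ?Y] by (intro mult_mono) auto
  finally show ?case by simp
qed

text \<open>For consecutive iterates, \<open>Y\<^sup>2 - Z\<^sup>2 = Y (Y - Z) + (Y - Z) Z\<close>
  holds without commutation, and \<open>Y\<close> and \<open>Z\<close> have norm at most
  \<open>opnorm B\<close>; with the factor 1/2 each step contracts differences by
  \<open>opnorm B\<close>.\<close>

lemma sqrt_iter_diff:
  assumes "opnorm B \<le> 1"
  shows "opnorm (sqrt_iter B (Suc k) - sqrt_iter B k) \<le> opnorm B ^ Suc k"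
proof (induction k)
  case 0
  show ?case using opnorm_scaleR[of "1/2" B] opnorm_nonneg[of B] by simp
next
  case (Suc k)
  let ?Y = "sqrt_iter B (Suc k)" and ?Z = "sqrt_iter B k"
  have "sqrt_iter B (Suc (Suc k)) - ?Y = (1/2) *\<^sub>R (?Y ** (?Y - ?Z) + (?Y - ?Z) ** ?Z)"
    unfolding sqrt_iter.simps(2)[of B "Suc k"] matrix_mult_diff_left matrix_mult_diff_right
    by (simp add: algebra_simps)
  then have "opnorm (sqrt_iter B (Suc (Suc k)) - ?Y) \<le> 1/2 * opnorm (?Y ** (?Y - ?Z) + (?Y - ?Z) ** ?Z)"
    using opnorm_scaleR[of "1/2" "?Y ** (?Y - ?Z) + (?Y - ?Z) ** ?Z"] by simp
  also have "\<dots> \<le> 1/2 * (opnorm ?Y * opnorm (?Y - ?Z) + opnorm (?Y - ?Z) * opnorm ?Z)"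
    using opnorm_triangle[of "?Y ** (?Y - ?Z)" "(?Y - ?Z) ** ?Z"] opnorm_mult_le[of ?Y "?Y - ?Z"] opnorm_mult_le[of "?Y - ?Z" ?Z]
    by simp
  also have "\<dots> \<le> 1/2 * (opnorm B * opnorm (?Y - ?Z) + opnorm (?Y - ?Z) * opnorm B)"
    using sqrt_iter_opnorm[OF assms] by (intro mult_left_mono add_mono mult_right_mono) (auto simp: opnorm_nonneg simp del: sqrt_iter.simps)
  also have "\<dots> = opnorm B * opnorm (?Y - ?Z)" by simp
  also have "\<dots> \<le> opnorm B * opnorm B ^ Suc k" by (intro mult_left_mono Suc.IH opnorm_nonneg)
  finally show ?case by simp
qed

lemma sqrt_iter_convergent:
  assumes "opnorm (B::complex^'n^'n) < 1"
  shows "convergent (sqrt_iter B)"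
proof -
  have s: "summable (\<lambda>k. sqrt_iter B (Suc k) - sqrt_iter B k)"
  proof (rule summable_comparison_test')
    show "summable (\<lambda>k. CARD('n) * opnorm B ^ Suc k)"
      using assms by (intro summable_mult) (simp add: summable_Suc_iff opnorm_nonneg summable_geometric)
    fix k
    have "norm (sqrt_iter B (Suc k) - sqrt_iter B k) \<le> CARD('n) * opnorm (sqrt_iter B (Suc k) - sqrt_iter B k)"
      by (rule norm_le_card_opnorm)
    also have "\<dots> \<le> CARD('n) * opnorm B ^ Suc k"
      using assms by (intro mult_left_mono sqrt_iter_diff) auto
    finally show "norm (sqrt_iter B (Suc k) - sqrt_iter B k) \<le> CARD('n) * opnorm B ^ Suc k" .
  qed
  have "(\<Sum>k<m. sqrt_iter B (Suc k) - sqrt_iter B k) = sqrt_iter B m" for m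
    by (simp add: sum_lessThan_telescope del: sqrt_iter.simps(2))
  then show ?thesis using s unfolding summable_iff_convergent by simp
qed

lemma hermitian_sqrt_iter:
  assumes "hermitian B"
  shows "hermitian (sqrt_iter B k)"
proof (induction k)
  case (Suc k)
  let ?Y = "sqrt_iter B k"
  have "(?Y ** ?Y)$i$j = cnj ((?Y ** ?Y)$j$i)" for i j
  proof -
    have "(?Y ** ?Y)$i$j = (\<Sum>l\<in>UNIV. cnj (?Y$j$l * ?Y$l$i))"
      unfolding matrix_matrix_mult_def using hermitianD[OF Suc, of i] hermitianD[OF Suc, of _ j]
      by (simp add: mult.commute)
    then show ?thesis by (simp add: matrix_matrix_mult_def)
  qed
  then show ?case using hermitianD[OF assms]
    unfolding hermitian_def by (metis (no_types, lifting) complex_cnj_add complex_cnj_scaleR sqrt_iter.simps(2) vector_add_component vector_scaleR_component)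
qed (simp add: hermitian_def)

lemma sqrt_iter_commute:
  assumes "R ** B = B ** R"
  shows "R ** sqrt_iter B k = sqrt_iter B k ** R"
proof (induction k)
  case (Suc k)
  have "R ** (sqrt_iter B k ** sqrt_iter B k) = (sqrt_iter B k ** sqrt_iter B k) ** R"
    by (metis Suc matrix_mul_assoc)
  then show ?case using assms
    by (simp add: matrix_mult_scaleR_left matrix_mult_scaleR_right matrix_add_ldistrib matrix_mult_add_left)
qed (simp add: vec_eq_iff matrix_matrix_mult_def)

text \<open>Compactness of the unit sphere, then homogeneity of degree 2.\<close>

lemma posdef_lower_bound:
  fixes M :: "complex^'n^'n"
  assumes "posdef_matrix M"
  shows "\<exists>m>0. \<forall>v. m * (norm v)\<^sup>2 \<le> v \<bullet> (M *v v)"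
proof -
  have ne: "sphere (0::complex^'n) 1 \<noteq> {}"
    using vector_choose_size[of 1] by (auto simp: sphere_def)
  have cont: "continuous_on (sphere 0 1) (\<lambda>v. v \<bullet> (M *v v))"
    by (intro continuous_intros linear_continuous_on matrix_vector_mul_bounded_linear)
  obtain v0 where v0: "v0 \<in> sphere 0 1" "\<And>v. v \<in> sphere 0 1 \<Longrightarrow> v0 \<bullet> (M *v v0) \<le> v \<bullet> (M *v v)"
    using continuous_attains_inf[OF compact_sphere ne cont] by blast
  let ?m = "v0 \<bullet> (M *v v0)"
  have "v0 \<noteq> 0" using v0(1) by auto
  then have m: "?m > 0" using assms unfolding posdef_matrix_def inner_matrix_vector[symmetric] by blast
  have "?m * (norm v)\<^sup>2 \<le> v \<bullet> (M *v v)" for v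
  proof (cases "v = 0")
    case False
    define w where "w = (1 / norm v) *\<^sub>R v"
    have "?m \<le> w \<bullet> (M *v w)" using False by (intro v0(2)) (auto simp: w_def)
    moreover have "v = norm v *\<^sub>R w" using False by (simp add: w_def)
    then have "v \<bullet> (M *v v) = (norm v)\<^sup>2 * (w \<bullet> (M *v w))"
      by (metis (no_types, lifting) inner_scaleR_left inner_scaleR_right linear_cmul matrix_vector_mul_linear mult.assoc power2_eq_square)
    ultimately show ?thesis using mult_left_mono[of ?m "w \<bullet> (M *v w)" "(norm v)\<^sup>2"] by (simp add: mult.commute)
  qed simp
  then show ?thesis using m by blast
qed

text \<open>Expanding the square of |v - Mv/k| gives at most 1 - 2m/k + |M|^2/k^2 times |v|^2, and
  \<open>(opnorm M)\<^sup>2 \<le> m * k\<close> leaves 1 - m/k. Dividing by a large \<open>k\<close>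
  thus brings every positive definite matrix into the range where the iteration converges.\<close>

lemma opnorm_lt_one:
  fixes M :: "complex^'n^'n" and k m :: real
  assumes m: "0 < m" "\<And>v. m * (norm v)\<^sup>2 \<le> v \<bullet> (M *v v)" and k: "0 < k" "(opnorm M)\<^sup>2 \<le> m * k" "m \<le> k"
  shows "opnorm (mat 1 - (1/k) *\<^sub>R M) < 1"
proof -
  have "norm ((mat 1 - (1/k) *\<^sub>R M) *v v) \<le> sqrt (1 - m / k) * norm v" for v
  proof (rule power2_le_imp_le)
    have e: "(mat 1 - (1/k) *\<^sub>R M) *v v = v - (1/k) *\<^sub>R (M *v v)"
      by (simp add: matrix_vector_mult_diff_rdistrib matrix_vector_scaleR)
    have "(norm (v - (1/k) *\<^sub>R (M *v v)))\<^sup>2 = (norm v)\<^sup>2 - 2 / k * (v \<bullet> (M *v v)) + (1/k)\<^sup>2 * (norm (M *v v))\<^sup>2"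
      unfolding power2_norm_eq_inner by (simp add: inner_diff_left inner_diff_right inner_commute power2_eq_square algebra_simps)
    also have "\<dots> \<le> (norm v)\<^sup>2 - 2 / k * (m * (norm v)\<^sup>2) + (1/k)\<^sup>2 * ((m * k) * (norm v)\<^sup>2)"
    proof -
      have "(norm (M *v v))\<^sup>2 \<le> (opnorm M * norm v)\<^sup>2" by (intro power_mono norm_le_opnorm_mult) auto
      also have "\<dots> \<le> (m * k) * (norm v)\<^sup>2" unfolding power_mult_distrib by (intro mult_right_mono k) auto
      finally have 1: "(1/k)\<^sup>2 * (norm (M *v v))\<^sup>2 \<le> (1/k)\<^sup>2 * ((m * k) * (norm v)\<^sup>2)" by (intro mult_left_mono) auto
      have 2: "2 / k * (m * (norm v)\<^sup>2) \<le> 2 / k * (v \<bullet> (M *v v))" using k by (intro mult_left_mono m) auto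
      show ?thesis using 1 2 by linarith
    qed
    also have "\<dots> = (1 - m / k) * (norm v)\<^sup>2" using k by (simp add: field_simps power2_eq_square)
    also have "\<dots> = (sqrt (1 - m / k) * norm v)\<^sup>2" using k m by (simp add: power_mult_distrib)
    finally show "(norm ((mat 1 - (1/k) *\<^sub>R M) *v v))\<^sup>2 \<le> (sqrt (1 - m / k) * norm v)\<^sup>2" unfolding e .
    show "0 \<le> sqrt (1 - m / k) * norm v" using k m by simp
  qed
  then have "opnorm (mat 1 - (1/k) *\<^sub>R M) \<le> sqrt (1 - m / k)" by (rule opnorm_bound)
  also have "\<dots> < 1" using m k by simp
  finally show ?thesis .
qed

text \<open>For \<open>k\<close> large this is exactly the root of \<open>M\<close>: the limit
  \<open>Y\<close> satisfies (1 - Y)^2 = M/k. The threshold for \<open>k\<close> depends on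
  \<open>M\<close>; keeping \<open>k\<close> as an index presents the root as a pointwise limit of
  functions of \<open>M\<close> that are visibly Borel.\<close>

definition sqrt_approx :: "complex^'n^'n \<Rightarrow> nat \<Rightarrow> complex^'n^'n" where
  "sqrt_approx M k = sqrt (real k) *\<^sub>R (mat 1 - lim (sqrt_iter (mat 1 - (1 / real k) *\<^sub>R M)))"

lemma posdef_imp_invertible_form:
  fixes S :: "complex^'n^'n"
  assumes "c > 0" "\<And>v. c * (norm v)\<^sup>2 \<le> v \<bullet> (S *v v)"
  shows "S *v v = 0 \<Longrightarrow> v = 0"
  using assms(2)[of v] assms(1) by (simp add: mult_le_0_iff)

text \<open>Hermitian symmetry and commutation with whatever commutes with \<open>M\<close> pass
  from the iterates to the limit. The fixed-point equation gives the square, and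
  \<open>opnorm Y < 1\<close> makes \<open>mat 1 - Y\<close> coercive.\<close>

lemma sqrt_approx_props:
  fixes M :: "complex^'n^'n" and k :: nat
  assumes herm: "hermitian M" and k: "0 < k" and lt: "opnorm (mat 1 - (1 / real k) *\<^sub>R M) < 1"
  defines "S \<equiv> sqrt_approx M k"
  shows "hermitian S" "S ** S = M" "\<exists>c>0. \<forall>v. c * (norm v)\<^sup>2 \<le> v \<bullet> (S *v v)"
    "\<And>R. R ** M = M ** R \<Longrightarrow> R ** S = S ** R"
proof -
  let ?B = "mat 1 - (1 / real k) *\<^sub>R M"
  define Y where "Y = lim (sqrt_iter ?B)"
  have S: "S = sqrt (real k) *\<^sub>R (mat 1 - Y)" by (simp add: S_def sqrt_approx_def Y_def)
  have lim: "sqrt_iter ?B \<longlonglongrightarrow> Y"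
    using sqrt_iter_convergent[OF lt] unfolding Y_def by (simp add: convergent_LIMSEQ_iff)
  have "(\<lambda>n. sqrt_iter ?B (Suc n)) \<longlonglongrightarrow> (1/2) *\<^sub>R (?B + Y ** Y)"
    unfolding sqrt_iter.simps by (intro tendsto_intros tendsto_matrix_mult lim)
  moreover have "(\<lambda>n. sqrt_iter ?B (Suc n)) \<longlonglongrightarrow> Y" using lim by (rule LIMSEQ_Suc)
  ultimately have fixeq: "Y = (1/2) *\<^sub>R (?B + Y ** Y)" using LIMSEQ_unique by blast
  have hB: "hermitian ?B"
    unfolding hermitian_def
  proof (intro allI)
    fix i j
    show "?B $ i $ j = cnj (?B $ j $ i)" using hermitianD[OF herm, of i j] by (simp add: mat_def)
  qed
  have hY: "hermitian Y"
    unfolding hermitian_def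
  proof (intro allI)
    fix i j
    have "(\<lambda>n. sqrt_iter ?B n $ i $ j) \<longlonglongrightarrow> Y $ i $ j" by (intro tendsto_vec_nth lim)
    moreover have "(\<lambda>n. cnj (sqrt_iter ?B n $ j $ i)) \<longlonglongrightarrow> cnj (Y $ j $ i)" by (intro tendsto_cnj tendsto_vec_nth lim)
    moreover have "sqrt_iter ?B n $ i $ j = cnj (sqrt_iter ?B n $ j $ i)" for n
      by (rule hermitianD[OF hermitian_sqrt_iter[OF hB]])
    ultimately show "Y $ i $ j = cnj (Y $ j $ i)" using LIMSEQ_unique by auto
  qed
  show "hermitian S"
    unfolding hermitian_def S
  proof (intro allI)
    fix i j
    show "(sqrt (real k) *\<^sub>R (mat 1 - Y)) $ i $ j = cnj ((sqrt (real k) *\<^sub>R (mat 1 - Y)) $ j $ i)"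
      using hermitianD[OF hY, of i j] by (simp add: mat_def)
  qed
  have "2 *\<^sub>R Y = ?B + Y ** Y" using arg_cong[OF fixeq, of "\<lambda>z. 2 *\<^sub>R z"] by simp
  then have YY: "Y ** Y = 2 *\<^sub>R Y - ?B" by simp
  have "(mat 1 - Y) ** (mat 1 - Y) = mat 1 - Y - (Y - Y ** Y)"
    by (simp add: matrix_mult_diff_left matrix_mult_diff_right)
  also have "\<dots> = (1 / real k) *\<^sub>R M" unfolding YY by (simp add: scaleR_2)
  finally show "S ** S = M" unfolding S using k by (simp add: matrix_mult_scaleR_left matrix_mult_scaleR_right)
  have "opnorm Y \<le> opnorm ?B"
  proof -
    have "(\<lambda>n. opnorm (sqrt_iter ?B n)) \<longlonglongrightarrow> opnorm Y"
      by (rule continuous_on_tendsto_compose[OF continuous_opnorm lim]) auto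
    then show ?thesis by (rule LIMSEQ_le_const2) (use lt sqrt_iter_opnorm[of ?B] in auto)
  qed
  then have oY: "opnorm Y < 1" using lt by simp
  show "\<exists>c>0. \<forall>v. c * (norm v)\<^sup>2 \<le> v \<bullet> (S *v v)"
  proof (intro exI[of _ "sqrt (real k) * (1 - opnorm Y)"] conjI allI)
    show "0 < sqrt (real k) * (1 - opnorm Y)" using k oY by simp
    fix v :: "complex^'n"
    have "v \<bullet> (Y *v v) \<le> norm v * norm (Y *v v)" by (rule norm_cauchy_schwarz)
    also have "\<dots> \<le> norm v * (opnorm Y * norm v)" by (intro mult_left_mono norm_le_opnorm_mult) auto
    finally have "(1 - opnorm Y) * (norm v)\<^sup>2 \<le> v \<bullet> v - v \<bullet> (Y *v v)"
      by (simp add: power2_norm_eq_inner[symmetric] power2_eq_square algebra_simps)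
    then have "sqrt (real k) * ((1 - opnorm Y) * (norm v)\<^sup>2) \<le> sqrt (real k) * (v \<bullet> v - v \<bullet> (Y *v v))"
      by (intro mult_left_mono) auto
    then show "sqrt (real k) * (1 - opnorm Y) * (norm v)\<^sup>2 \<le> v \<bullet> (S *v v)"
      unfolding S by (simp add: matrix_vector_scaleR matrix_vector_mult_diff_rdistrib inner_diff_right mult.assoc)
  qed
  fix R assume RM: "R ** M = M ** R"
  have RB: "R ** ?B = ?B ** R"
    using RM by (simp add: matrix_mult_diff_left matrix_mult_diff_right matrix_mult_scaleR_left matrix_mult_scaleR_right)
  have "(\<lambda>n. R ** sqrt_iter ?B n) \<longlonglongrightarrow> R ** Y" by (intro tendsto_matrix_mult lim tendsto_const)
  moreover have "(\<lambda>n. sqrt_iter ?B n ** R) \<longlonglongrightarrow> Y ** R" by (intro tendsto_matrix_mult lim tendsto_const)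
  ultimately have "R ** Y = Y ** R" using LIMSEQ_unique sqrt_iter_commute[OF RB] by auto
  then show "R ** S = S ** R" unfolding S
    by (simp add: matrix_mult_diff_left matrix_mult_diff_right matrix_mult_scaleR_left matrix_mult_scaleR_right)
qed

lemma inj_matrix_mult_zero:
  fixes A B :: "complex^'n^'n"
  assumes "A ** B = 0" "\<And>v. A *v v = 0 \<Longrightarrow> v = 0"
  shows "B = 0"
proof -
  have "B *v v = 0" for v
    using assms(2)[of "B *v v"] arg_cong[OF assms(1), of "\<lambda>X. X *v v"] by (simp add: matrix_vector_mul_assoc)
  then show ?thesis by (simp add: matrix_eq)
qed

text \<open>Uniqueness of the positive root: a root \<open>R\<close> commutes with its square
  \<open>M\<close>, hence with the root \<open>S\<close> already found, so
  \<open>(R + S) ** (R - S) = 0\<close>. The sum is coercive because \<open>S\<close> is, so the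
  difference vanishes. This also justifies the description by \<open>THE\<close> in
  \<open>msqrt\<close>.\<close>

lemma msqrt_eq_sqrt_approx:
  fixes M :: "complex^'n^'n" and k :: nat
  assumes herm: "hermitian M" and k: "0 < k" and lt: "opnorm (mat 1 - (1 / real k) *\<^sub>R M) < 1"
  shows "msqrt M = sqrt_approx M k"
proof -
  let ?S = "sqrt_approx M k"
  note P = sqrt_approx_props[OF assms]
  obtain c where c: "c > 0" "\<And>v. c * (norm v)\<^sup>2 \<le> v \<bullet> (?S *v v)" using P(3) by blast
  show ?thesis unfolding msqrt_def
  proof (rule the_equality)
    have "0 \<le> v \<bullet> (?S *v v)" for v
      using c(1) by (intro order_trans[OF _ c(2)]) simp
    then show "psd_matrix ?S \<and> ?S ** ?S = M"
      unfolding psd_matrix_def inner_matrix_vector[symmetric] using P(1,2) by blast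
    fix R assume R: "psd_matrix R \<and> R ** R = M"
    then have "R ** M = M ** R" by (metis matrix_mul_assoc)
    then have comm: "R ** ?S = ?S ** R" by (rule P(4))
    have "(R + ?S) ** (R - ?S) = 0"
      using R P(2) comm by (simp add: matrix_mult_add_left matrix_mult_diff_right)
    moreover have "v = 0" if "(R + ?S) *v v = 0" for v
    proof (rule posdef_imp_invertible_form[OF c(1) _ that])
      fix w
      have "0 \<le> w \<bullet> (R *v w)" using R unfolding psd_matrix_def inner_matrix_vector[symmetric] by blast
      then show "c * (norm w)\<^sup>2 \<le> w \<bullet> ((R + ?S) *v w)"
        using c(2)[of w] by (simp add: matrix_vector_mult_add_rdistrib inner_add_right)
    qed
    ultimately have "R - ?S = 0" by (rule inj_matrix_mult_zero)
    then show "R = ?S" by simp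
  qed
qed

lemma eventually_msqrt_eq:
  fixes M :: "complex^'n^'n"
  assumes "posdef_matrix M"
  shows "\<forall>\<^sub>F k in sequentially. 0 < k \<and> opnorm (mat 1 - (1 / real k) *\<^sub>R M) < 1"
proof -
  obtain m where m: "m > 0" "\<And>v. m * (norm v)\<^sup>2 \<le> v \<bullet> (M *v v)" using posdef_lower_bound[OF assms] by blast
  obtain k0 :: nat where k0: "max m ((opnorm M)\<^sup>2 / m) \<le> real k0" using real_arch_simple by blast
  have "0 < k \<and> opnorm (mat 1 - (1 / real k) *\<^sub>R M) < 1" if "k0 \<le> k" for k
  proof -
    have k: "m \<le> real k" "(opnorm M)\<^sup>2 / m \<le> real k" using k0 that by auto
    then have "0 < real k" using m by linarith
    then show ?thesis using opnorm_lt_one[OF m, of "real k"] k m by (auto simp: field_simps)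
  qed
  then show ?thesis by (auto simp: eventually_sequentially)
qed

lemma
  fixes M :: "complex^'n^'n"
  assumes "posdef_matrix M"
  shows hermitian_msqrt: "hermitian (msqrt M)"
    and msqrt_minvsqrt: "msqrt M ** minvsqrt M = mat 1"
    and minvsqrt_msqrt: "minvsqrt M ** msqrt M = mat 1"
    and hermitian_minvsqrt: "hermitian (minvsqrt M)"
    and msqrt_eq_lim: "msqrt M = lim (sqrt_approx M)"
proof -
  have herm: "hermitian M" using assms by (simp add: posdef_matrix_def)
  obtain k where k: "0 < k" "opnorm (mat 1 - (1 / real k) *\<^sub>R M) < 1"
    using eventually_msqrt_eq[OF assms] by (auto simp: eventually_sequentially)
  note P = sqrt_approx_props[OF herm k] and eq = msqrt_eq_sqrt_approx[OF herm k]
  show hS: "hermitian (msqrt M)" using P(1) eq by simp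
  obtain c where c: "c > 0" "\<And>v. c * (norm v)\<^sup>2 \<le> v \<bullet> (msqrt M *v v)" using P(3) eq by auto
  have "inj ((*v) (msqrt M))"
  proof (rule injI)
    fix x y assume "msqrt M *v x = msqrt M *v y"
    then have "msqrt M *v (x - y) = 0" by (simp add: matrix_vector_mult_diff_distrib)
    then have "x - y = 0" by (rule posdef_imp_invertible_form[OF c])
    then show "x = y" by simp
  qed
  then obtain B where "B ** msqrt M = mat 1" using matrix_left_invertible_injective by blast
  then have "\<exists>A'. msqrt M ** A' = mat 1 \<and> A' ** msqrt M = mat 1" using matrix_left_right_inverse by blast
  then have inv: "msqrt M ** minvsqrt M = mat 1 \<and> minvsqrt M ** msqrt M = mat 1"
    unfolding minvsqrt_def matrix_inv_def by (rule someI_ex)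
  then show "msqrt M ** minvsqrt M = mat 1" "minvsqrt M ** msqrt M = mat 1" by auto
  \<comment> \<open>The adjoint of the inverse. Taking adjoints in
    \<open>msqrt M ** minvsqrt M = mat 1\<close> shows that it is a left inverse of the root too,
    and inverses are unique.\<close>
  define N where "N = (\<chi> i j. cnj (minvsqrt M $ j $ i))"
  have "N ** msqrt M = mat 1"
  proof -
    have "(N ** msqrt M) $ i $ j = (mat 1 :: complex^'n^'n) $ i $ j" for i j
    proof -
      have "(N ** msqrt M) $ i $ j = cnj (\<Sum>k\<in>UNIV. msqrt M $ j $ k * minvsqrt M $ k $ i)"
        unfolding matrix_matrix_mult_def N_def using hermitianD[OF hS, of _ j] by (simp add: mult.commute)
      also have "\<dots> = cnj ((msqrt M ** minvsqrt M) $ j $ i)" by (simp add: matrix_matrix_mult_def)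
      finally show ?thesis using inv by (auto simp: mat_def)
    qed
    then show ?thesis by (simp add: vec_eq_iff)
  qed
  then have "N = minvsqrt M" using inv by (metis matrix_mul_assoc matrix_mul_lid matrix_mul_rid)
  then show "hermitian (minvsqrt M)" unfolding hermitian_def N_def vec_eq_iff by (metis vec_lambda_beta)
  have "sqrt_approx M \<longlonglongrightarrow> msqrt M"
    by (rule tendsto_eventually) (use eventually_msqrt_eq[OF assms] msqrt_eq_sqrt_approx[OF herm] in \<open>auto elim!: eventually_mono\<close>)
  then show "msqrt M = lim (sqrt_approx M)" by (simp add: limI)
qed

section \<open>The kernel of a matrix weight\<close>

lemma continuous_on_matrix_mult[continuous_intros]:
  fixes A :: "'a::topological_space \<Rightarrow> complex^'k^'n" and B :: "'a \<Rightarrow> complex^'m^'k"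
  assumes "continuous_on S A" "continuous_on S B"
  shows "continuous_on S (\<lambda>x. A x ** B x)"
  using assms unfolding continuous_on_def by (auto intro: tendsto_matrix_mult)

lemma borel_measurable_matrix_mult[measurable (raw)]:
  fixes A :: "'a \<Rightarrow> complex^'k^'n" and B :: "'a \<Rightarrow> complex^'m^'k"
  assumes "A \<in> borel_measurable M" "B \<in> borel_measurable M"
  shows "(\<lambda>x. A x ** B x) \<in> borel_measurable M"
  by (rule borel_measurable_continuous_Pair[OF assms]) (intro continuous_intros)

lemma continuous_on_matrix_vector_mult[continuous_intros]:
  fixes A :: "'a::topological_space \<Rightarrow> complex^'m^'n"
  assumes "continuous_on S A" "continuous_on S B"
  shows "continuous_on S (\<lambda>x. A x *v B x)"
  unfolding matrix_vector_mult_def using assms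
  by (auto intro!: continuous_intros)

lemma borel_measurable_matrix_vector_mult[measurable (raw)]:
  fixes A :: "'a \<Rightarrow> complex^'m^'n"
  assumes "A \<in> borel_measurable M" "B \<in> borel_measurable M"
  shows "(\<lambda>x. A x *v B x) \<in> borel_measurable M"
  by (rule borel_measurable_continuous_Pair[OF assms]) (intro continuous_intros)

section \<open>The scalar functions |W^{-1/2} e| and the kernel K\<close>

text \<open>\<open>P\<close> and \<open>N\<close> stand for W^{1/2} and W^{-1/2} of a Borel
  representative that is positive definite at every point. The A_2 condition is over balls and in
  the Hilbert-Schmidt norm instead of cubes and the operator norm, which changes only the
  constant.\<close>

locale A2_pair =
  fixes P N :: "'a::euclidean_space \<Rightarrow> complex^'n^'n" and CA :: real
  assumes P_meas[measurable]: "P \<in> borel_measurable borel" and N_meas[measurable]: "N \<in> borel_measurable borel"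
    and PN: "\<And>x. P x ** N x = mat 1" and NP: "\<And>x. N x ** P x = mat 1"
    and herm_P: "\<And>x. hermitian (P x)" and herm_N: "\<And>x. hermitian (N x)"
    and CA: "0 < CA"
    and A2: "\<And>z r. 0 < r \<Longrightarrow> (\<integral>\<^sup>+x\<in>ball z r. (\<integral>\<^sup>+y\<in>ball z r. ennreal ((norm (P x ** N y))\<^sup>2) \<partial>lborel) \<partial>lborel)
        \<le> ennreal CA * (emeasure lborel (ball z r))\<^sup>2"
begin

definition K :: "'a \<Rightarrow> 'a \<Rightarrow> real" where "K x y = norm (P x ** N y)"

lemma K_nonneg: "0 \<le> K x y" by (simp add: K_def)

lemma K_measurable[measurable (raw)]:
  assumes "f \<in> borel_measurable M" "g \<in> borel_measurable M"
  shows "(\<lambda>x. K (f x) (g x)) \<in> borel_measurable M"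
  using measurable_compose[OF assms(1) P_meas] measurable_compose[OF assms(2) N_meas] unfolding K_def by measurable

lemma K_A2: "0 < r \<Longrightarrow> (\<integral>\<^sup>+x\<in>ball z r. (\<integral>\<^sup>+y\<in>ball z r. ennreal ((K x y)\<^sup>2) \<partial>lborel) \<partial>lborel)
        \<le> ennreal CA * (emeasure lborel (ball z r))\<^sup>2"
  using A2 by (simp add: K_def)

definition h :: "complex^'n \<Rightarrow> 'a \<Rightarrow> real" where "h e y = norm (N y *v e)"

lemma h_measurable[measurable]: "h e \<in> borel_measurable borel"
  unfolding h_def by measurable

lemma h_nonneg: "0 \<le> h e y" by (simp add: h_def)

text \<open>Insert \<open>P x ** N x = mat 1\<close> in front of \<open>e\<close>;
  \<open>N y ** P x\<close> is the adjoint of the matrix in \<open>K x y\<close>.\<close>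

lemma h_le: "h e y \<le> K x y * h e x"
proof -
  have "N y *v e = (N y ** P x) *v (N x *v e)"
    by (simp add: matrix_vector_mul_assoc matrix_mul_assoc[symmetric] PN)
  then have "h e y \<le> norm (N y ** P x) * h e x" unfolding h_def using norm_matrix_vector_mult_le by metis
  then show ?thesis using norm_hermitian_mult_commute[OF herm_N herm_P, of y x] by (simp add: K_def)
qed

text \<open>The columns of \<open>N y ** P x\<close> are \<open>N y\<close> applied to the columns
  of \<open>P x\<close>. This reduces the kernel to scalar functions \<open>h e\<close>, for which a
  reverse Hoelder inequality is at hand.\<close>

lemma h_column_le: "h (column i (P x)) y \<le> K x y" and K_sq: "(K x y)\<^sup>2 = (\<Sum>i\<in>UNIV. (h (column i (P x)) y)\<^sup>2)"
proof -
  show *: "(K x y)\<^sup>2 = (\<Sum>i\<in>UNIV. (h (column i (P x)) y)\<^sup>2)"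
    using norm_hermitian_mult_commute[OF herm_N herm_P, of y x] norm_matrix_sq_columns[of "N y" "P x"] by (simp add: K_def h_def)
  have "(h (column i (P x)) y)\<^sup>2 \<le> (\<Sum>i\<in>UNIV. (h (column i (P x)) y)\<^sup>2)" by (intro member_le_sum) auto
  then show "h (column i (P x)) y \<le> K x y" unfolding *[symmetric] by (rule power2_le_imp_le) (rule K_nonneg)
qed

lemma K_sq_integral_measurable[measurable]: "(\<lambda>x. \<integral>\<^sup>+y\<in>ball z r. ennreal ((K x y)\<^sup>2) \<partial>lborel) \<in> borel_measurable borel"
proof -
  have "(\<lambda>x. \<integral>\<^sup>+y\<in>ball z r. ennreal ((K x y)\<^sup>2) \<partial>lborel) \<in> borel_measurable lborel" by measurable
  then show ?thesis by simp
qed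

text \<open>Since \<open>s\<^sup>2 \<le> \<alpha> (h e x)\<^sup>2\<close> implies \<open>s \<le> h e x + s \<alpha>\<close>, the \<open>A\<^sub>2\<close> bound on the average of \<open>\<alpha>\<close> lets \<open>s \<alpha>\<close> be absorbed.\<close>

lemma h_reverse_Holder: "weak_reverse_Holder (2 * sqrt (2 * CA)) UNIV (h e) (\<lambda>_. 0)"
  unfolding weak_reverse_Holder_def
proof (intro allI impI)
  fix x :: 'a and t l :: real
  assume t: "0 < t" and l: "0 < l"
    and le: "(\<integral>\<^sup>+y\<in>ball x (2*t). ennreal ((h e y)\<^sup>2) \<partial>lborel) \<le> ennreal (l\<^sup>2) * emeasure lborel (ball x (2*t))"
  let ?B = "ball x (2*t)"
  obtain V where V: "emeasure lborel ?B = ennreal V" "V > 0" using t by (simp add: emeasure_ball)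
  obtain m where m: "(\<integral>\<^sup>+y\<in>?B. ennreal ((h e y)\<^sup>2) \<partial>lborel) = ennreal m" "0 \<le> m"
    using le V by (cases "\<integral>\<^sup>+y\<in>?B. ennreal ((h e y)\<^sup>2) \<partial>lborel") (auto simp: ennreal_mult[symmetric] top_unique)
  have ml: "m \<le> l\<^sup>2 * V" using le V by (simp add: m ennreal_mult[symmetric])
  \<comment> \<open>Normalised so that the quadratic mean of \<open>h e\<close> over the ball is
    \<open>s * sqrt (2 * CA)\<close>. The factor 2 makes the integrated term with \<open>a z\<close>
    equal to at most \<open>s * V / 2\<close>, half of the left side.\<close>
  define s where "s = sqrt (m / (2 * CA * V))"
  have s: "0 \<le> s" "m = s\<^sup>2 * (2 * CA * V)" using m V CA by (auto simp: s_def)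
  define a where "a z = (\<integral>\<^sup>+y\<in>?B. ennreal ((K z y)\<^sup>2) \<partial>lborel)" for z
  have [measurable]: "a \<in> borel_measurable borel" unfolding a_def by measurable
  have am: "ennreal m \<le> a z * ennreal ((h e z)\<^sup>2)" for z
  proof -
    have "(\<integral>\<^sup>+y\<in>?B. ennreal ((h e y)\<^sup>2) \<partial>lborel) \<le> (\<integral>\<^sup>+y\<in>?B. ennreal ((h e z)\<^sup>2) * ennreal ((K z y)\<^sup>2) \<partial>lborel)"
    proof (rule nn_set_integral_mono)
      fix y
      have "(h e y)\<^sup>2 \<le> (K z y * h e z)\<^sup>2" by (intro power_mono h_le h_nonneg)
      then show "ennreal ((h e y)\<^sup>2) \<le> ennreal ((h e z)\<^sup>2) * ennreal ((K z y)\<^sup>2)"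
        by (simp add: ennreal_mult[symmetric] power_mult_distrib mult.commute ennreal_leI)
    qed
    also have "\<dots> = ennreal ((h e z)\<^sup>2) * a z" unfolding a_def by (rule nn_set_integral_cmult) measurable
    finally show ?thesis using m by (simp add: mult.commute)
  qed
  have pt: "ennreal s \<le> ennreal (h e z) + ennreal (s / (2 * CA * V)) * a z" for z
  proof (cases "a z < ennreal (2 * CA * V)")
    case True
    then obtain r where r: "a z = ennreal r" "0 \<le> r" "r < 2 * CA * V" by (cases "a z") (auto simp: ennreal_less_iff)
    have "s\<^sup>2 * (2 * CA * V) \<le> r * (h e z)\<^sup>2" using am[of z] r m s by (simp add: ennreal_mult[symmetric])
    also have "\<dots> \<le> (2 * CA * V) * (h e z)\<^sup>2" using r by (intro mult_right_mono) auto
    finally have "s\<^sup>2 \<le> (h e z)\<^sup>2" using CA V by simp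
    then have "s \<le> h e z" by (rule power2_le_imp_le) (rule h_nonneg)
    then show ?thesis by (intro add_increasing2 ennreal_leI) auto
  next
    case False
    have "ennreal s = ennreal (s / (2 * CA * V)) * ennreal (2 * CA * V)"
      using s CA V by (subst ennreal_mult[symmetric]) auto
    also have "\<dots> \<le> ennreal (s / (2 * CA * V)) * a z" using False by (intro mult_left_mono) auto
    finally show ?thesis by (simp add: add_increasing)
  qed
  have "ennreal (s * V) = (\<integral>\<^sup>+z\<in>?B. ennreal s \<partial>lborel)" using s V by (simp add: nn_integral_cmult_indicator ennreal_mult)
  also have "\<dots> \<le> (\<integral>\<^sup>+z. ennreal (h e z) * indicator ?B z + ennreal (s / (2 * CA * V)) * (a z * indicator ?B z) \<partial>lborel)"
    using pt by (intro nn_integral_mono) (auto split: split_indicator)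
  also have "\<dots> = (\<integral>\<^sup>+z\<in>?B. ennreal (h e z) \<partial>lborel) + ennreal (s / (2 * CA * V)) * (\<integral>\<^sup>+z\<in>?B. a z \<partial>lborel)"
    by (subst nn_integral_add, measurable, subst nn_integral_cmult) auto
  also have "\<dots> \<le> (\<integral>\<^sup>+z\<in>?B. ennreal (h e z) \<partial>lborel) + ennreal (s / (2 * CA * V)) * ennreal (CA * V\<^sup>2)"
  proof (intro add_left_mono mult_left_mono)
    show "(\<integral>\<^sup>+z\<in>?B. a z \<partial>lborel) \<le> ennreal (CA * V\<^sup>2)"
      unfolding a_def using K_A2[of "2*t" x] t V CA by (simp add: ennreal_mult ennreal_power)
  qed auto
  also have "ennreal (s / (2 * CA * V)) * ennreal (CA * V\<^sup>2) = ennreal (s * V / 2)"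
    using s CA V by (subst ennreal_mult[symmetric]) (auto simp: power2_eq_square)
  finally have sV: "ennreal (s * V / 2) \<le> (\<integral>\<^sup>+z\<in>?B. ennreal (h e z) \<partial>lborel)"
    using s V by (cases "\<integral>\<^sup>+z\<in>?B. ennreal (h e z) \<partial>lborel") (auto simp: ennreal_plus[symmetric] simp del: ennreal_plus)
  \<comment> \<open>One factor, the quadratic mean \<open>s * sqrt (2 * CA)\<close>, is at most
    \<open>l\<close>; the other is \<open>s * V\<close> up to constants, which \<open>sV\<close>
    bounds by the integral of \<open>h e\<close>.\<close>
  have "m \<le> 2 * sqrt (2 * CA) * l * (s * V / 2)"
  proof -
    have "s\<^sup>2 * (2 * CA) \<le> l\<^sup>2" using ml s V by (simp add: mult.assoc[symmetric])
    then have "(s * sqrt (2 * CA))\<^sup>2 \<le> l\<^sup>2" using CA by (simp add: power_mult_distrib)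
    then have sl: "s * sqrt (2 * CA) \<le> l" by (rule power2_le_imp_le) (use l in auto)
    have "m = (s * sqrt (2 * CA)) * (sqrt (2 * CA) * (s * V))"
      using s(2) CA by (simp add: power2_eq_square algebra_simps)
    also have "\<dots> \<le> l * (sqrt (2 * CA) * (s * V))" using sl s V CA by (intro mult_right_mono) auto
    finally show ?thesis by (simp add: mult_ac)
  qed
  then have "ennreal m \<le> ennreal (2 * sqrt (2 * CA) * l * (s * V / 2))" by (rule ennreal_leI)
  also have "\<dots> = ennreal (2 * sqrt (2 * CA) * l) * ennreal (s * V / 2)" using CA l s V by (intro ennreal_mult) auto
  also have "\<dots> \<le> ennreal (2 * sqrt (2 * CA) * l) * (\<integral>\<^sup>+z\<in>?B. ennreal (h e z) \<partial>lborel)" by (intro mult_left_mono sV) auto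
  finally have main: "(\<integral>\<^sup>+y\<in>?B. ennreal ((h e y)\<^sup>2) \<partial>lborel) \<le> ennreal (2 * sqrt (2 * CA) * l) * (\<integral>\<^sup>+z\<in>?B. ennreal (h e z) \<partial>lborel)"
    unfolding m .
  have "(\<integral>\<^sup>+y\<in>ball x t. ennreal ((h e y)\<^sup>2) \<partial>lborel) \<le> (\<integral>\<^sup>+y\<in>?B. ennreal ((h e y)\<^sup>2) \<partial>lborel)"
    using t by (intro nn_set_integral_mono_set subset_ball) auto
  also note main
  finally show "(\<integral>\<^sup>+y\<in>ball x t. ennreal ((h e y)\<^sup>2) \<partial>lborel) \<le> ennreal (l\<^sup>2 / (4 * 8^DIM('a))) * emeasure lborel ?B
          + ennreal (2 * sqrt (2 * CA) * l) * (\<integral>\<^sup>+y\<in>?B. ennreal (h e y) \<partial>lborel)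
          + ennreal (2 * sqrt (2 * CA)) * (\<integral>\<^sup>+y\<in>?B. ennreal (0\<^sup>2) \<partial>lborel)"
    by (simp add: add_increasing)
qed

text \<open>Gehring's lemma applies to each column function with zero data and with a constant that
  does not involve the column, hence not \<open>x\<close>. The power of \<open>K\<close> is
  recovered from the largest column, at the cost of powers of the matrix size.\<close>

lemma K_higher_integrability:
  "\<exists>q>2. \<exists>C>0. \<forall>x z \<rho> L. 0 < \<rho> \<longrightarrow> 0 < L \<longrightarrow>
    (\<integral>\<^sup>+y\<in>ball z (2*\<rho>). ennreal ((K x y)\<^sup>2) \<partial>lborel) \<le> ennreal (L\<^sup>2) * emeasure lborel (ball z (2*\<rho>)) \<longrightarrow>
    (\<integral>\<^sup>+y\<in>ball z \<rho>. ennreal (K x y powr q) \<partial>lborel) \<le> ennreal (C * L powr q) * emeasure lborel (ball z (2*\<rho>))"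
proof -
  have b: "0 \<le> 2 * sqrt (2 * CA)" using CA by simp
  obtain q C where q: "q > 2" and C: "C > 0" and G: "\<And>(g::'a \<Rightarrow> real) f x0 r L.
    g \<in> borel_measurable borel \<Longrightarrow> f \<in> borel_measurable borel \<Longrightarrow> (\<forall>x. 0 \<le> g x) \<Longrightarrow> (\<forall>x. 0 \<le> f x) \<Longrightarrow>
    0 < r \<Longrightarrow> 0 < L \<Longrightarrow>
    (\<integral>\<^sup>+y\<in>ball x0 r. ennreal ((g y)\<^sup>2) \<partial>lborel) \<le> ennreal (L\<^sup>2) * emeasure lborel (ball x0 r) \<Longrightarrow>
    weak_reverse_Holder (2 * sqrt (2 * CA)) (ball x0 r) g f \<Longrightarrow>
    (\<integral>\<^sup>+y\<in>ball x0 (r/2). ennreal (g y powr q) \<partial>lborel) \<le>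
      ennreal C * (ennreal (L powr q) * emeasure lborel (ball x0 r) + (\<integral>\<^sup>+y\<in>ball x0 r. ennreal (f y powr q) \<partial>lborel))"
    using gehring[OF b, where 'a='a] by blast
  let ?n = "real CARD('n)"
  have n1: "1 \<le> ?n" by (simp add: Suc_leI)
  have "(\<integral>\<^sup>+y\<in>ball z \<rho>. ennreal (K x y powr q) \<partial>lborel) \<le> ennreal (?n powr q * ?n * C * L powr q) * emeasure lborel (ball z (2*\<rho>))"
    if \<rho>: "0 < \<rho>" and L: "0 < L" and le: "(\<integral>\<^sup>+y\<in>ball z (2*\<rho>). ennreal ((K x y)\<^sup>2) \<partial>lborel) \<le> ennreal (L\<^sup>2) * emeasure lborel (ball z (2*\<rho>))"
    for x z \<rho> L
  proof -
    let ?h = "\<lambda>i. h (column i (P x))"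
    have hi: "(\<integral>\<^sup>+y\<in>ball z \<rho>. ennreal (?h i y powr q) \<partial>lborel) \<le> ennreal C * (ennreal (L powr q) * emeasure lborel (ball z (2*\<rho>)))" for i
    proof -
      have "(\<integral>\<^sup>+y\<in>ball z (2*\<rho>). ennreal ((?h i y)\<^sup>2) \<partial>lborel) \<le> (\<integral>\<^sup>+y\<in>ball z (2*\<rho>). ennreal ((K x y)\<^sup>2) \<partial>lborel)"
        by (intro nn_set_integral_mono ennreal_leI power_mono h_column_le h_nonneg)
      also note le
      finally have "(\<integral>\<^sup>+y\<in>ball z (2*\<rho>). ennreal ((?h i y)\<^sup>2) \<partial>lborel) \<le> ennreal (L\<^sup>2) * emeasure lborel (ball z (2*\<rho>))" .
      moreover have "weak_reverse_Holder (2 * sqrt (2 * CA)) (ball z (2*\<rho>)) (?h i) (\<lambda>_. 0)"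
        using h_reverse_Holder[of "column i (P x)"] unfolding weak_reverse_Holder_def by blast
      ultimately show ?thesis using G[of "?h i" "\<lambda>_. 0" "2*\<rho>" L z] \<rho> L q by (simp add: h_nonneg)
    qed
    have "(\<integral>\<^sup>+y\<in>ball z \<rho>. ennreal (K x y powr q) \<partial>lborel) \<le> (\<integral>\<^sup>+y. (\<Sum>i\<in>UNIV. ennreal (?n powr q) * (ennreal (?h i y powr q) * indicator (ball z \<rho>) y)) \<partial>lborel)"
    proof (intro nn_integral_mono)
      fix y
      obtain i where i: "\<And>j. ?h j y \<le> ?h i y"
      proof -
        have fin: "finite (range (\<lambda>j. ?h j y))" by simp
        then have "Max (range (\<lambda>j. ?h j y)) \<in> range (\<lambda>j. ?h j y)" by (intro Max_in) auto
        then obtain i where i: "Max (range (\<lambda>j. ?h j y)) = ?h i y" by (rule rangeE)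
        show ?thesis
        proof (rule that[of i])
          fix j show "?h j y \<le> ?h i y" unfolding i[symmetric] using fin by (intro Max_ge) auto
        qed
      qed
      have "(K x y)\<^sup>2 \<le> (\<Sum>j\<in>(UNIV::'n set). (?h i y)\<^sup>2)"
        unfolding K_sq by (intro sum_mono power_mono i h_nonneg)
      also have "\<dots> = ?n * (?h i y)\<^sup>2" by simp
      also have "\<dots> \<le> ?n\<^sup>2 * (?h i y)\<^sup>2" using n1 by (intro mult_right_mono) (auto simp: power2_eq_square)
      finally have "(K x y)\<^sup>2 \<le> (?n * ?h i y)\<^sup>2" by (simp only: power_mult_distrib)
      then have "K x y \<le> ?n * ?h i y" by (rule power2_le_imp_le) (simp add: h_nonneg)
      then have "K x y powr q \<le> (?n * ?h i y) powr q" using q K_nonneg by (intro powr_mono2) auto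
      also have "\<dots> = ?n powr q * ?h i y powr q" using h_nonneg by (simp add: powr_mult)
      finally have "ennreal (K x y powr q) \<le> ennreal (?n powr q) * ennreal (?h i y powr q)"
        by (simp add: ennreal_mult[symmetric] ennreal_leI)
      then have "ennreal (K x y powr q) * indicator (ball z \<rho>) y \<le> ennreal (?n powr q) * (ennreal (?h i y powr q) * indicator (ball z \<rho>) y)"
        by (auto split: split_indicator)
      also have "\<dots> \<le> (\<Sum>i\<in>UNIV. ennreal (?n powr q) * (ennreal (?h i y powr q) * indicator (ball z \<rho>) y))"
        by (intro member_le_sum) auto
      finally show "ennreal (K x y powr q) * indicator (ball z \<rho>) y \<le> \<dots>" .
    qed
    also have "\<dots> = (\<Sum>i\<in>UNIV. ennreal (?n powr q) * (\<integral>\<^sup>+y\<in>ball z \<rho>. ennreal (?h i y powr q) \<partial>lborel))"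
      by (subst nn_integral_sum) (auto intro!: sum.cong nn_integral_cmult)
    also have "\<dots> \<le> (\<Sum>i\<in>(UNIV::'n set). ennreal (?n powr q) * (ennreal C * (ennreal (L powr q) * emeasure lborel (ball z (2*\<rho>)))))"
      by (intro sum_mono mult_left_mono hi) auto
    also have "\<dots> = ennreal ?n * (ennreal (?n powr q) * (ennreal C * (ennreal (L powr q) * emeasure lborel (ball z (2*\<rho>)))))"
      by (simp add: ennreal_of_nat_eq_real_of_nat)
    also have "\<dots> = ennreal (?n powr q * ?n * C * L powr q) * emeasure lborel (ball z (2*\<rho>))"
      using C by (simp add: ennreal_mult mult_ac)
    finally show ?thesis .
  qed
  then show ?thesis using q C n1 by (intro exI[of _ q] conjI exI[of _ "?n powr q * ?n * C"]) auto
qed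

end

section \<open>Equi-integrability of the squared kernel\<close>

lemma ennreal_add_square_le: "(a + b)\<^sup>2 \<le> 2 * a\<^sup>2 + 2 * b\<^sup>2" for a b :: ennreal
proof (cases a; cases b)
  fix x y :: real assume xy: "a = ennreal x" "0 \<le> x" "b = ennreal y" "0 \<le> y"
  have "(x + y)\<^sup>2 \<le> 2 * x\<^sup>2 + 2 * y\<^sup>2" using sum_squares_bound[of x y] by (simp add: power2_sum)
  then have "ennreal ((x + y)\<^sup>2) \<le> ennreal (2 * x\<^sup>2 + 2 * y\<^sup>2)" by (rule ennreal_leI)
  then show ?thesis using xy by (simp add: ennreal_power[symmetric] ennreal_mult)
qed (simp_all add: ennreal_mult_top power2_eq_square)

lemma nn_integral_affine:
  fixes f :: "'a::euclidean_space \<Rightarrow> ennreal"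
  assumes [measurable]: "f \<in> borel_measurable borel" and t: "0 < t"
  shows "(\<integral>\<^sup>+y. f (c + t *\<^sub>R y) \<partial>lborel) = ennreal (1 / t ^ DIM('a)) * (\<integral>\<^sup>+w. f w \<partial>lborel)"
proof -
  have "(\<integral>\<^sup>+w. f w \<partial>lborel) = (\<integral>\<^sup>+w. f w \<partial>density (distr lborel borel (\<lambda>x. c + t *\<^sub>R x)) (\<lambda>_. \<bar>t\<bar>^DIM('a)))"
    using lborel_affine[of t c] t by simp
  also have "\<dots> = ennreal (t ^ DIM('a)) * (\<integral>\<^sup>+y. f (c + t *\<^sub>R y) \<partial>lborel)"
    using t by (simp add: nn_integral_density nn_integral_distr nn_integral_cmult)
  finally have "ennreal (1 / t ^ DIM('a)) * (\<integral>\<^sup>+w. f w \<partial>lborel) = (ennreal (1 / t ^ DIM('a)) * ennreal (t ^ DIM('a))) * (\<integral>\<^sup>+y. f (c + t *\<^sub>R y) \<partial>lborel)"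
    by (simp add: mult.assoc)
  also have "ennreal (1 / t ^ DIM('a)) * ennreal (t ^ DIM('a)) = 1" using t by (subst ennreal_mult[symmetric]) auto
  finally show ?thesis by simp
qed

text \<open>Cauchy-Schwarz against the constant 1. The squared form avoids roots of extended reals;
  \<open>ennreal_power2_le_imp_le\<close> removes the squares.\<close>

lemma nn_integral_le_sqrt:
  fixes g :: "'a::euclidean_space \<Rightarrow> real"
  assumes [measurable]: "g \<in> borel_measurable borel" "B \<in> sets borel" and l: "0 < l"
    and le: "(\<integral>\<^sup>+y\<in>B. ennreal ((g y)\<^sup>2) \<partial>lborel) \<le> ennreal (l\<^sup>2) * emeasure lborel B"
  shows "(\<integral>\<^sup>+y\<in>B. ennreal (g y) \<partial>lborel)\<^sup>2 \<le> (ennreal l * emeasure lborel B)\<^sup>2"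
proof -
  have "(\<integral>\<^sup>+y\<in>B. ennreal (g y) \<partial>lborel) = (\<integral>\<^sup>+y. (ennreal (g y) * indicator B y) * indicator B y \<partial>lborel)"
    by (intro nn_integral_cong) (auto split: split_indicator)
  then have "(\<integral>\<^sup>+y\<in>B. ennreal (g y) \<partial>lborel)\<^sup>2 \<le> (\<integral>\<^sup>+y. (ennreal (g y) * indicator B y)\<^sup>2 \<partial>lborel) * (\<integral>\<^sup>+y. (indicator B y)\<^sup>2 \<partial>lborel)"
    by (simp only:) (rule Cauchy_Schwarz_nn_integral, measurable)
  also have "(\<integral>\<^sup>+y. (indicator B y)\<^sup>2 \<partial>lborel) = (\<integral>\<^sup>+y. indicator B y \<partial>lborel)"
    by (intro nn_integral_cong) (auto split: split_indicator)
  also have "\<dots> = emeasure lborel B" by simp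
  also have "(\<integral>\<^sup>+y. (ennreal (g y) * indicator B y)\<^sup>2 \<partial>lborel) \<le> (\<integral>\<^sup>+y\<in>B. ennreal ((g y)\<^sup>2) \<partial>lborel)"
  proof (intro nn_integral_mono)
    fix y
    have "(ennreal (g y))\<^sup>2 \<le> ennreal ((g y)\<^sup>2)"
      by (cases "0 \<le> g y") (auto simp: ennreal_power ennreal_neg)
    then show "(ennreal (g y) * indicator B y)\<^sup>2 \<le> ennreal ((g y)\<^sup>2) * indicator B y"
      by (auto split: split_indicator)
  qed
  also note le
  also have "ennreal (l\<^sup>2) * emeasure lborel B * emeasure lborel B = (ennreal l * emeasure lborel B)\<^sup>2"
    using l by (simp add: power2_eq_square ennreal_mult mult_ac)
  finally show ?thesis by (simp add: mult_right_mono)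
qed

lemma ennreal_power2_le_imp_le: "a\<^sup>2 \<le> b\<^sup>2 \<Longrightarrow> a \<le> b" for a b :: ennreal
proof (cases a; cases b)
  fix x y :: real assume *: "a\<^sup>2 \<le> b\<^sup>2" "a = ennreal x" "0 \<le> x" "b = ennreal y" "0 \<le> y"
  then have "x\<^sup>2 \<le> y\<^sup>2" by (simp add: ennreal_power)
  then have "x \<le> y" using *(5) by (rule power2_le_imp_le)
  then show ?thesis using * by (simp add: ennreal_leI)
next
  fix y :: real assume "a\<^sup>2 \<le> b\<^sup>2" "a = top" "b = ennreal y" "0 \<le> y"
  then show ?thesis by (simp add: ennreal_power power2_eq_square top_unique ennreal_mult[symmetric])
qed simp_all

context A2_pair
begin

text \<open>Where \<open>K x y\<close> exceeds \<open>\<mu> * L\<close> its square is at most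
  \<open>(\<mu> * L) powr (2 - q)\<close> times its q-th power, as \<open>q > 2\<close>. So a large
  \<open>\<mu>\<close> makes the tail of the square small, uniformly in \<open>x\<close> and in the
  ball.\<close>

lemma K_tail:
  assumes \<tau>: "0 < \<tau>"
  shows "\<exists>\<mu>>0. \<forall>x z \<rho> L. 0 < \<rho> \<longrightarrow> 0 < L \<longrightarrow>
    (\<integral>\<^sup>+y\<in>ball z (2*\<rho>). ennreal ((K x y)\<^sup>2) \<partial>lborel) \<le> ennreal (L\<^sup>2) * emeasure lborel (ball z (2*\<rho>)) \<longrightarrow>
    (\<integral>\<^sup>+y\<in>ball z \<rho>. ennreal ((K x y)\<^sup>2) * indicator {y. \<mu> * L < K x y} y \<partial>lborel) \<le> ennreal (\<tau> * L\<^sup>2) * emeasure lborel (ball z (2*\<rho>))"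
proof -
  obtain q C where q: "q > 2" and C: "C > 0" and H: "\<And>x z \<rho> L. 0 < \<rho> \<Longrightarrow> 0 < L \<Longrightarrow>
    (\<integral>\<^sup>+y\<in>ball z (2*\<rho>). ennreal ((K x y)\<^sup>2) \<partial>lborel) \<le> ennreal (L\<^sup>2) * emeasure lborel (ball z (2*\<rho>)) \<Longrightarrow>
    (\<integral>\<^sup>+y\<in>ball z \<rho>. ennreal (K x y powr q) \<partial>lborel) \<le> ennreal (C * L powr q) * emeasure lborel (ball z (2*\<rho>))"
    using K_higher_integrability by blast
  \<comment> \<open>The solution of \<open>C * \<mu> powr (2 - q) = \<tau>\<close>.\<close>
  define \<mu> where "\<mu> = (C / \<tau>) powr (1 / (q - 2))"
  have \<mu>: "0 < \<mu>" using C \<tau> by (simp add: \<mu>_def)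
  have "\<mu> powr (2 - q) = (C / \<tau>) powr (- 1)"
    unfolding \<mu>_def powr_powr using q by (intro arg_cong2[where f="(powr)"]) (auto simp: field_simps)
  then have \<mu>q: "C * \<mu> powr (2 - q) = \<tau>" using C \<tau> by (simp add: powr_minus)
  show ?thesis
  proof (intro exI[of _ \<mu>] conjI allI impI)
    fix x z \<rho> L
    assume \<rho>: "0 < \<rho>" and L: "0 < L" and le: "(\<integral>\<^sup>+y\<in>ball z (2*\<rho>). ennreal ((K x y)\<^sup>2) \<partial>lborel) \<le> ennreal (L\<^sup>2) * emeasure lborel (ball z (2*\<rho>))"
    have "(\<integral>\<^sup>+y\<in>ball z \<rho>. ennreal ((K x y)\<^sup>2) * indicator {y. \<mu> * L < K x y} y \<partial>lborel)
      \<le> (\<integral>\<^sup>+y\<in>ball z \<rho>. ennreal ((\<mu> * L) powr (2 - q)) * ennreal (K x y powr q) \<partial>lborel)"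
    proof (rule nn_set_integral_mono)
      fix y
      have "(K x y)\<^sup>2 \<le> (\<mu> * L) powr (2 - q) * K x y powr q" if "\<mu> * L < K x y"
      proof -
        have pos: "0 < \<mu> * L" "0 < K x y" using \<mu> L that by (auto intro: less_trans[OF _ that])
        have "(K x y)\<^sup>2 = K x y powr (2 - q) * K x y powr q" using pos by (simp add: powr_add[symmetric])
        also have "\<dots> \<le> (\<mu> * L) powr (2 - q) * K x y powr q"
          using pos that q by (intro mult_right_mono powr_mono2') auto
        finally show ?thesis .
      qed
      then show "ennreal ((K x y)\<^sup>2) * indicator {y. \<mu> * L < K x y} y \<le> ennreal ((\<mu> * L) powr (2 - q)) * ennreal (K x y powr q)"
        by (auto simp: ennreal_mult[symmetric] ennreal_leI split: split_indicator)
    qed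
    also have "\<dots> = ennreal ((\<mu> * L) powr (2 - q)) * (\<integral>\<^sup>+y\<in>ball z \<rho>. ennreal (K x y powr q) \<partial>lborel)"
      by (rule nn_set_integral_cmult) measurable
    also have "\<dots> \<le> ennreal ((\<mu> * L) powr (2 - q)) * (ennreal (C * L powr q) * emeasure lborel (ball z (2*\<rho>)))"
      by (intro mult_left_mono H[OF \<rho> L le]) auto
    also have "\<dots> = ennreal (\<tau> * L\<^sup>2) * emeasure lborel (ball z (2*\<rho>))"
    proof -
      have "(\<mu> * L) powr (2 - q) * (C * L powr q) = (C * \<mu> powr (2 - q)) * (L powr (2 - q) * L powr q)"
        using \<mu> L by (simp add: powr_mult)
      also have "L powr (2 - q) * L powr q = L\<^sup>2" using L by (simp add: powr_add[symmetric])
      finally have eq: "(\<mu> * L) powr (2 - q) * (C * L powr q) = \<tau> * L\<^sup>2" unfolding \<mu>q .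
      have "ennreal ((\<mu> * L) powr (2 - q)) * ennreal (C * L powr q) = ennreal (\<tau> * L\<^sup>2)"
        unfolding eq[symmetric] using C by (intro ennreal_mult[symmetric]) auto
      then show ?thesis by (simp only: mult.assoc[symmetric])
    qed
    finally show "(\<integral>\<^sup>+y\<in>ball z \<rho>. ennreal ((K x y)\<^sup>2) * indicator {y. \<mu> * L < K x y} y \<partial>lborel) \<le> ennreal (\<tau> * L\<^sup>2) * emeasure lborel (ball z (2*\<rho>))" .
  qed (rule \<mu>)
qed

text \<open>Split \<open>K x\<close> at \<open>\<mu>\<close> times its quadratic mean over the
  doubled ball. Above the threshold Cauchy-Schwarz meets the small tail and yields the
  \<open>\<tau>\<close> term; below it the kernel is replaced by the threshold and only the integral
  of \<open>g\<close> remains.\<close>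

lemma K_integral_square_pointwise:
  assumes \<tau>: "0 < \<tau>"
  shows "\<exists>\<mu>>0. \<forall>x z \<rho> g l. 0 < \<rho> \<longrightarrow> 0 < l \<longrightarrow> g \<in> borel_measurable borel \<longrightarrow> (\<forall>y. 0 \<le> g y) \<longrightarrow>
    (\<integral>\<^sup>+y\<in>ball z \<rho>. ennreal ((g y)\<^sup>2) \<partial>lborel) \<le> ennreal (l\<^sup>2) * emeasure lborel (ball z \<rho>) \<longrightarrow>
    (\<integral>\<^sup>+y\<in>ball z \<rho>. ennreal (K x y * g y) \<partial>lborel)\<^sup>2 \<le> (\<integral>\<^sup>+y\<in>ball z (2*\<rho>). ennreal ((K x y)\<^sup>2) \<partial>lborel) *
      (ennreal (\<tau> * l\<^sup>2) * emeasure lborel (ball z \<rho>) + ennreal (\<mu> * l) * (\<integral>\<^sup>+y\<in>ball z \<rho>. ennreal (g y) \<partial>lborel))"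
proof -
  \<comment> \<open>Half of \<open>\<tau>\<close>, because the square of a sum of two terms costs a
    factor 2.\<close>
  obtain \<mu> where \<mu>: "\<mu> > 0" and tail: "\<And>x z \<rho> L. 0 < \<rho> \<Longrightarrow> 0 < L \<Longrightarrow>
    (\<integral>\<^sup>+y\<in>ball z (2*\<rho>). ennreal ((K x y)\<^sup>2) \<partial>lborel) \<le> ennreal (L\<^sup>2) * emeasure lborel (ball z (2*\<rho>)) \<Longrightarrow>
    (\<integral>\<^sup>+y\<in>ball z \<rho>. ennreal ((K x y)\<^sup>2) * indicator {y. \<mu> * L < K x y} y \<partial>lborel) \<le> ennreal (\<tau>/2 * L\<^sup>2) * emeasure lborel (ball z (2*\<rho>))"
    using K_tail[of "\<tau>/2"] \<tau> by force
  show ?thesis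
  proof (intro exI[of _ "2 * \<mu>\<^sup>2"] conjI allI impI)
    fix x z \<rho> l and g :: "'a \<Rightarrow> real"
    assume \<rho>: "0 < \<rho>" and l: "0 < l" and [measurable]: "g \<in> borel_measurable borel" and g0: "\<forall>y. 0 \<le> g y"
      and le: "(\<integral>\<^sup>+y\<in>ball z \<rho>. ennreal ((g y)\<^sup>2) \<partial>lborel) \<le> ennreal (l\<^sup>2) * emeasure lborel (ball z \<rho>)"
    let ?B = "ball z \<rho>" and ?a = "\<integral>\<^sup>+y\<in>ball z (2*\<rho>). ennreal ((K x y)\<^sup>2) \<partial>lborel"
    let ?I = "\<integral>\<^sup>+y\<in>?B. ennreal (g y) \<partial>lborel" and ?J = "\<integral>\<^sup>+y\<in>?B. ennreal (K x y * g y) \<partial>lborel"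
    obtain V where V: "emeasure lborel ?B = ennreal V" "V > 0" using \<rho> by (simp add: emeasure_ball)
    define V2 where "V2 = 2^DIM('a) * V"
    have V2: "emeasure lborel (ball z (2*\<rho>)) = ennreal V2" "V \<le> V2" "0 < V2"
      unfolding V2_def using \<rho> V by (auto simp: emeasure_ball_mult ennreal_mult[symmetric])
    show "?J\<^sup>2 \<le> ?a * (ennreal (\<tau> * l\<^sup>2) * emeasure lborel ?B + ennreal (2 * \<mu>\<^sup>2 * l) * ?I)"
    proof (cases ?a)
      \<comment> \<open>The right side is infinite as well, since its \<open>\<tau>\<close> term is
        positive.\<close>
      case top
      have "ennreal (\<tau> * l\<^sup>2) \<noteq> 0" "emeasure lborel ?B \<noteq> 0" using V \<tau> l by auto
      then have "?a * (ennreal (\<tau> * l\<^sup>2) * emeasure lborel ?B + ennreal (2 * \<mu>\<^sup>2 * l) * ?I) = top"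
        unfolding top by (simp add: ennreal_top_mult)
      then show ?thesis by simp
    next
      case (real r)
      show ?thesis
      proof (cases "r = 0")
        case True
        have "AE y in lborel. ennreal ((K x y)\<^sup>2) * indicator (ball z (2*\<rho>)) y = 0"
          using real True by (subst nn_integral_0_iff_AE[symmetric]) auto
        then have "AE y in lborel. ennreal (K x y * g y) * indicator ?B y = 0"
        proof (rule AE_mp, intro AE_I2 impI)
          fix y assume y: "ennreal ((K x y)\<^sup>2) * indicator (ball z (2*\<rho>)) y = 0"
          show "ennreal (K x y * g y) * indicator ?B y = 0"
          proof (cases "y \<in> ?B")
            case True
            then have "y \<in> ball z (2*\<rho>)" using \<rho> by auto
            then have "K x y = 0" using y by simp
            then show ?thesis by simp
          qed simp
        qed
        then have "?J = (\<integral>\<^sup>+y. 0 \<partial>(lborel :: 'a measure))" by (rule nn_integral_cong_AE)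
        then have "?J = 0" by simp
        then show ?thesis by simp
      next
        case False
        \<comment> \<open>The quadratic mean of \<open>K x\<close> over the doubled ball. It has to
          be positive to serve as a threshold; for \<open>r = 0\<close> the kernel vanishes almost
          everywhere on the ball.\<close>
        define L where "L = sqrt (r / V2)"
        have L: "0 < L" "L\<^sup>2 * V2 = r" using False real V2 by (auto simp: L_def)
        have T: "(\<integral>\<^sup>+y\<in>?B. ennreal ((K x y)\<^sup>2) * indicator {y. \<mu> * L < K x y} y \<partial>lborel) \<le> ennreal (\<tau>/2 * r)"
        proof -
          have "?a \<le> ennreal (L\<^sup>2) * emeasure lborel (ball z (2*\<rho>))" using real L V2 by (simp add: ennreal_mult[symmetric])
          note tail[OF \<rho> L(1) this]
          also have "ennreal (\<tau>/2 * L\<^sup>2) * emeasure lborel (ball z (2*\<rho>)) = ennreal (\<tau>/2 * L\<^sup>2 * V2)"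
            unfolding V2(1) using \<tau> V2(3) by (intro ennreal_mult[symmetric]) auto
          also have "\<tau>/2 * L\<^sup>2 * V2 = \<tau>/2 * r" using L(2) by (simp add: mult.assoc)
          finally show ?thesis .
        qed
        let ?A1 = "\<integral>\<^sup>+y. (ennreal (K x y) * indicator {y. \<mu> * L < K x y} y * indicator ?B y) * (ennreal (g y) * indicator ?B y) \<partial>lborel"
        have "?J \<le> (\<integral>\<^sup>+y. (ennreal (K x y) * indicator {y. \<mu> * L < K x y} y * indicator ?B y) * (ennreal (g y) * indicator ?B y)
            + ennreal (\<mu> * L) * (ennreal (g y) * indicator ?B y) \<partial>lborel)"
        proof (intro nn_integral_mono)
          fix y
          show "ennreal (K x y * g y) * indicator ?B y \<le> (ennreal (K x y) * indicator {y. \<mu> * L < K x y} y * indicator ?B y) * (ennreal (g y) * indicator ?B y)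
            + ennreal (\<mu> * L) * (ennreal (g y) * indicator ?B y)"
          proof (cases "\<mu> * L < K x y")
            case True
            then show ?thesis using g0 K_nonneg[of x y] by (auto simp: ennreal_mult add_increasing2 split: split_indicator)
          next
            case False
            then have "K x y * g y \<le> \<mu> * L * g y" using g0 by (intro mult_right_mono) auto
            then show ?thesis using g0 \<mu> L False by (auto simp: ennreal_mult[symmetric] ennreal_leI split: split_indicator)
          qed
        qed
        also have "\<dots> = ?A1 + (\<integral>\<^sup>+y. ennreal (\<mu> * L) * (ennreal (g y) * indicator ?B y) \<partial>lborel)"
          by (rule nn_integral_add) measurable
        also have "(\<integral>\<^sup>+y. ennreal (\<mu> * L) * (ennreal (g y) * indicator ?B y) \<partial>lborel) = ennreal (\<mu> * L) * ?I"
          by (rule nn_integral_cmult) measurable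
        finally have "?J\<^sup>2 \<le> (?A1 + ennreal (\<mu> * L) * ?I)\<^sup>2" by (intro power_mono) auto
        also have "\<dots> \<le> 2 * ?A1\<^sup>2 + 2 * (ennreal (\<mu> * L) * ?I)\<^sup>2" by (rule ennreal_add_square_le)
        also have "\<dots> \<le> 2 * (ennreal (\<tau>/2 * r) * (ennreal (l\<^sup>2) * ennreal V)) + 2 * (ennreal (\<mu>\<^sup>2 * l * r) * ?I)"
        proof (intro add_mono mult_left_mono)
          have "?A1\<^sup>2 \<le> (\<integral>\<^sup>+y. (ennreal (K x y) * indicator {y. \<mu> * L < K x y} y * indicator ?B y)\<^sup>2 \<partial>lborel) * (\<integral>\<^sup>+y. (ennreal (g y) * indicator ?B y)\<^sup>2 \<partial>lborel)"
            by (rule Cauchy_Schwarz_nn_integral) measurable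
          also have "(\<integral>\<^sup>+y. (ennreal (K x y) * indicator {y. \<mu> * L < K x y} y * indicator ?B y)\<^sup>2 \<partial>lborel) =
            (\<integral>\<^sup>+y\<in>?B. ennreal ((K x y)\<^sup>2) * indicator {y. \<mu> * L < K x y} y \<partial>lborel)"
            using K_nonneg by (intro nn_integral_cong) (auto simp: ennreal_power split: split_indicator)
          also have "(\<integral>\<^sup>+y. (ennreal (g y) * indicator ?B y)\<^sup>2 \<partial>lborel) = (\<integral>\<^sup>+y\<in>?B. ennreal ((g y)\<^sup>2) \<partial>lborel)"
            using g0 by (intro nn_integral_cong) (auto simp: ennreal_power split: split_indicator)
          also have "(\<integral>\<^sup>+y\<in>?B. ennreal ((K x y)\<^sup>2) * indicator {y. \<mu> * L < K x y} y \<partial>lborel) * \<dots> \<le> ennreal (\<tau>/2 * r) * (ennreal (l\<^sup>2) * ennreal V)"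
            using le V by (intro mult_mono T) auto
          finally show "?A1\<^sup>2 \<le> ennreal (\<tau>/2 * r) * (ennreal (l\<^sup>2) * ennreal V)" .
          \<comment> \<open>One of the two factors in the square of \<open>?I\<close> is bounded by
            \<open>l * V\<close>, which leaves a term linear in the integral of
            \<open>g\<close>.\<close>
          have I: "?I \<le> ennreal (l * V)"
            using ennreal_power2_le_imp_le[OF nn_integral_le_sqrt[OF _ _ l le]] V l by (simp add: ennreal_mult)
          have "(ennreal (\<mu> * L) * ?I)\<^sup>2 = ennreal (\<mu>\<^sup>2 * L\<^sup>2) * (?I * ?I)"
            using \<mu> L by (simp add: power2_eq_square ennreal_mult mult_ac)
          also have "\<dots> \<le> ennreal (\<mu>\<^sup>2 * L\<^sup>2) * (ennreal (l * V) * ?I)"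
            by (intro mult_left_mono mult_right_mono I) auto
          also have "\<dots> = ennreal (\<mu>\<^sup>2 * L\<^sup>2 * (l * V)) * ?I"
            using l V by (simp add: ennreal_mult mult.assoc)
          also have "\<dots> \<le> ennreal (\<mu>\<^sup>2 * l * r) * ?I"
          proof (intro mult_right_mono ennreal_leI)
            have "\<mu>\<^sup>2 * L\<^sup>2 * (l * V) = \<mu>\<^sup>2 * l * (L\<^sup>2 * V)" by (simp add: mult_ac)
            also have "\<dots> \<le> \<mu>\<^sup>2 * l * (L\<^sup>2 * V2)" using l V2 by (intro mult_left_mono) auto
            finally show "\<mu>\<^sup>2 * L\<^sup>2 * (l * V) \<le> \<mu>\<^sup>2 * l * r" using L by simp
          qed auto
          finally show "(ennreal (\<mu> * L) * ?I)\<^sup>2 \<le> ennreal (\<mu>\<^sup>2 * l * r) * ?I" .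
        qed auto
        also have "\<dots> = ennreal r * (ennreal (\<tau> * l\<^sup>2) * ennreal V + ennreal (2 * \<mu>\<^sup>2 * l) * ?I)"
        proof -
          have "2 * (ennreal (\<tau>/2 * r) * (ennreal (l\<^sup>2) * ennreal V)) = ennreal (2 * (\<tau>/2 * r * (l\<^sup>2 * V)))"
          proof -
            have "ennreal (\<tau>/2 * r) * (ennreal (l\<^sup>2) * ennreal V) = ennreal (\<tau>/2 * r * (l\<^sup>2 * V))"
              using \<tau> real(1) V(2) by (simp add: ennreal_mult del: times_divide_eq_left times_divide_eq_right)
            then show ?thesis by (simp only: ennreal_mult'[of 2] ennreal_numeral zero_le_numeral)
          qed
          moreover have "2 * (ennreal (\<mu>\<^sup>2 * l * r) * ?I) = ennreal (2 * (\<mu>\<^sup>2 * l * r)) * ?I"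
            by (simp only: ennreal_mult'[of 2] ennreal_numeral zero_le_numeral mult.assoc)
          moreover have "ennreal r * (ennreal (\<tau> * l\<^sup>2) * ennreal V) = ennreal (r * (\<tau> * l\<^sup>2 * V))"
            using \<tau> real V by (simp add: ennreal_mult[symmetric])
          moreover have "ennreal r * (ennreal (2 * \<mu>\<^sup>2 * l) * ?I) = ennreal (r * (2 * \<mu>\<^sup>2 * l)) * ?I"
            using l real by (simp add: ennreal_mult mult.assoc)
          ultimately show ?thesis by (simp only: distrib_left) (simp add: mult_ac)
        qed
        finally show ?thesis using real V by simp
      qed
    qed
  qed (use \<mu> in auto)
qed

text \<open>Integrates the pointwise bound over \<open>x\<close>. The A_2 condition on the doubled
  ball contributes \<open>CA * 4^DIM('a)\<close> times the squared volume of
  \<open>ball z \<rho>\<close>, so the pointwise bound is used with \<open>\<tau>\<close> divided by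
  that constant.\<close>

lemma K_integral_square:
  assumes \<tau>: "0 < \<tau>"
  shows "\<exists>\<mu>>0. \<forall>z \<rho> g l. 0 < \<rho> \<longrightarrow> 0 < l \<longrightarrow> g \<in> borel_measurable borel \<longrightarrow> (\<forall>y. 0 \<le> g y) \<longrightarrow>
    (\<integral>\<^sup>+y\<in>ball z \<rho>. ennreal ((g y)\<^sup>2) \<partial>lborel) \<le> ennreal (l\<^sup>2) * emeasure lborel (ball z \<rho>) \<longrightarrow>
    (\<integral>\<^sup>+x\<in>ball z \<rho>. (\<integral>\<^sup>+y\<in>ball z \<rho>. ennreal (K x y * g y) \<partial>lborel)\<^sup>2 \<partial>lborel) \<le> (emeasure lborel (ball z \<rho>))\<^sup>2 *
      (ennreal (\<tau> * l\<^sup>2) * emeasure lborel (ball z \<rho>) + ennreal (\<mu> * l) * (\<integral>\<^sup>+y\<in>ball z \<rho>. ennreal (g y) \<partial>lborel))"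
proof -
  let ?c = "CA * 4^DIM('a)"
  have c: "0 < ?c" using CA by simp
  obtain \<mu> where \<mu>: "\<mu> > 0" and pt: "\<And>x z \<rho> g l. 0 < \<rho> \<Longrightarrow> 0 < l \<Longrightarrow> g \<in> borel_measurable borel \<Longrightarrow> (\<forall>y. 0 \<le> g y) \<Longrightarrow>
    (\<integral>\<^sup>+y\<in>ball z \<rho>. ennreal ((g y)\<^sup>2) \<partial>lborel) \<le> ennreal (l\<^sup>2) * emeasure lborel (ball z \<rho>) \<Longrightarrow>
    (\<integral>\<^sup>+y\<in>ball z \<rho>. ennreal (K x y * g y) \<partial>lborel)\<^sup>2 \<le> (\<integral>\<^sup>+y\<in>ball z (2*\<rho>). ennreal ((K x y)\<^sup>2) \<partial>lborel) *
      (ennreal (\<tau> / ?c * l\<^sup>2) * emeasure lborel (ball z \<rho>) + ennreal (\<mu> * l) * (\<integral>\<^sup>+y\<in>ball z \<rho>. ennreal (g y) \<partial>lborel))"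
    using K_integral_square_pointwise[OF divide_pos_pos[OF \<tau> c]] by blast
  show ?thesis
  proof (intro exI[of _ "?c * \<mu>"] conjI allI impI)
    fix z \<rho> l and g :: "'a \<Rightarrow> real"
    assume \<rho>: "0 < \<rho>" and l: "0 < l" and g: "g \<in> borel_measurable borel" and g0: "\<forall>y. 0 \<le> g y"
      and le: "(\<integral>\<^sup>+y\<in>ball z \<rho>. ennreal ((g y)\<^sup>2) \<partial>lborel) \<le> ennreal (l\<^sup>2) * emeasure lborel (ball z \<rho>)"
    let ?B = "ball z \<rho>" and ?a = "\<lambda>x. \<integral>\<^sup>+y\<in>ball z (2*\<rho>). ennreal ((K x y)\<^sup>2) \<partial>lborel"
    let ?I = "\<integral>\<^sup>+y\<in>?B. ennreal (g y) \<partial>lborel"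
    obtain V where V: "emeasure lborel ?B = ennreal V" "V > 0" using \<rho> by (simp add: emeasure_ball)
    have V2: "emeasure lborel (ball z (2*\<rho>)) = ennreal (2^DIM('a) * V)"
      using \<rho> V by (auto simp: emeasure_ball_mult ennreal_mult[symmetric])
    let ?R = "ennreal (\<tau> / ?c * l\<^sup>2) * emeasure lborel ?B + ennreal (\<mu> * l) * ?I"
    have "(\<integral>\<^sup>+x\<in>?B. (\<integral>\<^sup>+y\<in>?B. ennreal (K x y * g y) \<partial>lborel)\<^sup>2 \<partial>lborel) \<le> (\<integral>\<^sup>+x\<in>?B. ?R * ?a x \<partial>lborel)"
      using pt[OF \<rho> l g g0 le] by (intro nn_set_integral_mono) (simp add: mult.commute)
    also have "\<dots> = ?R * (\<integral>\<^sup>+x\<in>?B. ?a x \<partial>lborel)" by (rule nn_set_integral_cmult) auto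
    also have "\<dots> \<le> ?R * (\<integral>\<^sup>+x\<in>ball z (2*\<rho>). ?a x \<partial>lborel)"
      using \<rho> by (intro mult_left_mono nn_set_integral_mono_set subset_ball) auto
    also have "\<dots> \<le> ?R * (ennreal CA * (emeasure lborel (ball z (2*\<rho>)))\<^sup>2)"
      using \<rho> by (intro mult_left_mono K_A2) auto
    also have "\<dots> = (emeasure lborel ?B)\<^sup>2 * (ennreal ?c * ?R)"
    proof -
      have "ennreal CA * (emeasure lborel (ball z (2*\<rho>)))\<^sup>2 = ennreal (CA * (2^DIM('a) * V)\<^sup>2)"
      proof -
        have "0 \<le> 2^DIM('a) * V" using V by simp
        then show ?thesis unfolding V2 using CA by (simp only: ennreal_power ennreal_mult[symmetric] less_imp_le zero_le_power2)
      qed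
      also have "CA * (2^DIM('a) * V)\<^sup>2 = ?c * V\<^sup>2"
      proof -
        have "((2::real)^DIM('a))\<^sup>2 = (2\<^sup>2)^DIM('a)" by (simp only: power_mult[symmetric] mult.commute)
        then show ?thesis by (simp add: power_mult_distrib)
      qed
      also have "ennreal (?c * V\<^sup>2) = ennreal ?c * (emeasure lborel ?B)\<^sup>2"
        using V CA by (simp add: ennreal_power ennreal_mult)
      finally show ?thesis by (simp add: mult_ac)
    qed
    also have "ennreal ?c * ?R = ennreal (\<tau> * l\<^sup>2) * emeasure lborel ?B + ennreal (?c * \<mu> * l) * ?I"
    proof -
      have "ennreal ?c * ennreal (\<tau> / ?c * l\<^sup>2) = ennreal (\<tau> * l\<^sup>2)" using c \<tau> by (subst ennreal_mult[symmetric]) auto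
      moreover have "ennreal ?c * ennreal (\<mu> * l) = ennreal (?c * \<mu> * l)" using c \<mu> l by (subst ennreal_mult[symmetric]) (auto simp: mult.assoc)
      ultimately show ?thesis by (simp only: distrib_left mult.assoc[symmetric])
    qed
    finally show "(\<integral>\<^sup>+x\<in>?B. (\<integral>\<^sup>+y\<in>?B. ennreal (K x y * g y) \<partial>lborel)\<^sup>2 \<partial>lborel) \<le> (emeasure lborel ?B)\<^sup>2 *
      (ennreal (\<tau> * l\<^sup>2) * emeasure lborel ?B + ennreal (?c * \<mu> * l) * ?I)" .
  qed (use c \<mu> in auto)
qed

end

section \<open>Averaging operators and the kernel form of the Poincare inequality\<close>

context A2_pair
begin

text \<open>Cauchy-Schwarz on the ball around \<open>x\<close> separates the square of the kernel
  from the square of \<open>g\<close>. After exchanging the integrals only points \<open>x\<close>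
  within \<open>s\<close> of \<open>w\<close> contribute for fixed \<open>w\<close>, and their balls
  lie in \<open>ball w (2 * s)\<close>, where the A_2 condition applies. The bound scales like the
  squared volume, which later cancels a Jacobian.\<close>

lemma K_averaging_bound:
  fixes g :: "'a \<Rightarrow> real"
  assumes g[measurable]: "g \<in> borel_measurable borel" and g0: "\<And>y. 0 \<le> g y" and s: "0 < s"
    and B[measurable]: "B \<in> sets borel"
  shows "(\<integral>\<^sup>+x. (\<integral>\<^sup>+y\<in>ball x s. ennreal (K x y * g y) * indicator B y \<partial>lborel)\<^sup>2 \<partial>lborel)
    \<le> ennreal CA * (emeasure lborel (ball (0::'a) (2 * s)))\<^sup>2 * (\<integral>\<^sup>+y\<in>B. ennreal ((g y)\<^sup>2) \<partial>lborel)"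
proof -
  define d where "d x y = (if dist x y < s then 1 else 0 :: ennreal)" for x y :: 'a
  have dm[measurable (raw)]: "(\<lambda>x. d (f x) (k x)) \<in> borel_measurable M"
    if [measurable]: "f \<in> borel_measurable M" "k \<in> borel_measurable M" for f k and M :: "'b measure"
    unfolding d_def by measurable
  have ind: "indicator (ball x s) y = d x y" for x y by (simp add: d_def indicator_def)
  define A where "A x = (\<integral>\<^sup>+y. ennreal ((K x y)\<^sup>2) * d x y \<partial>lborel)" for x
  have Am[measurable]: "A \<in> borel_measurable borel"
  proof -
    have "A \<in> borel_measurable lborel" unfolding A_def by measurable
    then show ?thesis by simp
  qed
  let ?g = "\<lambda>y. ennreal ((g y)\<^sup>2) * indicator B y"
  have "(\<integral>\<^sup>+x. (\<integral>\<^sup>+y\<in>ball x s. ennreal (K x y * g y) * indicator B y \<partial>lborel)\<^sup>2 \<partial>lborel)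
    \<le> (\<integral>\<^sup>+x. A x * (\<integral>\<^sup>+w. ?g w * d x w \<partial>lborel) \<partial>lborel)"
  proof (intro nn_integral_mono)
    fix x
    have "(\<integral>\<^sup>+y\<in>ball x s. ennreal (K x y * g y) * indicator B y \<partial>lborel) =
       (\<integral>\<^sup>+y. (ennreal (K x y) * d x y) * (ennreal (g y) * indicator B y * d x y) \<partial>lborel)"
      unfolding ind using K_nonneg g0 by (intro nn_integral_cong) (simp add: d_def ennreal_mult mult_ac)
    also have "\<dots>\<^sup>2 \<le> (\<integral>\<^sup>+y. (ennreal (K x y) * d x y)\<^sup>2 \<partial>lborel) * (\<integral>\<^sup>+y. (ennreal (g y) * indicator B y * d x y)\<^sup>2 \<partial>lborel)"
      by (rule Cauchy_Schwarz_nn_integral) measurable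
    also have "(\<integral>\<^sup>+y. (ennreal (K x y) * d x y)\<^sup>2 \<partial>lborel) = A x"
      unfolding A_def using K_nonneg by (intro nn_integral_cong) (simp add: d_def ennreal_power power_mult_distrib)
    also have "(\<integral>\<^sup>+y. (ennreal (g y) * indicator B y * d x y)\<^sup>2 \<partial>lborel) = (\<integral>\<^sup>+w. ?g w * d x w \<partial>lborel)"
      using g0 by (intro nn_integral_cong) (auto simp: d_def ennreal_power power_mult_distrib split: split_indicator)
    finally show "(\<integral>\<^sup>+y\<in>ball x s. ennreal (K x y * g y) * indicator B y \<partial>lborel)\<^sup>2 \<le> A x * (\<integral>\<^sup>+w. ?g w * d x w \<partial>lborel)" .
  qed
  also have "\<dots> = (\<integral>\<^sup>+x. (\<integral>\<^sup>+w. A x * (?g w * d x w) \<partial>lborel) \<partial>lborel)"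
    by (intro nn_integral_cong nn_integral_cmult[symmetric]) measurable
  also have "\<dots> = (\<integral>\<^sup>+w. (\<integral>\<^sup>+x. A x * (?g w * d x w) \<partial>lborel) \<partial>lborel)"
    by (rule lborel_pair.Fubini') measurable
  also have "\<dots> \<le> (\<integral>\<^sup>+w. (ennreal CA * (emeasure lborel (ball (0::'a) (2 * s)))\<^sup>2) * ?g w \<partial>lborel)"
  proof (intro nn_integral_mono)
    fix w :: 'a
    have "(\<integral>\<^sup>+x. A x * (?g w * d x w) \<partial>lborel) = (\<integral>\<^sup>+x. ?g w * (A x * d x w) \<partial>lborel)"
      by (simp add: mult_ac)
    also have "\<dots> = ?g w * (\<integral>\<^sup>+x. A x * d x w \<partial>lborel)" by (rule nn_integral_cmult) measurable
    finally have 1: "(\<integral>\<^sup>+x. A x * (?g w * d x w) \<partial>lborel) = ?g w * (\<integral>\<^sup>+x. A x * d x w \<partial>lborel)" .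
    have "(\<integral>\<^sup>+x. A x * d x w \<partial>lborel) \<le> (\<integral>\<^sup>+x\<in>ball w (2 * s). (\<integral>\<^sup>+y\<in>ball w (2 * s). ennreal ((K x y)\<^sup>2) \<partial>lborel) \<partial>lborel)"
    proof (intro nn_integral_mono)
      fix x
      show "A x * d x w \<le> (\<integral>\<^sup>+y\<in>ball w (2 * s). ennreal ((K x y)\<^sup>2) \<partial>lborel) * indicator (ball w (2 * s)) x"
      proof (cases "dist x w < s")
        case True
        have "A x \<le> (\<integral>\<^sup>+y\<in>ball w (2 * s). ennreal ((K x y)\<^sup>2) \<partial>lborel)"
          unfolding A_def
        proof (intro nn_integral_mono)
          fix y
          have "dist w y < 2 * s" if "dist x y < s"
            using dist_triangle[of w y x] True that by (simp add: dist_commute)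
          then show "ennreal ((K x y)\<^sup>2) * d x y \<le> ennreal ((K x y)\<^sup>2) * indicator (ball w (2 * s)) y"
            by (auto simp: d_def)
        qed
        moreover have "x \<in> ball w (2 * s)" using True s by (simp add: dist_commute)
        ultimately show ?thesis using True by (simp add: d_def)
      qed (simp add: d_def)
    qed
    also have "\<dots> \<le> ennreal CA * (emeasure lborel (ball w (2 * s)))\<^sup>2" using s by (intro K_A2) simp
    also have "emeasure lborel (ball w (2 * s)) = emeasure lborel (ball (0::'a) (2 * s))" using s by (simp add: emeasure_ball)
    finally have "?g w * (\<integral>\<^sup>+x. A x * d x w \<partial>lborel) \<le> ?g w * (ennreal CA * (emeasure lborel (ball (0::'a) (2 * s)))\<^sup>2)"
      by (intro mult_left_mono) auto
    then show "(\<integral>\<^sup>+x. A x * (?g w * d x w) \<partial>lborel) \<le> (ennreal CA * (emeasure lborel (ball (0::'a) (2 * s)))\<^sup>2) * ?g w"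
      unfolding 1 by (simp only: mult.commute)
  qed
  also have "\<dots> = ennreal CA * (emeasure lborel (ball (0::'a) (2 * s)))\<^sup>2 * (\<integral>\<^sup>+y\<in>B. ennreal ((g y)\<^sup>2) \<partial>lborel)"
    by (rule nn_integral_cmult) measurable
  finally show ?thesis .
qed

text \<open>For \<open>t \<le> \<delta>\<close> the averages over \<open>x + t (B - x)\<close> are bounded on \<open>L\<^sup>2\<close> uniformly in \<open>t\<close>, which costs a small
  factor \<open>\<delta>\<^sup>2\<close>; for \<open>t > \<delta>\<close> they are dominated by the average over all of \<open>B\<close>.\<close>

lemma kernel_Poincare:
  assumes \<theta>: "0 < \<theta>"
  shows "\<exists>\<mu>>0. \<forall>z \<rho> g l v. 0 < \<rho> \<longrightarrow> 0 < l \<longrightarrow> g \<in> borel_measurable borel \<longrightarrow> (\<forall>y. 0 \<le> g y) \<longrightarrow>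
    v \<in> borel_measurable borel \<longrightarrow> (\<forall>y. 0 \<le> v y) \<longrightarrow>
    (\<forall>x\<in>ball z \<rho>. ennreal (v x) * emeasure lborel (ball z \<rho>) \<le> ennreal (2 * \<rho>) *
       (\<integral>\<^sup>+t\<in>{0<..1}. (\<integral>\<^sup>+y\<in>ball z \<rho>. ennreal (K x (x + t *\<^sub>R (y - x)) * g (x + t *\<^sub>R (y - x))) \<partial>lborel) \<partial>lborel)) \<longrightarrow>
    (\<integral>\<^sup>+y\<in>ball z \<rho>. ennreal ((g y)\<^sup>2) \<partial>lborel) \<le> ennreal (l\<^sup>2) * emeasure lborel (ball z \<rho>) \<longrightarrow>
    (\<integral>\<^sup>+x\<in>ball z \<rho>. ennreal ((v x)\<^sup>2) \<partial>lborel) \<le> ennreal (\<rho>\<^sup>2) *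
      (ennreal (\<theta> * l\<^sup>2) * emeasure lborel (ball z \<rho>) + ennreal (\<mu> * l) * (\<integral>\<^sup>+y\<in>ball z \<rho>. ennreal (g y) \<partial>lborel))"
proof -
  let ?d = "DIM('a)"
  \<comment> \<open>16^d is the square of 4^d: at parameter \<open>t\<close> the A_2 condition is
    used on balls of radius \<open>4 * \<rho> * t\<close>, of volume 4^d t^d times that of
    \<open>ball z \<rho>\<close>, and t^d cancels the Jacobian.\<close>
  define c where "c = CA * 16^?d"
  have c: "0 < c" using CA by (simp add: c_def)
  define \<delta> where "\<delta> = min 1 (sqrt (\<theta> / (16 * c)))"
  have \<delta>: "0 < \<delta>" "\<delta> \<le> 1" using \<theta> c by (auto simp: \<delta>_def)
  have "\<delta>\<^sup>2 \<le> (sqrt (\<theta> / (16 * c)))\<^sup>2" using \<delta> by (intro power_mono) (auto simp: \<delta>_def)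
  also have "\<dots> = \<theta> / (16 * c)" using \<theta> c by simp
  finally have \<delta>c: "8 * (\<delta>\<^sup>2 * c) \<le> \<theta> / 2" using c by (simp add: field_simps)
  \<comment> \<open>Bounds the Jacobian for \<open>t > \<delta>\<close>. The parameter
    \<open>\<theta> / (16 * e\<^sup>2)\<close> below is chosen against the factor
    \<open>8 * e\<^sup>2\<close> of the final sum and yields one half of \<open>\<theta>\<close>;
    the choice of \<open>\<delta>\<close> yields the other.\<close>
  define e where "e = 1 / \<delta>^?d"
  have e: "0 < e" using \<delta> by (simp add: e_def)
  have "0 < \<theta> / (16 * e\<^sup>2)" using \<theta> e by simp
  then obtain \<mu> where \<mu>: "\<mu> > 0" and J: "\<And>z \<rho> g l. 0 < \<rho> \<Longrightarrow> 0 < l \<Longrightarrow> g \<in> borel_measurable borel \<Longrightarrow> (\<forall>y. 0 \<le> g y) \<Longrightarrow>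
    (\<integral>\<^sup>+y\<in>ball z \<rho>. ennreal ((g y)\<^sup>2) \<partial>lborel) \<le> ennreal (l\<^sup>2) * emeasure lborel (ball z \<rho>) \<Longrightarrow>
    (\<integral>\<^sup>+x\<in>ball z \<rho>. (\<integral>\<^sup>+y\<in>ball z \<rho>. ennreal (K x y * g y) \<partial>lborel)\<^sup>2 \<partial>lborel) \<le> (emeasure lborel (ball z \<rho>))\<^sup>2 *
      (ennreal (\<theta> / (16 * e\<^sup>2) * l\<^sup>2) * emeasure lborel (ball z \<rho>) + ennreal (\<mu> * l) * (\<integral>\<^sup>+y\<in>ball z \<rho>. ennreal (g y) \<partial>lborel))"
    using K_integral_square by blast
  have main: "(\<integral>\<^sup>+x\<in>ball z \<rho>. ennreal ((v x)\<^sup>2) \<partial>lborel) \<le> ennreal (\<rho>\<^sup>2) *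
      (ennreal (\<theta> * l\<^sup>2) * emeasure lborel (ball z \<rho>) + ennreal (8 * e\<^sup>2 * \<mu> * l) * (\<integral>\<^sup>+y\<in>ball z \<rho>. ennreal (g y) \<partial>lborel))"
    if \<rho>: "0 < \<rho>" and l: "0 < l" and g[measurable]: "g \<in> borel_measurable borel" and g0: "\<forall>y. 0 \<le> g y"
      and v[measurable]: "v \<in> borel_measurable borel" and v0: "\<forall>y. 0 \<le> v y"
      and vle: "\<forall>x\<in>ball z \<rho>. ennreal (v x) * emeasure lborel (ball z \<rho>) \<le> ennreal (2 * \<rho>) *
       (\<integral>\<^sup>+t\<in>{0<..1}. (\<integral>\<^sup>+y\<in>ball z \<rho>. ennreal (K x (x + t *\<^sub>R (y - x)) * g (x + t *\<^sub>R (y - x))) \<partial>lborel) \<partial>lborel)"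
      and gle: "(\<integral>\<^sup>+y\<in>ball z \<rho>. ennreal ((g y)\<^sup>2) \<partial>lborel) \<le> ennreal (l\<^sup>2) * emeasure lborel (ball z \<rho>)"
    for z \<rho> g l v
  proof -
    let ?B = "ball z \<rho>"
    let ?I = "\<integral>\<^sup>+y\<in>?B. ennreal (g y) \<partial>lborel"
    obtain V where V: "emeasure lborel ?B = ennreal V" "V > 0" using \<rho> by (simp add: emeasure_ball)
    \<comment> \<open>The inner integral after the substitution
      \<open>w = x + t *\<^sub>R (y - x)\<close>: the point \<open>w\<close> stays in the ball by
      convexity and within \<open>2 * \<rho> * t\<close> of \<open>x\<close>.\<close>
    define Q where "Q t x = (\<integral>\<^sup>+w\<in>ball x (2*\<rho>*t). ennreal (K x w * g w) * indicator ?B w \<partial>lborel)" for t x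
    have Qm[measurable]: "(\<lambda>(t, x). Q t x) \<in> borel_measurable (borel \<Otimes>\<^sub>M borel)"
    proof -
      have eq: "Q t x = (\<integral>\<^sup>+w. ennreal (K x w * g w) * indicator ?B w * (if dist x w < 2*\<rho>*t then 1 else 0) \<partial>lborel)" for t x
        unfolding Q_def by (intro nn_integral_cong) (auto simp: indicator_def)
      have "(\<lambda>(t, x). Q t x) \<in> borel_measurable (lborel \<Otimes>\<^sub>M lborel)" unfolding eq by measurable
      then show ?thesis by (simp cong: measurable_cong_sets)
    qed
    have Qm2[measurable]: "(\<lambda>x. Q t x) \<in> borel_measurable borel" "(\<lambda>t. Q t x) \<in> borel_measurable borel" for t x
    proof -
      have 1: "(\<lambda>x::'a. (t, x)) \<in> borel \<rightarrow>\<^sub>M borel \<Otimes>\<^sub>M borel" and 2: "(\<lambda>t::real. (t, x)) \<in> borel \<rightarrow>\<^sub>M borel \<Otimes>\<^sub>M borel" by measurable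
      show "(\<lambda>x. Q t x) \<in> borel_measurable borel" using measurable_compose[OF 1 Qm] by simp
      show "(\<lambda>t. Q t x) \<in> borel_measurable borel" using measurable_compose[OF 2 Qm] by simp
    qed
    define G where "G x = (\<integral>\<^sup>+y\<in>?B. ennreal (K x y * g y) \<partial>lborel)" for x
    have Gm[measurable]: "G \<in> borel_measurable borel"
    proof -
      have "G \<in> borel_measurable lborel" unfolding G_def by measurable
      then show ?thesis by simp
    qed
    have QG: "Q t x \<le> G x" for t x unfolding Q_def G_def by (intro nn_integral_mono) (auto split: split_indicator)
    have chg: "(\<integral>\<^sup>+y\<in>?B. ennreal (K x (x + t *\<^sub>R (y - x)) * g (x + t *\<^sub>R (y - x))) \<partial>lborel) \<le> ennreal (1 / t^?d) * Q t x"
      if t: "0 < t" "t \<le> 1" and x: "x \<in> ?B" for t x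
    proof -
      have "(\<integral>\<^sup>+y\<in>?B. ennreal (K x (x + t *\<^sub>R (y - x)) * g (x + t *\<^sub>R (y - x))) \<partial>lborel)
        \<le> (\<integral>\<^sup>+y. (\<lambda>w. ennreal (K x w * g w) * indicator ?B w * indicator (ball x (2*\<rho>*t)) w) ((1 - t) *\<^sub>R x + t *\<^sub>R y) \<partial>lborel)"
      proof (intro nn_integral_mono)
        fix y
        have w: "x + t *\<^sub>R (y - x) = (1 - t) *\<^sub>R x + t *\<^sub>R y" by (simp add: algebra_simps)
        have "(1 - t) *\<^sub>R x + t *\<^sub>R y \<in> ?B" if "y \<in> ?B"
          using convex_ball[of z \<rho>] x that t unfolding convex_alt by auto
        moreover have "(1 - t) *\<^sub>R x + t *\<^sub>R y \<in> ball x (2*\<rho>*t)" if y: "y \<in> ?B"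
        proof -
          have "dist x y < 2 * \<rho>" using x y dist_triangle[of x y z] by (simp add: dist_commute)
          moreover have "dist x (x + t *\<^sub>R (y - x)) = t * dist x y" using t by (simp add: dist_norm norm_minus_commute)
          ultimately show ?thesis using t unfolding w[symmetric] by (simp add: mult.commute)
        qed
        ultimately show "ennreal (K x (x + t *\<^sub>R (y - x)) * g (x + t *\<^sub>R (y - x))) * indicator ?B y \<le>
          (\<lambda>w. ennreal (K x w * g w) * indicator ?B w * indicator (ball x (2*\<rho>*t)) w) ((1 - t) *\<^sub>R x + t *\<^sub>R y)"
          unfolding w by (cases "y \<in> ?B") simp_all
      qed
      also have "\<dots> = ennreal (1 / t^?d) * Q t x"
        unfolding Q_def by (rule nn_integral_affine) (use t in measurable)
      finally show ?thesis .
    qed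
    define X where "X x = (\<integral>\<^sup>+t\<in>{0<..\<delta>}. ennreal (1 / t^?d) * Q t x \<partial>lborel)" for x
    have Xm[measurable]: "X \<in> borel_measurable borel"
    proof -
      have "X \<in> borel_measurable lborel" unfolding X_def by measurable
      then show ?thesis by simp
    qed
    have pt: "ennreal (v x) * ennreal V \<le> ennreal (2 * \<rho>) * (X x + ennreal e * G x)" if x: "x \<in> ?B" for x
    proof -
      have "(\<integral>\<^sup>+t\<in>{0<..1}. (\<integral>\<^sup>+y\<in>?B. ennreal (K x (x + t *\<^sub>R (y - x)) * g (x + t *\<^sub>R (y - x))) \<partial>lborel) \<partial>lborel)
        \<le> (\<integral>\<^sup>+t. (ennreal (1 / t^?d) * Q t x) * indicator {0<..\<delta>} t + (ennreal e * G x) * indicator {\<delta><..1} t \<partial>lborel)"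
      proof (intro nn_integral_mono)
        fix t :: real
        consider "t \<in> {0<..\<delta>}" | "t \<in> {\<delta><..1}" | "t \<notin> {0<..1}" by fastforce
        then show "(\<integral>\<^sup>+y\<in>?B. ennreal (K x (x + t *\<^sub>R (y - x)) * g (x + t *\<^sub>R (y - x))) \<partial>lborel) * indicator {0<..1} t
          \<le> (ennreal (1 / t^?d) * Q t x) * indicator {0<..\<delta>} t + (ennreal e * G x) * indicator {\<delta><..1} t"
        proof cases
          case 1
          then show ?thesis using chg[of t x] x \<delta> by simp
        next
          case 2
          then have t: "0 < t" "t \<le> 1" "\<delta> \<le> t" using \<delta> by auto
          have "1 / t^?d \<le> e" unfolding e_def using t \<delta> by (intro divide_left_mono power_mono) auto
          then have "ennreal (1 / t^?d) * Q t x \<le> ennreal e * G x" by (intro mult_mono QG ennreal_leI) auto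
          then show ?thesis using chg[OF t(1,2) x] 2 t by (auto intro: order_trans)
        qed simp
      qed
      also have "\<dots> = X x + (\<integral>\<^sup>+t. (ennreal e * G x) * indicator {\<delta><..1} t \<partial>lborel)"
        unfolding X_def by (rule nn_integral_add) measurable
      also have "(\<integral>\<^sup>+t. (ennreal e * G x) * indicator {\<delta><..1} t \<partial>lborel) = (ennreal e * G x) * ennreal (1 - \<delta>)"
        using \<delta> by (simp add: nn_integral_cmult_indicator)
      also have "\<dots> \<le> (ennreal e * G x) * 1"
        using \<delta> by (intro mult_left_mono) (auto simp: ennreal_le_1)
      finally have "(\<integral>\<^sup>+t\<in>{0<..1}. (\<integral>\<^sup>+y\<in>?B. ennreal (K x (x + t *\<^sub>R (y - x)) * g (x + t *\<^sub>R (y - x))) \<partial>lborel) \<partial>lborel)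
         \<le> X x + ennreal e * G x" by (simp add: add_left_mono)
      then have b: "ennreal (2 * \<rho>) * (\<integral>\<^sup>+t\<in>{0<..1}. (\<integral>\<^sup>+y\<in>?B. ennreal (K x (x + t *\<^sub>R (y - x)) * g (x + t *\<^sub>R (y - x))) \<partial>lborel) \<partial>lborel)
        \<le> ennreal (2 * \<rho>) * (X x + ennreal e * G x)" by (intro mult_left_mono) auto
      have a: "ennreal (v x) * emeasure lborel ?B \<le> ennreal (2 * \<rho>) *
        (\<integral>\<^sup>+t\<in>{0<..1}. (\<integral>\<^sup>+y\<in>?B. ennreal (K x (x + t *\<^sub>R (y - x)) * g (x + t *\<^sub>R (y - x))) \<partial>lborel) \<partial>lborel)"
        using vle x by (rule bspec)
      show ?thesis using order_trans[OF a b] unfolding V(1) .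
    qed
    \<comment> \<open>One factor \<open>\<delta>\<close> comes from Cauchy-Schwarz in
      \<open>t\<close> and one from the length of the range of \<open>t\<close>. For each
      \<open>t\<close> the averaging bound together with the Jacobian no longer depends on
      \<open>t\<close>.\<close>
    have X2: "(\<integral>\<^sup>+x. (X x)\<^sup>2 \<partial>lborel) \<le> ennreal (\<delta>\<^sup>2 * c * V\<^sup>2) * (\<integral>\<^sup>+y\<in>?B. ennreal ((g y)\<^sup>2) \<partial>lborel)"
    proof -
      have "(\<integral>\<^sup>+x. (X x)\<^sup>2 \<partial>lborel) \<le> (\<integral>\<^sup>+x. ennreal \<delta> * (\<integral>\<^sup>+t\<in>{0<..\<delta>}. (ennreal (1 / t^?d) * Q t x)\<^sup>2 \<partial>lborel) \<partial>lborel)"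
      proof (intro nn_integral_mono)
        fix x
        have "X x = (\<integral>\<^sup>+t. indicator {0<..\<delta>} t * (ennreal (1 / t^?d) * Q t x * indicator {0<..\<delta>} t) \<partial>lborel)"
          unfolding X_def by (intro nn_integral_cong) (auto split: split_indicator)
        also have "\<dots>\<^sup>2 \<le> (\<integral>\<^sup>+t. (indicator {0<..\<delta>} t)\<^sup>2 \<partial>lborel) * (\<integral>\<^sup>+t. (ennreal (1 / t^?d) * Q t x * indicator {0<..\<delta>} t)\<^sup>2 \<partial>lborel)"
          by (rule Cauchy_Schwarz_nn_integral) measurable
        also have "(\<integral>\<^sup>+t. (indicator {0<..\<delta>} t)\<^sup>2 \<partial>lborel) = (\<integral>\<^sup>+t. indicator {0<..\<delta>} t \<partial>lborel)"
          by (intro nn_integral_cong) (auto split: split_indicator)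
        also have "\<dots> = ennreal \<delta>" using \<delta> by simp
        also have "(\<integral>\<^sup>+t. (ennreal (1 / t^?d) * Q t x * indicator {0<..\<delta>} t)\<^sup>2 \<partial>lborel) = (\<integral>\<^sup>+t\<in>{0<..\<delta>}. (ennreal (1 / t^?d) * Q t x)\<^sup>2 \<partial>lborel)"
          by (intro nn_integral_cong) (auto split: split_indicator)
        finally show "(X x)\<^sup>2 \<le> ennreal \<delta> * (\<integral>\<^sup>+t\<in>{0<..\<delta>}. (ennreal (1 / t^?d) * Q t x)\<^sup>2 \<partial>lborel)" .
      qed
      also have "\<dots> = ennreal \<delta> * (\<integral>\<^sup>+x. (\<integral>\<^sup>+t\<in>{0<..\<delta>}. (ennreal (1 / t^?d) * Q t x)\<^sup>2 \<partial>lborel) \<partial>lborel)"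
        by (rule nn_integral_cmult) measurable
      also have "(\<integral>\<^sup>+x. (\<integral>\<^sup>+t\<in>{0<..\<delta>}. (ennreal (1 / t^?d) * Q t x)\<^sup>2 \<partial>lborel) \<partial>lborel)
         = (\<integral>\<^sup>+t. (\<integral>\<^sup>+x. (ennreal (1 / t^?d) * Q t x)\<^sup>2 * indicator {0<..\<delta>} t \<partial>lborel) \<partial>lborel)"
        by (rule lborel_pair.Fubini') measurable
      also have "\<dots> \<le> (\<integral>\<^sup>+t. (ennreal (c * V\<^sup>2) * (\<integral>\<^sup>+y\<in>?B. ennreal ((g y)\<^sup>2) \<partial>lborel)) * indicator {0<..\<delta>} t \<partial>lborel)"
      proof (intro nn_integral_mono)
        fix t :: real
        show "(\<integral>\<^sup>+x. (ennreal (1 / t^?d) * Q t x)\<^sup>2 * indicator {0<..\<delta>} t \<partial>lborel) \<le>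
          (ennreal (c * V\<^sup>2) * (\<integral>\<^sup>+y\<in>?B. ennreal ((g y)\<^sup>2) \<partial>lborel)) * indicator {0<..\<delta>} t"
        proof (cases "t \<in> {0<..\<delta>}")
          case True
          then have t: "0 < t" by simp
          have "(\<integral>\<^sup>+x. (ennreal (1 / t^?d) * Q t x)\<^sup>2 \<partial>lborel) = (\<integral>\<^sup>+x. ennreal ((1 / t^?d)\<^sup>2) * (Q t x)\<^sup>2 \<partial>lborel)"
            using t by (intro nn_integral_cong) (simp add: power_mult_distrib ennreal_power)
          also have "\<dots> = ennreal ((1 / t^?d)\<^sup>2) * (\<integral>\<^sup>+x. (Q t x)\<^sup>2 \<partial>lborel)" by (rule nn_integral_cmult) measurable
          also have "(\<integral>\<^sup>+x. (Q t x)\<^sup>2 \<partial>lborel) \<le> ennreal CA * (emeasure lborel (ball (0::'a) (2*(2*\<rho>*t))))\<^sup>2 * (\<integral>\<^sup>+y\<in>?B. ennreal ((g y)\<^sup>2) \<partial>lborel)"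
            unfolding Q_def using g0 \<rho> t by (intro K_averaging_bound) auto
          also have "ennreal ((1 / t^?d)\<^sup>2) * \<dots> = ennreal (c * V\<^sup>2) * (\<integral>\<^sup>+y\<in>?B. ennreal ((g y)\<^sup>2) \<partial>lborel)"
          proof -
            have "emeasure lborel (ball (0::'a) (2*(2*\<rho>*t))) = emeasure lborel (ball z ((4 * t) * \<rho>))"
              using \<rho> t by (simp add: emeasure_ball mult_ac)
            also have "\<dots> = ennreal ((4*t)^?d * V)"
              using \<rho> t V by (subst emeasure_ball_mult) (auto simp: ennreal_mult[symmetric])
            finally have em: "emeasure lborel (ball (0::'a) (2*(2*\<rho>*t))) = ennreal ((4*t)^?d * V)" .
            have pw: "ennreal a * (ennreal CA * (ennreal b)\<^sup>2) = ennreal (a * (CA * b\<^sup>2))" if "0 \<le> a" "0 \<le> b" for a b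
              using that CA by (simp add: ennreal_power ennreal_mult)
            have "ennreal ((1 / t^?d)\<^sup>2) * (ennreal CA * (emeasure lborel (ball (0::'a) (2*(2*\<rho>*t))))\<^sup>2) = ennreal ((1 / t^?d)\<^sup>2 * (CA * ((4*t)^?d * V)\<^sup>2))"
              unfolding em using t V by (intro pw) auto
            also have "(1 / t^?d)\<^sup>2 * (CA * ((4*t)^?d * V)\<^sup>2) = c * V\<^sup>2"
            proof -
              have "((4::real)^?d)\<^sup>2 = (4\<^sup>2)^?d" by (simp only: power_mult[symmetric] mult.commute)
              then have "((4::real)^?d)\<^sup>2 = 16^?d" by simp
              then show ?thesis unfolding c_def using t by (simp add: power_mult_distrib power_divide field_simps)
            qed
            finally show ?thesis by (simp only: mult.assoc[symmetric])
          qed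
          finally show ?thesis using True by (simp add: mult_left_mono)
        qed simp
      qed
      also have "\<dots> = (ennreal (c * V\<^sup>2) * (\<integral>\<^sup>+y\<in>?B. ennreal ((g y)\<^sup>2) \<partial>lborel)) * ennreal \<delta>"
        using \<delta> by (simp add: nn_integral_cmult_indicator)
      finally have "(\<integral>\<^sup>+x. (X x)\<^sup>2 \<partial>lborel) \<le> ennreal \<delta> * ((ennreal (c * V\<^sup>2) * (\<integral>\<^sup>+y\<in>?B. ennreal ((g y)\<^sup>2) \<partial>lborel)) * ennreal \<delta>)"
        by (simp add: mult_left_mono)
      also have "\<dots> = ennreal (\<delta>\<^sup>2 * c * V\<^sup>2) * (\<integral>\<^sup>+y\<in>?B. ennreal ((g y)\<^sup>2) \<partial>lborel)"
      proof -
        have "\<delta>\<^sup>2 * c * V\<^sup>2 = \<delta> * (c * V\<^sup>2) * \<delta>" by (simp add: power2_eq_square mult_ac)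
        then have "ennreal (\<delta>\<^sup>2 * c * V\<^sup>2) = ennreal \<delta> * ennreal (c * V\<^sup>2) * ennreal \<delta>"
          using \<delta> c by (simp only: ennreal_mult mult_nonneg_nonneg less_imp_le zero_le_power2)
        then show ?thesis by (simp only: mult_ac)
      qed
      finally show ?thesis .
    qed
    have "(\<integral>\<^sup>+x\<in>?B. ennreal ((v x)\<^sup>2) \<partial>lborel) * ennreal (V\<^sup>2) \<le>
        ennreal (4 * \<rho>\<^sup>2) * (2 * (\<integral>\<^sup>+x. (X x)\<^sup>2 \<partial>lborel) + 2 * (ennreal (e\<^sup>2) * (\<integral>\<^sup>+x\<in>?B. (G x)\<^sup>2 \<partial>lborel)))"
    proof -
      have "(\<integral>\<^sup>+x\<in>?B. ennreal ((v x)\<^sup>2) \<partial>lborel) * ennreal (V\<^sup>2) = (\<integral>\<^sup>+x\<in>?B. ennreal (V\<^sup>2) * ennreal ((v x)\<^sup>2) \<partial>lborel)"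
        by (subst nn_set_integral_cmult) (auto simp: mult.commute)
      also have "\<dots> \<le> (\<integral>\<^sup>+x. ennreal (4 * \<rho>\<^sup>2) * (2 * (X x)\<^sup>2 + 2 * (ennreal (e\<^sup>2) * ((G x)\<^sup>2 * indicator ?B x))) \<partial>lborel)"
      proof (intro nn_integral_mono)
        fix x
        show "ennreal (V\<^sup>2) * ennreal ((v x)\<^sup>2) * indicator ?B x \<le> ennreal (4 * \<rho>\<^sup>2) * (2 * (X x)\<^sup>2 + 2 * (ennreal (e\<^sup>2) * ((G x)\<^sup>2 * indicator ?B x)))"
        proof (cases "x \<in> ?B")
          case True
          have "ennreal (V\<^sup>2) * ennreal ((v x)\<^sup>2) = (ennreal (v x) * ennreal V)\<^sup>2"
            using V v0 by (simp add: power_mult_distrib ennreal_power mult.commute)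
          also have "\<dots> \<le> (ennreal (2 * \<rho>) * (X x + ennreal e * G x))\<^sup>2" by (intro power_mono pt[OF True]) auto
          also have "\<dots> = ennreal (4 * \<rho>\<^sup>2) * (X x + ennreal e * G x)\<^sup>2"
            using \<rho> by (simp add: power_mult_distrib ennreal_power)
          also have "\<dots> \<le> ennreal (4 * \<rho>\<^sup>2) * (2 * (X x)\<^sup>2 + 2 * (ennreal e * G x)\<^sup>2)"
            by (intro mult_left_mono ennreal_add_square_le) auto
          also have "(ennreal e * G x)\<^sup>2 = ennreal (e\<^sup>2) * (G x)\<^sup>2" using e by (simp add: power_mult_distrib ennreal_power)
          finally show ?thesis using True by simp
        qed simp
      qed
      also have "\<dots> = ennreal (4 * \<rho>\<^sup>2) * (2 * (\<integral>\<^sup>+x. (X x)\<^sup>2 \<partial>lborel) + (\<integral>\<^sup>+x. 2 * (ennreal (e\<^sup>2) * ((G x)\<^sup>2 * indicator ?B x)) \<partial>lborel))"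
        by (rule nn_integral_lincomb) measurable
      also have "(\<integral>\<^sup>+x. 2 * (ennreal (e\<^sup>2) * ((G x)\<^sup>2 * indicator ?B x)) \<partial>lborel) = 2 * (ennreal (e\<^sup>2) * (\<integral>\<^sup>+x\<in>?B. (G x)\<^sup>2 \<partial>lborel))"
        by (simp add: nn_integral_cmult)
      finally show ?thesis .
    qed
    also have "\<dots> \<le> ennreal (4 * \<rho>\<^sup>2) * (2 * (ennreal (\<delta>\<^sup>2 * c * V\<^sup>2) * (ennreal (l\<^sup>2) * ennreal V)) +
       2 * (ennreal (e\<^sup>2) * (ennreal (V\<^sup>2) * (ennreal (\<theta> / (16 * e\<^sup>2) * l\<^sup>2) * ennreal V + ennreal (\<mu> * l) * ?I))))"
    proof (intro mult_left_mono add_mono)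
      show "(\<integral>\<^sup>+x. (X x)\<^sup>2 \<partial>lborel) \<le> ennreal (\<delta>\<^sup>2 * c * V\<^sup>2) * (ennreal (l\<^sup>2) * ennreal V)"
        using gle V by (intro order_trans[OF X2] mult_left_mono) auto
      show "(\<integral>\<^sup>+x\<in>?B. (G x)\<^sup>2 \<partial>lborel) \<le> ennreal (V\<^sup>2) * (ennreal (\<theta> / (16 * e\<^sup>2) * l\<^sup>2) * ennreal V + ennreal (\<mu> * l) * ?I)"
        unfolding G_def using J[OF \<rho> l g g0 gle] V by (simp add: ennreal_power)
    qed auto
    also have "\<dots> \<le> ennreal (V\<^sup>2) * (ennreal (\<rho>\<^sup>2) * (ennreal (\<theta> * l\<^sup>2) * ennreal V + ennreal (8 * e\<^sup>2 * \<mu> * l) * ?I))"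
    proof (cases ?I)
      case (real i)
      have "4 * \<rho>\<^sup>2 * (2 * (\<delta>\<^sup>2 * c * V\<^sup>2 * (l\<^sup>2 * V)) + 2 * (e\<^sup>2 * (V\<^sup>2 * (\<theta> / (16 * e\<^sup>2) * l\<^sup>2 * V + \<mu> * l * i))))
        = V\<^sup>2 * (\<rho>\<^sup>2 * ((8 * (\<delta>\<^sup>2 * c) + \<theta> / 2) * l\<^sup>2 * V + 8 * e\<^sup>2 * \<mu> * l * i))"
        using e by (simp add: field_simps)
      also have "\<dots> \<le> V\<^sup>2 * (\<rho>\<^sup>2 * (\<theta> * l\<^sup>2 * V + 8 * e\<^sup>2 * \<mu> * l * i))"
        using \<delta>c V by (intro mult_left_mono add_right_mono mult_right_mono) auto
      finally have le: "4 * \<rho>\<^sup>2 * (2 * (\<delta>\<^sup>2 * c * V\<^sup>2 * (l\<^sup>2 * V)) + 2 * (e\<^sup>2 * (V\<^sup>2 * (\<theta> / (16 * e\<^sup>2) * l\<^sup>2 * V + \<mu> * l * i))))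
        \<le> V\<^sup>2 * (\<rho>\<^sup>2 * (\<theta> * l\<^sup>2 * V + 8 * e\<^sup>2 * \<mu> * l * i))" .
      have nn: "0 \<le> \<theta> / (16 * e\<^sup>2) * l\<^sup>2 * V" "0 \<le> \<mu> * l * i" "0 \<le> \<delta>\<^sup>2 * c * V\<^sup>2 * (l\<^sup>2 * V)" "0 \<le> \<theta> * l\<^sup>2 * V" "0 \<le> 8 * e\<^sup>2 * \<mu> * l * i"
        using \<theta> e l V \<mu> c real by auto
      have L: "ennreal (4 * \<rho>\<^sup>2) * (2 * (ennreal (\<delta>\<^sup>2 * c * V\<^sup>2) * (ennreal (l\<^sup>2) * ennreal V)) +
       2 * (ennreal (e\<^sup>2) * (ennreal (V\<^sup>2) * (ennreal (\<theta> / (16 * e\<^sup>2) * l\<^sup>2) * ennreal V + ennreal (\<mu> * l) * ?I))))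
        = ennreal (4 * \<rho>\<^sup>2 * (2 * (\<delta>\<^sup>2 * c * V\<^sup>2 * (l\<^sup>2 * V)) + 2 * (e\<^sup>2 * (V\<^sup>2 * (\<theta> / (16 * e\<^sup>2) * l\<^sup>2 * V + \<mu> * l * i)))))"
        unfolding real ennreal_numeral[symmetric]
        using \<theta> e l V \<mu> c real(1) nn
        by (simp only: ennreal_mult[symmetric] ennreal_plus[symmetric] mult_nonneg_nonneg add_nonneg_nonneg zero_le_power2 less_imp_le zero_le_numeral divide_nonneg_nonneg)
      have R: "ennreal (V\<^sup>2) * (ennreal (\<rho>\<^sup>2) * (ennreal (\<theta> * l\<^sup>2) * ennreal V + ennreal (8 * e\<^sup>2 * \<mu> * l) * ?I))
        = ennreal (V\<^sup>2 * (\<rho>\<^sup>2 * (\<theta> * l\<^sup>2 * V + 8 * e\<^sup>2 * \<mu> * l * i)))"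
        unfolding real
        using \<theta> e l V \<mu> c real(1) nn
        by (simp only: ennreal_mult[symmetric] ennreal_plus[symmetric] mult_nonneg_nonneg add_nonneg_nonneg zero_le_power2 less_imp_le zero_le_numeral)
      show ?thesis unfolding L R by (rule ennreal_leI[OF le])
    next
      case top
      have "ennreal (8 * e\<^sup>2 * \<mu> * l) \<noteq> 0" "ennreal (\<rho>\<^sup>2) \<noteq> 0" "ennreal (V\<^sup>2) \<noteq> 0" using e \<mu> l \<rho> V by auto
      then have "ennreal (V\<^sup>2) * (ennreal (\<rho>\<^sup>2) * (ennreal (\<theta> * l\<^sup>2) * ennreal V + ennreal (8 * e\<^sup>2 * \<mu> * l) * ?I)) = top"
        unfolding top by (simp add: ennreal_mult_top)
      then show ?thesis by simp
    qed
    finally have fin: "(\<integral>\<^sup>+x\<in>?B. ennreal ((v x)\<^sup>2) \<partial>lborel) * ennreal (V\<^sup>2) \<le> ennreal (V\<^sup>2) * (ennreal (\<rho>\<^sup>2) * (ennreal (\<theta> * l\<^sup>2) * ennreal V + ennreal (8 * e\<^sup>2 * \<mu> * l) * ?I))" .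
    have one: "ennreal (1 / V\<^sup>2) * ennreal (V\<^sup>2) = 1" using V by (simp add: ennreal_mult[symmetric])
    have cancel: "ennreal (1 / V\<^sup>2) * (ennreal (V\<^sup>2) * a) = a" for a
      unfolding mult.assoc[symmetric] one by simp
    have "ennreal (1 / V\<^sup>2) * (ennreal (V\<^sup>2) * (\<integral>\<^sup>+x\<in>?B. ennreal ((v x)\<^sup>2) \<partial>lborel)) \<le> ennreal (1 / V\<^sup>2) * (ennreal (V\<^sup>2) * (ennreal (\<rho>\<^sup>2) * (ennreal (\<theta> * l\<^sup>2) * ennreal V + ennreal (8 * e\<^sup>2 * \<mu> * l) * ?I)))"
    proof (rule mult_left_mono)
      show "ennreal (V\<^sup>2) * (\<integral>\<^sup>+x\<in>?B. ennreal ((v x)\<^sup>2) \<partial>lborel) \<le> ennreal (V\<^sup>2) * (ennreal (\<rho>\<^sup>2) * (ennreal (\<theta> * l\<^sup>2) * ennreal V + ennreal (8 * e\<^sup>2 * \<mu> * l) * ?I))"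
        using fin by (subst mult.commute)
    qed simp
    then show ?thesis unfolding cancel V(1) .
  qed
  show ?thesis
  proof (intro exI[of _ "8 * e\<^sup>2 * \<mu>"] conjI)
    show "0 < 8 * e\<^sup>2 * \<mu>" using e \<mu> by simp
  qed (use main in blast)
qed

end

section \<open>Weighted Poincare inequality\<close>

lemma has_vector_derivative_partial:
  fixes g :: "real^'d \<Rightarrow> 'b::real_normed_vector"
  assumes "(\<lambda>s. g ((y + t *\<^sub>R axis \<alpha> 1) + s *\<^sub>R axis \<alpha> 1)) differentiable (at 0)"
  shows "((\<lambda>t. g (y + t *\<^sub>R axis \<alpha> 1)) has_vector_derivative partial \<alpha> g (y + t *\<^sub>R axis \<alpha> 1)) (at t)"
proof -
  have "((\<lambda>s. g ((y + t *\<^sub>R axis \<alpha> 1) + s *\<^sub>R axis \<alpha> 1)) has_vector_derivative partial \<alpha> g (y + t *\<^sub>R axis \<alpha> 1)) (at 0)"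
    using assms unfolding partial_def by (simp add: vector_derivative_works)
  then have "((\<lambda>s. g ((y + t *\<^sub>R axis \<alpha> 1) + s *\<^sub>R axis \<alpha> 1)) has_vector_derivative partial \<alpha> g (y + t *\<^sub>R axis \<alpha> 1)) (at ((\<lambda>r. r - t) t))"
    by simp
  moreover have "((\<lambda>r::real. r - t) has_vector_derivative 1) (at t)"
    by (auto intro!: derivative_eq_intros)
  ultimately have "((\<lambda>s. g ((y + t *\<^sub>R axis \<alpha> 1) + s *\<^sub>R axis \<alpha> 1)) \<circ> (\<lambda>r. r - t) has_vector_derivative 1 *\<^sub>R partial \<alpha> g (y + t *\<^sub>R axis \<alpha> 1)) (at t)"
    by (intro vector_diff_chain_at)
  moreover have "(\<lambda>s. g ((y + t *\<^sub>R axis \<alpha> 1) + s *\<^sub>R axis \<alpha> 1)) \<circ> (\<lambda>r. r - t) = (\<lambda>t. g (y + t *\<^sub>R axis \<alpha> 1))"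
    by (auto simp: fun_eq_iff algebra_simps)
  ultimately show ?thesis by simp
qed

text \<open>The increment is built up coordinate by coordinate. \<open>F\<close> is the set of
  coordinates already moved; adding one more costs a mean value inequality along one axis, where the
  partial derivative is close to its value at \<open>x\<close> by continuity.\<close>

lemma has_derivative_continuous_partials:
  fixes g :: "real^'d \<Rightarrow> 'b::real_normed_vector"
  assumes S: "open S" "x \<in> S"
    and diff: "\<And>\<alpha> y. y \<in> S \<Longrightarrow> (\<lambda>t. g (y + t *\<^sub>R axis \<alpha> 1)) differentiable (at 0)"
    and cont: "\<And>\<alpha>. continuous_on S (partial \<alpha> g)"
  shows "(g has_derivative (\<lambda>h. \<Sum>\<alpha>\<in>UNIV. (h $ \<alpha>) *\<^sub>R partial \<alpha> g x)) (at x)"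
proof -
  let ?p = "\<lambda>F (h::real^'d). \<Sum>\<alpha>\<in>F. (h $ \<alpha>) *\<^sub>R axis \<alpha> (1::real)"
  have small: "norm (?p F h) \<le> real (card F) * norm h" for F :: "'d set" and h
  proof -
    have "norm (?p F h) \<le> (\<Sum>\<alpha>\<in>F. norm h)"
      by (rule order_trans[OF norm_sum], rule sum_mono) (simp add: norm_axis_1 component_le_norm_cart)
    then show ?thesis by simp
  qed
  have key: "\<forall>e>0. \<exists>d>0. \<forall>h. norm h < d \<longrightarrow> norm (g (x + ?p F h) - g x - (\<Sum>\<alpha>\<in>F. (h $ \<alpha>) *\<^sub>R partial \<alpha> g x)) \<le> e * norm h"
    if "finite F" for F :: "'d set"
    using that
  proof (induction F)
    case empty
    show ?case by (auto intro: exI[of _ 1])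
  next
    case (insert a F)
    show ?case
    proof (intro allI impI)
      fix e :: real assume e: "0 < e"
      then obtain d1 where d1: "d1 > 0" "\<And>h. norm h < d1 \<Longrightarrow> norm (g (x + ?p F h) - g x - (\<Sum>\<alpha>\<in>F. (h $ \<alpha>) *\<^sub>R partial \<alpha> g x)) \<le> e/2 * norm h"
        using insert.IH[rule_format, of "e/2"] by auto
      obtain r1 where r1: "r1 > 0" "ball x r1 \<subseteq> S" using S openE by blast
      obtain r2 where r2: "r2 > 0" "\<And>y. y \<in> S \<Longrightarrow> dist y x < r2 \<Longrightarrow> dist (partial a g y) (partial a g x) < e/2"
        using cont[of a] S(2) e unfolding continuous_on_iff by (meson half_gt_zero)
      let ?n = "real (card F) + 1"
      \<comment> \<open>A displacement in at most \<open>card F + 1\<close> coordinates has norm at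
        most that number times \<open>norm h\<close>; dividing by it keeps the broken path inside
        both neighbourhoods.\<close>
      define d where "d = min d1 (min r1 r2 / ?n)"
      have d: "d > 0" unfolding d_def using d1 r1 r2 by simp
      have "norm (g (x + ?p (insert a F) h) - g x - (\<Sum>\<alpha>\<in>insert a F. (h $ \<alpha>) *\<^sub>R partial \<alpha> g x)) \<le> e * norm h" if h: "norm h < d" for h
      proof -
        define y where "y = x + ?p F h"
        have near: "norm (?p F h + t *\<^sub>R axis a 1) < min r1 r2" if t: "\<bar>t\<bar> \<le> \<bar>h $ a\<bar>" for t
        proof -
          have "norm (?p F h + t *\<^sub>R axis a 1) \<le> norm (?p F h) + \<bar>t\<bar>"
            by (rule order_trans[OF norm_triangle_ineq]) (simp add: norm_axis_1)
          also have "\<dots> \<le> real (card F) * norm h + norm h"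
            using small[of h F] t component_le_norm_cart[of h a] by linarith
          also have "\<dots> = ?n * norm h" by (simp add: algebra_simps)
          also have "\<dots> < ?n * (min r1 r2 / ?n)" using h by (intro mult_strict_left_mono) (auto simp: d_def)
          finally show ?thesis by simp
        qed
        let ?seg = "closed_segment 0 (h $ a)"
        have seg: "\<bar>t\<bar> \<le> \<bar>h $ a\<bar>" if "t \<in> ?seg" for t using that by (auto simp: closed_segment_eq_real_ivl split: if_splits)
        have inS: "y + t *\<^sub>R axis a 1 \<in> S" "dist (y + t *\<^sub>R axis a 1) x < r2" if "t \<in> ?seg" for t
          using near[OF seg[OF that]] r1 unfolding y_def by (auto simp: dist_norm add.assoc subset_iff norm_minus_commute)
        define f where "f t = g (y + t *\<^sub>R axis a 1) - t *\<^sub>R partial a g x" for t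
        have der: "(f has_derivative (\<lambda>s. s *\<^sub>R (partial a g (y + t *\<^sub>R axis a 1) - partial a g x))) (at t within ?seg)" if t: "t \<in> ?seg" for t
        proof -
          have "((\<lambda>t. g (y + t *\<^sub>R axis a 1)) has_vector_derivative partial a g (y + t *\<^sub>R axis a 1)) (at t)"
            by (rule has_vector_derivative_partial) (use diff[OF inS(1)[OF t]] in auto)
          then have "(f has_vector_derivative (partial a g (y + t *\<^sub>R axis a 1) - partial a g x)) (at t)"
            unfolding f_def by (auto intro!: derivative_eq_intros)
          then show ?thesis unfolding has_vector_derivative_def by (rule has_derivative_at_withinI)
        qed
        have "norm (f (h $ a) - f 0) \<le> e/2 * norm (h $ a - 0)"
        proof (rule differentiable_bound[OF _ der])
          fix t assume t: "t \<in> ?seg"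
          have "norm (partial a g (y + t *\<^sub>R axis a 1) - partial a g x) \<le> e/2"
            using r2(2)[OF inS[OF t]] by (simp add: dist_norm)
          then show "onorm (\<lambda>s. s *\<^sub>R (partial a g (y + t *\<^sub>R axis a 1) - partial a g x)) \<le> e/2"
          proof (intro onorm_bound)
            assume le: "norm (partial a g (y + t *\<^sub>R axis a 1) - partial a g x) \<le> e/2"
            fix s :: real
            show "norm (s *\<^sub>R (partial a g (y + t *\<^sub>R axis a 1) - partial a g x)) \<le> e/2 * norm s"
              using mult_left_mono[OF le, of "\<bar>s\<bar>"] by (simp add: mult.commute)
          qed (use e in auto)
        qed auto
        also have "\<dots> \<le> e/2 * norm h" using e component_le_norm_cart[of h a] by (intro mult_left_mono) auto
        finally have 1: "norm (f (h $ a) - f 0) \<le> e/2 * norm h" .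
        have 2: "norm (g y - g x - (\<Sum>\<alpha>\<in>F. (h $ \<alpha>) *\<^sub>R partial \<alpha> g x)) \<le> e/2 * norm h"
          unfolding y_def using d1(2)[of h] h by (auto simp: d_def)
        have eq: "g (x + ?p (insert a F) h) - g x - (\<Sum>\<alpha>\<in>insert a F. (h $ \<alpha>) *\<^sub>R partial \<alpha> g x)
          = (f (h $ a) - f 0) + (g y - g x - (\<Sum>\<alpha>\<in>F. (h $ \<alpha>) *\<^sub>R partial \<alpha> g x))"
          using insert.hyps by (simp add: f_def y_def algebra_simps)
        show ?thesis unfolding eq using norm_triangle_ineq[of "f (h $ a) - f 0"] 1 2
          by (smt (verit, best) field_sum_of_halves distrib_right)
      qed
      then show "\<exists>d>0. \<forall>h. norm h < d \<longrightarrow> norm (g (x + ?p (insert a F) h) - g x - (\<Sum>\<alpha>\<in>insert a F. (h $ \<alpha>) *\<^sub>R partial \<alpha> g x)) \<le> e * norm h"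
        using d by blast
    qed
  qed
  have rep: "?p UNIV h = h" for h by (simp add: vec_eq_iff axis_def if_distrib sum.delta cong: if_cong)
  show ?thesis
    unfolding has_derivative_at_alt
  proof (intro conjI allI impI)
    show "bounded_linear (\<lambda>h::real^'d. \<Sum>\<alpha>\<in>UNIV. (h $ \<alpha>) *\<^sub>R partial \<alpha> g x)"
      by (intro bounded_linear_sum bounded_linear_compose[OF bounded_linear_scaleR_left bounded_linear_vec_nth])
    fix e :: real assume "0 < e"
    moreover have "\<forall>e>0. \<exists>d>0. \<forall>h. norm h < d \<longrightarrow> norm (g (x + h) - g x - (\<Sum>\<alpha>\<in>UNIV. (h $ \<alpha>) *\<^sub>R partial \<alpha> g x)) \<le> e * norm h"
      using key[OF finite_class.finite_UNIV] unfolding rep .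
    ultimately obtain d where d: "d > 0" "\<And>h. norm h < d \<Longrightarrow> norm (g (x + h) - g x - (\<Sum>\<alpha>\<in>UNIV. (h $ \<alpha>) *\<^sub>R partial \<alpha> g x)) \<le> e * norm h"
      by blast
    show "\<exists>d>0. \<forall>y. norm (y - x) < d \<longrightarrow> norm (g y - g x - (\<Sum>\<alpha>\<in>UNIV. ((y - x) $ \<alpha>) *\<^sub>R partial \<alpha> g x)) \<le> e * norm (y - x)"
    proof (intro exI[of _ d] conjI allI impI d(1))
      fix y assume "norm (y - x) < d"
      then show "norm (g y - g x - (\<Sum>\<alpha>\<in>UNIV. ((y - x) $ \<alpha>) *\<^sub>R partial \<alpha> g x)) \<le> e * norm (y - x)"
        using d(2)[of "y - x"] by simp
    qed
  qed
qed

lemma smooth_on_has_derivative: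
  fixes g :: "real^'d \<Rightarrow> 'b::real_normed_vector"
  assumes "open S" "smooth_on S g" "x \<in> S"
  shows "(g has_derivative (\<lambda>h. \<Sum>\<alpha>\<in>UNIV. (h $ \<alpha>) *\<^sub>R partial \<alpha> g x)) (at x)"
proof (rule has_derivative_continuous_partials[OF assms(1,3)])
  fix \<alpha> y assume "y \<in> S"
  then show "(\<lambda>t. g (y + t *\<^sub>R axis \<alpha> 1)) differentiable (at 0)"
    using assms(2) unfolding smooth_on_def by (metis iter_partial.simps(1))
next
  fix \<alpha>
  show "continuous_on S (partial \<alpha> g)"
    using assms(2) unfolding smooth_on_def by (metis iter_partial.simps)
qed

lemma smooth_on_continuous: "smooth_on S g \<Longrightarrow> continuous_on S g"
  unfolding smooth_on_def by (metis iter_partial.simps(1))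

lemma smooth_on_continuous_grad:
  assumes "smooth_on S (g :: real^'d \<Rightarrow> complex^'n)"
  shows "continuous_on S (grad g)"
proof -
  have "continuous_on S (partial \<alpha> g)" for \<alpha>
    using assms unfolding smooth_on_def by (metis iter_partial.simps)
  then show ?thesis unfolding grad_def by (intro continuous_on_vec_lambda continuous_intros)
qed

section \<open>From the gradient to the kernel estimate\<close>

text \<open>Fundamental theorem of calculus along the segment with the matrix \<open>A\<close>
  frozen; it will be \<open>P x\<close>, the weight at one endpoint. The endpoint
  \<open>t = 0\<close> is left out because a later substitution divides by powers of
  \<open>t\<close>.\<close>

lemma segment_gradient_bound:
  fixes \<phi> :: "real^'d \<Rightarrow> complex^'n" and A :: "complex^'n^'n"
  assumes S: "open S" "smooth_on S \<phi>" "closed_segment x y \<subseteq> S"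
  shows "ennreal (norm (A *v (\<phi> y - \<phi> x))) \<le> (\<integral>\<^sup>+t\<in>{0<..1}. ennreal (norm (y - x) * norm (A ** grad \<phi> (x + t *\<^sub>R (y - x)))) \<partial>lborel)"
proof -
  let ?w = "\<lambda>t. x + t *\<^sub>R (y - x)"
  define f where "f t = A *v (\<Sum>\<alpha>\<in>UNIV. ((y - x) $ \<alpha>) *\<^sub>R partial \<alpha> \<phi> (?w t))" for t
  have wS: "?w t \<in> S" if "t \<in> {0..1}" for t
  proof -
    have "?w t = (1 - t) *\<^sub>R x + t *\<^sub>R y" by (simp add: algebra_simps)
    then have "?w t \<in> closed_segment x y" unfolding closed_segment_def using that by auto
    then show ?thesis using S(3) by auto
  qed
  have der: "((\<lambda>t. A *v \<phi> (?w t)) has_vector_derivative f t) (at t within {0..1})" if t: "t \<in> {0..1}" for t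
  proof -
    have d1: "(\<phi> has_derivative (\<lambda>h. \<Sum>\<alpha>\<in>UNIV. (h $ \<alpha>) *\<^sub>R partial \<alpha> \<phi> (?w t))) (at (?w t))"
      by (rule smooth_on_has_derivative[OF S(1,2) wS[OF t]])
    have d2: "(?w has_vector_derivative (y - x)) (at t)" by (auto intro!: derivative_eq_intros)
    have "((\<phi> \<circ> ?w) has_vector_derivative (\<Sum>\<alpha>\<in>UNIV. ((y - x) $ \<alpha>) *\<^sub>R partial \<alpha> \<phi> (?w t))) (at t)"
      using vector_derivative_diff_chain_within[OF d2 has_derivative_at_withinI[OF d1]] .
    then have "((\<lambda>t. A *v (\<phi> \<circ> ?w) t) has_vector_derivative f t) (at t)"
      unfolding f_def by (rule bounded_linear.has_vector_derivative[OF matrix_vector_mul_bounded_linear])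
    then show ?thesis by (auto intro: has_vector_derivative_at_within simp: o_def)
  qed
  have contw: "continuous_on {0..1} ?w" by (intro continuous_intros)
  have cp: "continuous_on S (partial \<alpha> \<phi>)" for \<alpha>
    using S(2) unfolding smooth_on_def by (metis iter_partial.simps)
  have cpw: "continuous_on {0..1} (\<lambda>t. partial \<alpha> \<phi> (?w t))" for \<alpha>
    by (rule continuous_on_compose2[OF cp contw]) (use wS in auto)
  have contf: "continuous_on {0..1} f"
    unfolding f_def by (intro continuous_intros cpw)
  have FTC: "(\<integral>t. indicator {0..1} t *\<^sub>R f t \<partial>lborel) = A *v \<phi> (?w 1) - A *v \<phi> (?w 0)"
    by (rule integral_FTC_Icc) (use der contf in auto)
  have int: "integrable lborel (\<lambda>t. indicator {0..1} t *\<^sub>R f t)"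
    using borel_integrable_atLeastAtMost'[OF contf] unfolding set_integrable_def .
  have "ennreal (norm (A *v (\<phi> y - \<phi> x))) = ennreal (norm (\<integral>t. indicator {0..1} t *\<^sub>R f t \<partial>lborel))"
    unfolding FTC by (simp add: matrix_vector_mult_diff_distrib)
  also have "\<dots> \<le> (\<integral>\<^sup>+t. ennreal (norm (indicator {0..1} t *\<^sub>R f t)) \<partial>lborel)"
    by (rule integral_norm_bound_ennreal[OF int])
  also have "\<dots> \<le> (\<integral>\<^sup>+t\<in>{0<..1}. ennreal (norm (y - x) * norm (A ** grad \<phi> (?w t))) \<partial>lborel)"
  proof (rule nn_integral_mono_AE)
    have fb: "norm (f t) \<le> norm (y - x) * norm (A ** grad \<phi> (?w t))" for t
    proof -
      \<comment> \<open>The direction as a complex vector of the same norm, so that the directional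
        derivative becomes a product with the matrix \<open>grad \<phi>\<close>.\<close>
      define hc where "hc = (\<chi> \<alpha>. complex_of_real ((y - x) $ \<alpha>))"
      have "(norm (\<chi> \<alpha>. complex_of_real (h $ \<alpha>)))\<^sup>2 = (norm h)\<^sup>2" for h :: "real^'d"
        unfolding norm_cvec_sq by (simp add: norm_vec_def L2_set_def sum_nonneg)
      then have "(norm hc)\<^sup>2 = (norm (y - x))\<^sup>2" unfolding hc_def .
      then have nh: "norm hc = norm (y - x)" by (simp add: power2_eq_iff_nonneg)
      have "(\<Sum>\<alpha>\<in>UNIV. ((y - x) $ \<alpha>) *\<^sub>R partial \<alpha> \<phi> (?w t)) = grad \<phi> (?w t) *v hc"
        unfolding grad_def hc_def matrix_vector_mult_def by (simp add: vec_eq_iff scaleR_conv_of_real[where 'a=complex] mult.commute)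
      then have "f t = (A ** grad \<phi> (?w t)) *v hc" unfolding f_def by (simp add: matrix_vector_mul_assoc)
      then show ?thesis using norm_matrix_vector_mult_le[of "A ** grad \<phi> (?w t)" hc] by (simp add: nh mult.commute)
    qed
    show "AE t in lborel. ennreal (norm (indicator {0..1} t *\<^sub>R f t)) \<le> ennreal (norm (y - x) * norm (A ** grad \<phi> (?w t))) * indicator {0<..1} t"
      using AE_lborel_singleton[of "0::real"]
      by eventually_elim (use fb in \<open>auto simp: indicator_def ennreal_leI\<close>)
  qed
  finally show ?thesis .
qed

text \<open>\<open>c\<close> is the unweighted mean of \<open>\<phi>\<close>. The fixed matrix
  \<open>A\<close> passes through the integral as a bounded linear map, so the weight does not enter
  the choice of the constant. Multiplying by the volume avoids a division of extended reals.\<close>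

lemma ball_average_bound:
  fixes \<phi> :: "real^'d \<Rightarrow> complex^'n" and A :: "complex^'n^'n"
  assumes cont: "continuous_on (cball z \<rho>) \<phi>" and \<rho>: "0 < \<rho>"
  defines "c \<equiv> (1 / measure lborel (ball z \<rho>)) *\<^sub>R (\<integral>y. indicator (ball z \<rho>) y *\<^sub>R \<phi> y \<partial>lborel)"
  shows "ennreal (norm (A *v (a - c))) * emeasure lborel (ball z \<rho>) \<le> (\<integral>\<^sup>+y\<in>ball z \<rho>. ennreal (norm (A *v (a - \<phi> y))) \<partial>lborel)"
proof -
  let ?B = "ball z \<rho>"
  define V where "V = measure lborel ?B"
  have V: "emeasure lborel ?B = ennreal V" "0 < V"
    using \<rho> emeasure_lborel_ball_finite[of z \<rho>] content_ball_pos[OF \<rho>, of z] by (auto simp: V_def emeasure_eq_ennreal_measure)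
  have "set_integrable lborel (cball z \<rho>) \<phi>"
    unfolding set_integrable_def by (rule borel_integrable_compact[OF compact_cball cont])
  then have "set_integrable lborel ?B \<phi>" by (rule set_integrable_subset) auto
  then have i1: "integrable lborel (\<lambda>y. indicator ?B y *\<^sub>R \<phi> y)" by (simp add: set_integrable_def)
  have ii: "integrable lborel (indicator ?B :: real^'d \<Rightarrow> real)"
    using V by (intro integrable_real_indicator) auto
  then have i2: "integrable lborel (\<lambda>y. indicator ?B y *\<^sub>R a)"
    by (intro integrable_scaleR_left)
  have int: "integrable lborel (\<lambda>y. indicator ?B y *\<^sub>R (a - \<phi> y))"
    using Bochner_Integration.integrable_diff[OF i2 i1] by (simp add: scaleR_diff_right)
  have bl: "bounded_linear ((*v) A)" by simp
  have iA: "integrable lborel (\<lambda>y. A *v (indicator ?B y *\<^sub>R (a - \<phi> y)))"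
    by (rule integrable_bounded_linear[OF bl int])
  have "(\<integral>y. indicator ?B y *\<^sub>R (a - \<phi> y) \<partial>lborel) = (\<integral>y. indicator ?B y *\<^sub>R a \<partial>lborel) - (\<integral>y. indicator ?B y *\<^sub>R \<phi> y \<partial>lborel)"
    using Bochner_Integration.integral_diff[OF i2 i1] by (simp add: scaleR_diff_right)
  also have "(\<integral>y. indicator ?B y *\<^sub>R a \<partial>lborel) = V *\<^sub>R a" using ii by (simp add: V_def integral_scaleR_left)
  also have "(\<integral>y. indicator ?B y *\<^sub>R \<phi> y \<partial>lborel) = V *\<^sub>R c" using V by (simp add: c_def V_def)
  finally have I: "(\<integral>y. indicator ?B y *\<^sub>R (a - \<phi> y) \<partial>lborel) = V *\<^sub>R (a - c)" by (simp add: scaleR_diff_right)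
  have "(\<integral>y. A *v (indicator ?B y *\<^sub>R (a - \<phi> y)) \<partial>lborel) = A *v (V *\<^sub>R (a - c))"
    using integral_bounded_linear[OF bl int] I by simp
  also have "\<dots> = V *\<^sub>R (A *v (a - c))" by (rule linear_scale[OF bounded_linear.linear[OF bl]])
  finally have "ennreal (norm (V *\<^sub>R (A *v (a - c)))) \<le> (\<integral>\<^sup>+y. ennreal (norm (A *v (indicator ?B y *\<^sub>R (a - \<phi> y)))) \<partial>lborel)"
    using integral_norm_bound_ennreal[OF iA] by simp
  also have "\<dots> = (\<integral>\<^sup>+y\<in>?B. ennreal (norm (A *v (a - \<phi> y))) \<partial>lborel)"
    by (intro nn_integral_cong) (auto split: split_indicator)
  finally show ?thesis using V by (simp add: ennreal_mult mult.commute)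
qed

context A2_pair
begin

text \<open>Transfers the weight from \<open>x\<close> to the moving point \<open>w\<close> by
  inserting \<open>N w ** P w = mat 1\<close>; this is where the kernel enters.\<close>

lemma norm_P_mult_le: "norm (P x ** X) \<le> K x w * norm (P w ** X)"
proof -
  have "P x ** X = (P x ** N w) ** (P w ** X)"
    by (metis NP matrix_mul_assoc matrix_mul_lid)
  then show ?thesis unfolding K_def using norm_matrix_mult_le[of "P x ** N w" "P w ** X"] by simp
qed

end

text \<open>Fixes the domain to \<open>real^'d\<close>, since \<open>partial\<close> and
  \<open>grad\<close> refer to coordinate axes; the kernel estimates hold on any Euclidean
  space.\<close>

locale A2_pair_vec = A2_pair P N CA for P N :: "real^'d \<Rightarrow> complex^'n^'n" and CA
begin

text \<open>Verifies the hypothesis of \<open>kernel_Poincare\<close> for the weighted oscillation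
  and the weighted gradient: subtract the ball mean, run along segments of length at most
  \<open>2 * \<rho>\<close>, transfer the weight to the moving point, and exchange the integrals
  over \<open>y\<close> and \<open>t\<close>.\<close>

lemma weighted_Poincare:
  assumes \<theta>: "0 < \<theta>"
  shows "\<exists>\<mu>>0. \<forall>\<Omega> (\<phi>::real^'d \<Rightarrow> complex^'n) z \<rho> l. open \<Omega> \<longrightarrow> smooth_on \<Omega> \<phi> \<longrightarrow> 0 < \<rho> \<longrightarrow> cball z \<rho> \<subseteq> \<Omega> \<longrightarrow> 0 < l \<longrightarrow>
    (\<integral>\<^sup>+y\<in>ball z \<rho>. ennreal ((norm (P y ** grad \<phi> y))\<^sup>2) \<partial>lborel) \<le> ennreal (l\<^sup>2) * emeasure lborel (ball z \<rho>) \<longrightarrow>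
    (\<exists>c. (\<integral>\<^sup>+x\<in>ball z \<rho>. ennreal ((norm (P x *v (\<phi> x - c)))\<^sup>2) \<partial>lborel) \<le> ennreal (\<rho>\<^sup>2) *
      (ennreal (\<theta> * l\<^sup>2) * emeasure lborel (ball z \<rho>) + ennreal (\<mu> * l) * (\<integral>\<^sup>+y\<in>ball z \<rho>. ennreal (norm (P y ** grad \<phi> y)) \<partial>lborel)))"
proof -
  obtain \<mu> where \<mu>: "\<mu> > 0" and KP: "\<And>z \<rho> g l v. 0 < \<rho> \<Longrightarrow> 0 < l \<Longrightarrow> g \<in> borel_measurable borel \<Longrightarrow> (\<forall>y. 0 \<le> g y) \<Longrightarrow>
    v \<in> borel_measurable borel \<Longrightarrow> (\<forall>y. 0 \<le> v y) \<Longrightarrow>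
    (\<forall>x\<in>ball z \<rho>. ennreal (v x) * emeasure lborel (ball z \<rho>) \<le> ennreal (2 * \<rho>) *
       (\<integral>\<^sup>+t\<in>{0<..1}. (\<integral>\<^sup>+y\<in>ball z \<rho>. ennreal (K x (x + t *\<^sub>R (y - x)) * g (x + t *\<^sub>R (y - x))) \<partial>lborel) \<partial>lborel)) \<Longrightarrow>
    (\<integral>\<^sup>+y\<in>ball z \<rho>. ennreal ((g y)\<^sup>2) \<partial>lborel) \<le> ennreal (l\<^sup>2) * emeasure lborel (ball z \<rho>) \<Longrightarrow>
    (\<integral>\<^sup>+x\<in>ball z \<rho>. ennreal ((v x)\<^sup>2) \<partial>lborel) \<le> ennreal (\<rho>\<^sup>2) *
      (ennreal (\<theta> * l\<^sup>2) * emeasure lborel (ball z \<rho>) + ennreal (\<mu> * l) * (\<integral>\<^sup>+y\<in>ball z \<rho>. ennreal (g y) \<partial>lborel))"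
    using kernel_Poincare[OF \<theta>] by blast
  show ?thesis
  proof (rule exI[of _ \<mu>], intro conjI allI impI \<mu>)
    fix \<Omega> z \<rho> l and \<phi> :: "real^'d \<Rightarrow> complex^'n"
    assume \<Omega>: "open \<Omega>" and sm: "smooth_on \<Omega> \<phi>" and \<rho>: "0 < \<rho>" and sub: "cball z \<rho> \<subseteq> \<Omega>" and l: "0 < l"
      and le: "(\<integral>\<^sup>+y\<in>ball z \<rho>. ennreal ((norm (P y ** grad \<phi> y))\<^sup>2) \<partial>lborel) \<le> ennreal (l\<^sup>2) * emeasure lborel (ball z \<rho>)"
    let ?B = "ball z \<rho>"
    have BO: "?B \<subseteq> \<Omega>" using sub by auto
    define c where "c = (1 / measure lborel ?B) *\<^sub>R (\<integral>y. indicator ?B y *\<^sub>R \<phi> y \<partial>lborel)"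
    \<comment> \<open>Here and in \<open>v\<close> the indicator is placed under the matrix product:
      \<open>\<phi>\<close> is controlled only on \<open>\<Omega>\<close>, and the cut-off functions
      are Borel on the whole space.\<close>
    define g where "g y = norm (P y ** (indicator ?B y *\<^sub>R grad \<phi> y))" for y
    define v where "v x = norm (P x *v (indicator ?B x *\<^sub>R (\<phi> x - c)))" for x
    have [measurable]: "(\<lambda>y. indicator ?B y *\<^sub>R grad \<phi> y) \<in> borel_measurable borel"
      using continuous_on_subset[OF smooth_on_continuous_grad[OF sm] BO] by (intro borel_measurable_continuous_on_indicator) auto
    have [measurable]: "(\<lambda>x. indicator ?B x *\<^sub>R (\<phi> x - c)) \<in> borel_measurable borel"
      using continuous_on_subset[OF smooth_on_continuous[OF sm] BO] by (intro borel_measurable_continuous_on_indicator continuous_intros) auto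
    have gm[measurable]: "g \<in> borel_measurable borel" unfolding g_def by measurable
    have vm: "v \<in> borel_measurable borel" unfolding v_def by measurable
    have gB: "g y = norm (P y ** grad \<phi> y)" if "y \<in> ?B" for y using that by (simp add: g_def)
    have vB: "v y = norm (P y *v (\<phi> y - c))" if "y \<in> ?B" for y using that by (simp add: v_def)
    have main: "ennreal (v x) * emeasure lborel ?B \<le> ennreal (2 * \<rho>) *
       (\<integral>\<^sup>+t\<in>{0<..1}. (\<integral>\<^sup>+y\<in>?B. ennreal (K x (x + t *\<^sub>R (y - x)) * g (x + t *\<^sub>R (y - x))) \<partial>lborel) \<partial>lborel)" if x: "x \<in> ?B" for x
    proof -
      have "ennreal (v x) * emeasure lborel ?B \<le> (\<integral>\<^sup>+y\<in>?B. ennreal (norm (P x *v (\<phi> x - \<phi> y))) \<partial>lborel)"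
        unfolding vB[OF x] c_def
        by (rule ball_average_bound) (use \<rho> continuous_on_subset[OF smooth_on_continuous[OF sm] sub] in auto)
      also have "\<dots> \<le> (\<integral>\<^sup>+y. (\<integral>\<^sup>+t. ennreal (2 * \<rho>) * (ennreal (K x (x + t *\<^sub>R (y - x)) * g (x + t *\<^sub>R (y - x))) * indicator ?B y * indicator {0<..1} t) \<partial>lborel) \<partial>lborel)"
      proof (intro nn_integral_mono)
        fix y
        show "ennreal (norm (P x *v (\<phi> x - \<phi> y))) * indicator ?B y \<le>
          (\<integral>\<^sup>+t. ennreal (2 * \<rho>) * (ennreal (K x (x + t *\<^sub>R (y - x)) * g (x + t *\<^sub>R (y - x))) * indicator ?B y * indicator {0<..1} t) \<partial>lborel)"
        proof (cases "y \<in> ?B")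
          case True
          have seg: "closed_segment x y \<subseteq> ?B" using x True by (simp add: closed_segment_subset)
          have xy: "norm (y - x) \<le> 2 * \<rho>"
            using x True dist_triangle[of x y z] by (simp add: dist_norm norm_minus_commute)
          have "norm (P x *v (\<phi> x - \<phi> y)) = norm (P x *v (\<phi> y - \<phi> x))"
            by (metis matrix_vector_mult_diff_distrib norm_minus_commute)
          then have "ennreal (norm (P x *v (\<phi> x - \<phi> y))) \<le> (\<integral>\<^sup>+t\<in>{0<..1}. ennreal (norm (y - x) * norm (P x ** grad \<phi> (x + t *\<^sub>R (y - x)))) \<partial>lborel)"
            using segment_gradient_bound[OF \<Omega> sm, of x y "P x"] seg BO by auto
          also have "\<dots> \<le> (\<integral>\<^sup>+t. ennreal (2 * \<rho>) * (ennreal (K x (x + t *\<^sub>R (y - x)) * g (x + t *\<^sub>R (y - x))) * indicator ?B y * indicator {0<..1} t) \<partial>lborel)"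
          proof (intro nn_integral_mono)
            fix t :: real
            show "ennreal (norm (y - x) * norm (P x ** grad \<phi> (x + t *\<^sub>R (y - x)))) * indicator {0<..1} t \<le>
              ennreal (2 * \<rho>) * (ennreal (K x (x + t *\<^sub>R (y - x)) * g (x + t *\<^sub>R (y - x))) * indicator ?B y * indicator {0<..1} t)"
            proof (cases "t \<in> {0<..1}")
              case t: True
              let ?w = "x + t *\<^sub>R (y - x)"
              have "?w = (1 - t) *\<^sub>R x + t *\<^sub>R y" by (simp add: algebra_simps)
              then have "?w \<in> closed_segment x y" unfolding closed_segment_def using t by auto
              then have w: "?w \<in> ?B" using seg by auto
              have "norm (y - x) * norm (P x ** grad \<phi> ?w) \<le> (2 * \<rho>) * (K x ?w * g ?w)"
                unfolding gB[OF w] using xy \<rho> by (intro mult_mono norm_P_mult_le) auto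
              then show ?thesis using t True \<rho> K_nonneg[of x ?w]
                by (simp add: ennreal_mult[symmetric] g_def ennreal_leI)
            qed simp
          qed
          finally show ?thesis using True by simp
        qed simp
      qed
      also have "\<dots> = (\<integral>\<^sup>+t. (\<integral>\<^sup>+y. ennreal (2 * \<rho>) * (ennreal (K x (x + t *\<^sub>R (y - x)) * g (x + t *\<^sub>R (y - x))) * indicator ?B y * indicator {0<..1} t) \<partial>lborel) \<partial>lborel)"
        by (rule lborel_pair.Fubini') measurable
      also have "\<dots> = (\<integral>\<^sup>+t. ennreal (2 * \<rho>) * ((\<integral>\<^sup>+y\<in>?B. ennreal (K x (x + t *\<^sub>R (y - x)) * g (x + t *\<^sub>R (y - x))) \<partial>lborel) * indicator {0<..1} t) \<partial>lborel)"
      proof (intro nn_integral_cong)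
        fix t :: real
        have "(\<integral>\<^sup>+y. ennreal (2 * \<rho>) * (ennreal (K x (x + t *\<^sub>R (y - x)) * g (x + t *\<^sub>R (y - x))) * indicator ?B y * indicator {0<..1} t) \<partial>lborel)
          = ennreal (2 * \<rho>) * (\<integral>\<^sup>+y. (ennreal (K x (x + t *\<^sub>R (y - x)) * g (x + t *\<^sub>R (y - x))) * indicator ?B y * indicator {0<..1} t) \<partial>lborel)"
          by (rule nn_integral_cmult) measurable
        also have "(\<integral>\<^sup>+y. (ennreal (K x (x + t *\<^sub>R (y - x)) * g (x + t *\<^sub>R (y - x))) * indicator ?B y * indicator {0<..1} t) \<partial>lborel)
          = (\<integral>\<^sup>+y\<in>?B. ennreal (K x (x + t *\<^sub>R (y - x)) * g (x + t *\<^sub>R (y - x))) \<partial>lborel) * indicator {0<..1} t"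
          by (rule nn_integral_multc) measurable
        finally show "(\<integral>\<^sup>+y. ennreal (2 * \<rho>) * (ennreal (K x (x + t *\<^sub>R (y - x)) * g (x + t *\<^sub>R (y - x))) * indicator ?B y * indicator {0<..1} t) \<partial>lborel)
          = ennreal (2 * \<rho>) * ((\<integral>\<^sup>+y\<in>?B. ennreal (K x (x + t *\<^sub>R (y - x)) * g (x + t *\<^sub>R (y - x))) \<partial>lborel) * indicator {0<..1} t)" .
      qed
      also have "\<dots> = ennreal (2 * \<rho>) * (\<integral>\<^sup>+t\<in>{0<..1}. (\<integral>\<^sup>+y\<in>?B. ennreal (K x (x + t *\<^sub>R (y - x)) * g (x + t *\<^sub>R (y - x))) \<partial>lborel) \<partial>lborel)"
        by (rule nn_integral_cmult) measurable
      finally show ?thesis .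
    qed
    have eqs: "(\<integral>\<^sup>+y\<in>?B. ennreal ((g y)\<^sup>2) \<partial>lborel) = (\<integral>\<^sup>+y\<in>?B. ennreal ((norm (P y ** grad \<phi> y))\<^sup>2) \<partial>lborel)"
      "(\<integral>\<^sup>+y\<in>?B. ennreal (g y) \<partial>lborel) = (\<integral>\<^sup>+y\<in>?B. ennreal (norm (P y ** grad \<phi> y)) \<partial>lborel)"
      "(\<integral>\<^sup>+y\<in>?B. ennreal ((v y)\<^sup>2) \<partial>lborel) = (\<integral>\<^sup>+y\<in>?B. ennreal ((norm (P y *v (\<phi> y - c)))\<^sup>2) \<partial>lborel)"
      using gB vB by (auto intro!: nn_integral_cong split: split_indicator)
    have "(\<integral>\<^sup>+x\<in>?B. ennreal ((v x)\<^sup>2) \<partial>lborel) \<le> ennreal (\<rho>\<^sup>2) *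
      (ennreal (\<theta> * l\<^sup>2) * emeasure lborel ?B + ennreal (\<mu> * l) * (\<integral>\<^sup>+y\<in>?B. ennreal (g y) \<partial>lborel))"
      by (rule KP[OF \<rho> l gm _ vm]) (use main le eqs in \<open>auto simp: g_def v_def\<close>)
    then show "\<exists>c. (\<integral>\<^sup>+x\<in>?B. ennreal ((norm (P x *v (\<phi> x - c)))\<^sup>2) \<partial>lborel) \<le> ennreal (\<rho>\<^sup>2) *
      (ennreal (\<theta> * l\<^sup>2) * emeasure lborel ?B + ennreal (\<mu> * l) * (\<integral>\<^sup>+y\<in>?B. ennreal (norm (P y ** grad \<phi> y)) \<partial>lborel))"
      unfolding eqs by (rule exI)
  qed
qed

end

section \<open>Cutoff functions\<close>

text \<open>\<open>n = 0\<close> is the classical flat function exp(-1/t); the powers in the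
  denominator occur in its derivatives.\<close>

definition flat_exp :: "nat \<Rightarrow> real \<Rightarrow> real" where
  "flat_exp n t = (if 0 < t then exp (- (1 / t)) / t ^ n else 0)"

lemma power_le_fact_exp: "0 \<le> x \<Longrightarrow> x ^ k \<le> fact k * exp (x::real)"
proof -
  assume x: "0 \<le> x"
  have "(\<Sum>n\<in>{k}. inverse (fact n) *\<^sub>R x ^ n) \<le> (\<Sum>n. inverse (fact n) *\<^sub>R x ^ n)"
    by (rule sum_le_suminf[OF summable_exp_generic]) (use x in auto)
  then have "x ^ k / fact k \<le> exp x" by (simp add: exp_def divide_inverse mult.commute)
  then show ?thesis by (simp add: field_simps)
qed

lemma flat_exp_nonneg: "0 \<le> flat_exp n t"
  by (simp add: flat_exp_def)

text \<open>The exponential series dominates each of its terms, taken at \<open>1 / t\<close> with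
  the exponent \<open>n + k\<close>.\<close>

lemma flat_exp_le: "0 < t \<Longrightarrow> flat_exp n t \<le> fact (n + k) * t ^ k"
proof -
  assume t: "0 < t"
  have "(1 / t) ^ (n + k) \<le> fact (n + k) * exp (1 / t)" using t by (intro power_le_fact_exp) auto
  then have "exp (- (1 / t)) * (1 / t) ^ (n + k) \<le> exp (- (1 / t)) * (fact (n + k) * exp (1 / t))"
    by (intro mult_left_mono) auto
  also have "\<dots> = fact (n + k)" by (simp add: exp_minus)
  finally have "exp (- (1 / t)) * (1 / t) ^ (n + k) \<le> fact (n + k)" .
  then have "exp (- (1 / t)) * (1 / t) ^ (n + k) * t ^ k \<le> fact (n + k) * t ^ k"
    using t by (intro mult_right_mono) auto
  moreover have "exp (- (1 / t)) * (1 / t) ^ (n + k) * t ^ k = flat_exp n t"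
    using t by (simp add: flat_exp_def power_add power_divide)
  ultimately show ?thesis by simp
qed

lemma DERIV_flat_exp:
  "(flat_exp n has_real_derivative (flat_exp (n + 2) t - real n * flat_exp (n + 1) t)) (at t)"
proof -
  consider "0 < t" | "t < 0" | "t = 0" by linarith
  then show ?thesis
  proof cases
    case 1
    have "((\<lambda>t. exp (- (1 / t)) / t ^ n) has_real_derivative (flat_exp (n + 2) t - real n * flat_exp (n + 1) t)) (at t)"
      using 1 by (auto intro!: derivative_eq_intros simp: flat_exp_def)
        (cases n, auto simp: field_simps power2_eq_square)
    then show ?thesis
      by (rule has_field_derivative_transform_within_open[where S="{0<..}"]) (use 1 in \<open>auto simp: flat_exp_def\<close>)
  next
    case 2
    have "((\<lambda>t::real. 0) has_real_derivative 0) (at t)" by simp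
    then have "(flat_exp n has_real_derivative 0) (at t)"
      by (rule has_field_derivative_transform_within_open[where S="{..<0}"]) (use 2 in \<open>auto simp: flat_exp_def\<close>)
    then show ?thesis using 2 by (simp add: flat_exp_def)
  next
    case 3
    \<comment> \<open>The decay of order \<open>k = 2\<close> bounds the difference quotient at the
      origin by a multiple of the increment.\<close>
    have b: "norm (flat_exp n h / h) \<le> fact (n + 2) * \<bar>h\<bar>" for h
    proof (cases "0 < h")
      case True
      have "flat_exp n h / h \<le> fact (n + 2) * h ^ 2 / h"
        using True by (intro divide_right_mono flat_exp_le) auto
      then show ?thesis using True flat_exp_nonneg[of n h] by (simp add: power2_eq_square)
    next
      case False
      have "0 \<le> fact (n + 2) * \<bar>h\<bar>" by (intro mult_nonneg_nonneg) (simp_all only: fact_ge_zero abs_ge_zero)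
      moreover have "norm (flat_exp n h / h) = 0" using False by (simp add: flat_exp_def)
      ultimately show ?thesis by linarith
    qed
    have "((\<lambda>h. flat_exp n h / h) \<longlongrightarrow> 0) (at 0)"
    proof (rule Lim_null_comparison)
      show "\<forall>\<^sub>F h in at 0. norm (flat_exp n h / h) \<le> fact (n + 2) * \<bar>h\<bar>" using b by simp
      show "((\<lambda>h::real. fact (n + 2) * \<bar>h\<bar>) \<longlongrightarrow> 0) (at 0)" by (auto intro!: tendsto_eq_intros)
    qed
    then show ?thesis unfolding 3 by (simp add: DERIV_def flat_exp_def)
  qed
qed

text \<open>The class is closed under partial derivatives since the derivative of \<open>flat_exp n\<close> is
  \<open>flat_exp (n + 2) - n flat_exp (n + 1)\<close>.\<close>

inductive smooth_expr :: "(real^'d \<Rightarrow> real) \<Rightarrow> bool" where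
  const: "smooth_expr (\<lambda>x. c)"
| coord: "smooth_expr (\<lambda>x. x $ i)"
| add: "smooth_expr f \<Longrightarrow> smooth_expr g \<Longrightarrow> smooth_expr (\<lambda>x. f x + g x)"
| mult: "smooth_expr f \<Longrightarrow> smooth_expr g \<Longrightarrow> smooth_expr (\<lambda>x. f x * g x)"
| flat: "smooth_expr f \<Longrightarrow> smooth_expr (\<lambda>x. flat_exp n (f x))"

lemma smooth_expr_sum: "finite I \<Longrightarrow> (\<And>i. i \<in> I \<Longrightarrow> smooth_expr (f i)) \<Longrightarrow> smooth_expr (\<lambda>x. \<Sum>i\<in>I. f i x)"
  by (induction I rule: finite_induct) (auto intro: smooth_expr.intros)

lemma smooth_expr_continuous: "smooth_expr f \<Longrightarrow> continuous_on UNIV f"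
proof (induction rule: smooth_expr.induct)
  case (flat f n)
  have "continuous_on UNIV (flat_exp n)"
    using DERIV_flat_exp by (auto intro!: DERIV_continuous_on[where D="\<lambda>t. flat_exp (n + 2) t - real n * flat_exp (n + 1) t"] intro: has_field_derivative_at_within)
  then show ?case using flat.IH by (rule continuous_on_compose2) auto
qed (auto intro!: continuous_intros)

lemma smooth_expr_derivative:
  "smooth_expr f \<Longrightarrow> \<exists>f'. smooth_expr f' \<and> (\<forall>x. ((\<lambda>t. f (x + t *\<^sub>R axis \<alpha> 1)) has_real_derivative f' x) (at 0))"
proof (induction rule: smooth_expr.induct)
  case (const c)
  show ?case by (intro exI[of _ "\<lambda>x. 0"]) (auto intro: smooth_expr.const)
next
  case (coord i)
  show ?case by (intro exI[of _ "\<lambda>x. if i = \<alpha> then 1 else 0"]) (auto intro!: smooth_expr.const derivative_eq_intros simp: axis_def)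
next
  case (add f g)
  then obtain f' g' where "smooth_expr f'" "smooth_expr g'"
    "\<And>x. ((\<lambda>t. f (x + t *\<^sub>R axis \<alpha> 1)) has_real_derivative f' x) (at 0)" "\<And>x. ((\<lambda>t. g (x + t *\<^sub>R axis \<alpha> 1)) has_real_derivative g' x) (at 0)" by blast
  then show ?case by (intro exI[of _ "\<lambda>x. f' x + g' x"]) (auto intro!: smooth_expr.add DERIV_add)
next
  case (mult f g)
  then obtain f' g' where D: "smooth_expr f'" "smooth_expr g'"
    "\<And>x. ((\<lambda>t. f (x + t *\<^sub>R axis \<alpha> 1)) has_real_derivative f' x) (at 0)" "\<And>x. ((\<lambda>t. g (x + t *\<^sub>R axis \<alpha> 1)) has_real_derivative g' x) (at 0)" by blast
  show ?case
  proof (intro exI[of _ "\<lambda>x. f' x * g x + g' x * f x"] conjI allI)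
    show "smooth_expr (\<lambda>x. f' x * g x + g' x * f x)" using D mult by (auto intro: smooth_expr.intros)
    fix x show "((\<lambda>t. f (x + t *\<^sub>R axis \<alpha> 1) * g (x + t *\<^sub>R axis \<alpha> 1)) has_real_derivative f' x * g x + g' x * f x) (at 0)"
      using DERIV_mult[OF D(3)[of x] D(4)[of x]] by simp
  qed
next
  case (flat f n)
  then obtain f' where D: "smooth_expr f'" "\<And>x. ((\<lambda>t. f (x + t *\<^sub>R axis \<alpha> 1)) has_real_derivative f' x) (at 0)" by blast
  show ?case
  proof (intro exI[of _ "\<lambda>x. (flat_exp (n + 2) (f x) + (- real n) * flat_exp (n + 1) (f x)) * f' x"] conjI allI)
    show "smooth_expr (\<lambda>x. (flat_exp (n + 2) (f x) + (- real n) * flat_exp (n + 1) (f x)) * f' x)"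
      using D flat by (intro smooth_expr.intros)
    fix x
    show "((\<lambda>t. flat_exp n (f (x + t *\<^sub>R axis \<alpha> 1))) has_real_derivative (flat_exp (n + 2) (f x) + (- real n) * flat_exp (n + 1) (f x)) * f' x) (at 0)"
      using DERIV_chain2[OF DERIV_flat_exp D(2)[of x]] by simp
  qed
qed

lemma smooth_expr_partial:
  assumes "smooth_expr f"
  shows "((\<lambda>t. f (x + t *\<^sub>R axis \<alpha> 1)) has_real_derivative partial \<alpha> f x) (at 0)" "smooth_expr (partial \<alpha> f)"
proof -
  obtain f' where D: "smooth_expr f'" "\<And>x. ((\<lambda>t. f (x + t *\<^sub>R axis \<alpha> 1)) has_real_derivative f' x) (at 0)"
    using smooth_expr_derivative[OF assms] by blast
  have "partial \<alpha> f x = f' x" for x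
    unfolding partial_def using D(2)[of x] by (intro vector_derivative_at) (simp add: has_real_derivative_iff_has_vector_derivative)
  then have "partial \<alpha> f = f'" by auto
  then show "((\<lambda>t. f (x + t *\<^sub>R axis \<alpha> 1)) has_real_derivative partial \<alpha> f x) (at 0)" "smooth_expr (partial \<alpha> f)"
    using D by auto
qed

section \<open>Products of smooth scalars with a given smooth function\<close>

text \<open>The Leibniz rule keeps this class closed under partial derivatives, so smoothness of a
  product with a cutoff needs only first-order arguments. The constant vectors are there because
  test functions subtract a constant from \<open>\<phi>\<close>.\<close>

inductive smooth_comb :: "(real^'d \<Rightarrow> 'b::real_normed_vector) \<Rightarrow> (real^'d \<Rightarrow> 'b) \<Rightarrow> bool" for \<phi> where
  smul: "smooth_expr f \<Longrightarrow> smooth_comb \<phi> (\<lambda>x. f x *\<^sub>R iter_partial \<alpha>s \<phi> x)"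
| smul_const: "smooth_expr f \<Longrightarrow> smooth_comb \<phi> (\<lambda>x. f x *\<^sub>R c)"
| comb_add: "smooth_comb \<phi> \<psi> \<Longrightarrow> smooth_comb \<phi> \<xi> \<Longrightarrow> smooth_comb \<phi> (\<lambda>x. \<psi> x + \<xi> x)"

lemma smooth_comb_continuous:
  assumes "smooth_on \<Omega> \<phi>"
  shows "smooth_comb \<phi> \<psi> \<Longrightarrow> continuous_on \<Omega> \<psi>"
proof (induction rule: smooth_comb.induct)
  case (smul f \<alpha>s)
  have "continuous_on \<Omega> (iter_partial \<alpha>s \<phi>)" using assms unfolding smooth_on_def by blast
  then show ?case using continuous_on_subset[OF smooth_expr_continuous[OF smul]] by (intro continuous_intros) auto
next
  case (smul_const f c)
  show ?case using continuous_on_subset[OF smooth_expr_continuous[OF smul_const]] by (intro continuous_intros) auto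
qed (auto intro: continuous_on_add)

lemma has_vector_derivative_smul:
  assumes "(f has_real_derivative f') (at (t::real))" "(g has_vector_derivative g') (at t)"
  shows "((\<lambda>t. f t *\<^sub>R g t) has_vector_derivative (f t *\<^sub>R g' + f' *\<^sub>R g t)) (at t)"
  using has_vector_derivative_scaleR[OF assms] .

lemma smooth_comb_derivative:
  assumes "smooth_on \<Omega> \<phi>"
  shows "smooth_comb \<phi> \<psi> \<Longrightarrow> \<exists>\<psi>'. smooth_comb \<phi> \<psi>' \<and> (\<forall>x\<in>\<Omega>. ((\<lambda>t. \<psi> (x + t *\<^sub>R axis \<alpha> 1)) has_vector_derivative \<psi>' x) (at 0))"
proof (induction rule: smooth_comb.induct)
  case (smul f \<alpha>s)
  note D = smooth_expr_partial(1)[OF smul, of _ \<alpha>] smooth_expr_partial(2)[OF smul, of \<alpha>]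
  show ?case
  proof (intro exI[of _ "\<lambda>x. f x *\<^sub>R iter_partial (\<alpha> # \<alpha>s) \<phi> x + partial \<alpha> f x *\<^sub>R iter_partial \<alpha>s \<phi> x"] conjI ballI)
    show "smooth_comb \<phi> (\<lambda>x. f x *\<^sub>R iter_partial (\<alpha> # \<alpha>s) \<phi> x + partial \<alpha> f x *\<^sub>R iter_partial \<alpha>s \<phi> x)"
      using smul D by (intro smooth_comb.intros)
    fix x assume "x \<in> \<Omega>"
    then have "(\<lambda>t. iter_partial \<alpha>s \<phi> (x + t *\<^sub>R axis \<alpha> 1)) differentiable (at 0)" using assms unfolding smooth_on_def by blast
    then have "((\<lambda>t. iter_partial \<alpha>s \<phi> (x + t *\<^sub>R axis \<alpha> 1)) has_vector_derivative iter_partial (\<alpha> # \<alpha>s) \<phi> x) (at 0)"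
      by (simp add: partial_def vector_derivative_works)
    from has_vector_derivative_smul[OF D(1)[of x] this]
    show "((\<lambda>t. f (x + t *\<^sub>R axis \<alpha> 1) *\<^sub>R iter_partial \<alpha>s \<phi> (x + t *\<^sub>R axis \<alpha> 1)) has_vector_derivative
        (f x *\<^sub>R iter_partial (\<alpha> # \<alpha>s) \<phi> x + partial \<alpha> f x *\<^sub>R iter_partial \<alpha>s \<phi> x)) (at 0)"
      by simp
  qed
next
  case (smul_const f c)
  note D = smooth_expr_partial(1)[OF smul_const, of _ \<alpha>] smooth_expr_partial(2)[OF smul_const, of \<alpha>]
  show ?case
  proof (intro exI[of _ "\<lambda>x. partial \<alpha> f x *\<^sub>R c"] conjI ballI)
    show "smooth_comb \<phi> (\<lambda>x. partial \<alpha> f x *\<^sub>R c)" using D by (intro smooth_comb.intros)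
    fix x
    show "((\<lambda>t. f (x + t *\<^sub>R axis \<alpha> 1) *\<^sub>R c) has_vector_derivative partial \<alpha> f x *\<^sub>R c) (at 0)"
      using has_vector_derivative_smul[OF D(1)[of x] has_vector_derivative_const, of c] by simp
  qed
next
  case (comb_add \<psi> \<xi>)
  then obtain \<psi>' \<xi>' where D: "smooth_comb \<phi> \<psi>'" "smooth_comb \<phi> \<xi>'"
    "\<forall>x\<in>\<Omega>. ((\<lambda>t. \<psi> (x + t *\<^sub>R axis \<alpha> 1)) has_vector_derivative \<psi>' x) (at 0)"
    "\<forall>x\<in>\<Omega>. ((\<lambda>t. \<xi> (x + t *\<^sub>R axis \<alpha> 1)) has_vector_derivative \<xi>' x) (at 0)" by blast
  then show ?case
    by (intro exI[of _ "\<lambda>x. \<psi>' x + \<xi>' x"]) (auto intro!: smooth_comb.comb_add has_vector_derivative_add)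
qed

text \<open>Iterated partial derivatives are identified only on \<open>\<Omega>\<close>; agreement
  on an open set suffices for the next derivative.\<close>

lemma has_vector_derivative_line_cong:
  fixes f g :: "real^'d \<Rightarrow> 'b::real_normed_vector"
  assumes "open \<Omega>" "x \<in> \<Omega>" "\<And>y. y \<in> \<Omega> \<Longrightarrow> f y = g y"
    and "((\<lambda>t. f (x + t *\<^sub>R axis \<alpha> 1)) has_vector_derivative D) (at 0)"
  shows "((\<lambda>t. g (x + t *\<^sub>R axis \<alpha> 1)) has_vector_derivative D) (at 0)"
proof (rule has_vector_derivative_transform_within_open[OF assms(4)])
  show "open ((\<lambda>t::real. x + t *\<^sub>R axis \<alpha> 1) -` \<Omega>)"
    using assms(1) by (intro open_vimage continuous_intros) auto
qed (use assms in auto)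

text \<open>By induction on the list of directions, every iterated partial derivative of
  \<open>\<psi>\<close> agrees on \<open>\<Omega>\<close> with a member of the class, which is
  continuous and differentiable along the axes.\<close>

lemma smooth_on_smooth_comb:
  assumes \<Omega>: "open \<Omega>" "smooth_on \<Omega> \<phi>" and \<psi>: "smooth_comb \<phi> \<psi>"
  shows "smooth_on \<Omega> \<psi>"
proof -
  have rep: "\<exists>\<xi>. smooth_comb \<phi> \<xi> \<and> (\<forall>x\<in>\<Omega>. iter_partial \<alpha>s \<psi> x = \<xi> x)" for \<alpha>s
  proof (induction \<alpha>s)
    case Nil
    show ?case using \<psi> by auto
  next
    case (Cons \<alpha> \<alpha>s)
    then obtain \<xi> where \<xi>: "smooth_comb \<phi> \<xi>" "\<And>x. x \<in> \<Omega> \<Longrightarrow> iter_partial \<alpha>s \<psi> x = \<xi> x" by blast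
    obtain \<xi>' where \<xi>': "smooth_comb \<phi> \<xi>'" "\<And>x. x \<in> \<Omega> \<Longrightarrow> ((\<lambda>t. \<xi> (x + t *\<^sub>R axis \<alpha> 1)) has_vector_derivative \<xi>' x) (at 0)"
      using smooth_comb_derivative[OF \<Omega>(2) \<xi>(1)] by blast
    have "iter_partial (\<alpha> # \<alpha>s) \<psi> x = \<xi>' x" if x: "x \<in> \<Omega>" for x
      using has_vector_derivative_line_cong[OF \<Omega>(1) x \<xi>(2)[symmetric] \<xi>'(2)[OF x]]
      by (simp add: partial_def vector_derivative_at)
    then show ?case using \<xi>'(1) by blast
  qed
  show ?thesis unfolding smooth_on_def
  proof (intro allI conjI ballI)
    fix \<alpha>s
    obtain \<xi> where \<xi>: "smooth_comb \<phi> \<xi>" "\<And>x. x \<in> \<Omega> \<Longrightarrow> iter_partial \<alpha>s \<psi> x = \<xi> x" using rep by blast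
    show "continuous_on \<Omega> (iter_partial \<alpha>s \<psi>)"
      using smooth_comb_continuous[OF \<Omega>(2) \<xi>(1)] \<xi>(2) by (simp cong: continuous_on_cong)
    fix \<alpha> x assume x: "x \<in> \<Omega>"
    obtain \<xi>' where \<xi>': "\<And>x. x \<in> \<Omega> \<Longrightarrow> ((\<lambda>t. \<xi> (x + t *\<^sub>R axis \<alpha> 1)) has_vector_derivative \<xi>' x) (at 0)"
      using smooth_comb_derivative[OF \<Omega>(2) \<xi>(1)] by blast
    show "(\<lambda>t. iter_partial \<alpha>s \<psi> (x + t *\<^sub>R axis \<alpha> 1)) differentiable at 0"
      using has_vector_derivative_line_cong[OF \<Omega>(1) x \<xi>(2)[symmetric] \<xi>'[OF x]] by (rule differentiableI_vector)
  qed
qed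

section \<open>The radial cutoff and the test functions\<close>

lemma norm_sq_real_vec: "(norm (x::real^'d))\<^sup>2 = (\<Sum>i\<in>UNIV. (x $ i)\<^sup>2)"
  by (simp add: norm_vec_def L2_set_def sum_nonneg)

text \<open>One minus the squared relative distance to the centre, spelled with sums and products
  only to match the constructors of \<open>smooth_expr\<close>.\<close>

definition cutoff_arg :: "real^'d \<Rightarrow> real \<Rightarrow> real^'d \<Rightarrow> real" where
  "cutoff_arg z \<rho> x = 1 + (- (1 / \<rho>\<^sup>2)) * (\<Sum>i\<in>UNIV. (x $ i + (- (z $ i))) * (x $ i + (- (z $ i))))"

definition cutoff :: "real^'d \<Rightarrow> real \<Rightarrow> real^'d \<Rightarrow> real" where
  "cutoff z \<rho> x = flat_exp 0 (cutoff_arg z \<rho> x)"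

lemma cutoff_arg_eq: "cutoff_arg z \<rho> x = 1 - (norm (x - z))\<^sup>2 / \<rho>\<^sup>2"
  unfolding cutoff_arg_def norm_sq_real_vec by (simp add: power2_eq_square)

lemma smooth_expr_cutoff: "smooth_expr (cutoff (z::real^'d) \<rho>)"
proof -
  have "smooth_expr (\<lambda>x::real^'d. x $ i + (- (z $ i)))" for i
    by (rule smooth_expr.add[OF smooth_expr.coord smooth_expr.const])
  then have "smooth_expr (\<lambda>x::real^'d. (x $ i + (- (z $ i))) * (x $ i + (- (z $ i))))" for i
    by (intro smooth_expr.mult)
  then have "smooth_expr (\<lambda>x::real^'d. \<Sum>i\<in>UNIV. (x $ i + (- (z $ i))) * (x $ i + (- (z $ i))))"
    by (intro smooth_expr_sum) auto
  then have "smooth_expr (\<lambda>x. 1 + (- (1 / \<rho>\<^sup>2)) * (\<Sum>i\<in>UNIV. (x $ i + (- (z $ i))) * (x $ i + (- (z $ i)))))"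
    by (intro smooth_expr.add[OF smooth_expr.const] smooth_expr.mult[OF smooth_expr.const])
  then have "smooth_expr (cutoff_arg z \<rho>)" unfolding cutoff_arg_def[abs_def] .
  then show ?thesis unfolding cutoff_def[abs_def] by (rule smooth_expr.flat)
qed

lemma partial_cutoff: "partial \<beta> (cutoff z \<rho>) x = flat_exp 2 (cutoff_arg z \<rho> x) * (- (2 / \<rho>\<^sup>2) * (x $ \<beta> - z $ \<beta>))"
proof -
  let ?g = "\<lambda>t. \<Sum>i\<in>UNIV. ((x + t *\<^sub>R axis \<beta> 1) $ i + (- (z $ i))) * ((x + t *\<^sub>R axis \<beta> 1) $ i + (- (z $ i)))"
  have "(?g has_real_derivative (\<Sum>i\<in>UNIV. if i = \<beta> then 2 * (x $ i - z $ i) else 0)) (at 0)"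
    by (rule DERIV_sum) (auto intro!: derivative_eq_intros simp: axis_def)
  then have "(?g has_real_derivative (2 * (x $ \<beta> - z $ \<beta>))) (at 0)" by simp
  then have "((\<lambda>t. 1 + (- (1 / \<rho>\<^sup>2)) * ?g t) has_real_derivative (0 + (- (1 / \<rho>\<^sup>2)) * (2 * (x $ \<beta> - z $ \<beta>)))) (at 0)"
    by (intro DERIV_add DERIV_const DERIV_cmult)
  then have "((\<lambda>t. cutoff_arg z \<rho> (x + t *\<^sub>R axis \<beta> 1)) has_real_derivative (- (2 / \<rho>\<^sup>2) * (x $ \<beta> - z $ \<beta>))) (at 0)"
    unfolding cutoff_arg_def by simp
  from DERIV_chain2[OF DERIV_flat_exp[of 0] this]
  have "((\<lambda>t. cutoff z \<rho> (x + t *\<^sub>R axis \<beta> 1)) has_real_derivative flat_exp 2 (cutoff_arg z \<rho> x) * (- (2 / \<rho>\<^sup>2) * (x $ \<beta> - z $ \<beta>))) (at 0)"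
    by (simp add: cutoff_def numeral_2_eq_2)
  then show ?thesis unfolding partial_def
    by (intro vector_derivative_at) (simp add: has_real_derivative_iff_has_vector_derivative)
qed

definition cutoff_grad :: "real^'d \<Rightarrow> real \<Rightarrow> real^'d \<Rightarrow> real^'d" where
  "cutoff_grad z \<rho> x = (\<chi> \<beta>. partial \<beta> (cutoff z \<rho>) x)"

lemma cutoff_arg_nonpos: "0 < \<rho> \<Longrightarrow> x \<notin> ball z \<rho> \<Longrightarrow> cutoff_arg z \<rho> x \<le> 0"
proof -
  assume "0 < \<rho>" "x \<notin> ball z \<rho>"
  then have "\<rho> \<le> norm (x - z)" by (simp add: dist_norm norm_minus_commute)
  then have "\<rho>\<^sup>2 \<le> (norm (x - z))\<^sup>2" using \<open>0 < \<rho>\<close> by (intro power_mono) auto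
  then show ?thesis using \<open>0 < \<rho>\<close> by (simp add: cutoff_arg_eq)
qed

lemma cutoff_outside: "0 < \<rho> \<Longrightarrow> x \<notin> ball z \<rho> \<Longrightarrow> cutoff z \<rho> x = 0"
  using cutoff_arg_nonpos by (auto simp: cutoff_def flat_exp_def not_less)

lemma cutoff_grad_outside: "0 < \<rho> \<Longrightarrow> x \<notin> ball z \<rho> \<Longrightarrow> cutoff_grad z \<rho> x = 0"
  using cutoff_arg_nonpos[of \<rho> x z] by (auto simp: cutoff_grad_def partial_cutoff flat_exp_def vec_eq_iff)

lemma cutoff_bounds: "0 \<le> cutoff z \<rho> x" "cutoff z \<rho> x \<le> 1"
  by (auto simp: cutoff_def flat_exp_def)

lemma cutoff_lower:
  assumes "0 < \<rho>" "x \<in> ball z (\<rho> / 2)"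
  shows "exp (- 2) \<le> cutoff z \<rho> x"
proof -
  have "norm (x - z) \<le> \<rho> / 2" using assms by (simp add: dist_norm norm_minus_commute)
  then have "(norm (x - z))\<^sup>2 \<le> (\<rho> / 2)\<^sup>2" by (intro power_mono) auto
  then have "(norm (x - z))\<^sup>2 / \<rho>\<^sup>2 \<le> 1/4" using assms(1) by (simp add: field_simps)
  \<comment> \<open>The true bound on the half ball is 3/4; 1/2 gives the round value
    \<open>exp (- 2)\<close>.\<close>
  then have q: "1/2 \<le> cutoff_arg z \<rho> x" unfolding cutoff_arg_eq by linarith
  then have "1 / cutoff_arg z \<rho> x \<le> 2" by (simp add: field_simps)
  then show ?thesis using q by (simp add: cutoff_def flat_exp_def)
qed

lemma norm_cutoff_grad:
  assumes "0 < \<rho>"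
  shows "norm (cutoff_grad z \<rho> x) \<le> 4 / \<rho>"
proof (cases "x \<in> ball z \<rho>")
  case False
  then have "cutoff_grad z \<rho> x = 0" by (rule cutoff_grad_outside[OF assms])
  then show ?thesis using assms by simp
next
  case True
  let ?e = "flat_exp 2 (cutoff_arg z \<rho> x)"
  \<comment> \<open>\<open>flat_exp_le\<close> with \<open>k = 0\<close> gives the bound
    \<open>fact 2\<close>, the source of the constant 4.\<close>
  have e: "0 \<le> ?e" "?e \<le> 2"
    using flat_exp_nonneg flat_exp_le[of "cutoff_arg z \<rho> x" 2 0] by (auto simp: fact_numeral flat_exp_def)
  have "cutoff_grad z \<rho> x = (- (?e * (2 / \<rho>\<^sup>2))) *\<^sub>R (x - z)"
    by (simp add: cutoff_grad_def partial_cutoff vec_eq_iff)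
  then have "norm (cutoff_grad z \<rho> x) = ?e * (2 / \<rho>\<^sup>2) * norm (x - z)" using e by simp
  also have "\<dots> \<le> 2 * (2 / \<rho>\<^sup>2) * \<rho>"
    using e True assms by (intro mult_mono mult_right_mono) (auto simp: dist_norm norm_minus_commute)
  finally show ?thesis using assms by (simp add: power2_eq_square)
qed

text \<open>The rank-one matrix in the product rule when the derivative falls on the cutoff.\<close>

definition outer_prod :: "complex^'n \<Rightarrow> real^'d \<Rightarrow> complex^'d^'n" where
  "outer_prod w d = (\<chi> j \<beta>. (w $ j) * of_real (d $ \<beta>))"

lemma norm_mult_outer_prod: "norm (A ** outer_prod w d) = norm (A *v w) * norm d" for A :: "complex^'n^'n"
proof -
  have eq: "A ** outer_prod w d = outer_prod (A *v w) d"
    by (simp add: outer_prod_def matrix_matrix_mult_def matrix_vector_mult_def vec_eq_iff sum_distrib_right mult.assoc)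
  have "(norm (outer_prod v d))\<^sup>2 = (norm v * norm d)\<^sup>2" for v :: "complex^'n"
    by (simp add: norm_matrix_sq outer_prod_def norm_mult power_mult_distrib norm_cvec_sq norm_sq_real_vec sum_product)
  then show ?thesis unfolding eq by (metis mult_nonneg_nonneg norm_ge_zero power2_eq_iff_nonneg)
qed

text \<open>The squared cutoff leaves one factor \<open>cutoff z \<rho>\<close> on the term with its
  gradient, as Young's inequality requires for absorption. \<open>\<phi>\<close> will be a smooth
  approximant of the solution, which makes this an admissible test function.\<close>

definition cutoff_test :: "real^'d \<Rightarrow> real \<Rightarrow> (real^'d \<Rightarrow> complex^'n) \<Rightarrow> complex^'n \<Rightarrow> real^'d \<Rightarrow> complex^'n" where
  "cutoff_test z \<rho> \<phi> c x = (cutoff z \<rho> x * cutoff z \<rho> x) *\<^sub>R (\<phi> x - c)"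

lemma smooth_on_cutoff_test:
  assumes "open \<Omega>" "smooth_on \<Omega> \<phi>"
  shows "smooth_on \<Omega> (cutoff_test z \<rho> \<phi> c)"
proof -
  let ?\<eta> = "\<lambda>x. cutoff z \<rho> x * cutoff z \<rho> x"
  have \<eta>: "smooth_expr ?\<eta>" by (intro smooth_expr.mult smooth_expr_cutoff)
  have "smooth_comb \<phi> (\<lambda>x. ?\<eta> x *\<^sub>R iter_partial [] \<phi> x + ?\<eta> x *\<^sub>R (- c))"
    by (intro smooth_comb.comb_add smooth_comb.smul[OF \<eta>] smooth_comb.smul_const[OF \<eta>])
  moreover have "(\<lambda>x. ?\<eta> x *\<^sub>R iter_partial [] \<phi> x + ?\<eta> x *\<^sub>R (- c)) = cutoff_test z \<rho> \<phi> c"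
    by (auto simp: cutoff_test_def fun_eq_iff scaleR_diff_right)
  ultimately show ?thesis using smooth_on_smooth_comb[OF assms] by metis
qed

lemma test_fun_cutoff_test:
  assumes "open \<Omega>" "smooth_on \<Omega> \<phi>" "0 < \<rho>" "cball z \<rho> \<subseteq> \<Omega>"
  shows "test_fun \<Omega> (cutoff_test z \<rho> \<phi> c)"
proof -
  have "{x. cutoff_test z \<rho> \<phi> c x \<noteq> 0} \<subseteq> cball z \<rho>"
  proof
    fix x assume "x \<in> {x. cutoff_test z \<rho> \<phi> c x \<noteq> 0}"
    then have "cutoff z \<rho> x \<noteq> 0" by (auto simp: cutoff_test_def)
    then have "x \<in> ball z \<rho>" using cutoff_outside[OF assms(3)] by blast
    then show "x \<in> cball z \<rho>" by auto
  qed
  then have sub: "closure {x. cutoff_test z \<rho> \<phi> c x \<noteq> 0} \<subseteq> cball z \<rho>" by (intro closure_minimal) auto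
  then have "compact (closure {x. cutoff_test z \<rho> \<phi> c x \<noteq> 0})"
    by (meson bounded_cball bounded_subset closed_closure compact_eq_bounded_closed)
  then show ?thesis unfolding test_fun_def using smooth_on_cutoff_test[OF assms(1,2)] sub assms(4) by auto
qed

lemma grad_cutoff_test:
  assumes "smooth_on \<Omega> \<phi>" "x \<in> \<Omega>"
  shows "grad (cutoff_test z \<rho> \<phi> c) x = (cutoff z \<rho> x)\<^sup>2 *\<^sub>R grad \<phi> x
    + (2 * cutoff z \<rho> x) *\<^sub>R outer_prod (\<phi> x - c) (cutoff_grad z \<rho> x)"
proof -
  have "partial \<beta> (cutoff_test z \<rho> \<phi> c) x = (cutoff z \<rho> x)\<^sup>2 *\<^sub>R partial \<beta> \<phi> x + (2 * cutoff z \<rho> x * partial \<beta> (cutoff z \<rho>) x) *\<^sub>R (\<phi> x - c)" for \<beta>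
  proof -
    let ?l = "\<lambda>t. x + t *\<^sub>R axis \<beta> (1::real)"
    have 1: "((\<lambda>t. cutoff z \<rho> (?l t)) has_real_derivative partial \<beta> (cutoff z \<rho>) x) (at 0)"
      by (rule smooth_expr_partial(1)[OF smooth_expr_cutoff])
    have 2: "((\<lambda>t. cutoff z \<rho> (?l t) * cutoff z \<rho> (?l t)) has_real_derivative 2 * cutoff z \<rho> x * partial \<beta> (cutoff z \<rho>) x) (at 0)"
      using DERIV_mult[OF 1 1] by (simp add: mult_ac)
    have "(\<lambda>t. \<phi> (?l t)) differentiable (at 0)"
      using assms unfolding smooth_on_def by (metis iter_partial.simps(1))
    then have "((\<lambda>t. \<phi> (?l t)) has_vector_derivative partial \<beta> \<phi> x) (at 0)"
      by (simp add: partial_def vector_derivative_works)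
    then have 3: "((\<lambda>t. \<phi> (?l t) - c) has_vector_derivative partial \<beta> \<phi> x) (at 0)"
      by (auto intro!: derivative_eq_intros)
    have "((\<lambda>t. cutoff_test z \<rho> \<phi> c (?l t)) has_vector_derivative
      (cutoff z \<rho> x)\<^sup>2 *\<^sub>R partial \<beta> \<phi> x + (2 * cutoff z \<rho> x * partial \<beta> (cutoff z \<rho>) x) *\<^sub>R (\<phi> x - c)) (at 0)"
      using has_vector_derivative_smul[OF 2 3] unfolding cutoff_test_def by (simp add: power2_eq_square)
    then show ?thesis unfolding partial_def[of \<beta> "cutoff_test z \<rho> \<phi> c"] by (rule vector_derivative_at)
  qed
  then show ?thesis
    by (simp add: grad_def outer_prod_def cutoff_grad_def vec_eq_iff scaleR_conv_of_real[where 'a=complex])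
qed

section \<open>The bilinear form and the matrix pairing\<close>

lemma bilin_add_right: "bilin A x \<nu> (\<eta> + \<xi>) = bilin A x \<nu> \<eta> + bilin A x \<nu> \<xi>"
  by (simp add: bilin_def sum.distrib distrib_left)

lemma bilin_scaleR_right: "bilin A x \<nu> (r *\<^sub>R \<eta>) = r *\<^sub>R bilin A x \<nu> \<eta>"
  by (simp add: bilin_def scaleR_sum_right)

text \<open>The Hilbert-Schmidt pairing, which is the integrand on the data side of
  \<open>weak_solution\<close>.\<close>

definition frob :: "complex^'d^'n \<Rightarrow> complex^'d^'n \<Rightarrow> complex" where
  "frob F X = (\<Sum>i\<in>UNIV. \<Sum>\<alpha>\<in>UNIV. F $ i $ \<alpha> * cnj (X $ i $ \<alpha>))"

lemma sum_UNIV_prod: "(\<Sum>i\<in>UNIV. \<Sum>j\<in>UNIV. f i j) = (\<Sum>p\<in>UNIV. f (fst p) (snd p))"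
  by (subst sum.cartesian_product) (simp add: case_prod_unfold)

lemma cmod_frob_le: "cmod (frob F X) \<le> norm F * norm X"
proof -
  have "(cmod (frob F X))\<^sup>2 = (cmod (\<Sum>p\<in>UNIV. F $ fst p $ snd p * cnj (X $ fst p $ snd p)))\<^sup>2"
    unfolding frob_def sum_UNIV_prod ..
  also have "\<dots> \<le> (\<Sum>p\<in>UNIV. (cmod (F $ fst p $ snd p))\<^sup>2) * (\<Sum>p\<in>UNIV. (cmod (cnj (X $ fst p $ snd p)))\<^sup>2)"
    by (rule cmod_sum_mult_le)
  also have "\<dots> = (norm F * norm X)\<^sup>2"
    unfolding power_mult_distrib norm_matrix_sq sum_UNIV_prod by simp
  finally show ?thesis by (rule power2_le_imp_le) simp
qed

lemma frob_hermitian: "hermitian A \<Longrightarrow> frob (A ** Y) X = frob Y (A ** X)"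
proof -
  assume A: "hermitian A"
  have "frob (A ** Y) X = (\<Sum>i\<in>UNIV. \<Sum>\<alpha>\<in>UNIV. \<Sum>k\<in>UNIV. A $ i $ k * Y $ k $ \<alpha> * cnj (X $ i $ \<alpha>))"
    by (simp add: frob_def matrix_matrix_mult_def sum_distrib_right)
  also have "\<dots> = (\<Sum>k\<in>UNIV. \<Sum>\<alpha>\<in>UNIV. \<Sum>i\<in>UNIV. A $ i $ k * Y $ k $ \<alpha> * cnj (X $ i $ \<alpha>))"
    by (subst sum.swap, subst (2) sum.swap, subst sum.swap) simp
  also have "\<dots> = (\<Sum>k\<in>UNIV. \<Sum>\<alpha>\<in>UNIV. \<Sum>i\<in>UNIV. Y $ k $ \<alpha> * cnj (A $ k $ i * X $ i $ \<alpha>))"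
  proof (intro sum.cong refl)
    fix k \<alpha> i
    show "A $ i $ k * Y $ k $ \<alpha> * cnj (X $ i $ \<alpha>) = Y $ k $ \<alpha> * cnj (A $ k $ i * X $ i $ \<alpha>)"
      using hermitianD[OF A, of i k] by simp
  qed
  also have "\<dots> = frob Y (A ** X)" by (simp add: frob_def matrix_matrix_mult_def sum_distrib_left)
  finally show ?thesis .
qed

section \<open>Caccioppoli inequality\<close>

text \<open>The weak formulation enters the energy estimate as the function \<open>Z\<close> of mean
  zero. If the integral of \<open>R\<close> is infinite there is nothing to show; otherwise
  \<open>Lf\<close> is dominated by an integrable function and the inequality may be
  integrated.\<close>

lemma nn_integral_le_of_zero_mean:
  fixes Z R Lf :: "'a \<Rightarrow> real"
  assumes Z: "integrable M Z" "integral\<^sup>L M Z = 0"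
    and [measurable]: "R \<in> borel_measurable M" "Lf \<in> borel_measurable M"
    and R0: "\<And>x. 0 \<le> R x" and L0: "\<And>x. 0 \<le> Lf x"
    and le: "AE x in M. Lf x \<le> Z x + R x"
  shows "(\<integral>\<^sup>+x. ennreal (Lf x) \<partial>M) \<le> (\<integral>\<^sup>+x. ennreal (R x) \<partial>M)"
proof (cases "(\<integral>\<^sup>+x. ennreal (R x) \<partial>M) < \<infinity>")
  case True
  have Ri: "integrable M R" using True R0 by (intro integrableI_nonneg) auto
  have Li: "integrable M Lf"
  proof (rule Bochner_Integration.integrable_bound)
    show "integrable M (\<lambda>x. Z x + R x)" using Z Ri by simp
    show "AE x in M. norm (Lf x) \<le> norm (Z x + R x)" using le by eventually_elim (use L0 in auto)
  qed simp
  have "integral\<^sup>L M Lf \<le> integral\<^sup>L M (\<lambda>x. Z x + R x)"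
    using Li Z(1) Ri le by (intro integral_mono_AE) auto
  also have "\<dots> = integral\<^sup>L M R" using Z Ri by simp
  finally show ?thesis
    using Li Ri L0 R0 by (simp add: nn_integral_eq_integral ennreal_leI)
qed (simp add: not_less top_unique)

lemma young_le: "0 < k \<Longrightarrow> a * b \<le> k * a\<^sup>2 + b\<^sup>2 / (4 * k)" for a b k :: real
proof -
  assume k: "0 < k"
  have "0 \<le> (2 * k * a - b)\<^sup>2" by simp
  also have "\<dots> = 4 * k * (k * a\<^sup>2 + b\<^sup>2 / (4 * k) - a * b)" using k by (simp add: power2_eq_square field_simps)
  finally show ?thesis using k by (simp add: zero_le_mult_iff)
qed

text \<open>\<open>e\<close> is the cutoff, \<open>g\<close> the weighted gradient, \<open>f\<close>
  the data, \<open>d\<close> the approximation error and \<open>u\<close> the weighted oscillation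
  divided by the radius. The terms pairing \<open>f\<close> or \<open>u\<close> with
  \<open>e * g\<close> take c1/4 each of the elliptic term. The product of \<open>g\<close> and
  \<open>d\<close> leaves \<open>\<theta> * g\<^sup>2\<close> without the cutoff, which is absorbed
  only later, through the level.\<close>

lemma caccioppoli_young:
  fixes e g f d u c1 C2 \<theta> :: real
  assumes e: "0 \<le> e" "e \<le> 1" and nn: "0 \<le> g" "0 \<le> f" "0 \<le> d" "0 \<le> u" and c: "0 < c1" "0 \<le> C2" "0 < \<theta>"
  shows "C2 * g * (e\<^sup>2 * d + 8 * e * u) + f * (e\<^sup>2 * g + e\<^sup>2 * d + 8 * e * u)
    \<le> c1 / 2 * (e\<^sup>2 * g\<^sup>2) + ((1 / c1 + 2) * f\<^sup>2 + (1 + C2\<^sup>2 / (4 * \<theta>)) * d\<^sup>2 + \<theta> * g\<^sup>2 + (16 + 64 * C2\<^sup>2 / c1) * u\<^sup>2)"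
proof -
  have e2: "e\<^sup>2 \<le> 1" using e by (simp add: power_le_one)
  have 1: "f * (e\<^sup>2 * g) \<le> c1 / 4 * (e\<^sup>2 * g\<^sup>2) + f\<^sup>2 / c1"
  proof -
    have "(e * g) * (e * f) \<le> c1 / 4 * (e * g)\<^sup>2 + (e * f)\<^sup>2 / (4 * (c1 / 4))" using c by (intro young_le) auto
    moreover have "(e * f)\<^sup>2 \<le> f\<^sup>2" using e2 mult_right_mono[of "e\<^sup>2" 1 "f\<^sup>2"] by (simp add: power_mult_distrib)
    then have "(e * f)\<^sup>2 / c1 \<le> f\<^sup>2 / c1" using c by (intro divide_right_mono) auto
    ultimately show ?thesis by (simp add: power_mult_distrib power2_eq_square mult_ac)
  qed
  have 2: "f * (e\<^sup>2 * d) \<le> f\<^sup>2 + d\<^sup>2"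
  proof -
    have "f * (e\<^sup>2 * d) \<le> f * (1 * d)" using e2 nn by (intro mult_left_mono mult_right_mono) auto
    also have "\<dots> \<le> f\<^sup>2 + d\<^sup>2"
    proof -
      have "2 * (f * d) \<le> f\<^sup>2 + d\<^sup>2" using sum_squares_bound[of f d] by (simp add: mult.assoc)
      moreover have "0 \<le> f * d" using nn by simp
      ultimately show ?thesis by simp
    qed
    finally show ?thesis .
  qed
  have 3: "f * (8 * e * u) \<le> f\<^sup>2 + 16 * u\<^sup>2"
  proof -
    have "f * (8 * e * u) \<le> f * (8 * 1 * u)" using e nn by (intro mult_left_mono mult_right_mono) auto
    also have "\<dots> \<le> f\<^sup>2 + (4 * u)\<^sup>2" using sum_squares_bound[of f "4 * u"] by simp
    finally show ?thesis by (simp add: power_mult_distrib)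
  qed
  have 4: "C2 * g * (e\<^sup>2 * d) \<le> \<theta> * g\<^sup>2 + C2\<^sup>2 / (4 * \<theta>) * d\<^sup>2"
  proof -
    have "C2 * g * (e\<^sup>2 * d) \<le> C2 * g * (1 * d)" using e2 nn c by (intro mult_left_mono mult_right_mono) auto
    also have "\<dots> = g * (C2 * d)" by simp
    also have "\<dots> \<le> \<theta> * g\<^sup>2 + (C2 * d)\<^sup>2 / (4 * \<theta>)" using c by (intro young_le)
    finally show ?thesis by (simp add: power_mult_distrib)
  qed
  have 5: "C2 * g * (8 * e * u) \<le> c1 / 4 * (e\<^sup>2 * g\<^sup>2) + 64 * C2\<^sup>2 / c1 * u\<^sup>2"
  proof -
    have "(e * g) * (8 * C2 * u) \<le> c1 / 4 * (e * g)\<^sup>2 + (8 * C2 * u)\<^sup>2 / (4 * (c1 / 4))" using c by (intro young_le) auto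
    then show ?thesis by (simp add: power_mult_distrib mult_ac)
  qed
  show ?thesis using 1 2 3 4 5 by (simp add: distrib_left distrib_right)
qed

lemma borel_measurable_vec_component[measurable (raw)]:
  fixes f :: "'a \<Rightarrow> 'b::real_normed_vector^'n"
  assumes "f \<in> borel_measurable M"
  shows "(\<lambda>x. f x $ i) \<in> borel_measurable M"
  using measurable_compose[OF assms borel_measurable_continuous_onI[of "\<lambda>v. v $ i"]] by (simp add: continuous_on_component)

lemma borel_measurable_cnj[measurable (raw)]:
  assumes "f \<in> borel_measurable M"
  shows "(\<lambda>x. cnj (f x)) \<in> borel_measurable M"
  using measurable_compose[OF assms borel_measurable_continuous_onI[of cnj]] by (simp add: continuous_on_cnj)

lemma continuous_on_outer_prod: "continuous_on UNIV (\<lambda>p. outer_prod (fst p) (snd p))"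
  unfolding outer_prod_def by (intro continuous_on_vec_lambda continuous_intros)

lemma borel_measurable_outer_prod[measurable (raw)]:
  fixes w :: "'a \<Rightarrow> complex^'n" and d :: "'a \<Rightarrow> real^'d"
  assumes "w \<in> borel_measurable M" "d \<in> borel_measurable M"
  shows "(\<lambda>x. outer_prod (w x) (d x)) \<in> borel_measurable M"
  by (rule borel_measurable_continuous_Pair[OF assms continuous_on_outer_prod])

lemma borel_measurable_cutoff[measurable]: "cutoff z \<rho> \<in> borel_measurable borel"
  by (rule borel_measurable_continuous_onI[OF smooth_expr_continuous[OF smooth_expr_cutoff]])

lemma borel_measurable_cutoff_grad[measurable]: "cutoff_grad z \<rho> \<in> borel_measurable borel"
  unfolding cutoff_grad_def[abs_def]
  by (intro borel_measurable_continuous_onI continuous_on_vec_lambda smooth_expr_continuous smooth_expr_partial(2) smooth_expr_cutoff)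

context A2_pair_vec
begin

text \<open>Insert \<open>P x ** N x = mat 1\<close> in front of \<open>F\<close> and move the
  hermitian \<open>P x\<close> to the other argument.\<close>

lemma frob_le: "cmod (frob F X) \<le> norm (N x ** F) * norm (P x ** X)"
proof -
  have "F = P x ** (N x ** F)" by (simp add: matrix_mul_assoc PN)
  then have "frob F X = frob (N x ** F) (P x ** X)" using frob_hermitian[OF herm_P] by metis
  then show ?thesis using cmod_frob_le by metis
qed

text \<open>Since the test function is built from \<open>\<phi>\<close> and not from the solution,
  its gradient is split as \<open>\<eta>\<^sup>2\<close> times \<open>G\<close> plus a remainder.
  Ellipticity acts on the first part; the remainder consists of the approximation error and the
  gradient of the cutoff, and (E2) with Young's inequality controls it. The constant
  \<open>c\<close> stays free for the Poincare inequality.\<close>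

lemma caccioppoli_ball:
  fixes A :: "'d \<Rightarrow> 'd \<Rightarrow> 'n \<Rightarrow> 'n \<Rightarrow> real^'d \<Rightarrow> complex" and G F :: "real^'d \<Rightarrow> complex^'d^'n" and \<phi> :: "real^'d \<Rightarrow> complex^'n"
  assumes \<Omega>: "open \<Omega>" and sm: "smooth_on \<Omega> \<phi>" and \<rho>: "0 < \<rho>" and sub: "cball z \<rho> \<subseteq> \<Omega>"
    and Am: "\<And>\<alpha> \<beta> i j. set_borel_measurable lebesgue \<Omega> (A \<alpha> \<beta> i j)"
    and Gm[measurable]: "G \<in> borel_measurable borel" and Fm[measurable]: "F \<in> borel_measurable borel"
    and c1: "0 < c1" and ell1: "AE x in lebesgue. x \<in> \<Omega> \<longrightarrow> (\<forall>\<eta>. c1 * (norm (P x ** \<eta>))\<^sup>2 \<le> Re (bilin A x \<eta> \<eta>))"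
    and C2: "0 \<le> C2" and ell2: "AE x in lebesgue. x \<in> \<Omega> \<longrightarrow> (\<forall>\<eta> \<nu>. cmod (bilin A x \<nu> \<eta>) \<le> C2 * norm (P x ** \<eta>) * norm (P x ** \<nu>))"
    and weak: "weak_solution \<Omega> A G F"
    and fin: "(\<integral>\<^sup>+x\<in>ball z \<rho>. ennreal ((norm (P x ** G x))\<^sup>2) \<partial>lborel) < \<infinity>"
      "(\<integral>\<^sup>+x\<in>ball z \<rho>. ennreal ((norm (N x ** F x))\<^sup>2) \<partial>lborel) < \<infinity>"
      "(\<integral>\<^sup>+x\<in>ball z \<rho>. ennreal ((norm (P x ** (G x - grad \<phi> x)))\<^sup>2) \<partial>lborel) < \<infinity>"
      "(\<integral>\<^sup>+x\<in>ball z \<rho>. ennreal ((norm (P x *v (\<phi> x - c)))\<^sup>2) \<partial>lborel) < \<infinity>"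
    and \<theta>: "0 < \<theta>"
  shows "(\<integral>\<^sup>+x\<in>ball z (\<rho>/2). ennreal ((norm (P x ** G x))\<^sup>2) \<partial>lborel) \<le> ennreal (2 * exp 4 / c1) *
    (ennreal (1 / c1 + 2) * (\<integral>\<^sup>+x\<in>ball z \<rho>. ennreal ((norm (N x ** F x))\<^sup>2) \<partial>lborel)
     + ennreal (1 + C2\<^sup>2 / (4 * \<theta>)) * (\<integral>\<^sup>+x\<in>ball z \<rho>. ennreal ((norm (P x ** (G x - grad \<phi> x)))\<^sup>2) \<partial>lborel)
     + ennreal \<theta> * (\<integral>\<^sup>+x\<in>ball z \<rho>. ennreal ((norm (P x ** G x))\<^sup>2) \<partial>lborel)
     + ennreal ((16 + 64 * C2\<^sup>2 / c1) / \<rho>\<^sup>2) * (\<integral>\<^sup>+x\<in>ball z \<rho>. ennreal ((norm (P x *v (\<phi> x - c)))\<^sup>2) \<partial>lborel))"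
proof -
  let ?B = "ball z \<rho>"
  have BO: "?B \<subseteq> \<Omega>" using sub by auto
  define \<phi>B where "\<phi>B x = indicator ?B x *\<^sub>R (\<phi> x - c)" for x
  define DB where "DB x = indicator ?B x *\<^sub>R grad \<phi> x" for x
  have DBm[measurable]: "DB \<in> borel_measurable borel"
    unfolding DB_def using continuous_on_subset[OF smooth_on_continuous_grad[OF sm] BO] by (intro borel_measurable_continuous_on_indicator) auto
  have \<phi>Bm[measurable]: "\<phi>B \<in> borel_measurable borel"
    unfolding \<phi>B_def using continuous_on_subset[OF smooth_on_continuous[OF sm] BO] by (intro borel_measurable_continuous_on_indicator continuous_intros) auto
  define \<eta> where "\<eta> = cutoff z \<rho>"
  have [measurable]: "\<eta> \<in> borel_measurable borel" unfolding \<eta>_def by measurable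
  have \<eta>01: "0 \<le> \<eta> x" "\<eta> x \<le> 1" for x unfolding \<eta>_def by (rule cutoff_bounds)+
  \<comment> \<open>The gradient of the test function by the product rule, with its ingredients cut
    off to the ball so that it is Borel on the whole space.\<close>
  define \<Psi> where "\<Psi> x = (\<eta> x)\<^sup>2 *\<^sub>R DB x + (2 * \<eta> x) *\<^sub>R outer_prod (\<phi>B x) (cutoff_grad z \<rho> x)" for x
  have \<Psi>m[measurable]: "\<Psi> \<in> borel_measurable borel" unfolding \<Psi>_def by measurable
  have \<Psi>_out: "\<Psi> x = 0" "\<eta> x = 0" if "x \<notin> ?B" for x
    using cutoff_outside[OF \<rho> that] unfolding \<Psi>_def \<eta>_def by auto
  have grad\<Psi>: "grad (cutoff_test z \<rho> \<phi> c) x = \<Psi> x" if "x \<in> \<Omega>" for x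
  proof (cases "x \<in> ?B")
    case True
    then show ?thesis unfolding grad_cutoff_test[OF sm that] \<Psi>_def \<eta>_def DB_def \<phi>B_def by simp
  next
    case False
    then show ?thesis unfolding grad_cutoff_test[OF sm that] using \<Psi>_out[OF False] by (simp add: \<eta>_def)
  qed
  define g where "g x = norm (P x ** G x)" for x
  define f where "f x = norm (N x ** F x)" for x
  define d where "d x = norm (P x ** (indicator ?B x *\<^sub>R G x - DB x))" for x
  define v where "v x = norm (P x *v \<phi>B x)" for x
  have [measurable]: "g \<in> borel_measurable borel" "f \<in> borel_measurable borel" "d \<in> borel_measurable borel" "v \<in> borel_measurable borel"
    unfolding g_def f_def d_def v_def by measurable
  have dB: "d x = norm (P x ** (G x - grad \<phi> x))" and vB: "v x = norm (P x *v (\<phi> x - c))" if "x \<in> ?B" for x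
    using that by (auto simp: d_def v_def DB_def \<phi>B_def)
  have nn: "0 \<le> g x" "0 \<le> f x" "0 \<le> d x" "0 \<le> v x" for x by (auto simp: g_def f_def d_def v_def)
  \<comment> \<open>The remainder to which ellipticity does not apply.\<close>
  define X where "X x = \<Psi> x - (\<eta> x)\<^sup>2 *\<^sub>R G x" for x
  have PX: "norm (P x ** X x) \<le> (\<eta> x)\<^sup>2 * d x + 8 * \<eta> x * (v x / \<rho>)" if x: "x \<in> ?B" for x
  proof -
    have "P x ** X x = (- ((\<eta> x)\<^sup>2)) *\<^sub>R (P x ** (G x - grad \<phi> x)) + (2 * \<eta> x) *\<^sub>R (P x ** outer_prod (\<phi> x - c) (cutoff_grad z \<rho> x))"
      unfolding X_def \<Psi>_def DB_def \<phi>B_def using x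
      by (simp add: matrix_mult_diff_right matrix_add_ldistrib matrix_mult_scaleR_right algebra_simps)
    then have "norm (P x ** X x) \<le> (\<eta> x)\<^sup>2 * d x + 2 * \<eta> x * (v x * norm (cutoff_grad z \<rho> x))"
      unfolding dB[OF x] vB[OF x] norm_mult_outer_prod[symmetric]
      using norm_triangle_ineq[of "(- ((\<eta> x)\<^sup>2)) *\<^sub>R (P x ** (G x - grad \<phi> x))" "(2 * \<eta> x) *\<^sub>R (P x ** outer_prod (\<phi> x - c) (cutoff_grad z \<rho> x))"] \<eta>01[of x]
      by simp
    also have "\<dots> \<le> (\<eta> x)\<^sup>2 * d x + 2 * \<eta> x * (v x * (4 / \<rho>))"
      using \<eta>01[of x] nn[of x] norm_cutoff_grad[OF \<rho>] by (intro add_left_mono mult_left_mono) auto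
    finally show ?thesis by simp
  qed
  have P\<Psi>: "norm (P x ** \<Psi> x) \<le> (\<eta> x)\<^sup>2 * g x + ((\<eta> x)\<^sup>2 * d x + 8 * \<eta> x * (v x / \<rho>))" if x: "x \<in> ?B" for x
  proof -
    have "P x ** \<Psi> x = (\<eta> x)\<^sup>2 *\<^sub>R (P x ** G x) + P x ** X x"
      unfolding X_def by (simp add: matrix_mult_diff_right matrix_mult_scaleR_right)
    then have "norm (P x ** \<Psi> x) \<le> (\<eta> x)\<^sup>2 * g x + norm (P x ** X x)"
      using norm_triangle_ineq[of "(\<eta> x)\<^sup>2 *\<^sub>R (P x ** G x)" "P x ** X x"] by (simp add: g_def)
    then show ?thesis using PX[OF x] by linarith
  qed
  \<comment> \<open>The coefficients are only Lebesgue measurable, so the two integrands of the weak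
    formulation are treated over \<open>lebesgue\<close>, while everything else is Borel.\<close>
  define b where "b x = indicator \<Omega> x *\<^sub>R bilin A x (G x) (\<Psi> x)" for x
  define w where "w x = indicator \<Omega> x *\<^sub>R frob (F x) (\<Psi> x)" for x
  have \<Omega>m[measurable]: "\<Omega> \<in> sets borel" using \<Omega> by simp
  have lebI: "h \<in> borel_measurable lebesgue" if "h \<in> borel_measurable borel" for h :: "real^'d \<Rightarrow> 'z::topological_space"
    using that by (intro measurable_completion) simp
  have bm: "b \<in> borel_measurable lebesgue"
  proof -
    have eq: "b = (\<lambda>x. \<Sum>i\<in>UNIV. \<Sum>j\<in>UNIV. \<Sum>\<alpha>\<in>UNIV. \<Sum>\<beta>\<in>UNIV. (indicator \<Omega> x *\<^sub>R A \<alpha> \<beta> i j x) * G x $ j $ \<beta> * cnj (\<Psi> x $ i $ \<alpha>))"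
      unfolding b_def bilin_def by (auto simp: fun_eq_iff scaleR_sum_right)
    have "(\<lambda>x. (indicator \<Omega> x *\<^sub>R A \<alpha> \<beta> i j x) * G x $ j $ \<beta> * cnj (\<Psi> x $ i $ \<alpha>)) \<in> borel_measurable lebesgue" for \<alpha> \<beta> i j
    proof (intro borel_measurable_times)
      show "(\<lambda>x. indicator \<Omega> x *\<^sub>R A \<alpha> \<beta> i j x) \<in> borel_measurable lebesgue" using Am unfolding set_borel_measurable_def .
      show "(\<lambda>x. G x $ j $ \<beta>) \<in> borel_measurable lebesgue" by (rule lebI) measurable
      show "(\<lambda>x. cnj (\<Psi> x $ i $ \<alpha>)) \<in> borel_measurable lebesgue" by (rule lebI) measurable
    qed
    then show ?thesis unfolding eq by (intro borel_measurable_sum)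
  qed
  have wm: "w \<in> borel_measurable lebesgue"
    unfolding w_def frob_def by (rule lebI) measurable
  \<comment> \<open>A common integrable majorant, up to constants, of both integrands of the weak
    formulation: it makes their Bochner integrals genuine rather than default values. The factor 64
    is the square of the 8 in \<open>PX\<close>.\<close>
  define S where "S x = ((g x)\<^sup>2 + (f x)\<^sup>2 + (d x)\<^sup>2 + 64 * (v x / \<rho>)\<^sup>2) * indicator ?B x" for x
  have Sm: "S \<in> borel_measurable borel" unfolding S_def by measurable
  have Ig: "(\<integral>\<^sup>+x\<in>?B. ennreal ((g x)\<^sup>2) \<partial>lborel) < \<infinity>" and If: "(\<integral>\<^sup>+x\<in>?B. ennreal ((f x)\<^sup>2) \<partial>lborel) < \<infinity>"
    using fin(1,2) by (auto simp: g_def f_def)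
  have Ideq: "(\<integral>\<^sup>+x\<in>?B. ennreal ((d x)\<^sup>2) \<partial>lborel) = (\<integral>\<^sup>+x\<in>?B. ennreal ((norm (P x ** (G x - grad \<phi> x)))\<^sup>2) \<partial>lborel)"
    and Iveq: "(\<integral>\<^sup>+x\<in>?B. ennreal ((v x)\<^sup>2) \<partial>lborel) = (\<integral>\<^sup>+x\<in>?B. ennreal ((norm (P x *v (\<phi> x - c)))\<^sup>2) \<partial>lborel)"
    using dB vB by (auto intro!: nn_integral_cong split: split_indicator)
  have lin: "(\<integral>\<^sup>+x. ennreal ((k1 * (f x)\<^sup>2 + k2 * (d x)\<^sup>2 + k3 * (g x)\<^sup>2 + k4 * (v x / \<rho>)\<^sup>2) * indicator ?B x) \<partial>lborel) =
      ennreal k1 * (\<integral>\<^sup>+x\<in>?B. ennreal ((f x)\<^sup>2) \<partial>lborel) + ennreal k2 * (\<integral>\<^sup>+x\<in>?B. ennreal ((d x)\<^sup>2) \<partial>lborel)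
       + ennreal k3 * (\<integral>\<^sup>+x\<in>?B. ennreal ((g x)\<^sup>2) \<partial>lborel) + ennreal (k4 / \<rho>\<^sup>2) * (\<integral>\<^sup>+x\<in>?B. ennreal ((v x)\<^sup>2) \<partial>lborel)"
    if k: "0 \<le> k1" "0 \<le> k2" "0 \<le> k3" "0 \<le> k4" for k1 k2 k3 k4
  proof -
    have "ennreal ((k1 * (f x)\<^sup>2 + k2 * (d x)\<^sup>2 + k3 * (g x)\<^sup>2 + k4 * (v x / \<rho>)\<^sup>2) * indicator ?B x) =
      ennreal k1 * (ennreal ((f x)\<^sup>2) * indicator ?B x) + ennreal k2 * (ennreal ((d x)\<^sup>2) * indicator ?B x)
       + ennreal k3 * (ennreal ((g x)\<^sup>2) * indicator ?B x) + ennreal (k4 / \<rho>\<^sup>2) * (ennreal ((v x)\<^sup>2) * indicator ?B x)" for x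
    proof (cases "x \<in> ?B")
      case True
      have "k4 * (v x / \<rho>)\<^sup>2 = k4 / \<rho>\<^sup>2 * (v x)\<^sup>2" by (simp add: power_divide)
      then show ?thesis using True k by (simp add: ennreal_mult[symmetric] ennreal_plus[symmetric] del: ennreal_plus)
    qed simp
    then show ?thesis by (simp add: nn_integral_add nn_integral_cmult)
  qed
  have Si: "integrable lebesgue S"
  proof (rule integrableI_nonneg)
    show "S \<in> borel_measurable lebesgue" by (rule lebI[OF Sm])
    show "AE x in lebesgue. 0 \<le> S x" by (auto simp: S_def)
    have "(\<integral>\<^sup>+x. ennreal (S x) \<partial>lborel) < \<infinity>"
      using lin[of 1 1 1 64] Ig If fin(3,4) by (simp add: S_def Ideq Iveq ennreal_mult_less_top add_ac)
    then show "(\<integral>\<^sup>+x. ennreal (S x) \<partial>lebesgue) < \<infinity>" by (simp add: nn_integral_completion)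
  qed
  have prod: "p * norm (P x ** \<Psi> x) \<le> 3 * S x" if x: "x \<in> ?B" and p: "p = g x \<or> p = f x" for p x
  proof -
    let ?u = "v x / \<rho>"
    have p0: "0 \<le> p" using p nn[of x] by auto
    have e: "(\<eta> x)\<^sup>2 \<le> 1" using \<eta>01[of x] by (simp add: power_le_one)
    have u: "0 \<le> ?u" using nn[of x] \<rho> by simp
    have "norm (P x ** \<Psi> x) \<le> 1 * g x + (1 * d x + 8 * 1 * ?u)"
      using P\<Psi>[OF x] mult_right_mono[OF e nn(1)[of x]] mult_right_mono[OF e nn(3)[of x]] mult_right_mono[OF \<eta>01(2)[of x] u] by linarith
    then have "p * norm (P x ** \<Psi> x) \<le> p * (g x + d x + 8 * ?u)" using p0 by (intro mult_left_mono) auto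
    also have "\<dots> = p * g x + p * d x + p * (8 * ?u)" by (simp add: algebra_simps)
    also have "\<dots> \<le> 3 * (p\<^sup>2 + (g x)\<^sup>2 + (d x)\<^sup>2 + (8 * ?u)\<^sup>2) / 2"
    proof -
      have half: "a * b' \<le> (a\<^sup>2 + b'\<^sup>2) / 2" for a b' :: real
        using sum_squares_bound[of a b'] by (simp add: mult.assoc)
      have "p * g x + p * d x + p * U \<le> 3 * (p\<^sup>2 + (g x)\<^sup>2 + (d x)\<^sup>2 + U\<^sup>2) / 2" for U
        using half[of p "g x"] half[of p "d x"] half[of p U] zero_le_power2[of "g x"] zero_le_power2[of "d x"] zero_le_power2[of U] by argo
      then show ?thesis .
    qed
    also have "\<dots> \<le> 3 * S x"
    proof -
      have "p\<^sup>2 \<le> (g x)\<^sup>2 + (f x)\<^sup>2" using p by auto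
      moreover have "S x = (g x)\<^sup>2 + (f x)\<^sup>2 + (d x)\<^sup>2 + (8 * ?u)\<^sup>2" using x unfolding S_def power_mult_distrib by simp
      ultimately show ?thesis using zero_le_power2[of "f x"] zero_le_power2[of "d x"] zero_le_power2[of "8 * ?u"] by argo
    qed
    finally show ?thesis .
  qed
  have S0: "0 \<le> S x" for x by (auto simp: S_def)
  have bi: "integrable lebesgue b"
  proof (rule Bochner_Integration.integrable_bound)
    show "integrable lebesgue (\<lambda>x. C2 * (3 * S x))" using Si by simp
    show "AE x in lebesgue. norm (b x) \<le> norm (C2 * (3 * S x))"
      using ell2
    proof eventually_elim
      case (elim x)
      show ?case
      proof (cases "x \<in> ?B")
        case True
        then have xO: "x \<in> \<Omega>" using BO by auto
        have "norm (b x) \<le> C2 * (norm (P x ** \<Psi> x) * norm (P x ** G x))" using elim xO by (auto simp: b_def mult.assoc)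
        also have "\<dots> \<le> C2 * (3 * S x)" using prod[OF True, of "g x"] C2 by (intro mult_left_mono) (auto simp: g_def mult.commute)
        finally show ?thesis using S0[of x] C2 by simp
      next
        case False
        then show ?thesis using \<Psi>_out[OF False] by (simp add: b_def bilin_def)
      qed
    qed
  qed (rule bm)
  have wi: "integrable lebesgue w"
  proof (rule Bochner_Integration.integrable_bound)
    show "integrable lebesgue (\<lambda>x. 3 * S x)" using Si by simp
    show "AE x in lebesgue. norm (w x) \<le> norm (3 * S x)"
    proof (rule AE_I2)
      fix x
      show "norm (w x) \<le> norm (3 * S x)"
      proof (cases "x \<in> ?B")
        case True
        have "norm (w x) \<le> f x * norm (P x ** \<Psi> x)" using frob_le[of "F x" "\<Psi> x" x] by (auto simp: w_def f_def indicator_def)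
        also have "\<dots> \<le> 3 * S x" using prod[OF True, of "f x"] by simp
        finally show ?thesis using S0[of x] by simp
      next
        case False
        then show ?thesis using \<Psi>_out[OF False] by (simp add: w_def frob_def)
      qed
    qed
  qed (rule wm)
  have eq0: "integral\<^sup>L lebesgue b = - integral\<^sup>L lebesgue w"
  proof -
    have "test_fun \<Omega> (cutoff_test z \<rho> \<phi> c)" by (rule test_fun_cutoff_test[OF \<Omega> sm \<rho> sub])
    then have "(LINT x:\<Omega>|lebesgue. bilin A x (G x) (grad (cutoff_test z \<rho> \<phi> c) x)) =
      - (LINT x:\<Omega>|lebesgue. frob (F x) (grad (cutoff_test z \<rho> \<phi> c) x))"
      using weak unfolding weak_solution_def frob_def by blast
    moreover have "(LINT x:\<Omega>|lebesgue. bilin A x (G x) (grad (cutoff_test z \<rho> \<phi> c) x)) = integral\<^sup>L lebesgue b"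
      unfolding set_lebesgue_integral_def b_def by (intro Bochner_Integration.integral_cong) (auto simp: grad\<Psi> indicator_def)
    moreover have "(LINT x:\<Omega>|lebesgue. frob (F x) (grad (cutoff_test z \<rho> \<phi> c) x)) = integral\<^sup>L lebesgue w"
      unfolding set_lebesgue_integral_def w_def by (intro Bochner_Integration.integral_cong) (auto simp: grad\<Psi> indicator_def)
    ultimately show ?thesis by simp
  qed
  \<comment> \<open>The weak formulation says precisely that the integral of \<open>b + w\<close>
    vanishes.\<close>
  define Z where "Z x = Re (b x + w x)" for x
  have Zi: "integrable lebesgue Z" unfolding Z_def using bi wi by (intro integrable_Re Bochner_Integration.integrable_add)
  have Z0: "integral\<^sup>L lebesgue Z = 0"
    unfolding Z_def using bi wi eq0 by (simp add: integral_Re Bochner_Integration.integral_add)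
  define R where "R x = ((1 / c1 + 2) * (f x)\<^sup>2 + (1 + C2\<^sup>2 / (4 * \<theta>)) * (d x)\<^sup>2 + \<theta> * (g x)\<^sup>2 + (16 + 64 * C2\<^sup>2 / c1) * (v x / \<rho>)\<^sup>2) * indicator ?B x" for x
  \<comment> \<open>Half of the elliptic lower bound; \<open>caccioppoli_young\<close> consumes the
    other half.\<close>
  define Lf where "Lf x = c1 / 2 * ((\<eta> x)\<^sup>2 * (g x)\<^sup>2)" for x
  have le: "(\<integral>\<^sup>+x. ennreal (Lf x) \<partial>lebesgue) \<le> (\<integral>\<^sup>+x. ennreal (R x) \<partial>lebesgue)"
  proof (rule nn_integral_le_of_zero_mean[OF Zi Z0])
    show "R \<in> borel_measurable lebesgue" by (rule lebI) (unfold R_def, measurable)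
    show "Lf \<in> borel_measurable lebesgue" by (rule lebI) (unfold Lf_def, measurable)
    show "0 \<le> R x" for x using c1 C2 \<theta> unfolding R_def by (intro mult_nonneg_nonneg add_nonneg_nonneg) auto
    show "0 \<le> Lf x" for x using c1 by (simp add: Lf_def)
    show "AE x in lebesgue. Lf x \<le> Z x + R x"
      using ell1 ell2
    proof eventually_elim
      case (elim x)
      show ?case
      proof (cases "x \<in> ?B")
        case False
        then show ?thesis using \<Psi>_out[OF False] by (simp add: Lf_def Z_def b_def w_def R_def bilin_def frob_def)
      next
        case True
        then have xO: "x \<in> \<Omega>" using BO by auto
        have "\<Psi> x = (\<eta> x)\<^sup>2 *\<^sub>R G x + X x" by (simp add: X_def)
        then have "bilin A x (G x) (\<Psi> x) = (\<eta> x)\<^sup>2 *\<^sub>R bilin A x (G x) (G x) + bilin A x (G x) (X x)"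
          by (simp add: bilin_add_right bilin_scaleR_right)
        then have "Re (b x) = (\<eta> x)\<^sup>2 * Re (bilin A x (G x) (G x)) + Re (bilin A x (G x) (X x))"
          using xO by (simp add: b_def)
        moreover have "(\<eta> x)\<^sup>2 * (c1 * (g x)\<^sup>2) \<le> (\<eta> x)\<^sup>2 * Re (bilin A x (G x) (G x))"
          using elim(1) xO unfolding g_def by (intro mult_left_mono) auto
        moreover have "- (C2 * g x * ((\<eta> x)\<^sup>2 * d x + 8 * \<eta> x * (v x / \<rho>))) \<le> Re (bilin A x (G x) (X x))"
        proof -
          have "cmod (bilin A x (G x) (X x)) \<le> C2 * norm (P x ** X x) * norm (P x ** G x)" using elim(2) xO by blast
          also have "\<dots> = C2 * g x * norm (P x ** X x)" by (simp add: g_def mult_ac)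
          also have "\<dots> \<le> C2 * g x * ((\<eta> x)\<^sup>2 * d x + 8 * \<eta> x * (v x / \<rho>))"
            using C2 nn[of x] by (intro mult_left_mono PX[OF True]) auto
          finally show ?thesis using abs_Re_le_cmod[of "bilin A x (G x) (X x)"] by linarith
        qed
        moreover have "- (f x * ((\<eta> x)\<^sup>2 * g x + (\<eta> x)\<^sup>2 * d x + 8 * \<eta> x * (v x / \<rho>))) \<le> Re (w x)"
        proof -
          have "cmod (w x) \<le> f x * norm (P x ** \<Psi> x)" using frob_le[of "F x" "\<Psi> x" x] xO by (simp add: w_def f_def)
          also have "\<dots> \<le> f x * ((\<eta> x)\<^sup>2 * g x + ((\<eta> x)\<^sup>2 * d x + 8 * \<eta> x * (v x / \<rho>)))"
            using nn[of x] by (intro mult_left_mono P\<Psi>[OF True]) auto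
          finally show ?thesis using abs_Re_le_cmod[of "w x"] by (simp add: add.assoc)
        qed
        moreover note caccioppoli_young[OF \<eta>01[of x] nn(1-3)[of x] _ c1 C2 \<theta>, of "v x / \<rho>"]
        moreover have "R x = (1 / c1 + 2) * (f x)\<^sup>2 + (1 + C2\<^sup>2 / (4 * \<theta>)) * (d x)\<^sup>2 + \<theta> * (g x)\<^sup>2 + (16 + 64 * C2\<^sup>2 / c1) * (v x / \<rho>)\<^sup>2"
          using True by (simp add: R_def)
        moreover have "0 \<le> v x / \<rho>" using nn[of x] \<rho> by simp
        moreover have "Z x = Re (b x) + Re (w x)" by (simp add: Z_def)
        moreover have "(\<eta> x)\<^sup>2 * (c1 * (g x)\<^sup>2) = 2 * Lf x" "c1 / 2 * ((\<eta> x)\<^sup>2 * (g x)\<^sup>2) = Lf x" by (auto simp: Lf_def)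
        ultimately show ?thesis by linarith
      qed
    qed
  qed
  have "(\<integral>\<^sup>+x\<in>ball z (\<rho>/2). ennreal ((g x)\<^sup>2) \<partial>lborel) \<le> (\<integral>\<^sup>+x. ennreal (2 * exp 4 / c1) * ennreal (Lf x) \<partial>lborel)"
  proof (intro nn_integral_mono)
    fix x
    show "ennreal ((g x)\<^sup>2) * indicator (ball z (\<rho>/2)) x \<le> ennreal (2 * exp 4 / c1) * ennreal (Lf x)"
    proof (cases "x \<in> ball z (\<rho>/2)")
      case True
      \<comment> \<open>The cutoff is at least \<open>exp (-2)\<close> on the half ball and enters
        squared, whence \<open>exp 4\<close> in the constant; the factor \<open>2 / c1\<close>
        undoes the one in \<open>Lf\<close>.\<close>
      have "exp (-2) ^ 2 \<le> (\<eta> x)\<^sup>2" using cutoff_lower[OF \<rho> True] unfolding \<eta>_def by (intro power_mono) auto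
      then have "exp (-4) \<le> (\<eta> x)\<^sup>2" by (simp add: exp_double[symmetric] power2_eq_square exp_add[symmetric])
      then have "exp 4 * exp (-4) * (g x)\<^sup>2 \<le> exp 4 * (\<eta> x)\<^sup>2 * (g x)\<^sup>2" by (intro mult_right_mono mult_left_mono) auto
      then have "(g x)\<^sup>2 \<le> 2 * exp 4 / c1 * Lf x" using c1 by (simp add: Lf_def exp_minus mult.assoc)
      then show ?thesis using True c1 by (simp add: ennreal_mult'[symmetric] ennreal_leI)
    qed simp
  qed
  also have "\<dots> = ennreal (2 * exp 4 / c1) * (\<integral>\<^sup>+x. ennreal (Lf x) \<partial>lborel)"
    unfolding Lf_def by (rule nn_integral_cmult) measurable
  also have "\<dots> \<le> ennreal (2 * exp 4 / c1) * (\<integral>\<^sup>+x. ennreal (R x) \<partial>lborel)"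
    using le by (intro mult_left_mono) (auto simp: nn_integral_completion)
  finally show ?thesis
    unfolding R_def using lin[of "1 / c1 + 2" "1 + C2\<^sup>2 / (4 * \<theta>)" \<theta> "16 + 64 * C2\<^sup>2 / c1"] c1 C2 \<theta>
    by (simp add: Ideq Iveq g_def f_def)
qed

end

section \<open>Reverse Hoelder inequality for the weighted gradient\<close>

context A2_pair_vec
begin

text \<open>Of the four terms in the Caccioppoli inequality the data term is kept. The approximation
  error is small because \<open>\<phi>\<close> is chosen after the ball and \<open>l\<close>; the
  multiple of the squared gradient is small against \<open>l\<^sup>2\<close> times the volume by the
  level hypothesis; and the oscillation goes through the Poincare inequality, which returns a small
  multiple of the same quantity and \<open>l\<close> times the integral of the gradient.\<close>

lemma solution_reverse_Holder:
  fixes A :: "'d \<Rightarrow> 'd \<Rightarrow> 'n \<Rightarrow> 'n \<Rightarrow> real^'d \<Rightarrow> complex" and G F :: "real^'d \<Rightarrow> complex^'d^'n"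
  assumes \<Omega>: "open \<Omega>"
    and Am: "\<And>\<alpha> \<beta> i j. set_borel_measurable lebesgue \<Omega> (A \<alpha> \<beta> i j)"
    and Gm[measurable]: "G \<in> borel_measurable borel" and Fm[measurable]: "F \<in> borel_measurable borel"
    and c1: "0 < c1" and ell1: "AE x in lebesgue. x \<in> \<Omega> \<longrightarrow> (\<forall>\<eta>. c1 * (norm (P x ** \<eta>))\<^sup>2 \<le> Re (bilin A x \<eta> \<eta>))"
    and C2: "0 \<le> C2" and ell2: "AE x in lebesgue. x \<in> \<Omega> \<longrightarrow> (\<forall>\<eta> \<nu>. cmod (bilin A x \<nu> \<eta>) \<le> C2 * norm (P x ** \<eta>) * norm (P x ** \<nu>))"
    and weak: "weak_solution \<Omega> A G F"
    and finF: "(\<integral>\<^sup>+x\<in>\<Omega>. ennreal ((norm (N x ** F x))\<^sup>2) \<partial>lborel) < \<infinity>"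
    and approx: "\<And>\<epsilon>. 0 < \<epsilon> \<Longrightarrow> \<exists>\<phi>. smooth_on \<Omega> \<phi> \<and> (\<integral>\<^sup>+x\<in>\<Omega>. ennreal ((norm (P x ** (G x - grad \<phi> x)))\<^sup>2) \<partial>lborel) \<le> ennreal \<epsilon>"
  shows "\<exists>b\<ge>0. \<forall>x0 r. cball x0 r \<subseteq> \<Omega> \<longrightarrow> weak_reverse_Holder b (ball x0 r) (\<lambda>x. norm (P x ** G x)) (\<lambda>x. norm (N x ** F x))"
proof -
  \<comment> \<open>The coefficient prescribed by \<open>weak_reverse_Holder\<close>. It is spent in
    quarters: on the approximation error, on the squared gradient, and twice in the Poincare
    term.\<close>
  define \<kappa> :: real where "\<kappa> = 1 / (4 * 8^DIM(real^'d))"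
  have \<kappa>: "0 < \<kappa>" by (simp add: \<kappa>_def)
  define M where "M = 2 * exp 4 / c1"
  have M: "0 < M" using c1 by (simp add: M_def)
  define D where "D = 16 + 64 * C2\<^sup>2 / c1"
  have D: "0 < D" unfolding D_def using c1 by (intro add_pos_nonneg) auto
  define \<theta>2 where "\<theta>2 = \<kappa> / (4 * M)"
  have \<theta>2: "0 < \<theta>2" "M * \<theta>2 = \<kappa> / 4" using \<kappa> M by (auto simp: \<theta>2_def)
  \<comment> \<open>The Poincare inequality is used at level \<open>2 * l\<close>, hence the factor
    4; \<open>D\<close> is the coefficient of the oscillation.\<close>
  define \<theta>1 where "\<theta>1 = \<kappa> / (16 * M * D)"
  have \<theta>1: "0 < \<theta>1" "M * D * (4 * \<theta>1) = \<kappa> / 4" using \<kappa> M D by (auto simp: \<theta>1_def)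
  obtain \<mu> where \<mu>: "0 < \<mu>" and Poin: "\<And>\<Omega> (\<phi>::real^'d \<Rightarrow> complex^'n) z \<rho> l. open \<Omega> \<Longrightarrow> smooth_on \<Omega> \<phi> \<Longrightarrow> 0 < \<rho> \<Longrightarrow> cball z \<rho> \<subseteq> \<Omega> \<Longrightarrow> 0 < l \<Longrightarrow>
    (\<integral>\<^sup>+y\<in>ball z \<rho>. ennreal ((norm (P y ** grad \<phi> y))\<^sup>2) \<partial>lborel) \<le> ennreal (l\<^sup>2) * emeasure lborel (ball z \<rho>) \<Longrightarrow>
    (\<exists>c. (\<integral>\<^sup>+x\<in>ball z \<rho>. ennreal ((norm (P x *v (\<phi> x - c)))\<^sup>2) \<partial>lborel) \<le> ennreal (\<rho>\<^sup>2) *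
      (ennreal (\<theta>1 * l\<^sup>2) * emeasure lborel (ball z \<rho>) + ennreal (\<mu> * l) * (\<integral>\<^sup>+y\<in>ball z \<rho>. ennreal (norm (P y ** grad \<phi> y)) \<partial>lborel)))"
    using weighted_Poincare[OF \<theta>1(1)] by blast
  define k2 where "k2 = 1 + C2\<^sup>2 / (4 * \<theta>2)"
  have k2: "0 < k2" unfolding k2_def using \<theta>2 by (intro add_pos_nonneg) auto
  \<comment> \<open>The relative size of the approximation error. The two bounds serve its own term
    and its share in the integral of \<open>grad \<phi>\<close> on the right of the Poincare
    inequality.\<close>
  define s where "s = min 1 (min (\<kappa> / (4 * M * k2)) (\<kappa> / (8 * M * D * \<mu>)))"
  have s: "0 < s" "s \<le> 1" using \<kappa> M k2 D \<mu> by (auto simp: s_def)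
  have s1: "M * k2 * s \<le> \<kappa> / 4"
  proof -
    have "s \<le> \<kappa> / (4 * M * k2)" by (simp add: s_def)
    then show ?thesis using M k2 by (simp add: field_simps)
  qed
  have s2: "M * D * (2 * \<mu> * s) \<le> \<kappa> / 4"
  proof -
    have "s \<le> \<kappa> / (8 * M * D * \<mu>)" by (simp add: s_def)
    then show ?thesis using M D \<mu> by (simp add: field_simps)
  qed
  define b where "b = M * (1 / c1 + 2) + M * D * (2 * \<mu>)"
  have b0: "0 \<le> M * (1 / c1 + 2)" "0 \<le> M * D * (2 * \<mu>)" using M c1 D \<mu> by auto
  have b: "0 \<le> b" using b0 by (simp add: b_def)
  define g where "g x = norm (P x ** G x)" for x
  define f where "f x = norm (N x ** F x)" for x
  have [measurable]: "g \<in> borel_measurable borel" "f \<in> borel_measurable borel" unfolding g_def f_def by measurable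
  have "weak_reverse_Holder b (ball x0 r) g f" if sub0: "cball x0 r \<subseteq> \<Omega>" for x0 r
    unfolding weak_reverse_Holder_def
  proof (intro allI impI)
    fix z t l
    assume t: "0 < t" and l: "0 < l" and bsub: "ball z (2*t) \<subseteq> ball x0 r"
      and le: "(\<integral>\<^sup>+y\<in>ball z (2*t). ennreal ((g y)\<^sup>2) \<partial>lborel) \<le> ennreal (l\<^sup>2) * emeasure lborel (ball z (2*t))"
    define \<rho> where "\<rho> = 2 * t"
    have \<rho>: "0 < \<rho>" using t by (simp add: \<rho>_def)
    let ?B = "ball z \<rho>"
    \<comment> \<open>The definition of the reverse Hoelder property gives only an open ball inside
      \<open>ball x0 r\<close>; its closure stays in \<open>\<Omega>\<close> because
      \<open>cball x0 r\<close> does. Compact support of the test function depends on this.\<close>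
    have sub: "cball z \<rho> \<subseteq> \<Omega>"
    proof -
      have "closure (ball z \<rho>) \<subseteq> closure (ball x0 r)" using bsub unfolding \<rho>_def by (rule closure_mono)
      also have "\<dots> \<subseteq> cball x0 r" by (rule closure_minimal) auto
      finally show ?thesis using \<rho> sub0 by auto
    qed
    have BO: "?B \<subseteq> \<Omega>" using sub by auto
    obtain V where V: "emeasure lborel ?B = ennreal V" "V > 0" using \<rho> by (simp add: emeasure_ball)
    obtain \<phi> where sm: "smooth_on \<Omega> \<phi>" and ap: "(\<integral>\<^sup>+x\<in>\<Omega>. ennreal ((norm (P x ** (G x - grad \<phi> x)))\<^sup>2) \<partial>lborel) \<le> ennreal (s\<^sup>2 * l\<^sup>2 * V)"
      using approx[of "s\<^sup>2 * l\<^sup>2 * V"] s l V by auto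
    define DB where "DB x = indicator ?B x *\<^sub>R grad \<phi> x" for x
    have [measurable]: "DB \<in> borel_measurable borel"
      unfolding DB_def using continuous_on_subset[OF smooth_on_continuous_grad[OF sm] BO] by (intro borel_measurable_continuous_on_indicator) auto
    define d where "d x = norm (P x ** (indicator ?B x *\<^sub>R G x - DB x))" for x
    define h where "h x = norm (P x ** DB x)" for x
    have [measurable]: "d \<in> borel_measurable borel" "h \<in> borel_measurable borel" unfolding d_def h_def by measurable
    have dB: "d x = norm (P x ** (G x - grad \<phi> x))" and hB: "h x = norm (P x ** grad \<phi> x)" if "x \<in> ?B" for x
      using that by (auto simp: d_def h_def DB_def)
    have hgd: "h x \<le> g x + d x" if "x \<in> ?B" for x
    proof -
      have "P x ** grad \<phi> x = P x ** G x - P x ** (G x - grad \<phi> x)" by (simp add: matrix_mult_diff_right)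
      then show ?thesis unfolding dB[OF that] hB[OF that] g_def by (metis norm_triangle_ineq4)
    qed
    have Ideq: "(\<integral>\<^sup>+x\<in>?B. ennreal ((d x)\<^sup>2) \<partial>lborel) = (\<integral>\<^sup>+x\<in>?B. ennreal ((norm (P x ** (G x - grad \<phi> x)))\<^sup>2) \<partial>lborel)"
      using dB by (auto intro!: nn_integral_cong split: split_indicator)
    have Iheq: "(\<integral>\<^sup>+x\<in>?B. ennreal ((h x)\<^sup>2) \<partial>lborel) = (\<integral>\<^sup>+x\<in>?B. ennreal ((norm (P x ** grad \<phi> x))\<^sup>2) \<partial>lborel)"
      "(\<integral>\<^sup>+x\<in>?B. ennreal (h x) \<partial>lborel) = (\<integral>\<^sup>+x\<in>?B. ennreal (norm (P x ** grad \<phi> x)) \<partial>lborel)"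
      using hB by (auto intro!: nn_integral_cong split: split_indicator)
    have gle: "(\<integral>\<^sup>+y\<in>?B. ennreal ((g y)\<^sup>2) \<partial>lborel) \<le> ennreal (l\<^sup>2 * V)"
      using le V unfolding \<rho>_def[symmetric] by (simp add: ennreal_mult)
    have dle: "(\<integral>\<^sup>+x\<in>?B. ennreal ((d x)\<^sup>2) \<partial>lborel) \<le> ennreal (s\<^sup>2 * l\<^sup>2 * V)"
      unfolding Ideq by (rule order_trans[OF nn_set_integral_mono_set[OF BO] ap])
    obtain \<gamma> where \<gamma>: "(\<integral>\<^sup>+y\<in>?B. ennreal ((g y)\<^sup>2) \<partial>lborel) = ennreal \<gamma>" "0 \<le> \<gamma>" "\<gamma> \<le> l\<^sup>2 * V"
      using gle V by (cases "\<integral>\<^sup>+y\<in>?B. ennreal ((g y)\<^sup>2) \<partial>lborel") (auto simp: top_unique)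
    obtain \<delta> where \<delta>: "(\<integral>\<^sup>+y\<in>?B. ennreal ((d y)\<^sup>2) \<partial>lborel) = ennreal \<delta>" "0 \<le> \<delta>" "\<delta> \<le> s\<^sup>2 * l\<^sup>2 * V"
      using dle V by (cases "\<integral>\<^sup>+y\<in>?B. ennreal ((d y)\<^sup>2) \<partial>lborel") (auto simp: top_unique)
    have s2le: "s\<^sup>2 \<le> 1" using s by (simp add: power_le_one)
    have "(\<integral>\<^sup>+x\<in>?B. ennreal ((h x)\<^sup>2) \<partial>lborel) \<le> (\<integral>\<^sup>+x. 2 * (ennreal ((g x)\<^sup>2) * indicator ?B x) + 2 * (ennreal ((d x)\<^sup>2) * indicator ?B x) \<partial>lborel)"
    proof (intro nn_integral_mono)
      fix x
      show "ennreal ((h x)\<^sup>2) * indicator ?B x \<le> 2 * (ennreal ((g x)\<^sup>2) * indicator ?B x) + 2 * (ennreal ((d x)\<^sup>2) * indicator ?B x)"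
      proof (cases "x \<in> ?B")
        case True
        have "ennreal ((h x)\<^sup>2) \<le> ennreal ((g x + d x)\<^sup>2)" using hgd[OF True] by (intro ennreal_leI power_mono) (auto simp: h_def)
        also have "\<dots> = (ennreal (g x) + ennreal (d x))\<^sup>2"
        proof -
          have "0 \<le> g x" "0 \<le> d x" by (auto simp: g_def d_def)
          then show ?thesis by (simp only: ennreal_plus[symmetric] ennreal_power add_nonneg_nonneg)
        qed
        also have "\<dots> \<le> 2 * (ennreal (g x))\<^sup>2 + 2 * (ennreal (d x))\<^sup>2" by (rule ennreal_add_square_le)
        finally show ?thesis using True by (simp add: ennreal_power g_def d_def)
      qed simp
    qed
    also have "\<dots> = 2 * ennreal \<gamma> + 2 * ennreal \<delta>"
      by (simp add: nn_integral_add nn_integral_cmult \<gamma>(1) \<delta>(1))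
    also have "\<dots> = ennreal (2 * \<gamma> + 2 * \<delta>)" using \<gamma> \<delta> by (simp add: ennreal_mult')
    also have "\<dots> \<le> ennreal ((2 * l)\<^sup>2 * V)"
    proof (intro ennreal_leI)
      have "s\<^sup>2 * (l\<^sup>2 * V) \<le> 1 * (l\<^sup>2 * V)" using s2le V by (intro mult_right_mono) auto
      then show "2 * \<gamma> + 2 * \<delta> \<le> (2 * l)\<^sup>2 * V" using \<gamma>(3) \<delta>(3) by (simp add: power_mult_distrib mult.assoc)
    qed
    also have "\<dots> = ennreal ((2 * l)\<^sup>2) * emeasure lborel ?B" using V by (simp add: ennreal_mult)
    finally have hle: "(\<integral>\<^sup>+x\<in>?B. ennreal ((norm (P x ** grad \<phi> x))\<^sup>2) \<partial>lborel) \<le> ennreal ((2 * l)\<^sup>2) * emeasure lborel ?B"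
      unfolding Iheq(1) .
    \<comment> \<open>The weighted gradient of \<open>\<phi>\<close> is at most
      \<open>g + d\<close>, and both have quadratic mean at most \<open>l\<close>; so the level
      \<open>2 * l\<close> is admissible.\<close>
    obtain c where c: "(\<integral>\<^sup>+x\<in>?B. ennreal ((norm (P x *v (\<phi> x - c)))\<^sup>2) \<partial>lborel) \<le> ennreal (\<rho>\<^sup>2) *
      (ennreal (\<theta>1 * (2 * l)\<^sup>2) * emeasure lborel ?B + ennreal (\<mu> * (2 * l)) * (\<integral>\<^sup>+y\<in>?B. ennreal (norm (P y ** grad \<phi> y)) \<partial>lborel))"
      using Poin[OF \<Omega> sm \<rho> sub _ hle] l by auto
    have ig: "(\<integral>\<^sup>+y\<in>?B. ennreal (g y) \<partial>lborel) \<le> ennreal (l * V)"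
    proof -
      have "(\<integral>\<^sup>+y\<in>?B. ennreal (g y) \<partial>lborel)\<^sup>2 \<le> (ennreal l * emeasure lborel ?B)\<^sup>2"
        by (rule nn_integral_le_sqrt) (use l le in \<open>auto simp: \<rho>_def\<close>)
      then show ?thesis using ennreal_power2_le_imp_le V l by (simp add: ennreal_mult)
    qed
    have id: "(\<integral>\<^sup>+y\<in>?B. ennreal (d y) \<partial>lborel) \<le> ennreal (s * l * V)"
    proof -
      have "(\<integral>\<^sup>+y\<in>?B. ennreal (d y) \<partial>lborel)\<^sup>2 \<le> (ennreal (s * l) * emeasure lborel ?B)\<^sup>2"
        by (rule nn_integral_le_sqrt) (use l s dle V in \<open>auto simp: power_mult_distrib ennreal_mult\<close>)
      then show ?thesis using ennreal_power2_le_imp_le V l s by (simp add: ennreal_mult)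
    qed
    obtain i where i: "(\<integral>\<^sup>+y\<in>?B. ennreal (g y) \<partial>lborel) = ennreal i" "0 \<le> i"
      using ig by (cases "\<integral>\<^sup>+y\<in>?B. ennreal (g y) \<partial>lborel") (auto simp: top_unique)
    have ih: "(\<integral>\<^sup>+y\<in>?B. ennreal (h y) \<partial>lborel) \<le> ennreal (i + s * l * V)"
    proof -
      have "(\<integral>\<^sup>+y\<in>?B. ennreal (h y) \<partial>lborel) \<le> (\<integral>\<^sup>+y. ennreal (g y) * indicator ?B y + ennreal (d y) * indicator ?B y \<partial>lborel)"
      proof (intro nn_integral_mono)
        fix y
        show "ennreal (h y) * indicator ?B y \<le> ennreal (g y) * indicator ?B y + ennreal (d y) * indicator ?B y"
        proof (cases "y \<in> ?B")
          case True
          have "ennreal (h y) \<le> ennreal (g y + d y)" by (rule ennreal_leI[OF hgd[OF True]])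
          also have "\<dots> = ennreal (g y) + ennreal (d y)" by (rule ennreal_plus) (auto simp: g_def d_def)
          finally show ?thesis using True by simp
        qed simp
      qed
      also have "\<dots> = ennreal i + (\<integral>\<^sup>+y\<in>?B. ennreal (d y) \<partial>lborel)" by (simp add: nn_integral_add i)
      also have "\<dots> \<le> ennreal i + ennreal (s * l * V)" by (intro add_left_mono id)
      also have "\<dots> = ennreal (i + s * l * V)" using i s l V by simp
      finally show ?thesis .
    qed
    define K1 where "K1 = \<theta>1 * (2 * l)\<^sup>2 * V + \<mu> * (2 * l) * (i + s * l * V)"
    have K1: "0 \<le> K1" unfolding K1_def using \<theta>1 \<mu> l i s V by auto
    have vle: "(\<integral>\<^sup>+x\<in>?B. ennreal ((norm (P x *v (\<phi> x - c)))\<^sup>2) \<partial>lborel) \<le> ennreal (\<rho>\<^sup>2 * K1)"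
    proof -
      have "ennreal (\<rho>\<^sup>2) * (ennreal (\<theta>1 * (2 * l)\<^sup>2) * emeasure lborel ?B + ennreal (\<mu> * (2 * l)) * (\<integral>\<^sup>+y\<in>?B. ennreal (norm (P y ** grad \<phi> y)) \<partial>lborel))
        \<le> ennreal (\<rho>\<^sup>2) * (ennreal (\<theta>1 * (2 * l)\<^sup>2) * ennreal V + ennreal (\<mu> * (2 * l)) * ennreal (i + s * l * V))"
        unfolding V(1) Iheq(2)[symmetric] by (intro mult_left_mono add_left_mono ih) auto
      also have "\<dots> = ennreal (\<rho>\<^sup>2 * K1)"
      proof -
        have nn: "0 \<le> \<theta>1 * (2 * l)\<^sup>2" "0 \<le> V" "0 \<le> \<mu> * (2 * l)" "0 \<le> i + s * l * V" using \<theta>1 \<mu> l i s V by auto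
        have "ennreal (\<theta>1 * (2 * l)\<^sup>2) * ennreal V + ennreal (\<mu> * (2 * l)) * ennreal (i + s * l * V) = ennreal K1"
          unfolding K1_def ennreal_mult[OF nn(1,2), symmetric] ennreal_mult[OF nn(3,4), symmetric]
          by (rule ennreal_plus[symmetric, OF mult_nonneg_nonneg[OF nn(1,2)] mult_nonneg_nonneg[OF nn(3,4)]])
        then show ?thesis using K1 by (simp add: ennreal_mult)
      qed
      finally show ?thesis using c by (rule order_trans[rotated])
    qed
    obtain \<nu> where \<nu>: "(\<integral>\<^sup>+x\<in>?B. ennreal ((norm (P x *v (\<phi> x - c)))\<^sup>2) \<partial>lborel) = ennreal \<nu>" "0 \<le> \<nu>" "\<nu> \<le> \<rho>\<^sup>2 * K1"
      using vle K1 by (cases "\<integral>\<^sup>+x\<in>?B. ennreal ((norm (P x *v (\<phi> x - c)))\<^sup>2) \<partial>lborel") (auto simp: top_unique)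
    have "(\<integral>\<^sup>+x\<in>?B. ennreal ((f x)\<^sup>2) \<partial>lborel) < \<infinity>"
      using finF unfolding f_def by (rule le_less_trans[OF nn_set_integral_mono_set[OF BO]])
    then obtain \<zeta> where \<zeta>: "(\<integral>\<^sup>+x\<in>?B. ennreal ((f x)\<^sup>2) \<partial>lborel) = ennreal \<zeta>" "0 \<le> \<zeta>"
      by (cases "\<integral>\<^sup>+x\<in>?B. ennreal ((f x)\<^sup>2) \<partial>lborel") auto
    have cacc: "(\<integral>\<^sup>+x\<in>ball z (\<rho>/2). ennreal ((g x)\<^sup>2) \<partial>lborel) \<le> ennreal M *
      (ennreal (1 / c1 + 2) * ennreal \<zeta> + ennreal k2 * ennreal \<delta> + ennreal \<theta>2 * ennreal \<gamma> + ennreal (D / \<rho>\<^sup>2) * ennreal \<nu>)"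
      unfolding \<zeta>(1)[symmetric] \<gamma>(1)[symmetric] \<delta>(1)[symmetric] \<nu>(1)[symmetric] Ideq M_def k2_def D_def f_def g_def
      by (rule caccioppoli_ball[OF \<Omega> sm \<rho> sub Am Gm Fm c1 ell1 C2 ell2 weak _ _ _ _ \<theta>2(1)])
         (use \<gamma>(1) \<delta>(1) \<nu>(1) \<zeta>(1) in \<open>auto simp: g_def f_def Ideq\<close>)
    define T where "T = (1 / c1 + 2) * \<zeta> + k2 * \<delta> + \<theta>2 * \<gamma> + D / \<rho>\<^sup>2 * \<nu>"
    have rhs: "ennreal M * (ennreal (1 / c1 + 2) * ennreal \<zeta> + ennreal k2 * ennreal \<delta> + ennreal \<theta>2 * ennreal \<gamma> + ennreal (D / \<rho>\<^sup>2) * ennreal \<nu>) = ennreal (M * T)"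
    proof -
      have n0: "0 \<le> 1 / c1 + 2" "0 \<le> k2" "0 \<le> \<theta>2" "0 \<le> D / \<rho>\<^sup>2" using c1 k2 \<theta>2 D by auto
      have n1: "0 \<le> (1 / c1 + 2) * \<zeta>" "0 \<le> k2 * \<delta>" "0 \<le> \<theta>2 * \<gamma>" "0 \<le> D / \<rho>\<^sup>2 * \<nu>"
        by (rule mult_nonneg_nonneg[OF n0(1) \<zeta>(2)], rule mult_nonneg_nonneg[OF n0(2) \<delta>(2)],
            rule mult_nonneg_nonneg[OF n0(3) \<gamma>(2)], rule mult_nonneg_nonneg[OF n0(4) \<nu>(2)])
      have "ennreal (1 / c1 + 2) * ennreal \<zeta> + ennreal k2 * ennreal \<delta> + ennreal \<theta>2 * ennreal \<gamma> + ennreal (D / \<rho>\<^sup>2) * ennreal \<nu> = ennreal T"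
        unfolding T_def ennreal_mult[OF n0(1) \<zeta>(2), symmetric] ennreal_mult[OF n0(2) \<delta>(2), symmetric] ennreal_mult[OF n0(3) \<gamma>(2), symmetric] ennreal_mult[OF n0(4) \<nu>(2), symmetric]
        using n1 by (simp only: ennreal_plus add_nonneg_nonneg)
      moreover have "0 \<le> T" unfolding T_def using n1 by (intro add_nonneg_nonneg)
      ultimately show ?thesis using M by (simp add: ennreal_mult)
    qed
    \<comment> \<open>The two quarters in \<open>k1\<close> come from the level term of the Poincare
      inequality and from the approximation error inside its linear term; the remaining linear term
      goes into \<open>b\<close>.\<close>
    have fin: "M * T \<le> \<kappa> * l\<^sup>2 * V + b * l * i + b * \<zeta>"
    proof -
      have v1: "D / \<rho>\<^sup>2 * \<nu> \<le> D * K1"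
      proof -
        have "D / \<rho>\<^sup>2 * \<nu> \<le> D / \<rho>\<^sup>2 * (\<rho>\<^sup>2 * K1)" using D by (intro mult_left_mono \<nu>(3)) auto
        then show ?thesis using \<rho> by simp
      qed
      have ll: "0 \<le> l\<^sup>2 * V" using V by simp
      have d1: "M * (k2 * \<delta>) \<le> \<kappa> / 4 * (l\<^sup>2 * V)"
      proof -
        have "s\<^sup>2 \<le> s" using s by (simp add: power2_eq_square mult_left_le)
        then have "s\<^sup>2 * (l\<^sup>2 * V) \<le> s * (l\<^sup>2 * V)" using ll by (rule mult_right_mono)
        then have "\<delta> \<le> s * (l\<^sup>2 * V)" using \<delta>(3) by (simp add: mult.assoc)
        then have "M * k2 * \<delta> \<le> M * k2 * (s * (l\<^sup>2 * V))" using M k2 by (intro mult_left_mono) auto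
        also have "\<dots> = (M * k2 * s) * (l\<^sup>2 * V)" by (simp add: mult_ac)
        also have "\<dots> \<le> \<kappa> / 4 * (l\<^sup>2 * V)" using s1 ll by (rule mult_right_mono)
        finally show ?thesis by (simp add: mult.assoc)
      qed
      have g1: "M * (\<theta>2 * \<gamma>) \<le> \<kappa> / 4 * (l\<^sup>2 * V)"
        unfolding mult.assoc[symmetric] \<theta>2(2) using \<gamma>(3) \<kappa> by (simp add: mult.assoc)
      have k1: "M * (D * K1) \<le> \<kappa> / 2 * (l\<^sup>2 * V) + M * D * (2 * \<mu>) * (l * i)"
      proof -
        have "M * (D * K1) = (M * D * (4 * \<theta>1)) * (l\<^sup>2 * V) + M * D * (2 * \<mu>) * (l * i) + (M * D * (2 * \<mu> * s)) * (l\<^sup>2 * V)"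
          unfolding K1_def by (simp add: algebra_simps power2_eq_square)
        also have "\<dots> \<le> \<kappa> / 4 * (l\<^sup>2 * V) + M * D * (2 * \<mu>) * (l * i) + \<kappa> / 4 * (l\<^sup>2 * V)"
          unfolding \<theta>1(2) by (intro add_mono mult_right_mono[OF s2 ll] order_refl)
        finally show ?thesis by argo
      qed
      have bi: "M * D * (2 * \<mu>) * (l * i) \<le> b * (l * i)" "M * (1 / c1 + 2) * \<zeta> \<le> b * \<zeta>"
      proof -
        have "M * D * (2 * \<mu>) \<le> b" "M * (1 / c1 + 2) \<le> b" using b0 unfolding b_def by linarith+
        moreover have "0 \<le> l * i" using l i by simp
        ultimately show "M * D * (2 * \<mu>) * (l * i) \<le> b * (l * i)" "M * (1 / c1 + 2) * \<zeta> \<le> b * \<zeta>"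
          using \<zeta>(2) by (auto intro: mult_right_mono)
      qed
      have "M * T = M * (1 / c1 + 2) * \<zeta> + M * (k2 * \<delta>) + M * (\<theta>2 * \<gamma>) + M * (D / \<rho>\<^sup>2 * \<nu>)"
        unfolding T_def by (simp add: distrib_left mult.assoc)
      moreover have "M * (D / \<rho>\<^sup>2 * \<nu>) \<le> M * (D * K1)" using v1 M by (intro mult_left_mono) auto
      moreover have "\<kappa> * l\<^sup>2 * V = \<kappa> * (l\<^sup>2 * V)" "b * l * i = b * (l * i)" by (auto simp: mult.assoc)
      ultimately show ?thesis using d1 g1 k1 bi by linarith
    qed
    have "(\<integral>\<^sup>+x\<in>ball z t. ennreal ((g x)\<^sup>2) \<partial>lborel) \<le> ennreal (M * T)"
      using cacc unfolding rhs by (simp add: \<rho>_def)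
    also have "\<dots> \<le> ennreal (\<kappa> * l\<^sup>2 * V + b * l * i + b * \<zeta>)" by (rule ennreal_leI[OF fin])
    also have "\<dots> = ennreal (l\<^sup>2 / (4 * 8^DIM(real^'d))) * emeasure lborel (ball z (2*t))
          + ennreal (b * l) * (\<integral>\<^sup>+y\<in>ball z (2*t). ennreal (g y) \<partial>lborel)
          + ennreal b * (\<integral>\<^sup>+y\<in>ball z (2*t). ennreal ((f y)\<^sup>2) \<partial>lborel)"
    proof -
      have n: "0 \<le> \<kappa> * l\<^sup>2 * V" "0 \<le> b * l * i" "0 \<le> b * \<zeta>" using \<kappa> V b l i \<zeta> by auto
      have "\<kappa> * l\<^sup>2 = l\<^sup>2 / (4 * 8^DIM(real^'d))" by (simp add: \<kappa>_def)
      then have e1: "ennreal (l\<^sup>2 / (4 * 8^DIM(real^'d))) * emeasure lborel (ball z (2*t)) = ennreal (\<kappa> * l\<^sup>2 * V)"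
        using V \<kappa> unfolding \<rho>_def[symmetric] V(1) by (metis ennreal_mult less_imp_le mult_nonneg_nonneg zero_le_power2)
      have e2: "ennreal (b * l) * (\<integral>\<^sup>+y\<in>ball z (2*t). ennreal (g y) \<partial>lborel) = ennreal (b * l * i)"
        unfolding \<rho>_def[symmetric] i(1) using b l i by (intro ennreal_mult[symmetric]) auto
      have e3: "ennreal b * (\<integral>\<^sup>+y\<in>ball z (2*t). ennreal ((f y)\<^sup>2) \<partial>lborel) = ennreal (b * \<zeta>)"
        unfolding \<rho>_def[symmetric] \<zeta>(1) using b \<zeta> by (intro ennreal_mult[symmetric]) auto
      show ?thesis unfolding e1 e2 e3 using n by (simp only: ennreal_plus add_nonneg_nonneg)
    qed
    finally show "(\<integral>\<^sup>+x\<in>ball z t. ennreal ((g x)\<^sup>2) \<partial>lborel) \<le> ennreal (l\<^sup>2 / (4 * 8^DIM(real^'d))) * emeasure lborel (ball z (2*t))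
          + ennreal (b * l) * (\<integral>\<^sup>+y\<in>ball z (2*t). ennreal (g y) \<partial>lborel)
          + ennreal b * (\<integral>\<^sup>+y\<in>ball z (2*t). ennreal ((f y)\<^sup>2) \<partial>lborel)" .
  qed
  then show ?thesis using b unfolding g_def f_def by blast
qed

end

section \<open>Borel representatives\<close>

lemma borel_measurable_vec_lambda:
  fixes f :: "'n::finite \<Rightarrow> 'a \<Rightarrow> 'b::euclidean_space"
  assumes "\<And>i. f i \<in> borel_measurable M"
  shows "(\<lambda>x. \<chi> i. f i x) \<in> borel_measurable M"
proof -
  have eq: "(\<lambda>x. \<chi> i. f i x) = (\<lambda>x. \<Sum>i\<in>UNIV. axis i (f i x))"
    by (auto simp: fun_eq_iff vec_eq_iff axis_def if_distrib sum.delta cong: if_cong)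
  have "continuous_on UNIV (axis i :: 'b \<Rightarrow> 'b^'n)" for i
    by (intro linear_continuous_on linear_conv_bounded_linear[THEN iffD1] linearI) (auto simp: axis_def vec_eq_iff)
  then have "(\<lambda>x. axis i (f i x)) \<in> borel_measurable M" for i
    using measurable_compose[OF assms borel_measurable_continuous_onI] by blast
  then show ?thesis unfolding eq by (intro borel_measurable_sum)
qed

text \<open>Real and imaginary parts of every entry have Borel versions, and finitely many null sets
  are discarded.\<close>

lemma borel_version_matrix:
  fixes f :: "'a::euclidean_space \<Rightarrow> complex^'m^'n"
  assumes m: "\<And>i j. (\<lambda>x. f x $ i $ j) \<in> borel_measurable lebesgue"
  shows "\<exists>f'\<in>borel_measurable borel. AE x in lebesgue. f x = f' x"
proof -
  define r where "r i j = (SOME h. h \<in> borel_measurable lborel \<and> (AE x in lborel. Re (f x $ i $ j) = h x))" for i j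
  have "(\<lambda>x. Re (f x $ i $ j)) \<in> borel_measurable lebesgue" for i j
    using measurable_compose[OF m borel_measurable_continuous_onI[OF continuous_on_Re[OF continuous_on_id]]] by simp
  then have "\<exists>h. h \<in> borel_measurable lborel \<and> (AE x in lborel. Re (f x $ i $ j) = h x)" for i j
    using completion_ex_borel_measurable_real by blast
  then have "r i j \<in> borel_measurable lborel \<and> (AE x in lborel. Re (f x $ i $ j) = r i j x)" for i j
    unfolding r_def by (rule someI_ex)
  then have r: "\<And>i j. r i j \<in> borel_measurable lborel" "\<And>i j. AE x in lborel. Re (f x $ i $ j) = r i j x" by auto
  define s where "s i j = (SOME h. h \<in> borel_measurable lborel \<and> (AE x in lborel. Im (f x $ i $ j) = h x))" for i j
  have "(\<lambda>x. Im (f x $ i $ j)) \<in> borel_measurable lebesgue" for i j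
    using measurable_compose[OF m borel_measurable_continuous_onI[OF continuous_on_Im[OF continuous_on_id]]] by simp
  then have "\<exists>h. h \<in> borel_measurable lborel \<and> (AE x in lborel. Im (f x $ i $ j) = h x)" for i j
    using completion_ex_borel_measurable_real by blast
  then have "s i j \<in> borel_measurable lborel \<and> (AE x in lborel. Im (f x $ i $ j) = s i j x)" for i j
    unfolding s_def by (rule someI_ex)
  then have s: "\<And>i j. s i j \<in> borel_measurable lborel" "\<And>i j. AE x in lborel. Im (f x $ i $ j) = s i j x" by auto
  define f' where "f' x = (\<chi> i j. complex_of_real (r i j x) + \<i> * complex_of_real (s i j x))" for x
  have "(\<lambda>x. complex_of_real (r i j x) + \<i> * complex_of_real (s i j x)) \<in> borel_measurable borel" for i j
  proof -
    have [measurable]: "r i j \<in> borel_measurable borel" "s i j \<in> borel_measurable borel" using r(1) s(1) by auto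
    show ?thesis by measurable
  qed
  then have "f' \<in> borel_measurable borel" unfolding f'_def by (intro borel_measurable_vec_lambda)
  moreover have "AE x in lborel. \<forall>i\<in>UNIV. \<forall>j\<in>UNIV. Re (f x $ i $ j) = r i j x \<and> Im (f x $ i $ j) = s i j x"
    using r(2) s(2) by (intro AE_finite_allI) auto
  then have "AE x in lborel. f x = f' x"
    by eventually_elim (auto simp: f'_def vec_eq_iff complex_eq_iff)
  then have "AE x in lebesgue. f x = f' x" by (rule AE_completion)
  ultimately show ?thesis by blast
qed

text \<open>Local integrability yields measurability after cutting to a ball; the cut-off weights
  are eventually constant at each point.\<close>

lemma matrix_weight_measurable:
  fixes W :: "real^'d \<Rightarrow> complex^'n^'n"
  assumes "matrix_weight W"
  shows "(\<lambda>x. W x $ i $ j) \<in> borel_measurable lebesgue"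
proof (rule borel_measurable_LIMSEQ_metric[where f="\<lambda>k x. indicator (cball 0 (real k)) x *\<^sub>R W x $ i $ j"])
  fix k :: nat
  have "set_integrable lebesgue (cball 0 (real k)) (\<lambda>x. W x $ i $ j)"
    using assms[unfolded matrix_weight_def, THEN conjunct1, rule_format, OF compact_cball] .
  then show "(\<lambda>x. indicator (cball 0 (real k)) x *\<^sub>R W x $ i $ j) \<in> borel_measurable lebesgue"
    unfolding set_integrable_def by (rule borel_measurable_integrable)
next
  fix x :: "real^'d"
  obtain k0 :: nat where k0: "norm x \<le> real k0" using real_arch_simple by blast
  have "\<forall>\<^sub>F k in sequentially. indicator (cball 0 (real k)) x *\<^sub>R W x $ i $ j = W x $ i $ j"
    using eventually_ge_at_top[of k0] by eventually_elim (use k0 in \<open>auto simp: indicator_def\<close>)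
  then show "(\<lambda>k. indicator (cball 0 (real k)) x *\<^sub>R W x $ i $ j) \<longlonglongrightarrow> W x $ i $ j"
    by (rule tendsto_eventually)
qed

lemma posdef_mat_1: "posdef_matrix (mat 1 :: complex^'n^'n)"
  unfolding posdef_matrix_def inner_matrix_vector[symmetric]
proof (intro conjI allI impI)
  show "hermitian (mat 1 :: complex^'n^'n)" by (auto simp: hermitian_def mat_def)
qed simp

text \<open>A Borel null set contains all exceptional points; putting the identity matrix there
  makes the representative positive definite everywhere, so that root and inverse behave well at
  every point.\<close>

lemma borel_version_weight:
  fixes W :: "real^'d \<Rightarrow> complex^'n^'n"
  assumes "matrix_weight W"
  shows "\<exists>W'\<in>borel_measurable borel. (\<forall>x. posdef_matrix (W' x)) \<and> (AE x in lebesgue. W x = W' x)"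
proof -
  obtain V where V: "V \<in> borel_measurable borel" "AE x in lebesgue. W x = V x"
    using borel_version_matrix[OF matrix_weight_measurable[OF assms]] by blast
  have "AE x in lebesgue. posdef_matrix (W x)" using assms by (simp add: matrix_weight_def)
  with V(2) have "AE x in lebesgue. W x = V x \<and> posdef_matrix (W x)" by eventually_elim simp
  then have "AE x in lborel. W x = V x \<and> posdef_matrix (W x)" by (simp add: AE_completion_iff)
  then obtain E where E: "E \<in> null_sets lborel" "{x. \<not> (W x = V x \<and> posdef_matrix (W x))} \<subseteq> E"
    unfolding eventually_ae_filter by auto
  define W' where "W' x = (if x \<in> E then mat 1 else V x)" for x
  have Em: "E \<in> sets borel" using E(1) by auto
  have "W' \<in> borel_measurable borel" unfolding W'_def using V(1) Em by measurable
  moreover have "posdef_matrix (W' x)" for x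
  proof (cases "x \<in> E")
    case False
    then have "W x = V x \<and> posdef_matrix (W x)" using E(2) by blast
    then have "posdef_matrix (V x)" by metis
    then show ?thesis using False by (simp add: W'_def)
  qed (simp add: W'_def posdef_mat_1)
  moreover have "AE x in lebesgue. W x = W' x"
  proof -
    have "AE x in lborel. x \<notin> E" using E(1) by (rule AE_not_in)
    then have "AE x in lborel. W x = W' x" by eventually_elim (use E(2) in \<open>auto simp: W'_def\<close>)
    then show ?thesis by (rule AE_completion)
  qed
  ultimately show ?thesis by blast
qed

section \<open>Measurability of the square root and of its inverse\<close>

lemma borel_measurable_sqrt_iter:
  assumes "B \<in> borel_measurable M"
  shows "(\<lambda>x. sqrt_iter (B x) k) \<in> borel_measurable M"
proof (induction k)
  case (Suc k)
  then show ?case using assms by simp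
qed simp

text \<open>\<open>msqrt\<close> is a definite description and gives no direct access to
  measurability. It is the pointwise limit of \<open>sqrt_approx\<close>, whose members are limits
  of matrix polynomials; where the iteration diverges, \<open>lim\<close> is a default value and
  measurability persists.\<close>

lemma borel_measurable_msqrt:
  fixes W :: "'a \<Rightarrow> complex^'n^'n"
  assumes [measurable]: "W \<in> borel_measurable M" and pd: "\<And>x. posdef_matrix (W x)"
  shows "(\<lambda>x. msqrt (W x)) \<in> borel_measurable M"
proof -
  have "(\<lambda>x. sqrt_approx (W x) k) \<in> borel_measurable M" for k
  proof -
    have "(\<lambda>x. lim (sqrt_iter (mat 1 - (1 / real k) *\<^sub>R W x))) \<in> borel_measurable M"
      by (intro borel_measurable_lim_metric borel_measurable_sqrt_iter) measurable
    then show ?thesis unfolding sqrt_approx_def by measurable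
  qed
  then have "(\<lambda>x. lim (sqrt_approx (W x))) \<in> borel_measurable M" by (rule borel_measurable_lim_metric)
  then show ?thesis using msqrt_eq_lim[OF pd] by simp
qed

lemma borel_measurable_det:
  fixes A :: "'a \<Rightarrow> complex^'n^'n"
  assumes "\<And>i j. (\<lambda>x. A x $ i $ j) \<in> borel_measurable M"
  shows "(\<lambda>x. det (A x)) \<in> borel_measurable M"
  unfolding det_def using assms by (intro borel_measurable_sum borel_measurable_times borel_measurable_prod) auto

text \<open>Cramer's rule expresses the entries of the inverse as quotients of determinants, hence
  as rational functions of the measurable entries of the root.\<close>

lemma borel_measurable_minvsqrt:
  fixes W :: "'a \<Rightarrow> complex^'n^'n"
  assumes Wm: "W \<in> borel_measurable M" and pd: "\<And>x. posdef_matrix (W x)"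
  shows "(\<lambda>x. minvsqrt (W x)) \<in> borel_measurable M"
proof -
  let ?P = "\<lambda>x. msqrt (W x)"
  have Pm[measurable]: "?P \<in> borel_measurable M" by (rule borel_measurable_msqrt[OF assms])
  have Pc: "(\<lambda>x. ?P x $ i $ j) \<in> borel_measurable M" for i j by measurable
  have ent: "minvsqrt (W x) $ i $ k = det (\<chi> a b. if b = i then axis k 1 $ a else ?P x $ a $ b) / det (?P x)" for x i k
  proof -
    have PN: "?P x ** minvsqrt (W x) = mat 1" by (rule msqrt_minvsqrt[OF pd])
    have "det (?P x) * det (minvsqrt (W x)) = 1" using arg_cong[OF PN, of det] by (simp add: det_mul)
    then have d: "det (?P x) \<noteq> 0" by auto
    have "?P x *v column k (minvsqrt (W x)) = column k (?P x ** minvsqrt (W x))"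
      by (simp add: vec_eq_iff matrix_vector_mult_def column_def matrix_matrix_mult_def)
    also have "\<dots> = axis k 1" unfolding PN by (simp add: vec_eq_iff column_def mat_def axis_def)
    finally have "column k (minvsqrt (W x)) = (\<chi> i. det (\<chi> a b. if b = i then axis k 1 $ a else ?P x $ a $ b) / det (?P x))"
      using cramer[OF d] by blast
    then show ?thesis by (simp add: column_def vec_eq_iff)
  qed
  have "(\<lambda>x. minvsqrt (W x) $ i $ k) \<in> borel_measurable M" for i k
    unfolding ent
  proof (intro borel_measurable_divide borel_measurable_det)
    show "(\<lambda>x. (\<chi> a b. if b = i then axis k 1 $ a else ?P x $ a $ b) $ a $ b) \<in> borel_measurable M" for a b
      using Pc[of a b] by (cases "b = i") auto
  qed (rule Pc)
  then have "(\<lambda>x. \<chi> i k. minvsqrt (W x) $ i $ k) \<in> borel_measurable M" by (intro borel_measurable_vec_lambda)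
  then show ?thesis by simp
qed

section \<open>From cubes to balls\<close>

lemma ball_subset_cube: "ball z r \<subseteq> cube (z - (\<chi> k. r)) (2 * r)"
proof
  fix x assume "x \<in> ball z r"
  then have "\<bar>x $ k - z $ k\<bar> \<le> r" for k
    using component_le_norm_cart[of "x - z" k] by (simp add: dist_norm norm_minus_commute)
  then have "z $ k - r \<le> x $ k" "x $ k \<le> z $ k + r" for k by (smt (verit))+
  then show "x \<in> cube (z - (\<chi> k. r)) (2 * r)" by (auto simp: cube_def mem_box_cart add.commute)
qed

lemma measure_cube: "0 \<le> h \<Longrightarrow> measure lebesgue (cube a h) = h ^ CARD('d)" for a :: "real^'d"
  by (subst measure_completion) (auto simp: cube_def content_cbox_if_cart interval_eq_empty_cart not_less[symmetric])

text \<open>A ball of radius r lies in a cube of side 2r of comparable volume, and null sets do not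
  affect the double integral, so the A_2 condition survives for the representative over
  balls.\<close>

lemma A2_balls:
  fixes W W' :: "real^'d \<Rightarrow> complex^'n^'n"
  assumes A2: "matrix_A2 W" and Wm: "W' \<in> borel_measurable borel" and pd: "\<And>x. posdef_matrix (W' x)" and eq: "AE x in lebesgue. W x = W' x"
  shows "\<exists>CA. A2_pair_vec (\<lambda>x. msqrt (W' x)) (\<lambda>x. minvsqrt (W' x)) CA"
proof -
  let ?P = "\<lambda>x. msqrt (W' x)" and ?N = "\<lambda>x. minvsqrt (W' x)"
  have [measurable]: "?P \<in> borel_measurable borel" "?N \<in> borel_measurable borel"
    by (rule borel_measurable_msqrt[OF Wm pd], rule borel_measurable_minvsqrt[OF Wm pd])
  obtain C where C: "\<And>a h. h > 0 \<Longrightarrow>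
        (\<integral>\<^sup>+ x. (\<integral>\<^sup>+ y. ennreal ((opnorm (msqrt (W x) ** minvsqrt (W y)))\<^sup>2)
              * indicator (cube a h) y \<partial>lebesgue) * indicator (cube a h) x \<partial>lebesgue)
        \<le> ennreal (C * (measure lebesgue (cube a h))\<^sup>2)"
    using A2 unfolding matrix_A2_def by blast
  have AEb: "AE x in lborel. W x = W' x" using eq by (simp add: AE_completion_iff)
  have C': "(\<integral>\<^sup>+ x\<in>cube a h. (\<integral>\<^sup>+ y\<in>cube a h. ennreal ((opnorm (?P x ** ?N y))\<^sup>2) \<partial>lborel) \<partial>lborel)
        \<le> ennreal (C * (h ^ CARD('d))\<^sup>2)" if h: "h > 0" for a h
  proof -
    have "(\<integral>\<^sup>+ x\<in>cube a h. (\<integral>\<^sup>+ y\<in>cube a h. ennreal ((opnorm (?P x ** ?N y))\<^sup>2) \<partial>lborel) \<partial>lborel)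
      = (\<integral>\<^sup>+ x. (\<integral>\<^sup>+ y. ennreal ((opnorm (msqrt (W x) ** minvsqrt (W y)))\<^sup>2)
              * indicator (cube a h) y \<partial>lborel) * indicator (cube a h) x \<partial>lborel)"
    proof (rule nn_integral_cong_AE)
      show "AE x in lborel. (\<integral>\<^sup>+ y\<in>cube a h. ennreal ((opnorm (?P x ** ?N y))\<^sup>2) \<partial>lborel) * indicator (cube a h) x =
        (\<integral>\<^sup>+ y. ennreal ((opnorm (msqrt (W x) ** minvsqrt (W y)))\<^sup>2) * indicator (cube a h) y \<partial>lborel) * indicator (cube a h) x"
        using AEb
      proof eventually_elim
        case (elim x)
        have "(\<integral>\<^sup>+ y\<in>cube a h. ennreal ((opnorm (?P x ** ?N y))\<^sup>2) \<partial>lborel) =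
          (\<integral>\<^sup>+ y. ennreal ((opnorm (msqrt (W x) ** minvsqrt (W y)))\<^sup>2) * indicator (cube a h) y \<partial>lborel)"
          by (rule nn_integral_cong_AE) (use AEb elim in \<open>auto elim!: eventually_mono\<close>)
        then show ?case by simp
      qed
    qed
    also have "\<dots> \<le> ennreal (C * (measure lebesgue (cube a h))\<^sup>2)" using C[OF h, of a] by (simp add: nn_integral_completion)
    finally show ?thesis using h by (simp add: measure_cube)
  qed
  let ?d = "CARD('d)" and ?n = "real CARD('n)"
  define u where "u = unit_ball_vol (real ?d)"
  have u: "u > 0" by (simp add: u_def)
  \<comment> \<open>The squared matrix size pays for the Hilbert-Schmidt norm, and the squared
    quotient of 2^d and \<open>u\<close> is that of the volumes of cube and ball.
    \<open>max C 1\<close> makes the constant positive.\<close>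
  define CA where "CA = ?n\<^sup>2 * max C 1 * (2 ^ ?d)\<^sup>2 / u\<^sup>2"
  have n: "0 < ?n" by simp
  have CA: "0 < CA" unfolding CA_def using u n by (intro divide_pos_pos mult_pos_pos) auto
  have A2b: "(\<integral>\<^sup>+x\<in>ball z r. (\<integral>\<^sup>+y\<in>ball z r. ennreal ((norm (?P x ** ?N y))\<^sup>2) \<partial>lborel) \<partial>lborel)
        \<le> ennreal CA * (emeasure lborel (ball z r))\<^sup>2" if r: "0 < r" for z r
  proof -
    let ?Q = "cube (z - (\<chi> k. r)) (2 * r)"
    have Qm[measurable]: "?Q \<in> sets borel" by (simp add: cube_def)
    have "(\<integral>\<^sup>+x\<in>ball z r. (\<integral>\<^sup>+y\<in>ball z r. ennreal ((norm (?P x ** ?N y))\<^sup>2) \<partial>lborel) \<partial>lborel)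
      \<le> (\<integral>\<^sup>+x\<in>?Q. ennreal (?n\<^sup>2) * (\<integral>\<^sup>+y\<in>?Q. ennreal ((opnorm (?P x ** ?N y))\<^sup>2) \<partial>lborel) \<partial>lborel)"
    proof (rule order_trans[OF nn_set_integral_mono_set[OF ball_subset_cube]], rule nn_set_integral_mono)
      fix x
      have "(\<integral>\<^sup>+y\<in>ball z r. ennreal ((norm (?P x ** ?N y))\<^sup>2) \<partial>lborel) \<le> (\<integral>\<^sup>+y\<in>?Q. ennreal (?n\<^sup>2) * ennreal ((opnorm (?P x ** ?N y))\<^sup>2) \<partial>lborel)"
      proof (rule order_trans[OF nn_set_integral_mono_set[OF ball_subset_cube]], rule nn_set_integral_mono)
        fix y
        have "(norm (?P x ** ?N y))\<^sup>2 \<le> (?n * opnorm (?P x ** ?N y))\<^sup>2" by (intro power_mono norm_le_card_opnorm) auto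
        then show "ennreal ((norm (?P x ** ?N y))\<^sup>2) \<le> ennreal (?n\<^sup>2) * ennreal ((opnorm (?P x ** ?N y))\<^sup>2)"
          by (simp add: ennreal_mult[symmetric] power_mult_distrib ennreal_leI)
      qed
      also have "\<dots> = ennreal (?n\<^sup>2) * (\<integral>\<^sup>+y\<in>?Q. ennreal ((opnorm (?P x ** ?N y))\<^sup>2) \<partial>lborel)"
        by (rule nn_set_integral_cmult) measurable
      finally show "(\<integral>\<^sup>+y\<in>ball z r. ennreal ((norm (?P x ** ?N y))\<^sup>2) \<partial>lborel) \<le> ennreal (?n\<^sup>2) * (\<integral>\<^sup>+y\<in>?Q. ennreal ((opnorm (?P x ** ?N y))\<^sup>2) \<partial>lborel)" .
    qed
    also have "\<dots> = ennreal (?n\<^sup>2) * (\<integral>\<^sup>+x\<in>?Q. (\<integral>\<^sup>+y\<in>?Q. ennreal ((opnorm (?P x ** ?N y))\<^sup>2) \<partial>lborel) \<partial>lborel)"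
      by (rule nn_set_integral_cmult) measurable
    also have "\<dots> \<le> ennreal (?n\<^sup>2) * ennreal (max C 1 * ((2 * r) ^ ?d)\<^sup>2)"
      using r by (intro mult_left_mono order_trans[OF C'] ennreal_leI mult_right_mono) auto
    also have "\<dots> = ennreal CA * (emeasure lborel (ball z r))\<^sup>2"
    proof -
      have "?n\<^sup>2 * (max C 1 * ((2 * r) ^ ?d)\<^sup>2) = CA * (u * r ^ ?d)\<^sup>2"
        unfolding CA_def using u by (simp add: power_mult_distrib)
      moreover have "emeasure lborel (ball z r) = ennreal (u * r ^ ?d)" using r by (simp add: emeasure_ball u_def)
      ultimately show ?thesis using u r CA by (simp add: ennreal_mult[symmetric] ennreal_power)
    qed
    finally show ?thesis .
  qed
  have "A2_pair_vec ?P ?N CA"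
    by unfold_locales (use CA A2b msqrt_minvsqrt[OF pd] minvsqrt_msqrt[OF pd] hermitian_msqrt[OF pd] hermitian_minvsqrt[OF pd] in auto)
  then show ?thesis by blast
qed

section \<open>Higher integrability of the gradient\<close>

lemma Lp_avg_lborel:
  assumes "B \<in> sets borel"
  shows "Lp_avg p B f = enn_root p ((\<integral>\<^sup>+x\<in>B. ennreal (f x powr p) \<partial>lborel) / emeasure lborel B)"
  using assms by (simp add: Lp_avg_def nn_integral_completion emeasure_completion)

text \<open>Gehring's lemma speaks of levels and integrals, the conclusion of means. The level is
  the quadratic mean \<open>a\<close> enlarged by a small \<open>\<delta>\<close>, since a level
  must be positive and \<open>a\<close> may vanish. In the constant, 2^d is the volume ratio of ball
  and half ball, and 2 bounds a sum of two q-th powers by the q-th power of the sum.\<close>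

lemma Lp_avg_from_level_bound:
  fixes g f :: "real^'d \<Rightarrow> real"
  assumes g0: "\<And>x. 0 \<le> g x" and q: "2 < q" and C: "0 < C" and r: "0 < r"
    and fin: "(\<integral>\<^sup>+x\<in>ball x0 r. ennreal ((g x)\<^sup>2) \<partial>lborel) < \<infinity>"
    and H: "\<And>L. 0 < L \<Longrightarrow> (\<integral>\<^sup>+x\<in>ball x0 r. ennreal ((g x)\<^sup>2) \<partial>lborel) \<le> ennreal (L\<^sup>2) * emeasure lborel (ball x0 r) \<Longrightarrow>
      (\<integral>\<^sup>+x\<in>ball x0 (r/2). ennreal (g x powr q) \<partial>lborel) \<le>
        ennreal C * (ennreal (L powr q) * emeasure lborel (ball x0 r) + (\<integral>\<^sup>+x\<in>ball x0 r. ennreal (f x powr q) \<partial>lborel))"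
  shows "Lp_avg q (ball x0 (r/2)) g \<le> ennreal ((2 * 2^CARD('d) * C) powr (1/q)) * (Lp_avg 2 (ball x0 r) g + Lp_avg q (ball x0 r) f)"
proof -
  define k where "k = 2 * 2^CARD('d) * C"
  have k: "0 < k" using C by (simp add: k_def)
  define V where "V = measure lborel (ball x0 r)"
  have V: "emeasure lborel (ball x0 r) = ennreal V" "0 < V"
    using r emeasure_lborel_ball_finite[of x0 r] content_ball_pos[OF r, of x0] by (auto simp: V_def emeasure_eq_ennreal_measure)
  have Vh: "emeasure lborel (ball x0 (r/2)) = ennreal (V / 2^CARD('d))"
    using r by (simp add: emeasure_ball V_def content_ball power_divide)
  define I where "I = enn2real (\<integral>\<^sup>+x\<in>ball x0 r. ennreal ((g x)\<^sup>2) \<partial>lborel)"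
  have I: "(\<integral>\<^sup>+x\<in>ball x0 r. ennreal ((g x)\<^sup>2) \<partial>lborel) = ennreal I" "0 \<le> I" using fin by (auto simp: I_def)
  define a where "a = sqrt (I / V)"
  have a: "0 \<le> a" "I = a\<^sup>2 * V" using I V by (auto simp: a_def)
  have "g x powr 2 = (g x)\<^sup>2" for x using g0[of x] by (simp add: powr_numeral)
  then have A2: "Lp_avg 2 (ball x0 r) g = ennreal a"
    using I V by (simp add: Lp_avg_lborel divide_ennreal enn_root_def a_def powr_half_sqrt)
  let ?J = "\<integral>\<^sup>+x\<in>ball x0 r. ennreal (f x powr q) \<partial>lborel"
  show ?thesis
  proof (cases "?J = \<infinity>")
    case True
    then have "Lp_avg q (ball x0 r) f = \<infinity>"
      using V by (simp add: Lp_avg_lborel enn_root_def ennreal_top_divide)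
    then show ?thesis using k by (simp add: k_def[symmetric] ennreal_mult_top)
  next
    case False
    define J where "J = enn2real ?J"
    have J: "?J = ennreal J" "0 \<le> J" using False by (auto simp: J_def less_top)
    define b where "b = (J / V) powr (1/q)"
    have b: "0 \<le> b" "J = b powr q * V" using J V q by (auto simp: b_def powr_powr)
    have Aq: "Lp_avg q (ball x0 r) f = ennreal b"
      using J V by (simp add: Lp_avg_lborel divide_ennreal enn_root_def b_def)
    let ?X = "\<integral>\<^sup>+x\<in>ball x0 (r/2). ennreal (g x powr q) \<partial>lborel"
    have bound: "?X \<le> ennreal (C * (((a + \<delta>) powr q + b powr q) * V))" if \<delta>: "0 < \<delta>" for \<delta>
    proof -
      have "a\<^sup>2 * V \<le> (a + \<delta>)\<^sup>2 * V" using a V \<delta> by (intro mult_right_mono power_mono) auto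
      then have "ennreal I \<le> ennreal ((a + \<delta>)\<^sup>2) * ennreal V" using a V by (simp add: ennreal_mult[symmetric] ennreal_leI)
      then have "?X \<le> ennreal C * (ennreal ((a + \<delta>) powr q) * ennreal V + ennreal J)"
        using H[of "a + \<delta>"] a \<delta> unfolding I V J by simp
      also have "\<dots> = ennreal (C * (((a + \<delta>) powr q + b powr q) * V))"
        using C V b by (simp add: ennreal_mult[symmetric] ennreal_plus[symmetric] distrib_right del: ennreal_plus)
      finally show ?thesis .
    qed
    have "?X < \<infinity>" using le_less_trans[OF bound[of 1]] by simp
    define X where "X = enn2real ?X"
    have X: "?X = ennreal X" "0 \<le> X" using \<open>?X < \<infinity>\<close> by (auto simp: X_def)
    define w where "w = (X / (V / 2^CARD('d))) powr (1/q)"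
    have w: "Lp_avg q (ball x0 (r/2)) g = ennreal w"
      using X V by (simp add: Lp_avg_lborel divide_ennreal enn_root_def w_def Vh)
    have "w \<le> k powr (1/q) * (a + b) + e" if e: "0 < e" for e
    proof -
      \<comment> \<open>After the q-th root the enlargement of the level costs
        \<open>k powr (1/q) * \<delta>\<close>, which this makes equal to \<open>e\<close>.\<close>
      define \<delta> where "\<delta> = e / k powr (1/q)"
      have \<delta>: "0 < \<delta>" using e k by (simp add: \<delta>_def)
      have ab: "0 \<le> a + \<delta> + b" using a b \<delta> by simp
      have "(a + \<delta>) powr q \<le> (a + \<delta> + b) powr q" "b powr q \<le> (a + \<delta> + b) powr q"
        using a b \<delta> q by (auto intro!: powr_mono2)
      then have s: "(a + \<delta>) powr q + b powr q \<le> 2 * (a + \<delta> + b) powr q" by linarith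
      have "X \<le> C * (((a + \<delta>) powr q + b powr q) * V)"
        using bound[OF \<delta>] C V unfolding X(1) by (subst (asm) ennreal_le_iff) auto
      also have "\<dots> \<le> C * ((2 * (a + \<delta> + b) powr q) * V)"
        using s C V by (intro mult_left_mono mult_right_mono) auto
      finally have "X * 2^CARD('d) \<le> C * ((2 * (a + \<delta> + b) powr q) * V) * 2^CARD('d)" by (intro mult_right_mono) auto
      then have "X / (V / 2^CARD('d)) \<le> k * (a + \<delta> + b) powr q" using V by (simp add: k_def field_simps)
      then have "w \<le> (k * (a + \<delta> + b) powr q) powr (1/q)" unfolding w_def using X V q by (intro powr_mono2) auto
      also have "\<dots> = k powr (1/q) * (a + \<delta> + b)" using k ab q by (simp add: powr_mult powr_powr)
      also have "\<dots> = k powr (1/q) * (a + b) + e" using k by (simp add: \<delta>_def field_simps)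
      finally show ?thesis .
    qed
    then have "w \<le> k powr (1/q) * (a + b)" by (rule field_le_epsilon)
    then have "ennreal w \<le> ennreal (k powr (1/q)) * (ennreal a + ennreal b)"
      using a b by (simp add: ennreal_mult[symmetric] ennreal_plus[symmetric] ennreal_leI del: ennreal_plus)
    then show ?thesis unfolding w A2 Aq k_def .
  qed
qed

section \<open>Passage to Borel representatives\<close>

lemma set_borel_measurable_bilin:
  fixes A :: "'d::finite \<Rightarrow> 'd \<Rightarrow> 'n::finite \<Rightarrow> 'n \<Rightarrow> real^'d \<Rightarrow> complex" and G H :: "real^'d \<Rightarrow> complex^'d^'n"
  assumes A: "\<And>\<alpha> \<beta> i j. set_borel_measurable M S (A \<alpha> \<beta> i j)"
    and G: "set_borel_measurable M S G" and H: "set_borel_measurable M S H"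
  shows "set_borel_measurable M S (\<lambda>x. bilin A x (G x) (H x))"
proof -
  have [measurable]: "(\<lambda>x. indicator S x *\<^sub>R A \<alpha> \<beta> i j x) \<in> borel_measurable M" for \<alpha> \<beta> i j
    using A by (simp add: set_borel_measurable_def)
  have [measurable]: "(\<lambda>x. indicator S x *\<^sub>R G x) \<in> borel_measurable M" "(\<lambda>x. indicator S x *\<^sub>R H x) \<in> borel_measurable M"
    using G H by (simp_all add: set_borel_measurable_def)
  have eq: "(\<lambda>x. indicator S x *\<^sub>R bilin A x (G x) (H x)) = (\<lambda>x. \<Sum>i\<in>UNIV. \<Sum>j\<in>UNIV. \<Sum>\<alpha>\<in>UNIV. \<Sum>\<beta>\<in>UNIV.
       (indicator S x *\<^sub>R A \<alpha> \<beta> i j x) * (indicator S x *\<^sub>R G x) $ j $ \<beta> * cnj ((indicator S x *\<^sub>R H x) $ i $ \<alpha>))"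
    by (auto simp: fun_eq_iff bilin_def indicator_def)
  show ?thesis unfolding set_borel_measurable_def eq by measurable
qed

text \<open>Equality almost everywhere transfers Bochner integrals once both integrands are
  measurable; continuity of the gradient of the test function on \<open>\<Omega>\<close> and
  measurability of the coefficients supply that.\<close>

lemma weak_solution_cong_AE:
  fixes A :: "'d::finite \<Rightarrow> 'd \<Rightarrow> 'n::finite \<Rightarrow> 'n \<Rightarrow> real^'d \<Rightarrow> complex" and F G F' G' :: "real^'d \<Rightarrow> complex^'d^'n"
  assumes \<Omega>: "open \<Omega>" and A: "\<And>\<alpha> \<beta> i j. set_borel_measurable lebesgue \<Omega> (A \<alpha> \<beta> i j)"
    and m: "set_borel_measurable lebesgue \<Omega> G" "set_borel_measurable lebesgue \<Omega> G'" "set_borel_measurable lebesgue \<Omega> F" "set_borel_measurable lebesgue \<Omega> F'"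
    and G: "AE x in lebesgue. x \<in> \<Omega> \<longrightarrow> G x = G' x" and F: "AE x in lebesgue. x \<in> \<Omega> \<longrightarrow> F x = F' x"
    and weak: "weak_solution \<Omega> A G F"
  shows "weak_solution \<Omega> A G' F'"
  unfolding weak_solution_def
proof (intro allI impI)
  fix \<phi> :: "real^'d \<Rightarrow> complex^'n" assume \<phi>: "test_fun \<Omega> \<phi>"
  have "(\<lambda>x. indicator \<Omega> x *\<^sub>R grad \<phi> x) \<in> borel_measurable borel"
    using \<Omega> \<phi> by (intro borel_measurable_continuous_on_indicator smooth_on_continuous_grad) (auto simp: test_fun_def)
  then have g: "set_borel_measurable lebesgue \<Omega> (grad \<phi>)" unfolding set_borel_measurable_def by (intro measurable_completion) simp
  have [measurable]: "(\<lambda>x. indicator \<Omega> x *\<^sub>R F x) \<in> borel_measurable lebesgue" "(\<lambda>x. indicator \<Omega> x *\<^sub>R F' x) \<in> borel_measurable lebesgue"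
    "(\<lambda>x. indicator \<Omega> x *\<^sub>R grad \<phi> x) \<in> borel_measurable lebesgue"
    using m g by (auto simp: set_borel_measurable_def)
  let ?f = "\<lambda>F x. \<Sum>i\<in>UNIV. \<Sum>\<alpha>\<in>UNIV. F x $ i $ \<alpha> * cnj (grad \<phi> x $ i $ \<alpha>)"
  have eq: "(\<lambda>x. indicator \<Omega> x *\<^sub>R ?f H x) = (\<lambda>x. \<Sum>i\<in>UNIV. \<Sum>\<alpha>\<in>UNIV. (indicator \<Omega> x *\<^sub>R H x) $ i $ \<alpha> * cnj ((indicator \<Omega> x *\<^sub>R grad \<phi> x) $ i $ \<alpha>))" for H :: "real^'d \<Rightarrow> complex^'d^'n"
    by (auto simp: fun_eq_iff indicator_def)
  have fm: "(\<lambda>x. indicator \<Omega> x *\<^sub>R ?f F x) \<in> borel_measurable lebesgue" "(\<lambda>x. indicator \<Omega> x *\<^sub>R ?f F' x) \<in> borel_measurable lebesgue"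
    unfolding eq by measurable
  have 1: "(LINT x:\<Omega>|lebesgue. bilin A x (G x) (grad \<phi> x)) = (LINT x:\<Omega>|lebesgue. bilin A x (G' x) (grad \<phi> x))"
    unfolding set_lebesgue_integral_def
  proof (rule integral_cong_AE)
    show "AE x in lebesgue. indicator \<Omega> x *\<^sub>R bilin A x (G x) (grad \<phi> x) = indicator \<Omega> x *\<^sub>R bilin A x (G' x) (grad \<phi> x)"
      using G by eventually_elim (auto simp: indicator_def)
  qed (use set_borel_measurable_bilin[OF A _ g] m in \<open>auto simp: set_borel_measurable_def\<close>)
  have 2: "(LINT x:\<Omega>|lebesgue. ?f F x) = (LINT x:\<Omega>|lebesgue. ?f F' x)"
    unfolding set_lebesgue_integral_def
  proof (rule integral_cong_AE)
    show "AE x in lebesgue. indicator \<Omega> x *\<^sub>R ?f F x = indicator \<Omega> x *\<^sub>R ?f F' x"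
      using F by eventually_elim (auto simp: indicator_def)
  qed (rule fm)+
  show "(LINT x:\<Omega>|lebesgue. bilin A x (G' x) (grad \<phi> x)) = - (LINT x:\<Omega>|lebesgue. ?f F' x)"
    using weak \<phi> unfolding weak_solution_def 1[symmetric] 2[symmetric] by blast
qed

lemma borel_version_on:
  fixes f :: "real^'d \<Rightarrow> complex^'m^'n"
  assumes "set_borel_measurable lebesgue \<Omega> f"
  obtains f' where "f' \<in> borel_measurable borel" "AE x in lebesgue. x \<in> \<Omega> \<longrightarrow> f x = f' x"
proof -
  have "(\<lambda>x. (indicator \<Omega> x *\<^sub>R f x) $ i $ j) \<in> borel_measurable lebesgue" for i j
    using assms unfolding set_borel_measurable_def by (intro borel_measurable_vec_component)
  from borel_version_matrix[OF this] obtain f' where f': "f' \<in> borel_measurable borel" "AE x in lebesgue. indicator \<Omega> x *\<^sub>R f x = f' x"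
    by blast
  have "AE x in lebesgue. x \<in> \<Omega> \<longrightarrow> f x = f' x" using f'(2) by eventually_elim (auto simp: indicator_def)
  with f'(1) show ?thesis by (rule that)
qed

lemma Lp_avg_cong_AE:
  assumes "AE x in lebesgue. x \<in> B \<longrightarrow> f x = g x"
  shows "Lp_avg p B f = Lp_avg p B g"
proof -
  have "(\<integral>\<^sup>+x\<in>B. ennreal (f x powr p) \<partial>lebesgue) = (\<integral>\<^sup>+x\<in>B. ennreal (g x powr p) \<partial>lebesgue)"
    by (rule nn_integral_cong_AE) (use assms in \<open>eventually_elim, auto simp: indicator_def\<close>)
  then show ?thesis by (simp add: Lp_avg_def)
qed

text \<open>Measurability is asked for the cut-off matrix because smooth approximants are controlled
  on \<open>\<Omega>\<close> only; \<open>opnorm\<close> vanishes at zero, so the indicator may be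
  moved inside.\<close>

lemma nn_set_integral_norm_le_opnorm:
  fixes X :: "real^'d \<Rightarrow> complex^'m^'n"
  assumes [measurable]: "(\<lambda>x. indicator S x *\<^sub>R X x) \<in> borel_measurable borel"
  shows "(\<integral>\<^sup>+x\<in>S. ennreal ((norm (X x))\<^sup>2) \<partial>lborel) \<le> ennreal ((real CARD('m))\<^sup>2) * (\<integral>\<^sup>+x\<in>S. ennreal ((opnorm (X x))\<^sup>2) \<partial>lborel)"
proof -
  have "opnorm (0::complex^'m^'n) = 0" using opnorm_le_norm[of "0::complex^'m^'n"] opnorm_nonneg[of "0::complex^'m^'n"] by simp
  then have e: "ennreal ((opnorm (X x))\<^sup>2) * indicator S x = ennreal ((opnorm (indicator S x *\<^sub>R X x))\<^sup>2)" for x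
    by (simp add: indicator_def)
  have "(\<integral>\<^sup>+x\<in>S. ennreal ((norm (X x))\<^sup>2) \<partial>lborel) \<le> (\<integral>\<^sup>+x. ennreal ((real CARD('m))\<^sup>2) * ennreal ((opnorm (indicator S x *\<^sub>R X x))\<^sup>2) \<partial>lborel)"
  proof (rule nn_integral_mono)
    fix x
    have "(norm (X x))\<^sup>2 \<le> (CARD('m) * opnorm (X x))\<^sup>2" by (intro power_mono norm_le_card_opnorm) auto
    then show "ennreal ((norm (X x))\<^sup>2) * indicator S x \<le> ennreal ((real CARD('m))\<^sup>2) * ennreal ((opnorm (indicator S x *\<^sub>R X x))\<^sup>2)"
      by (simp add: indicator_def ennreal_mult[symmetric] power_mult_distrib ennreal_leI)
  qed
  also have "\<dots> = ennreal ((real CARD('m))\<^sup>2) * (\<integral>\<^sup>+x. ennreal ((opnorm (indicator S x *\<^sub>R X x))\<^sup>2) \<partial>lborel)"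
    by (rule nn_integral_cmult) measurable
  finally show ?thesis unfolding e .
qed

theorem theorem1p5:
  fixes W :: "real^'d \<Rightarrow> complex^'n^'n"
    and \<Omega> :: "(real^'d) set"
    and F :: "real^'d \<Rightarrow> complex^'d^'n"
    and A :: "'d \<Rightarrow> 'd \<Rightarrow> 'n \<Rightarrow> 'n \<Rightarrow> real^'d \<Rightarrow> complex"
    and u :: "real^'d \<Rightarrow> complex^'n"
    and Du :: "real^'d \<Rightarrow> complex^'d^'n"
    and s :: real
  assumes "matrix_A2 W"
    and "domain \<Omega>"
    and "set_borel_measurable lebesgue \<Omega> F"
    and "(\<integral>\<^sup>+ x\<in>\<Omega>. ennreal ((opnorm (minvsqrt (W x) ** F x))\<^sup>2) \<partial>lebesgue) < \<infinity>"
    and "s > 2"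
    and "(\<integral>\<^sup>+ x\<in>\<Omega>. ennreal (opnorm (minvsqrt (W x) ** F x) powr s) \<partial>lebesgue) < \<infinity>"
    and "\<forall>\<alpha> \<beta> i j. set_borel_measurable lebesgue \<Omega> (A \<alpha> \<beta> i j)"
    and "E1 \<Omega> W A"
    and "E2 \<Omega> W A"
    and "H12_fun \<Omega> W u Du"
    and "weak_solution \<Omega> A Du F"
  shows "\<exists>q>2. \<exists>C::real. \<forall>x0 r. r > 0 \<and> ball x0 (2 * r) \<subseteq> \<Omega> \<longrightarrow>
           Lp_avg q (ball x0 (r / 2)) (\<lambda>x. opnorm (msqrt (W x) ** Du x))
           \<le> ennreal C * (Lp_avg 2 (ball x0 r) (\<lambda>x. opnorm (msqrt (W x) ** Du x))
                          + Lp_avg q (ball x0 r) (\<lambda>x. opnorm (minvsqrt (W x) ** F x)))"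
proof -
  have \<Omega>: "open \<Omega>" using assms(2) by (simp add: domain_def)
  then have \<Omega>m[measurable]: "\<Omega> \<in> sets borel" by simp
  have Am: "\<And>\<alpha> \<beta> i j. set_borel_measurable lebesgue \<Omega> (A \<alpha> \<beta> i j)" using assms(7) by blast
  have "matrix_weight W" using assms(1) by (simp add: matrix_A2_def)
  from borel_version_weight[OF this] obtain W' where Wm: "W' \<in> borel_measurable borel" and pd: "\<And>x. posdef_matrix (W' x)"
    and Weq: "AE x in lebesgue. W x = W' x" by blast
  define P where "P = (\<lambda>x. msqrt (W' x))"
  define N where "N = (\<lambda>x. minvsqrt (W' x))"
  obtain CA where "A2_pair_vec P N CA" using A2_balls[OF assms(1) Wm pd Weq] unfolding P_def N_def by blast
  then interpret A2_pair_vec P N CA .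
  obtain \<phi> :: "nat \<Rightarrow> real^'d \<Rightarrow> complex^'n" where Dum: "set_borel_measurable lebesgue \<Omega> Du"
    and sm: "\<And>k. smooth_on \<Omega> (\<phi> k)"
    and \<phi>fin: "\<And>k. (\<integral>\<^sup>+ x\<in>\<Omega>. ennreal ((opnorm (msqrt (W x) ** grad (\<phi> k) x))\<^sup>2) \<partial>lebesgue) < \<infinity>"
    and lim: "(\<lambda>k. \<integral>\<^sup>+ x\<in>\<Omega>. ennreal ((opnorm (msqrt (W x) ** (Du x - grad (\<phi> k) x)))\<^sup>2) \<partial>lebesgue) \<longlonglongrightarrow> 0"
    using assms(10) unfolding H12_fun_def by blast
  obtain G where Gm[measurable]: "G \<in> borel_measurable borel" and Geq: "AE x in lebesgue. x \<in> \<Omega> \<longrightarrow> Du x = G x"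
    using borel_version_on[OF Dum] .
  obtain H where Hm[measurable]: "H \<in> borel_measurable borel" and Heq: "AE x in lebesgue. x \<in> \<Omega> \<longrightarrow> F x = H x"
    using borel_version_on[OF assms(3)] .
  \<comment> \<open>Comparison constant between \<open>norm\<close> and \<open>opnorm\<close> for
    matrices with \<open>'d\<close> columns; the statement uses \<open>opnorm\<close>, the estimates
    use \<open>norm\<close>.\<close>
  define d where "d = real CARD('d)"
  have d: "1 \<le> d" unfolding d_def by simp
  have nd: "norm X \<le> d * opnorm X" for X :: "complex^'d^'n" unfolding d_def by (rule norm_le_card_opnorm)
  have to_lborel: "(\<integral>\<^sup>+x\<in>\<Omega>. f x \<partial>lebesgue) = (\<integral>\<^sup>+x\<in>\<Omega>. g x \<partial>lborel)" if "AE x in lebesgue. x \<in> \<Omega> \<longrightarrow> f x = g x" for f g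
  proof -
    have "(\<integral>\<^sup>+x\<in>\<Omega>. f x \<partial>lebesgue) = (\<integral>\<^sup>+x\<in>\<Omega>. g x \<partial>lebesgue)"
      by (rule nn_integral_cong_AE) (use that in \<open>eventually_elim, auto simp: indicator_def\<close>)
    then show ?thesis by (simp add: nn_integral_completion)
  qed
  have gradm[measurable]: "(\<lambda>x. indicator \<Omega> x *\<^sub>R grad (\<phi> k) x) \<in> borel_measurable borel" for k
    using sm by (intro borel_measurable_continuous_on_indicator smooth_on_continuous_grad) auto
  have Xm[measurable]: "(\<lambda>x. indicator \<Omega> x *\<^sub>R (P x ** (G x - grad (\<phi> k) x))) \<in> borel_measurable borel" for k
  proof -
    have "(\<lambda>x. indicator \<Omega> x *\<^sub>R (P x ** (G x - grad (\<phi> k) x))) = (\<lambda>x. P x ** (indicator \<Omega> x *\<^sub>R G x - indicator \<Omega> x *\<^sub>R grad (\<phi> k) x))"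
      by (simp add: matrix_mult_scaleR_right[symmetric] scaleR_diff_right)
    then show ?thesis by simp
  qed
  have Ym[measurable]: "(\<lambda>x. indicator \<Omega> x *\<^sub>R (P x ** grad (\<phi> k) x)) \<in> borel_measurable borel" for k
  proof -
    have "(\<lambda>x. indicator \<Omega> x *\<^sub>R (P x ** grad (\<phi> k) x)) = (\<lambda>x. P x ** (indicator \<Omega> x *\<^sub>R grad (\<phi> k) x))"
      by (simp add: matrix_mult_scaleR_right[symmetric])
    then show ?thesis by simp
  qed
  obtain c where c: "0 < c" and e1: "AE x in lebesgue. x \<in> \<Omega> \<longrightarrow> (\<forall>\<eta>. c * (opnorm (msqrt (W x) ** \<eta>))\<^sup>2 \<le> Re (bilin A x \<eta> \<eta>))"
    using assms(8) unfolding E1_def by blast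
  \<comment> \<open>Replacing \<open>opnorm\<close> by the larger \<open>norm\<close> on the lower
    side costs the factor \<open>d\<^sup>2\<close>.\<close>
  have ell1: "AE x in lebesgue. x \<in> \<Omega> \<longrightarrow> (\<forall>\<eta>. c / d\<^sup>2 * (norm (P x ** \<eta>))\<^sup>2 \<le> Re (bilin A x \<eta> \<eta>))"
    using e1 Weq
  proof eventually_elim
    case (elim x)
    have "c / d\<^sup>2 * (norm (P x ** \<eta>))\<^sup>2 \<le> c * (opnorm (P x ** \<eta>))\<^sup>2" for \<eta> :: "complex^'d^'n"
    proof -
      have "(norm (P x ** \<eta>))\<^sup>2 \<le> (d * opnorm (P x ** \<eta>))\<^sup>2" by (intro power_mono nd) auto
      then have "c / d\<^sup>2 * (norm (P x ** \<eta>))\<^sup>2 \<le> c / d\<^sup>2 * (d * opnorm (P x ** \<eta>))\<^sup>2" using c by (intro mult_left_mono) auto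
      then show ?thesis using d by (simp add: power_mult_distrib)
    qed
    then show ?case using elim unfolding P_def by (auto intro: order_trans)
  qed
  obtain C2 where e2: "AE x in lebesgue. x \<in> \<Omega> \<longrightarrow> (\<forall>\<eta> \<nu>. cmod (bilin A x \<nu> \<eta>) \<le> C2 * opnorm (msqrt (W x) ** \<eta>) * opnorm (msqrt (W x) ** \<nu>))"
    using assms(9) unfolding E2_def by blast
  \<comment> \<open>On the upper side \<open>norm\<close> dominates at no cost; the absolute value
    is taken because the constant in (E2) carries no sign.\<close>
  have ell2: "AE x in lebesgue. x \<in> \<Omega> \<longrightarrow> (\<forall>\<eta> \<nu>. cmod (bilin A x \<nu> \<eta>) \<le> \<bar>C2\<bar> * norm (P x ** \<eta>) * norm (P x ** \<nu>))"
    using e2 Weq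
  proof eventually_elim
    case (elim x)
    have "C2 * opnorm (P x ** \<eta>) * opnorm (P x ** \<nu>) \<le> \<bar>C2\<bar> * norm (P x ** \<eta>) * norm (P x ** \<nu>)" for \<eta> \<nu> :: "complex^'d^'n"
    proof -
      have "C2 * opnorm (P x ** \<eta>) \<le> \<bar>C2\<bar> * opnorm (P x ** \<eta>)" by (intro mult_right_mono opnorm_nonneg) auto
      then have "C2 * opnorm (P x ** \<eta>) * opnorm (P x ** \<nu>) \<le> \<bar>C2\<bar> * opnorm (P x ** \<eta>) * opnorm (P x ** \<nu>)"
        by (rule mult_right_mono) (rule opnorm_nonneg)
      also have "\<dots> \<le> \<bar>C2\<bar> * norm (P x ** \<eta>) * norm (P x ** \<nu>)"
        by (intro mult_mono mult_left_mono opnorm_le_norm opnorm_nonneg mult_nonneg_nonneg) auto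
      finally show ?thesis .
    qed
    note bd = this
    show ?case
    proof (intro impI allI)
      fix \<eta> \<nu> :: "complex^'d^'n" assume "x \<in> \<Omega>"
      then have "cmod (bilin A x \<nu> \<eta>) \<le> C2 * opnorm (P x ** \<eta>) * opnorm (P x ** \<nu>)" using elim by (simp add: P_def)
      then show "cmod (bilin A x \<nu> \<eta>) \<le> \<bar>C2\<bar> * norm (P x ** \<eta>) * norm (P x ** \<nu>)" using bd by (rule order_trans)
    qed
  qed
  have "set_borel_measurable lebesgue \<Omega> G" "set_borel_measurable lebesgue \<Omega> H"
    unfolding set_borel_measurable_def by (auto intro!: borel_measurable_scaleR measurable_completion)
  from weak_solution_cong_AE[OF \<Omega> Am Dum this(1) assms(3) this(2) Geq Heq assms(11)]
  have weak: "weak_solution \<Omega> A G H" .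
  have finF: "(\<integral>\<^sup>+x\<in>\<Omega>. ennreal ((norm (N x ** H x))\<^sup>2) \<partial>lborel) < \<infinity>"
  proof -
    have "(\<integral>\<^sup>+ x\<in>\<Omega>. ennreal ((opnorm (minvsqrt (W x) ** F x))\<^sup>2) \<partial>lebesgue) = (\<integral>\<^sup>+ x\<in>\<Omega>. ennreal ((opnorm (N x ** H x))\<^sup>2) \<partial>lborel)"
      by (rule to_lborel) (use Weq Heq in \<open>eventually_elim, auto simp: N_def\<close>)
    then have "(\<integral>\<^sup>+ x\<in>\<Omega>. ennreal ((opnorm (N x ** H x))\<^sup>2) \<partial>lborel) < \<infinity>" using assms(4) by simp
    then show ?thesis by (intro le_less_trans[OF nn_set_integral_norm_le_opnorm]) (auto simp: ennreal_mult_less_top)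
  qed
  have approx: "\<exists>k. (\<integral>\<^sup>+x\<in>\<Omega>. ennreal ((norm (P x ** (G x - grad (\<phi> k) x)))\<^sup>2) \<partial>lborel) \<le> ennreal \<epsilon>" if \<epsilon>: "0 < \<epsilon>" for \<epsilon>
  proof -
    have "0 < ennreal (\<epsilon> / d\<^sup>2)" using \<epsilon> d by simp
    from order_tendstoD(2)[OF lim this] obtain k where
      k: "(\<integral>\<^sup>+ x\<in>\<Omega>. ennreal ((opnorm (msqrt (W x) ** (Du x - grad (\<phi> k) x)))\<^sup>2) \<partial>lebesgue) < ennreal (\<epsilon> / d\<^sup>2)"
      by (auto simp: eventually_sequentially)
    have "(\<integral>\<^sup>+ x\<in>\<Omega>. ennreal ((opnorm (msqrt (W x) ** (Du x - grad (\<phi> k) x)))\<^sup>2) \<partial>lebesgue)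
        = (\<integral>\<^sup>+ x\<in>\<Omega>. ennreal ((opnorm (P x ** (G x - grad (\<phi> k) x)))\<^sup>2) \<partial>lborel)"
      by (rule to_lborel) (use Weq Geq in \<open>eventually_elim, auto simp: P_def\<close>)
    with k have k': "(\<integral>\<^sup>+ x\<in>\<Omega>. ennreal ((opnorm (P x ** (G x - grad (\<phi> k) x)))\<^sup>2) \<partial>lborel) \<le> ennreal (\<epsilon> / d\<^sup>2)" by simp
    have "(\<integral>\<^sup>+x\<in>\<Omega>. ennreal ((norm (P x ** (G x - grad (\<phi> k) x)))\<^sup>2) \<partial>lborel) \<le> ennreal (d\<^sup>2) * ennreal (\<epsilon> / d\<^sup>2)"
      unfolding d_def by (rule order_trans[OF nn_set_integral_norm_le_opnorm[OF Xm]]) (rule mult_left_mono[OF k'[unfolded d_def]], simp)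
    also have "\<dots> = ennreal \<epsilon>" using d \<epsilon> by (simp add: ennreal_mult[symmetric])
    finally show ?thesis by blast
  qed
  \<comment> \<open>The triangle inequality with one approximant at squared distance at most 1,
    whose own weighted gradient is square integrable.\<close>
  have finG: "(\<integral>\<^sup>+x\<in>\<Omega>. ennreal ((norm (P x ** G x))\<^sup>2) \<partial>lborel) < \<infinity>"
  proof -
    obtain k where k: "(\<integral>\<^sup>+x\<in>\<Omega>. ennreal ((norm (P x ** (G x - grad (\<phi> k) x)))\<^sup>2) \<partial>lborel) \<le> ennreal 1" using approx[of 1] by auto
    have "(\<integral>\<^sup>+ x\<in>\<Omega>. ennreal ((opnorm (msqrt (W x) ** grad (\<phi> k) x))\<^sup>2) \<partial>lebesgue)
        = (\<integral>\<^sup>+ x\<in>\<Omega>. ennreal ((opnorm (P x ** grad (\<phi> k) x))\<^sup>2) \<partial>lborel)"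
      by (rule to_lborel) (use Weq in \<open>eventually_elim, auto simp: P_def\<close>)
    with \<phi>fin[of k] have "(\<integral>\<^sup>+ x\<in>\<Omega>. ennreal ((opnorm (P x ** grad (\<phi> k) x))\<^sup>2) \<partial>lborel) < \<infinity>" by simp
    then have k2: "(\<integral>\<^sup>+ x\<in>\<Omega>. ennreal ((norm (P x ** grad (\<phi> k) x))\<^sup>2) \<partial>lborel) < \<infinity>"
      by (intro le_less_trans[OF nn_set_integral_norm_le_opnorm[OF Ym]]) (auto simp: ennreal_mult_less_top)
    let ?X = "\<lambda>x. ennreal ((norm (indicator \<Omega> x *\<^sub>R (P x ** (G x - grad (\<phi> k) x))))\<^sup>2)" and ?Y = "\<lambda>x. ennreal ((norm (indicator \<Omega> x *\<^sub>R (P x ** grad (\<phi> k) x)))\<^sup>2)"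
    have "(\<integral>\<^sup>+x\<in>\<Omega>. ennreal ((norm (P x ** G x))\<^sup>2) \<partial>lborel) \<le> (\<integral>\<^sup>+x. 2 * ?X x + 2 * ?Y x \<partial>lborel)"
    proof (rule nn_integral_mono)
      fix x
      let ?a = "norm (P x ** (G x - grad (\<phi> k) x))" and ?b = "norm (P x ** grad (\<phi> k) x)"
      have "norm (P x ** G x) \<le> ?a + ?b"
        using norm_triangle_ineq[of "P x ** (G x - grad (\<phi> k) x)" "P x ** grad (\<phi> k) x"] by (simp add: matrix_mult_diff_right)
      then have "(norm (P x ** G x))\<^sup>2 \<le> (?a + ?b)\<^sup>2" by (intro power_mono) auto
      also have "\<dots> \<le> 2 * ?a\<^sup>2 + 2 * ?b\<^sup>2" using sum_squares_bound[of ?a ?b] by (simp add: power2_sum)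
      finally have "ennreal ((norm (P x ** G x))\<^sup>2) \<le> ennreal (2 * ?a\<^sup>2 + 2 * ?b\<^sup>2)" by (rule ennreal_leI)
      also have "\<dots> = 2 * ennreal (?a\<^sup>2) + 2 * ennreal (?b\<^sup>2)" by (simp add: ennreal_mult)
      finally show "ennreal ((norm (P x ** G x))\<^sup>2) * indicator \<Omega> x \<le> 2 * ?X x + 2 * ?Y x" by (cases "x \<in> \<Omega>") auto
    qed
    also have "\<dots> = 2 * (\<integral>\<^sup>+x. ?X x \<partial>lborel) + 2 * (\<integral>\<^sup>+x. ?Y x \<partial>lborel)"
    proof -
      have m: "?X \<in> borel_measurable lborel" "?Y \<in> borel_measurable lborel" by measurable
      have "(\<lambda>x. 2 * ?X x) \<in> borel_measurable lborel" "(\<lambda>x. 2 * ?Y x) \<in> borel_measurable lborel" by measurable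
      then show ?thesis by (simp only: nn_integral_add nn_integral_cmult m)
    qed
    also have "(\<integral>\<^sup>+x. ?X x \<partial>lborel) = (\<integral>\<^sup>+x\<in>\<Omega>. ennreal ((norm (P x ** (G x - grad (\<phi> k) x)))\<^sup>2) \<partial>lborel)"
      by (rule nn_integral_cong) (auto simp: indicator_def)
    also have "(\<integral>\<^sup>+x. ?Y x \<partial>lborel) = (\<integral>\<^sup>+x\<in>\<Omega>. ennreal ((norm (P x ** grad (\<phi> k) x))\<^sup>2) \<partial>lborel)"
      by (rule nn_integral_cong) (auto simp: indicator_def)
    also have "2 * (\<integral>\<^sup>+x\<in>\<Omega>. ennreal ((norm (P x ** (G x - grad (\<phi> k) x)))\<^sup>2) \<partial>lborel) + 2 * (\<integral>\<^sup>+x\<in>\<Omega>. ennreal ((norm (P x ** grad (\<phi> k) x))\<^sup>2) \<partial>lborel) < \<infinity>"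
      using k2 le_less_trans[OF k] by (auto simp: ennreal_mult_less_top)
    finally show ?thesis .
  qed
  have "0 < c / d\<^sup>2" using c d by simp
  note solution_reverse_Holder[OF \<Omega> Am Gm Hm this ell1 abs_ge_zero ell2 weak finF]
  moreover have "\<exists>\<psi>. smooth_on \<Omega> \<psi> \<and> (\<integral>\<^sup>+x\<in>\<Omega>. ennreal ((norm (P x ** (G x - grad \<psi> x)))\<^sup>2) \<partial>lborel) \<le> ennreal \<epsilon>" if \<epsilon>: "0 < \<epsilon>" for \<epsilon>
  proof -
    obtain k where "(\<integral>\<^sup>+x\<in>\<Omega>. ennreal ((norm (P x ** (G x - grad (\<phi> k) x)))\<^sup>2) \<partial>lborel) \<le> ennreal \<epsilon>" using approx[OF \<epsilon>] ..
    with sm[of k] show ?thesis by (intro exI[of _ "\<phi> k"] conjI)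
  qed
  ultimately have "\<exists>b\<ge>0. \<forall>x0 r. cball x0 r \<subseteq> \<Omega> \<longrightarrow> weak_reverse_Holder b (ball x0 r) (\<lambda>x. norm (P x ** G x)) (\<lambda>x. norm (N x ** H x))" .
  then obtain b where b: "0 \<le> b"
    and rH: "\<And>x0 r. cball x0 r \<subseteq> \<Omega> \<Longrightarrow> weak_reverse_Holder b (ball x0 r) (\<lambda>x. norm (P x ** G x)) (\<lambda>x. norm (N x ** H x))"
    by auto
  \<comment> \<open>\<open>b\<close> is uniform over all balls in question, so the exponent and the
    constant are fixed before a ball is chosen.\<close>
  obtain q C where q: "2 < q" and C: "0 < C" and ge: "\<forall>(g::real^'d \<Rightarrow> real) f x0 r L.
    g \<in> borel_measurable borel \<longrightarrow> f \<in> borel_measurable borel \<longrightarrow> (\<forall>x. 0 \<le> g x) \<longrightarrow> (\<forall>x. 0 \<le> f x) \<longrightarrow>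
    0 < r \<longrightarrow> 0 < L \<longrightarrow>
    (\<integral>\<^sup>+y\<in>ball x0 r. ennreal ((g y)\<^sup>2) \<partial>lborel) \<le> ennreal (L\<^sup>2) * emeasure lborel (ball x0 r) \<longrightarrow>
    weak_reverse_Holder b (ball x0 r) g f \<longrightarrow>
    (\<integral>\<^sup>+y\<in>ball x0 (r/2). ennreal (g y powr q) \<partial>lborel) \<le>
      ennreal C * (ennreal (L powr q) * emeasure lborel (ball x0 r) + (\<integral>\<^sup>+y\<in>ball x0 r. ennreal (f y powr q) \<partial>lborel))"
    using gehring[OF b, where 'a="real^'d"] by blast
  \<comment> \<open>\<open>d powr q\<close> pays for passing from \<open>opnorm\<close> to
    \<open>norm\<close> both in the level and in the data; on the left side \<open>opnorm\<close> is
    already the smaller one.\<close>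
  define C' where "C' = C * d powr q"
  have C': "0 < C'" using C d by (simp add: C'_def)
  have "Lp_avg q (ball x0 (r / 2)) (\<lambda>x. opnorm (msqrt (W x) ** Du x))
           \<le> ennreal ((2 * 2^CARD('d) * C') powr (1/q)) * (Lp_avg 2 (ball x0 r) (\<lambda>x. opnorm (msqrt (W x) ** Du x))
                          + Lp_avg q (ball x0 r) (\<lambda>x. opnorm (minvsqrt (W x) ** F x)))"
    if r: "r > 0" and sub: "ball x0 (2 * r) \<subseteq> \<Omega>" for x0 r
  proof -
    \<comment> \<open>The open ball of twice the radius provides the closed ball on which the
      reverse Hoelder inequality was proved.\<close>
    have cb: "cball x0 r \<subseteq> \<Omega>" using r sub by auto
    then have bs: "ball x0 r \<subseteq> \<Omega>" "ball x0 (r/2) \<subseteq> \<Omega>" using r by auto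
    have eqG: "Lp_avg p B (\<lambda>x. opnorm (msqrt (W x) ** Du x)) = Lp_avg p B (\<lambda>x. opnorm (P x ** G x))" if "B \<subseteq> \<Omega>" for p B
      by (rule Lp_avg_cong_AE) (use Weq Geq in eventually_elim, use that in \<open>auto simp: P_def\<close>)
    have eqF: "Lp_avg q (ball x0 r) (\<lambda>x. opnorm (minvsqrt (W x) ** F x)) = Lp_avg q (ball x0 r) (\<lambda>x. opnorm (N x ** H x))"
      by (rule Lp_avg_cong_AE) (use Weq Heq in eventually_elim, use bs in \<open>auto simp: N_def\<close>)
    show ?thesis unfolding eqG[OF bs(1)] eqG[OF bs(2)] eqF
    proof (rule Lp_avg_from_level_bound[OF opnorm_nonneg q C' r])
      have "(\<integral>\<^sup>+x\<in>ball x0 r. ennreal ((opnorm (P x ** G x))\<^sup>2) \<partial>lborel) \<le> (\<integral>\<^sup>+x\<in>\<Omega>. ennreal ((norm (P x ** G x))\<^sup>2) \<partial>lborel)"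
        by (rule order_trans[OF nn_set_integral_mono_set[OF bs(1)]], rule nn_set_integral_mono)
          (intro ennreal_leI power_mono opnorm_le_norm opnorm_nonneg)
      then show "(\<integral>\<^sup>+x\<in>ball x0 r. ennreal ((opnorm (P x ** G x))\<^sup>2) \<partial>lborel) < \<infinity>" using finG by (rule le_less_trans)
    next
      fix L :: real
      assume L: "0 < L" and le: "(\<integral>\<^sup>+x\<in>ball x0 r. ennreal ((opnorm (P x ** G x))\<^sup>2) \<partial>lborel) \<le> ennreal (L\<^sup>2) * emeasure lborel (ball x0 r)"
      have "(\<integral>\<^sup>+x\<in>ball x0 r. ennreal ((norm (P x ** G x))\<^sup>2) \<partial>lborel) \<le> ennreal (d\<^sup>2) * (ennreal (L\<^sup>2) * emeasure lborel (ball x0 r))"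
        unfolding d_def by (rule order_trans[OF nn_set_integral_norm_le_opnorm]) (measurable, intro mult_left_mono le, simp)
      also have "\<dots> = ennreal ((d * L)\<^sup>2) * emeasure lborel (ball x0 r)"
        by (simp add: power_mult_distrib ennreal_mult mult.assoc)
      finally have g2: "(\<integral>\<^sup>+x\<in>ball x0 r. ennreal ((norm (P x ** G x))\<^sup>2) \<partial>lborel) \<le> ennreal ((d * L)\<^sup>2) * emeasure lborel (ball x0 r)" .
      have dL: "0 < d * L" using d L by simp
      have "(\<integral>\<^sup>+x\<in>ball x0 (r/2). ennreal (opnorm (P x ** G x) powr q) \<partial>lborel) \<le> (\<integral>\<^sup>+x\<in>ball x0 (r/2). ennreal (norm (P x ** G x) powr q) \<partial>lborel)"
        using q by (intro nn_set_integral_mono ennreal_leI powr_mono2 opnorm_le_norm opnorm_nonneg) auto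
      also have "\<dots> \<le> ennreal C * (ennreal ((d * L) powr q) * emeasure lborel (ball x0 r) + (\<integral>\<^sup>+x\<in>ball x0 r. ennreal (norm (N x ** H x) powr q) \<partial>lborel))"
        by (rule ge[rule_format, OF _ _ _ _ r dL g2 rH[OF cb]]) simp_all
      also have "\<dots> \<le> ennreal C * (ennreal (d powr q) * (ennreal (L powr q) * emeasure lborel (ball x0 r) + (\<integral>\<^sup>+x\<in>ball x0 r. ennreal (opnorm (N x ** H x) powr q) \<partial>lborel)))"
      proof (rule mult_left_mono)
        have "(\<integral>\<^sup>+x\<in>ball x0 r. ennreal (norm (N x ** H x) powr q) \<partial>lborel) \<le> (\<integral>\<^sup>+x\<in>ball x0 r. ennreal (d powr q) * ennreal (opnorm (N x ** H x) powr q) \<partial>lborel)"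
        proof (rule nn_set_integral_mono)
          fix x
          have "norm (N x ** H x) powr q \<le> (d * opnorm (N x ** H x)) powr q" using q by (intro powr_mono2 nd) auto
          also have "\<dots> = d powr q * opnorm (N x ** H x) powr q" using d opnorm_nonneg by (simp add: powr_mult)
          finally show "ennreal (norm (N x ** H x) powr q) \<le> ennreal (d powr q) * ennreal (opnorm (N x ** H x) powr q)"
            by (simp add: ennreal_mult[symmetric] ennreal_leI)
        qed
        also have "\<dots> = ennreal (d powr q) * (\<integral>\<^sup>+x\<in>ball x0 r. ennreal (opnorm (N x ** H x) powr q) \<partial>lborel)"
          by (rule nn_set_integral_cmult) measurable
        finally show "ennreal ((d * L) powr q) * emeasure lborel (ball x0 r) + (\<integral>\<^sup>+x\<in>ball x0 r. ennreal (norm (N x ** H x) powr q) \<partial>lborel)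
          \<le> ennreal (d powr q) * (ennreal (L powr q) * emeasure lborel (ball x0 r) + (\<integral>\<^sup>+x\<in>ball x0 r. ennreal (opnorm (N x ** H x) powr q) \<partial>lborel))"
          using d L by (simp add: powr_mult ennreal_mult distrib_left mult.assoc)
      qed simp
      also have "\<dots> = ennreal C' * (ennreal (L powr q) * emeasure lborel (ball x0 r) + (\<integral>\<^sup>+x\<in>ball x0 r. ennreal (opnorm (N x ** H x) powr q) \<partial>lborel))"
        using C by (simp add: C'_def ennreal_mult mult.assoc)
      finally show "(\<integral>\<^sup>+x\<in>ball x0 (r/2). ennreal (opnorm (P x ** G x) powr q) \<partial>lborel)
        \<le> ennreal C' * (ennreal (L powr q) * emeasure lborel (ball x0 r) + (\<integral>\<^sup>+x\<in>ball x0 r. ennreal (opnorm (N x ** H x) powr q) \<partial>lborel))" .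
    qed
  qed
  then show ?thesis using q by blast
qed

end
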